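(* Let $\beta,\gamma\in\mathbb R$, let $\mathcal W_1,\mathcal W_2\in\mathcal S(\mathbb R)$ be real-valued, and let $A\in C_c^\infty(\mathbb R;\mathbb C)$ with $\operatorname{dist}(\operatorname{supp}A,\{-\gamma\})>0$. Assume that $|\beta|\,\mathfrak a_\beta(A)^2\le\eta_0$ and $\|A\|_2\le m_0(\|\mathcal W_j\|_\infty)$ for $j=1,2$. For $j=1,2$, let $u^{(j)}$ be the solution produced by the modified wave operator with coefficient $\mathcal W_j$ and final profile $A$ (with the same $\beta$, $\gamma$, $A$ for both). Then for every $\nu_{\mathrm{dec}}>0$ there are $C_{\nu_{\mathrm{dec}}},T_{\nu_{\mathrm{dec}}}>0$ such that $$\|u^{(1)}(t)-u^{(2)}(t)\|_{H^1}+\|u^{(1)}(t)-u^{(2)}(t)\|_\infty\le C_{\nu_{\mathrm{dec}}}t^{-\nu_{\mathrm{dec}}},\qquad t\ge T_{\nu_{\mathrm{dec}}} .$$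
   Context: $\mathcal S(\mathbb R)$ is the Schwartz class, $\langle\xi\rangle=(1+\xi^2)^{1/2}$, $\|\cdot\|_q$ is the $L^q(\mathbb R)$ norm. Modified wave operator: put $$u_A(t,y)=t^{-1/2}e^{iy^2/(4t)}A(y/t)e^{-i\beta|A(y/t)|^2\log t},\qquad \mathfrak a_\beta(A)=\sup_{t\ge2}t^{1/2}\big(\|u_A(t)\|_\infty+\|\partial_yu_A(t)\|_\infty\big).$$ Here $\eta_0>0$ is a fixed, sufficiently small universal constant and, for each real-valued coefficient $\mathcal W$ satisfying $|\partial_x^j\mathcal W(x)|\le C_{\mathcal W,j}\langle x\rangle^{-p-j}$ for all $j\ge0$ and some $p>2$ (in particular each real Schwartz $\mathcal W$), $m_0=m_0(\|\mathcal W\|_\infty)>0$ is a constant, chosen so that for every $A$ with $\langle\xi\rangle A\in H^3(\mathbb R)$, $|\beta|\mathfrak a_\beta(A)^2\le\eta_0$ and $\|A\|_2\le m_0$ there is a global solution $u\in C([1,\infty);H^1)\cap C^1([1,\infty);H^{-1})$ of $$i\partial_tu+\partial_y^2u-\beta|u|^2u+\mathcal W(y+\gamma t)|u|^4u=0$$ with $\|u(t)-u_A(t)\|_{H^1}+\|u(t)-u_A(t)\|_{\infty}\le C_{A,\beta,\mathcal W}\,t^{-1}(1+|\beta|\log t)^2$ for all large $t$, and it is the unique mild (Duhamel) solution in $C([1,\infty);H^1)$ with $\|u(t)-u_A(t)\|_{H^1}=O(t^{-3/4})$ as $t\to\infty$. This $u$ is the solution produced by the modified wave operator with coefficient $\mathcal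 W$ and final profile $A$. *)

theory Defs
  imports "HOL-Probability.Probability" "HOL-Library.Landau_Symbols"
begin

section \<open>Function classes on the real line\<close>

text \<open>
  Elements of \<open>L\<^sup>2\<close>, \<open>L\<^sup>\<infinity>\<close>, \<open>H\<^sup>k\<close> are represented by Borel functions on the line; every notion
  below depends only on the a.e. equivalence class of its argument.
\<close>

definition nth_vderiv :: "nat \<Rightarrow> (real \<Rightarrow> 'a::real_normed_vector) \<Rightarrow> real \<Rightarrow> 'a" where
  "nth_vderiv k f = ((\<lambda>g x. vector_derivative g (at x)) ^^ k) f"

definition smooth :: "(real \<Rightarrow> 'a::real_normed_vector) \<Rightarrow> bool" where
  "smooth f \<longleftrightarrow> (\<forall>k x. nth_vderiv k f differentiable (at x))"

definition fsupport :: "(real \<Rightarrow> 'a::real_normed_vector) \<Rightarrow> real set" where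
  "fsupport f = closure {x. f x \<noteq> 0}"

definition test_fun :: "(real \<Rightarrow> complex) set" where
  "test_fun = {f. smooth f \<and> compact (fsupport f)}"

definition schwartz :: "(real \<Rightarrow> 'a::real_normed_vector) \<Rightarrow> bool" where
  "schwartz f \<longleftrightarrow>
     smooth f \<and> (\<forall>j k::nat. \<exists>C. \<forall>x. \<bar>x\<bar> ^ k * norm (nth_vderiv j f x) \<le> C)"

definition japanese :: "real \<Rightarrow> real" where
  "japanese x = sqrt (1 + x\<^sup>2)"

definition decaying_coefficient :: "(real \<Rightarrow> real) \<Rightarrow> bool" where
  "decaying_coefficient W \<longleftrightarrow>
     smooth W \<and>
     (\<exists>p>2. \<forall>j. \<exists>C. \<forall>x. \<bar>nth_vderiv j W x\<bar> \<le> C * japanese x powr (- p - real j))"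

definition L2 :: "(real \<Rightarrow> complex) \<Rightarrow> bool" where
  "L2 f \<longleftrightarrow> f \<in> borel_measurable lborel \<and> integrable lborel (\<lambda>x. (norm (f x))\<^sup>2)"

definition L2_norm :: "(real \<Rightarrow> complex) \<Rightarrow> real" where
  "L2_norm f = sqrt (LINT x|lborel. (norm (f x))\<^sup>2)"

definition Linf_norm :: "(real \<Rightarrow> 'a::real_normed_vector) \<Rightarrow> ereal" where
  "Linf_norm f = esssup lborel (\<lambda>x. ereal (norm (f x)))"

definition has_weak_deriv :: "(real \<Rightarrow> complex) \<Rightarrow> (real \<Rightarrow> complex) \<Rightarrow> bool" where
  "has_weak_deriv f g \<longleftrightarrow>
     (\<forall>a b. set_integrable lborel {a..b} f \<and> set_integrable lborel {a..b} g) \<and>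
     (\<forall>\<phi>\<in>test_fun. (LINT x|lborel. f x * nth_vderiv 1 \<phi> x) = - (LINT x|lborel. g x * \<phi> x))"

definition weak_deriv :: "(real \<Rightarrow> complex) \<Rightarrow> real \<Rightarrow> complex" where
  "weak_deriv f = (SOME g. has_weak_deriv f g)"

fun sobolev :: "nat \<Rightarrow> (real \<Rightarrow> complex) \<Rightarrow> bool" where
  "sobolev 0 f \<longleftrightarrow> L2 f"
| "sobolev (Suc k) f \<longleftrightarrow> L2 f \<and> (\<exists>g. has_weak_deriv f g \<and> sobolev k g)"

abbreviation H1 :: "(real \<Rightarrow> complex) \<Rightarrow> bool" where
  "H1 \<equiv> sobolev 1"

text \<open>Meaningful for \<open>f\<close> in \<open>H\<^sup>1\<close> only; \<open>H1_norm\<close> and \<open>L2_norm\<close> are always used together with membership.\<close>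

definition H1_norm :: "(real \<Rightarrow> complex) \<Rightarrow> real" where
  "H1_norm f = sqrt ((L2_norm f)\<^sup>2 + (L2_norm (weak_deriv f))\<^sup>2)"

text \<open>
  \<open>H\<^sup>-\<^sup>1\<close> is the space of distributions that are bounded for the \<open>H\<^sup>1\<close> norm. Distributions are
  linear functionals on test functions, and a function acts by the bilinear pairing
  \<open>\<integral> f \<phi>\<close> (no complex conjugation).
\<close>

type_synonym distr = "(real \<Rightarrow> complex) \<Rightarrow> complex"

definition distr_of :: "(real \<Rightarrow> complex) \<Rightarrow> distr" where
  "distr_of f \<phi> = (LINT x|lborel. f x * \<phi> x)"

definition distr_deriv :: "distr \<Rightarrow> distr" where
  "distr_deriv F \<phi> = - F (nth_vderiv 1 \<phi>)"

definition Hminus1 :: "distr \<Rightarrow> bool" where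
  "Hminus1 F \<longleftrightarrow>
     (\<forall>\<phi>\<in>test_fun. \<forall>\<psi>\<in>test_fun. F (\<lambda>x. \<phi> x + \<psi> x) = F \<phi> + F \<psi>) \<and>
     (\<forall>c. \<forall>\<phi>\<in>test_fun. F (\<lambda>x. c * \<phi> x) = c * F \<phi>) \<and>
     (\<exists>C. \<forall>\<phi>\<in>test_fun. norm (F \<phi>) \<le> C * H1_norm \<phi>)"

definition Hminus1_norm :: "distr \<Rightarrow> real" where
  "Hminus1_norm F = (SUP \<phi>\<in>{\<phi>\<in>test_fun. H1_norm \<phi> \<le> 1}. norm (F \<phi>))"

section \<open>The Schroedinger group\<close>

text \<open>
  The \<open>L\<^sup>2\<close> Fourier transform in Plancherel's form: \<open>F\<close> is the \<open>L\<^sup>2\<close> limit, as \<open>R\<close> tends to infinity,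
  of \<open>\<integral>\<close> over \<open>[-R,R]\<close> of \<open>e\<^sup>-\<^sup>i\<^sup>y\<^sup>\<xi> f(y) dy\<close>.
\<close>

definition has_fourier_L2 :: "(real \<Rightarrow> complex) \<Rightarrow> (real \<Rightarrow> complex) \<Rightarrow> bool" where
  "has_fourier_L2 f F \<longleftrightarrow> L2 f \<and> L2 F \<and>
     ((\<lambda>R. L2_norm (\<lambda>\<xi>. F \<xi> - (LINT y:{-R..R}|lborel. cis (- (y * \<xi>)) * f y))) \<longlongrightarrow> 0) at_top"

text \<open>\<open>e\<^sup>i\<^sup>\<tau>\<^sup>\<Delta>\<close> on \<open>L\<^sup>2\<close>: the Fourier multiplier with symbol \<open>exp (- i \<tau> \<xi>\<^sup>2)\<close>.\<close>

definition schroedinger_group :: "real \<Rightarrow> (real \<Rightarrow> complex) \<Rightarrow> real \<Rightarrow> complex" where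
  "schroedinger_group \<tau> f =
     (SOME g. \<exists>F. has_fourier_L2 f F \<and> has_fourier_L2 g (\<lambda>\<xi>. cis (- (\<tau> * \<xi>\<^sup>2)) * F \<xi>))"

text \<open>\<open>G\<close> is the (weak) integral over \<open>s \<in> [a,b]\<close> of the \<open>L\<^sup>2\<close>-valued function \<open>F\<close>.\<close>

definition has_L2_integral ::
  "(real \<Rightarrow> real \<Rightarrow> complex) \<Rightarrow> real \<Rightarrow> real \<Rightarrow> (real \<Rightarrow> complex) \<Rightarrow> bool" where
  "has_L2_integral F a b G \<longleftrightarrow>
     L2 G \<and> (\<forall>s\<in>{a..b}. L2 (F s)) \<and>
     (\<forall>\<phi>\<in>test_fun. set_integrable lborel {a..b} (\<lambda>s. distr_of (F s) \<phi>) \<and>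
        distr_of G \<phi> = (LINT s:{a..b}|lborel. distr_of (F s) \<phi>))"

section \<open>The equation and the modified wave operator\<close>

text \<open>The equation is \<open>i \<partial>\<^sub>t u + \<partial>\<^sub>y\<^sup>2 u = nonlin W \<beta> \<gamma> t u\<close>.\<close>

definition nonlin ::
  "(real \<Rightarrow> real) \<Rightarrow> real \<Rightarrow> real \<Rightarrow> real \<Rightarrow> (real \<Rightarrow> complex) \<Rightarrow> real \<Rightarrow> complex" where
  "nonlin W \<beta> \<gamma> t f y =
     of_real (\<beta> * (norm (f y))\<^sup>2) * f y - of_real (W (y + \<gamma> * t) * (norm (f y)) ^ 4) * f y"

definition continuous_H1 :: "(real \<Rightarrow> real \<Rightarrow> complex) \<Rightarrow> bool" where
  "continuous_H1 u \<longleftrightarrow>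
     (\<forall>t\<ge>1. H1 (u t)) \<and>
     (\<forall>t\<ge>1. ((\<lambda>s. H1_norm (\<lambda>y. u s y - u t y)) \<longlongrightarrow> 0) (at t within {1..}))"

definition C1_Hminus1_deriv :: "(real \<Rightarrow> real \<Rightarrow> complex) \<Rightarrow> (real \<Rightarrow> distr) \<Rightarrow> bool" where
  "C1_Hminus1_deriv u v \<longleftrightarrow>
     (\<forall>t\<ge>1. Hminus1 (distr_of (u t)) \<and> Hminus1 (v t)) \<and>
     (\<forall>t\<ge>1. ((\<lambda>s. Hminus1_norm
         (\<lambda>\<phi>. (distr_of (u s) \<phi> - distr_of (u t) \<phi>) / of_real (s - t) - v t \<phi>)) \<longlongrightarrow> 0)
         (at t within {1..})) \<and>
     (\<forall>t\<ge>1. ((\<lambda>s. Hminus1_norm (\<lambda>\<phi>. v s \<phi> - v t \<phi>)) \<longlongrightarrow> 0) (at t within {1..}))"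

definition global_solution ::
  "(real \<Rightarrow> real) \<Rightarrow> real \<Rightarrow> real \<Rightarrow> (real \<Rightarrow> real \<Rightarrow> complex) \<Rightarrow> bool" where
  "global_solution W \<beta> \<gamma> u \<longleftrightarrow>
     continuous_H1 u \<and>
     (\<exists>v. C1_Hminus1_deriv u v \<and>
        (\<forall>t\<ge>1. \<forall>\<phi>\<in>test_fun.
           \<i> * v t \<phi> + distr_deriv (distr_deriv (distr_of (u t))) \<phi>
             - distr_of (nonlin W \<beta> \<gamma> t (u t)) \<phi> = 0))"

definition mild_solution ::
  "(real \<Rightarrow> real) \<Rightarrow> real \<Rightarrow> real \<Rightarrow> (real \<Rightarrow> real \<Rightarrow> complex) \<Rightarrow> bool" where
  "mild_solution W \<beta> \<gamma> u \<longleftrightarrow>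
     continuous_H1 u \<and>
     (\<forall>t\<ge>1. \<exists>G.
        has_L2_integral (\<lambda>s. schroedinger_group (t - s) (nonlin W \<beta> \<gamma> s (u s))) 1 t G \<and>
        (AE y in lborel. u t y = schroedinger_group (t - 1) (u 1) y - \<i> * G y))"

definition u_asym :: "real \<Rightarrow> (real \<Rightarrow> complex) \<Rightarrow> real \<Rightarrow> real \<Rightarrow> complex" where
  "u_asym \<beta> A t y =
     of_real (t powr (-1/2)) * cis (y\<^sup>2 / (4 * t)) * A (y / t)
       * cis (- (\<beta> * (norm (A (y / t)))\<^sup>2 * ln t))"

definition a_size :: "real \<Rightarrow> (real \<Rightarrow> complex) \<Rightarrow> ereal" where
  "a_size \<beta> A =
     (SUP t\<in>{2..}. ereal (t powr (1/2)) *
        (Linf_norm (u_asym \<beta> A t) + Linf_norm (weak_deriv (u_asym \<beta> A t))))"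

text \<open>
  \<open>u\<close> is the solution produced by the modified wave operator with coefficient \<open>W\<close> and final
  profile \<open>A\<close>; only the values \<open>u t\<close> for \<open>t \<ge> 1\<close> matter, and they are determined a.e.
\<close>

definition wave_operator_solution ::
  "(real \<Rightarrow> real) \<Rightarrow> real \<Rightarrow> real \<Rightarrow> (real \<Rightarrow> complex) \<Rightarrow> (real \<Rightarrow> real \<Rightarrow> complex) \<Rightarrow> bool" where
  "wave_operator_solution W \<beta> \<gamma> A u \<longleftrightarrow>
     global_solution W \<beta> \<gamma> u \<and>
     (\<exists>C. \<forall>\<^sub>F t in at_top.
        ereal (H1_norm (\<lambda>y. u t y - u_asym \<beta> A t y)) + Linf_norm (\<lambda>y. u t y - u_asym \<beta> A t y)
          \<le> ereal (C * t powr (-1) * (1 + \<bar>\<beta>\<bar> * ln t)\<^sup>2)) \<and>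
     mild_solution W \<beta> \<gamma> u \<and>
     (\<lambda>t. H1_norm (\<lambda>y. u t y - u_asym \<beta> A t y)) \<in> O(\<lambda>t. t powr (-3/4)) \<and>
     (\<forall>v. mild_solution W \<beta> \<gamma> v \<and>
          (\<lambda>t. H1_norm (\<lambda>y. v t y - u_asym \<beta> A t y)) \<in> O(\<lambda>t. t powr (-3/4)) \<longrightarrow>
          (\<forall>t\<ge>1. AE y in lborel. v t y = u t y))"

definition small_profile ::
  "real \<Rightarrow> (real \<Rightarrow> real) \<Rightarrow> (real \<Rightarrow> real) \<Rightarrow> real \<Rightarrow> (real \<Rightarrow> complex) \<Rightarrow> bool" where
  "small_profile \<eta>\<^sub>0 m\<^sub>0 W \<beta> A \<longleftrightarrow>
     ereal \<bar>\<beta>\<bar> * (a_size \<beta> A)\<^sup>2 \<le> ereal \<eta>\<^sub>0 \<and> L2_norm A \<le> m\<^sub>0 (real_of_ereal (Linf_norm W))"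

text \<open>
  The property for which the constant \<open>\<eta>\<^sub>0\<close> and the function \<open>m\<^sub>0\<close> of \<open>\<parallel>W\<parallel>\<^sub>\<infinity>\<close> are chosen:
  the modified wave operator is defined on all small profiles.
\<close>

definition wave_operator_constants :: "real \<Rightarrow> (real \<Rightarrow> real) \<Rightarrow> bool" where
  "wave_operator_constants \<eta>\<^sub>0 m\<^sub>0 \<longleftrightarrow>
     0 < \<eta>\<^sub>0 \<and> (\<forall>M\<ge>0. 0 < m\<^sub>0 M) \<and>
     (\<forall>W \<beta> \<gamma> A. decaying_coefficient W \<longrightarrow>
        sobolev 3 (\<lambda>\<xi>. of_real (japanese \<xi>) * A \<xi>) \<longrightarrow>
        small_profile \<eta>\<^sub>0 m\<^sub>0 W \<beta> A \<longrightarrow>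
        (\<exists>u. wave_operator_solution W \<beta> \<gamma> A u))"

text \<open>
  \<open>dist(supp A, {a}) > 0\<close>. The distance to the empty set is infinite, whereas \<open>setdist\<close> gives \<open>0\<close>.
\<close>

definition supported_away_from :: "(real \<Rightarrow> complex) \<Rightarrow> real \<Rightarrow> bool" where
  "supported_away_from A a \<longleftrightarrow> fsupport A = {} \<or> setdist (fsupport A) {a} > 0"

end

theory Submission
  imports Defs "HOL-Real_Asymp.Real_Asymp"
begin

text \<open>
  Both solutions are compared with one approximate solution that does not see the potential.
  In the coordinate \<open>x = y / t\<close>, a wave \<open>t\<^sup>-\<^sup>1\<^sup>/\<^sup>2 exp (i y\<^sup>2 / (4 t)) exp (- i \<beta> |A(x)|\<^sup>2 log t) b(t, x)\<close> solves the
  cubic equation up to a residual in which second derivatives of \<open>b\<close> carry the factor \<open>t\<^sup>-\<^sup>2\<close>, so that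
  to leading order only ordinary differential equations in time remain. Starting from \<open>b = A\<close>,
  one removes the residual order by order with corrections that are polynomials in \<open>1 / t\<close> and
  \<open>log t\<close> (\<open>expansion_step\<close>). Differentiation and multiplication do not enlarge supports, so
  all corrections live on the support of \<open>A\<close>; there the potential is evaluated at a distance
  comparable to \<open>t\<close> from the origin and is \<open>O(t\<^sup>-\<^sup>m)\<close> for every \<open>m\<close>. Hence the same wave is an
  approximate solution for every rapidly decaying potential (\<open>approximate_profile\<close>,
  \<open>error_bounds\<close>).

  Let \<open>w\<close> be the difference between a solution and the wave. The squared norm of \<open>w\<close> changes at a
  rate given by the forcing alone (\<open>energy_identity\<close>). The cubic term contributes at most
  \<open>(\<kappa> / t) |w|\<^sup>2\<close> with \<open>\<kappa>\<close> a multiple of \<open>|\<beta>| sup |A|\<^sup>2\<close>, and so can make \<open>w\<close> grow backwards in time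
  no faster than a small power of \<open>t\<close>. This is weaker than the decay \<open>t\<^sup>-\<^sup>3\<^sup>/\<^sup>4\<close> known for \<open>w\<close> once \<open>\<eta>\<^sub>s\<close> is small,
  so integrating from infinity leaves only the error of the wave (\<open>energy_decay\<close>). The choice of \<open>\<eta>\<^sub>s\<close>
  serves exactly this purpose.

  For the derivative of \<open>w\<close> the equation cannot be differentiated, because the solution is only in
  \<open>H\<^sup>1\<close>. The same argument is applied to the translation differences \<open>w(y + h) - w(y)\<close> with bounds
  proportional to \<open>h\<close>; they bound the weak derivative by duality
  (\<open>weak_deriv_norm_le_translations\<close>). Sobolev's inequality then gives the uniform estimate.

  The first half develops what this needs about weak derivatives: test functions are dense in
  \<open>L\<^sup>2\<close> and in \<open>H\<^sup>1\<close>. The second density lets the time derivative, which exists in \<open>H\<^sup>-\<^sup>1\<close> only, be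
  paired with the solution itself.
\<close>


section \<open>The space of square integrable functions\<close>

lemma L2_measurable: "L2 f \<Longrightarrow> f \<in> borel_measurable borel"
  by (simp add: L2_def)

lemma L2_integrable: "L2 f \<Longrightarrow> integrable lborel (\<lambda>x. (norm (f x))\<^sup>2)"
  by (simp add: L2_def)

lemma L2_norm_nonneg: "0 \<le> L2_norm f"
  by (simp add: L2_norm_def)

lemma L2_norm_square: "(L2_norm f)\<^sup>2 = (LINT x|lborel. (norm (f x))\<^sup>2)"
  by (simp add: L2_norm_def)

lemma L2_dominated:
  assumes "L2 g" "f \<in> borel_measurable borel" "AE x in lborel. norm (f x) \<le> norm (g x)"
  shows "L2 f" "L2_norm f \<le> L2_norm g"
proof -
  have m: "(\<lambda>x. (norm (f x))\<^sup>2) \<in> borel_measurable lborel"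
    using assms(2) by measurable
  have a: "AE x in lborel. (norm (f x))\<^sup>2 \<le> (norm (g x))\<^sup>2"
    using assms(3) by eventually_elim (simp add: power_mono)
  have i: "integrable lborel (\<lambda>x. (norm (f x))\<^sup>2)"
    by (rule Bochner_Integration.integrable_bound[OF L2_integrable[OF assms(1)] m]) (use a in auto)
  show "L2 f" using i assms(2) by (simp add: L2_def)
  show "L2_norm f \<le> L2_norm g"
    unfolding L2_norm_def
    by (intro real_sqrt_le_mono integral_mono_AE i L2_integrable assms(1) a)
qed

lemma L2_norm_cong_AE:
  assumes "AE x in lborel. norm (f x) = norm (g x)"
    "f \<in> borel_measurable borel" "g \<in> borel_measurable borel"
  shows "L2_norm f = L2_norm g"
proof -
  have "(LINT x|lborel. (norm (f x))\<^sup>2) = (LINT x|lborel. (norm (g x))\<^sup>2)"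
    by (rule integral_cong_AE) (use assms in auto)
  then show ?thesis by (simp add: L2_norm_def)
qed

lemma L2_add:
  assumes "L2 f" "L2 g"
  shows "L2 (\<lambda>x. f x + g x)"
proof -
  have m: "(\<lambda>x. f x + g x) \<in> borel_measurable lborel"
    using assms[THEN L2_measurable] by measurable
  have "integrable lborel (\<lambda>x. 2 * (norm (f x))\<^sup>2 + 2 * (norm (g x))\<^sup>2)"
    using assms[THEN L2_integrable] by auto
  then have "integrable lborel (\<lambda>x. (norm (f x + g x))\<^sup>2)"
  proof (rule Bochner_Integration.integrable_bound)
    show "(\<lambda>x. (norm (f x + g x))\<^sup>2) \<in> borel_measurable lborel" using m by measurable
    show "AE x in lborel. norm ((norm (f x + g x))\<^sup>2) \<le> norm (2 * (norm (f x))\<^sup>2 + 2 * (norm (g x))\<^sup>2)"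
    proof (rule AE_I2)
      fix x
      have "(norm (f x + g x))\<^sup>2 \<le> (norm (f x) + norm (g x))\<^sup>2"
        by (intro power_mono norm_triangle_ineq) auto
      also have "\<dots> \<le> 2 * (norm (f x))\<^sup>2 + 2 * (norm (g x))\<^sup>2"
        using sum_squares_bound[of "norm (f x)" "norm (g x)"] by (simp add: power2_sum)
      finally show "norm ((norm (f x + g x))\<^sup>2) \<le> norm (2 * (norm (f x))\<^sup>2 + 2 * (norm (g x))\<^sup>2)"
        by simp
    qed
  qed
  with m show ?thesis by (simp add: L2_def)
qed

lemma L2_cmult: "L2 f \<Longrightarrow> L2 (\<lambda>x. c * f x)"
  unfolding L2_def by (auto simp: norm_mult power_mult_distrib)

lemma L2_norm_cmult: "L2_norm (\<lambda>x. c * f x) = norm c * L2_norm f"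
  unfolding L2_norm_def by (simp add: norm_mult power_mult_distrib real_sqrt_mult)

lemma L2_cnj: "L2 f \<Longrightarrow> L2 (\<lambda>x. cnj (f x))"
  unfolding L2_def by (auto intro: borel_measurable_continuous_on continuous_intros)

lemma L2_norm_cnj: "L2_norm (\<lambda>x. cnj (f x)) = L2_norm f"
  by (simp add: L2_norm_def)

lemma L2_uminus: "L2 f \<Longrightarrow> L2 (\<lambda>x. - f x)"
  using L2_cmult[of f "-1"] by simp

lemma L2_diff: "L2 f \<Longrightarrow> L2 g \<Longrightarrow> L2 (\<lambda>x. f x - g x)"
  using L2_add[of f "\<lambda>x. - g x"] L2_uminus by simp

lemma L2_norm_zero: "L2_norm (\<lambda>x. 0) = 0"
  by (simp add: L2_norm_def)

lemma L2_norm_minus_commute: "L2_norm (\<lambda>x. f x - g x) = L2_norm (\<lambda>x. g x - f x)"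
  by (simp add: L2_norm_def norm_minus_commute)

lemma L2_integrable_mult:
  assumes "L2 f" "L2 g"
  shows "integrable lborel (\<lambda>x. f x * g x)"
proof -
  have "integrable lborel (\<lambda>x. (norm (f x))\<^sup>2 + (norm (g x))\<^sup>2)"
    using assms[THEN L2_integrable] by auto
  then show ?thesis
  proof (rule Bochner_Integration.integrable_bound)
    show "(\<lambda>x. f x * g x) \<in> borel_measurable lborel"
      using assms[THEN L2_measurable] by measurable
    show "AE x in lborel. norm (f x * g x) \<le> norm ((norm (f x))\<^sup>2 + (norm (g x))\<^sup>2)"
    proof (rule AE_I2)
      fix x
      have "norm (f x) * norm (g x) \<le> (norm (f x))\<^sup>2 + (norm (g x))\<^sup>2"
        using sum_squares_bound[of "norm (f x)" "norm (g x)"]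
          mult_nonneg_nonneg[of "norm (f x)" "norm (g x)"] norm_ge_zero[of "f x"] norm_ge_zero[of "g x"]
        by linarith
      then show "norm (f x * g x) \<le> norm ((norm (f x))\<^sup>2 + (norm (g x))\<^sup>2)"
        by (simp add: norm_mult)
    qed
  qed
qed

text \<open>The weight \<open>c = b / a\<close> is optimal. Shifting numerator and denominator by a small \<open>d\<close> keeps it
  positive when \<open>a\<close> or \<open>b\<close> vanishes.\<close>

lemma le_mult_of_weighted_AM_GM:
  fixes a b p :: real
  assumes "0 \<le> a" "0 \<le> b" and le: "\<And>c. 0 < c \<Longrightarrow> 2 * p \<le> c * a\<^sup>2 + b\<^sup>2 / c"
  shows "p \<le> a * b"
proof (rule field_le_epsilon)
  fix e :: real assume e: "0 < e"
  define d where "d = min 1 (e / (1 + a + b))"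
  have d: "0 < d"
    using e assms(1,2) by (simp add: d_def)
  have "d * (1 + a + b) \<le> e / (1 + a + b) * (1 + a + b)"
    by (rule mult_right_mono) (use assms in \<open>auto simp: d_def\<close>)
  also have "\<dots> = e" using assms(1,2) by (simp add: add_nonneg_eq_0_iff)
  finally have de: "d * (1 + a + b) \<le> e" .
  have "2 * p \<le> ((b + d) / (a + d)) * a\<^sup>2 + b\<^sup>2 / ((b + d) / (a + d))"
    by (rule le) (use d assms in auto)
  also have "((b + d) / (a + d)) * a\<^sup>2 \<le> (b + d) * a"
  proof -
    have "(a / (a + d)) * ((b + d) * a) \<le> 1 * ((b + d) * a)"
      by (rule mult_right_mono) (use d assms in auto)
    then show ?thesis by (simp add: power2_eq_square field_simps)
  qed
  also have "b\<^sup>2 / ((b + d) / (a + d)) \<le> b * (a + d)"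
  proof -
    have "(b / (b + d)) * (b * (a + d)) \<le> 1 * (b * (a + d))"
      by (rule mult_right_mono) (use d assms in auto)
    then show ?thesis by (simp add: power2_eq_square field_simps)
  qed
  also have "(b + d) * a + b * (a + d) \<le> 2 * (a * b + e)"
    using d de e by (simp add: algebra_simps)
  finally show "p \<le> a * b + e" by simp
qed

lemma L2_Cauchy_Schwarz_norm:
  assumes "L2 f" "L2 g"
  shows "(LINT x|lborel. norm (f x * g x)) \<le> L2_norm f * L2_norm g"
proof (rule le_mult_of_weighted_AM_GM)
  fix c :: real assume c: "0 < c"
  have "2 * norm (f x * g x) \<le> c * (norm (f x))\<^sup>2 + (norm (g x))\<^sup>2 / c" for x
  proof -
    have "0 \<le> (sqrt c * norm (f x) - norm (g x) / sqrt c)\<^sup>2" by simp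
    also have "\<dots> = c * (norm (f x))\<^sup>2 + (norm (g x))\<^sup>2 / c - 2 * norm (f x) * norm (g x)"
      using c by (simp add: power2_diff power_mult_distrib power_divide)
    finally show ?thesis by (simp add: norm_mult)
  qed
  then have "(LINT x|lborel. 2 * norm (f x * g x))
      \<le> (LINT x|lborel. c * (norm (f x))\<^sup>2 + (norm (g x))\<^sup>2 / c)"
    by (intro integral_mono) (use L2_integrable_mult[OF assms] assms[THEN L2_integrable] in auto)
  also have "\<dots> = c * (L2_norm f)\<^sup>2 + (L2_norm g)\<^sup>2 / c"
    using assms[THEN L2_integrable] by (simp add: L2_norm_square)
  finally show "2 * (LINT x|lborel. norm (f x * g x)) \<le> c * (L2_norm f)\<^sup>2 + (L2_norm g)\<^sup>2 / c"
    by simp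
qed (auto simp: L2_norm_nonneg)

lemma L2_Cauchy_Schwarz:
  assumes "L2 f" "L2 g"
  shows "norm (LINT x|lborel. f x * g x) \<le> L2_norm f * L2_norm g"
  using order_trans[OF integral_norm_bound[of lborel "\<lambda>x. f x * g x"] L2_Cauchy_Schwarz_norm[OF assms]] .

lemma L2_norm_triangle:
  assumes "L2 f" "L2 g"
  shows "L2_norm (\<lambda>x. f x + g x) \<le> L2_norm f + L2_norm g"
proof (rule power2_le_imp_le)
  have "(L2_norm (\<lambda>x. f x + g x))\<^sup>2
      \<le> (LINT x|lborel. (norm (f x))\<^sup>2 + 2 * norm (f x * g x) + (norm (g x))\<^sup>2)"
    unfolding L2_norm_square
  proof (rule integral_mono)
    show "integrable lborel (\<lambda>x. (norm (f x + g x))\<^sup>2)"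
      using L2_add[OF assms] by (rule L2_integrable)
    show "integrable lborel (\<lambda>x. (norm (f x))\<^sup>2 + 2 * norm (f x * g x) + (norm (g x))\<^sup>2)"
      using L2_integrable_mult[OF assms] assms[THEN L2_integrable] by auto
    fix x
    have "(norm (f x + g x))\<^sup>2 \<le> (norm (f x) + norm (g x))\<^sup>2"
      by (intro power_mono norm_triangle_ineq) auto
    then show "(norm (f x + g x))\<^sup>2 \<le> (norm (f x))\<^sup>2 + 2 * norm (f x * g x) + (norm (g x))\<^sup>2"
      by (simp add: power2_sum norm_mult)
  qed
  also have "\<dots> = (L2_norm f)\<^sup>2 + 2 * (LINT x|lborel. norm (f x * g x)) + (L2_norm g)\<^sup>2"
    using L2_integrable_mult[OF assms] assms[THEN L2_integrable] by (simp add: L2_norm_square)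
  also have "\<dots> \<le> (L2_norm f + L2_norm g)\<^sup>2"
    using L2_Cauchy_Schwarz_norm[OF assms] by (simp add: power2_sum)
  finally show "(L2_norm (\<lambda>x. f x + g x))\<^sup>2 \<le> (L2_norm f + L2_norm g)\<^sup>2" .
qed (simp add: L2_norm_nonneg add_nonneg_nonneg)

lemma L2_norm_diff_le:
  assumes "L2 f" "L2 g"
  shows "L2_norm (\<lambda>x. f x - g x) \<le> L2_norm f + L2_norm g"
  using L2_norm_triangle[OF assms(1) L2_uminus[OF assms(2)]] by (simp add: L2_norm_def)

lemma L2_norm_triangle_sub:
  assumes "L2 f" "L2 g"
  shows "L2_norm f \<le> L2_norm g + L2_norm (\<lambda>x. f x - g x)"
  using L2_norm_triangle[OF assms(2) L2_diff[OF assms]] by simp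

lemma L2_norm_abs_diff:
  assumes "L2 f" "L2 g"
  shows "\<bar>L2_norm f - L2_norm g\<bar> \<le> L2_norm (\<lambda>x. f x - g x)"
  using L2_norm_triangle_sub[OF assms] L2_norm_triangle_sub[OF assms(2,1)]
    L2_norm_minus_commute[of f g] by linarith

lemma L2_mult_bounded:
  assumes "L2 f" "m \<in> borel_measurable borel" "\<And>x. norm (m x :: complex) \<le> B"
  shows "L2 (\<lambda>x. m x * f x)" "L2_norm (\<lambda>x. m x * f x) \<le> B * L2_norm f"
proof -
  have B: "0 \<le> B" using assms(3)[of 0] norm_ge_zero order_trans by blast
  have m: "(\<lambda>x. m x * f x) \<in> borel_measurable borel"
    using assms(2) L2_measurable[OF assms(1)] by measurable
  have le: "AE x in lborel. norm (m x * f x) \<le> norm (of_real B * f x)"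
    using assms(3) B by (auto simp: norm_mult mult_right_mono)
  note L2_dominated[OF L2_cmult[OF assms(1)] m le]
  then show "L2 (\<lambda>x. m x * f x)" "L2_norm (\<lambda>x. m x * f x) \<le> B * L2_norm f"
    using B by (auto simp: L2_norm_cmult)
qed

lemma L2_indicator:
  assumes "L2 f" "S \<in> sets borel"
  shows "L2 (\<lambda>x. indicator S x * f x)"
  by (rule L2_mult_bounded(1)[OF assms(1), where B=1]) (use assms in \<open>auto simp: indicator_def\<close>)

lemma L2_bounded_on_interval:
  assumes "f \<in> borel_measurable borel" "\<And>x. norm (f x) \<le> B" "\<And>x. x \<notin> {a..b} \<Longrightarrow> f x = 0" "a \<le> b"
  shows "L2 f" "L2_norm f \<le> B * sqrt (b - a)"
proof -
  have B: "0 \<le> B" using assms(2)[of 0] norm_ge_zero order_trans by blast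
  define g where "g x = (indicator {a..b} x * B :: complex)" for x :: real
  have n: "(norm (g x))\<^sup>2 = B\<^sup>2 * indicator {a..b} x" for x
    by (auto simp: g_def indicator_def power_mult_distrib)
  have m: "g \<in> borel_measurable borel" unfolding g_def by measurable
  have g: "L2 g"
    unfolding L2_def n using m integrable_real_indicator[of "{a..b}" lborel] by (auto simp: emeasure_lborel_Icc_eq)
  have gn: "L2_norm g = B * sqrt (b - a)"
    unfolding L2_norm_def n using B assms(4) by (simp add: real_sqrt_mult)
  have "AE x in lborel. norm (f x) \<le> norm (g x)"
  proof (rule AE_I2)
    fix x show "norm (f x) \<le> norm (g x)"
      using assms(2)[of x] assms(3)[of x] B by (cases "x \<in> {a..b}") (auto simp: g_def)
  qed
  from L2_dominated[OF g assms(1) this] gn show "L2 f" "L2_norm f \<le> B * sqrt (b - a)" by auto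
qed

lemma L2_tendsto_dominated:
  assumes "L2 f" "L2 g" "\<And>n. s n \<in> borel_measurable borel"
    "\<And>n. AE x in lborel. norm (s n x) \<le> norm (g x)"
    "AE x in lborel. (\<lambda>n. s n x) \<longlonglongrightarrow> f x"
  shows "(\<lambda>n::nat. L2_norm (\<lambda>x. s n x - f x)) \<longlonglongrightarrow> 0"
proof -
  have "(\<lambda>n. LINT x|lborel. (norm (s n x - f x))\<^sup>2) \<longlonglongrightarrow> (LINT x::real|lborel. 0)"
  proof (rule integral_dominated_convergence[where w="\<lambda>x. 2 * (norm (g x))\<^sup>2 + 2 * (norm (f x))\<^sup>2"])
    show "integrable lborel (\<lambda>x. 2 * (norm (g x))\<^sup>2 + 2 * (norm (f x))\<^sup>2)"
      using assms(1,2)[THEN L2_integrable] by auto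
    show "(\<lambda>x. (norm (s n x - f x))\<^sup>2) \<in> borel_measurable lborel" for n
      using assms(3)[of n] L2_measurable[OF assms(1)] by measurable
    show "AE x in lborel. (\<lambda>n. (norm (s n x - f x))\<^sup>2) \<longlonglongrightarrow> 0"
      using assms(5)
    proof eventually_elim
      fix x assume "(\<lambda>n. s n x) \<longlonglongrightarrow> f x"
      then have "(\<lambda>n. norm (s n x - f x)) \<longlonglongrightarrow> 0"
        by (simp add: LIM_zero_iff tendsto_norm_zero)
      from tendsto_power[OF this, of 2] show "(\<lambda>n. (norm (s n x - f x))\<^sup>2) \<longlonglongrightarrow> 0" by simp
    qed
    show "AE x in lborel. norm ((norm (s n x - f x))\<^sup>2) \<le> 2 * (norm (g x))\<^sup>2 + 2 * (norm (f x))\<^sup>2" for n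
      using assms(4)[of n]
    proof eventually_elim
      fix x assume a: "norm (s n x) \<le> norm (g x)"
      have "(norm (s n x - f x))\<^sup>2 \<le> (norm (g x) + norm (f x))\<^sup>2"
        using a norm_triangle_ineq4[of "s n x" "f x"] by (intro power_mono) auto
      also have "\<dots> \<le> 2 * (norm (g x))\<^sup>2 + 2 * (norm (f x))\<^sup>2"
        using sum_squares_bound[of "norm (g x)" "norm (f x)"] by (simp add: power2_sum)
      finally show "norm ((norm (s n x - f x))\<^sup>2) \<le> 2 * (norm (g x))\<^sup>2 + 2 * (norm (f x))\<^sup>2"
        by simp
    qed
  qed auto
  from tendsto_real_sqrt[OF this] show ?thesis by (simp add: L2_norm_def)
qed

lemma pairing_tendsto:
  assumes "L2 f" "L2 g" "\<And>n. L2 (s n)" "(\<lambda>n::nat. L2_norm (\<lambda>x. s n x - g x)) \<longlonglongrightarrow> 0"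
  shows "(\<lambda>n. LINT x|lborel. f x * s n x) \<longlonglongrightarrow> (LINT x|lborel. f x * g x)"
proof (rule LIM_zero_cancel, rule tendsto_norm_zero_cancel, rule tendsto_sandwich[where f="\<lambda>_. 0"])
  show "\<forall>\<^sub>F n in sequentially. norm ((LINT x|lborel. f x * s n x) - (LINT x|lborel. f x * g x))
      \<le> L2_norm f * L2_norm (\<lambda>x. s n x - g x)"
  proof (rule always_eventually, rule allI)
    fix n
    have "(LINT x|lborel. f x * s n x) - (LINT x|lborel. f x * g x) = (LINT x|lborel. f x * (s n x - g x))"
      using L2_integrable_mult[OF assms(1) assms(3)[of n]] L2_integrable_mult[OF assms(1,2)]
      by (simp add: right_diff_distrib)
    then show "norm ((LINT x|lborel. f x * s n x) - (LINT x|lborel. f x * g x))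
      \<le> L2_norm f * L2_norm (\<lambda>x. s n x - g x)"
      using L2_Cauchy_Schwarz[OF assms(1) L2_diff[OF assms(3)[of n] assms(2)]] by simp
  qed
  show "(\<lambda>n. L2_norm f * L2_norm (\<lambda>x. s n x - g x)) \<longlonglongrightarrow> 0"
    using tendsto_mult_left[OF assms(4), of "L2_norm f"] by simp
qed auto

lemma L2_set_integrable:
  assumes "L2 f"
  shows "set_integrable lborel {a..b} f"
proof -
  have "L2 (\<lambda>x. indicator {a..b} x * 1)"
    by (rule L2_bounded_on_interval(1)[where B=1 and a="min a b" and b="max a b"])
      (auto simp: indicator_def)
  then have "L2 (\<lambda>x. indicator {a..b} x)" by simp
  from L2_integrable_mult[OF this assms]
  have i: "integrable lborel (\<lambda>x. indicator {a..b} x * f x)" .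
  have e: "(\<lambda>x. indicator {a..b} x *\<^sub>R f x) = (\<lambda>x. indicator {a..b} x * f x)"
    by (auto simp: indicator_def)
  show ?thesis using i unfolding set_integrable_def e .
qed

lemma LINT_shift: "(LINT x|lborel. f (x + h)) = (LINT x|lborel. (f x :: 'a::euclidean_space))" for h :: real
  using lborel_integral_real_affine[of 1 f h] by (simp add: add.commute)

lemma L2_shift:
  assumes "L2 f"
  shows "L2 (\<lambda>x. f (x + h))"
proof -
  have "integrable lborel (\<lambda>x. (norm (f (h + 1 * x)))\<^sup>2)"
    using lborel_integrable_real_affine[OF L2_integrable[OF assms], of 1 h] by simp
  then show ?thesis
    using L2_measurable[OF assms] by (simp add: L2_def add.commute)
qed

lemma L2_norm_shift: "L2_norm (\<lambda>x. f (x + h)) = L2_norm f"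
  unfolding L2_norm_def using LINT_shift[of "\<lambda>x. (norm (f x))\<^sup>2" h] by simp

section \<open>Smooth functions and test functions\<close>

text \<open>Being \<open>k\<close> times differentiable, by recursion on the derivative. Unlike the iterated
  \<^term>\<open>vector_derivative\<close>, this form supports induction on \<open>k\<close> for products.\<close>

primrec k_smooth :: "nat \<Rightarrow> (real \<Rightarrow> 'a::real_normed_vector) \<Rightarrow> bool" where
  "k_smooth 0 f \<longleftrightarrow> True"
| "k_smooth (Suc k) f \<longleftrightarrow> (\<exists>f'. (\<forall>x. (f has_vector_derivative f' x) (at x)) \<and> k_smooth k f')"

lemma nth_vderiv_0: "nth_vderiv 0 f = f"
  by (simp add: nth_vderiv_def)

lemma nth_vderiv_1: "nth_vderiv 1 f = (\<lambda>x. vector_derivative f (at x))"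
  by (simp add: nth_vderiv_def)

lemma nth_vderiv_Suc: "nth_vderiv (Suc k) f = nth_vderiv k (nth_vderiv 1 f)"
  by (simp add: nth_vderiv_def funpow_Suc_right del: funpow.simps(2) add: funpow.simps(1))

lemma nth_vderiv_1_eqI: "(\<And>x. (f has_vector_derivative f' x) (at x)) \<Longrightarrow> nth_vderiv 1 f = f'"
  unfolding nth_vderiv_1 by (auto simp: vector_derivative_at)

lemma smooth_has_vderiv: "smooth f \<Longrightarrow> (f has_vector_derivative nth_vderiv 1 f x) (at x)"
  unfolding smooth_def nth_vderiv_1
  using vector_derivative_works nth_vderiv_0 by metis

lemma smooth_vderiv: "smooth f \<Longrightarrow> smooth (nth_vderiv 1 f)"
  unfolding smooth_def by (metis nth_vderiv_Suc)

lemma smooth_k_smooth: "smooth f \<Longrightarrow> k_smooth k f"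
  by (induction k arbitrary: f) (auto intro: smooth_has_vderiv smooth_vderiv)

lemma k_smooth_differentiable:
  "k_smooth (Suc k) f \<Longrightarrow> nth_vderiv k f differentiable (at x)"
proof (induction k arbitrary: f)
  case 0
  then show ?case
    by (auto simp: nth_vderiv_0 has_vector_derivative_def differentiable_def)
next
  case (Suc k)
  then obtain f' where "\<And>x. (f has_vector_derivative f' x) (at x)" "k_smooth (Suc k) f'"
    by auto
  then show ?case using Suc.IH by (metis nth_vderiv_Suc nth_vderiv_1_eqI)
qed

lemma smooth_iff_k_smooth: "smooth f \<longleftrightarrow> (\<forall>k. k_smooth k f)"
  using smooth_k_smooth k_smooth_differentiable smooth_def by metis

lemma smoothI:
  assumes "\<And>x. (f has_vector_derivative f' x) (at x)" "smooth f'"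
  shows "smooth f"
proof -
  have "k_smooth k f" for k
    by (cases k) (use assms smooth_k_smooth in auto)
  then show ?thesis by (simp add: smooth_iff_k_smooth)
qed

lemma k_smooth_pred: "k_smooth (Suc k) f \<Longrightarrow> k_smooth k f"
proof (induction k arbitrary: f)
  case (Suc k)
  from Suc.prems obtain f' where "\<forall>x. (f has_vector_derivative f' x) (at x)" "k_smooth (Suc k) f'"
    by auto
  with Suc.IH[of f'] show ?case by auto
qed simp

lemma k_smooth_const: "k_smooth k (\<lambda>x. c)"
proof (induction k arbitrary: c)
  case (Suc k)
  then show ?case by (auto intro!: exI[of _ "\<lambda>x. 0"])
qed simp

lemma k_smooth_add: "k_smooth k f \<Longrightarrow> k_smooth k g \<Longrightarrow> k_smooth k (\<lambda>x. f x + g x)"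
proof (induction k arbitrary: f g)
  case (Suc k)
  then obtain f' g' where "\<forall>x. (f has_vector_derivative f' x) (at x)" "k_smooth k f'"
      "\<forall>x. (g has_vector_derivative g' x) (at x)" "k_smooth k g'"
    by auto
  then show ?case
    using Suc.IH[of f' g'] by (auto intro!: exI[of _ "\<lambda>x. f' x + g' x"] derivative_intros)
qed simp

lemma k_smooth_mult:
  fixes f g :: "real \<Rightarrow> 'a::real_normed_algebra"
  shows "k_smooth k f \<Longrightarrow> k_smooth k g \<Longrightarrow> k_smooth k (\<lambda>x. f x * g x)"
proof (induction k arbitrary: f g)
  case (Suc k)
  then obtain f' g' where *: "\<forall>x. (f has_vector_derivative f' x) (at x)" "k_smooth k f'"
      "\<forall>x. (g has_vector_derivative g' x) (at x)" "k_smooth k g'"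
    by auto
  have "k_smooth k (\<lambda>x. f x * g' x + f' x * g x)"
    using Suc * by (intro k_smooth_add Suc.IH k_smooth_pred[of k f] k_smooth_pred[of k g])
  then show ?case
    using * by (auto intro!: exI[of _ "\<lambda>x. f x * g' x + f' x * g x"] has_vector_derivative_mult)
qed simp

lemma k_smooth_bounded_linear:
  assumes "bounded_linear L"
  shows "k_smooth k f \<Longrightarrow> k_smooth k (\<lambda>x. L (f x))"
proof (induction k arbitrary: f)
  case (Suc k)
  then obtain f' where "\<forall>x. (f has_vector_derivative f' x) (at x)" "k_smooth k f'"
    by auto
  then show ?case
    using Suc.IH[of f']
    by (auto intro!: exI[of _ "\<lambda>x. L (f' x)"] bounded_linear.has_vector_derivative[OF assms])
qed simp

lemma k_smooth_affine:
  fixes f :: "real \<Rightarrow> 'a::real_normed_vector"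
  shows "k_smooth k f \<Longrightarrow> k_smooth k (\<lambda>x. f (a * x + b))"
proof (induction k arbitrary: f)
  case (Suc k)
  then obtain f' where *: "\<forall>x. (f has_vector_derivative f' x) (at x)" "k_smooth k f'"
    by auto
  have "((\<lambda>x. f (a * x + b)) has_vector_derivative a *\<^sub>R f' (a * x + b)) (at x)" for x
  proof -
    have "((\<lambda>x. a * x + b) has_vector_derivative a) (at x)"
      by (auto intro!: derivative_eq_intros)
    moreover have "(f has_vector_derivative f' (a * x + b)) (at (a * x + b))"
      using *(1) by auto
    ultimately show ?thesis
      using vector_diff_chain_at[of "\<lambda>x. a * x + b" a x f "f' (a * x + b)"] by (simp add: o_def)
  qed
  moreover have "k_smooth k (\<lambda>x. a *\<^sub>R f' (a * x + b))"
    by (rule k_smooth_bounded_linear[OF bounded_linear_scaleR_right Suc.IH[OF *(2)]])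
  ultimately show ?case
    by (auto intro!: exI[of _ "\<lambda>x. a *\<^sub>R f' (a * x + b)"])
qed simp

lemma smooth_const: "smooth (\<lambda>x. c)"
  by (simp add: smooth_iff_k_smooth k_smooth_const)

lemma smooth_add: "smooth f \<Longrightarrow> smooth g \<Longrightarrow> smooth (\<lambda>x. f x + g x)"
  by (simp add: smooth_iff_k_smooth k_smooth_add)

lemma smooth_mult:
  fixes f g :: "real \<Rightarrow> 'a::real_normed_algebra"
  shows "smooth f \<Longrightarrow> smooth g \<Longrightarrow> smooth (\<lambda>x. f x * g x)"
  by (simp add: smooth_iff_k_smooth k_smooth_mult)

lemma smooth_bounded_linear: "bounded_linear L \<Longrightarrow> smooth f \<Longrightarrow> smooth (\<lambda>x. L (f x))"
  by (simp add: smooth_iff_k_smooth k_smooth_bounded_linear)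

lemma smooth_affine: "smooth f \<Longrightarrow> smooth (\<lambda>x. f (a * x + b))"
  by (simp add: smooth_iff_k_smooth k_smooth_affine)

lemma smooth_cnj: "smooth f \<Longrightarrow> smooth (\<lambda>x. cnj (f x))"
  by (rule smooth_bounded_linear[OF bounded_linear_cnj])

lemma smooth_of_real: "smooth f \<Longrightarrow> smooth (\<lambda>x. of_real (f x) :: complex)"
  by (rule smooth_bounded_linear[OF bounded_linear_of_real])

lemma smooth_ident: "smooth (\<lambda>x::real. x)"
  by (rule smoothI[of _ "\<lambda>x. 1"]) (auto intro!: derivative_eq_intros smooth_const)

lemma smooth_diff: "smooth f \<Longrightarrow> smooth g \<Longrightarrow> smooth (\<lambda>x. f x - g x)"
  using smooth_add[of f "\<lambda>x. - g x"] smooth_bounded_linear[OF bounded_linear_minus[OF bounded_linear_ident], of g]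
  by simp

lemma smooth_power:
  fixes f :: "real \<Rightarrow> 'a::real_normed_algebra_1"
  shows "smooth f \<Longrightarrow> smooth (\<lambda>x. f x ^ n)"
  by (induction n) (auto intro: smooth_const smooth_mult)

lemma smooth_continuous: "smooth f \<Longrightarrow> continuous_on S f"
  by (metis continuous_at_imp_continuous_on has_vector_derivative_continuous smooth_has_vderiv)

lemma smooth_measurable:
  fixes f :: "real \<Rightarrow> 'a::euclidean_space"
  shows "smooth f \<Longrightarrow> f \<in> borel_measurable borel"
  by (intro borel_measurable_continuous_onI smooth_continuous)

lemma vderiv_zero_off_closed:
  assumes "closed K" "\<And>x. x \<notin> K \<Longrightarrow> f x = 0" "x \<notin> K"
    "(f has_vector_derivative d) (at x)"
  shows "d = 0"
proof -
  have "((\<lambda>x. 0) has_vector_derivative d) (at x)"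
    by (rule has_vector_derivative_transform_within_open[OF assms(4), of "-K"])
      (use assms in auto)
  then show ?thesis
    by (metis has_vector_derivative_const vector_derivative_at)
qed

lemma test_funI:
  assumes "smooth f" "\<And>x. x \<notin> {a..b} \<Longrightarrow> f x = 0"
  shows "f \<in> test_fun"
proof -
  have "fsupport f \<subseteq> {a..b}"
    unfolding fsupport_def by (rule closure_minimal) (use assms(2) in force)+
  moreover have "closed (fsupport f)" by (simp add: fsupport_def)
  ultimately have "compact (fsupport f)"
    using compact_Int_closed[of "{a..b}" "fsupport f"] by (simp add: Int_absorb1)
  with assms(1) show ?thesis by (simp add: test_fun_def)
qed

lemma test_fun_smooth: "f \<in> test_fun \<Longrightarrow> smooth f"
  by (simp add: test_fun_def)

lemma not_in_fsupport: "x \<notin> fsupport f \<Longrightarrow> f x = 0"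
  using closure_subset[of "{x. f x \<noteq> 0}"] by (auto simp: fsupport_def)

lemma compact_real_interval:
  assumes "compact (K::real set)"
  obtains R where "R \<ge> 1" "K \<subseteq> {-R..R}"
proof -
  from assms obtain B where "\<forall>x\<in>K. norm x \<le> B" by (meson bounded_iff compact_imp_bounded)
  then have "K \<subseteq> {- (max B 1)..max B 1}" by (force simp: abs_le_iff)
  then show ?thesis using that[of "max B 1"] by simp
qed

lemma test_fun_interval:
  assumes "f \<in> test_fun"
  obtains R where "R \<ge> 1" "\<And>x. x \<notin> {-R..R} \<Longrightarrow> f x = 0"
proof -
  obtain R where "R \<ge> 1" "fsupport f \<subseteq> {-R..R}"
    using assms compact_real_interval[of "fsupport f"] by (auto simp: test_fun_def)
  then show ?thesis using that[of R] not_in_fsupport[of _ f] by blast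
qed

lemma test_fun_deriv:
  assumes "f \<in> test_fun"
  shows "nth_vderiv 1 f \<in> test_fun"
proof -
  obtain R where "\<And>x. x \<notin> {-R..R} \<Longrightarrow> f x = 0" using test_fun_interval[OF assms] by metis
  then have "nth_vderiv 1 f x = 0" if "x \<notin> {-R..R}" for x
    using vderiv_zero_off_closed[of "{-R..R}" f x] that smooth_has_vderiv[OF test_fun_smooth[OF assms]]
    by auto
  then show ?thesis
    by (rule test_funI[OF smooth_vderiv[OF test_fun_smooth[OF assms]]])
qed

lemma continuous_zero_off_compact_bounded:
  fixes f :: "real \<Rightarrow> 'a::real_normed_vector"
  assumes "continuous_on UNIV f" "compact K" "\<And>x. x \<notin> K \<Longrightarrow> f x = 0"
  obtains B where "B \<ge> 0" "\<And>x. norm (f x) \<le> B"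
proof -
  have "compact (f ` K)"
    using assms by (intro compact_continuous_image continuous_on_subset[OF assms(1)]) auto
  then obtain B where "\<forall>y\<in>f ` K. norm y \<le> B" by (meson bounded_iff compact_imp_bounded)
  then have "norm (f x) \<le> max B 0" for x using assms(3)[of x] by (cases "x \<in> K") auto
  then show ?thesis using that[of "max B 0"] by auto
qed

lemma test_fun_bounded:
  assumes "f \<in> test_fun"
  obtains B where "B \<ge> 0" "\<And>x. norm (f x) \<le> B"
  using continuous_zero_off_compact_bounded[of f "fsupport f" thesis] assms not_in_fsupport[of _ f]
    smooth_continuous[of f UNIV] by (auto simp: test_fun_def)

lemma test_fun_L2:
  assumes "f \<in> test_fun"
  shows "L2 f"
proof -
  obtain R where "R \<ge> 1" "\<And>x. x \<notin> {-R..R} \<Longrightarrow> f x = 0" using test_fun_interval[OF assms] by metis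
  moreover obtain B where "\<And>x. norm (f x) \<le> B" using test_fun_bounded[OF assms] by metis
  ultimately show ?thesis
    using L2_bounded_on_interval(1)[of f B "-R" R] smooth_measurable[OF test_fun_smooth[OF assms]]
    by auto
qed

lemma test_fun_add:
  assumes "f \<in> test_fun" "g \<in> test_fun"
  shows "(\<lambda>x. f x + g x) \<in> test_fun"
proof -
  obtain R where "\<And>x. x \<notin> {-R..R} \<Longrightarrow> f x = 0" using test_fun_interval[OF assms(1)] by metis
  moreover obtain R' where "\<And>x. x \<notin> {-R'..R'} \<Longrightarrow> g x = 0" using test_fun_interval[OF assms(2)] by metis
  ultimately have "\<And>x. x \<notin> {- (max R R')..max R R'} \<Longrightarrow> f x + g x = 0"
    by (auto simp: max_def split: if_splits)
  then show ?thesis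
    by (rule test_funI[OF smooth_add[OF assms[THEN test_fun_smooth]]])
qed

lemma test_fun_mult:
  assumes "f \<in> test_fun" "smooth g"
  shows "(\<lambda>x. g x * f x) \<in> test_fun"
proof -
  obtain R where "\<And>x. x \<notin> {-R..R} \<Longrightarrow> f x = 0" using test_fun_interval[OF assms(1)] by metis
  then show ?thesis
    by (intro test_funI[OF smooth_mult[OF assms(2) test_fun_smooth[OF assms(1)]], of "-R" R]) auto
qed

lemma test_fun_cmult: "f \<in> test_fun \<Longrightarrow> (\<lambda>x. c * f x) \<in> test_fun"
  by (rule test_fun_mult[OF _ smooth_const])

lemma test_fun_diff: "f \<in> test_fun \<Longrightarrow> g \<in> test_fun \<Longrightarrow> (\<lambda>x. f x - g x) \<in> test_fun"
  using test_fun_add[of f "\<lambda>x. -1 * g x"] test_fun_cmult[of g "-1"] by simp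

lemma test_fun_cnj:
  assumes "f \<in> test_fun"
  shows "(\<lambda>x. cnj (f x)) \<in> test_fun"
proof -
  obtain R where "\<And>x. x \<notin> {-R..R} \<Longrightarrow> f x = 0" using test_fun_interval[OF assms] by metis
  then show ?thesis
    by (intro test_funI[OF smooth_cnj[OF test_fun_smooth[OF assms]], of "-R" R]) auto
qed

lemma test_fun_shift:
  assumes "f \<in> test_fun"
  shows "(\<lambda>x. f (x + h)) \<in> test_fun"
proof -
  obtain R where "\<And>x. x \<notin> {-R..R} \<Longrightarrow> f x = 0" using test_fun_interval[OF assms] by metis
  then show ?thesis
    using smooth_affine[OF test_fun_smooth[OF assms], of 1 h]
    by (intro test_funI[of _ "-R-h" "R-h"]) auto
qed

lemma nth_vderiv_1_shift:
  assumes "smooth f"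
  shows "nth_vderiv 1 (\<lambda>x. f (x + h)) = (\<lambda>x. nth_vderiv 1 f (x + h))"
proof (rule nth_vderiv_1_eqI)
  fix x
  have "((\<lambda>x. x + h) has_vector_derivative 1) (at x)"
    by (auto intro!: derivative_eq_intros)
  from vector_diff_chain_at[OF this smooth_has_vderiv[OF assms]]
  show "((\<lambda>x. f (x + h)) has_vector_derivative nth_vderiv 1 f (x + h)) (at x)"
    by (simp add: o_def)
qed

lemma nth_vderiv_1_mult:
  fixes f g :: "real \<Rightarrow> complex"
  assumes "smooth f" "smooth g"
  shows "nth_vderiv 1 (\<lambda>x. f x * g x) = (\<lambda>x. f x * nth_vderiv 1 g x + nth_vderiv 1 f x * g x)"
  by (intro nth_vderiv_1_eqI has_vector_derivative_mult smooth_has_vderiv assms)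

lemma LINT_deriv_compact_support:
  fixes f :: "real \<Rightarrow> complex"
  assumes "\<And>x. (f has_vector_derivative f' x) (at x)" "continuous_on UNIV f'"
    "\<And>x. x \<notin> {-R..R} \<Longrightarrow> f x = 0"
  shows "(LINT x|lborel. f' x) = 0"
proof -
  define S where "S = \<bar>R\<bar> + 1"
  have z: "f' x = 0" if "x \<notin> {-R..R}" for x
    using vderiv_zero_off_closed[of "{-R..R}" f x "f' x"] assms(1,3) that by auto
  have "(\<lambda>x. indicator {-S..S} x *\<^sub>R f' x) = f'"
    using z by (force simp: S_def indicator_def fun_eq_iff)
  moreover have "(LINT x|lborel. indicator {-S..S} x *\<^sub>R f' x) = f S - f (-S)"
  proof (rule integral_FTC_atLeastAtMost)
    show "(f has_vector_derivative f' x) (at x within {- S..S})" for x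
      using assms(1)[of x] by (rule has_vector_derivative_at_within)
    show "continuous_on {- S..S} f'" using assms(2) by (rule continuous_on_subset) auto
  qed (simp add: S_def)
  moreover have "f S = 0" "f (-S) = 0" by (auto intro!: assms(3) simp: S_def)
  ultimately show ?thesis by simp
qed

lemma vderiv_lipschitz:
  fixes f :: "real \<Rightarrow> 'a::real_normed_vector"
  assumes "\<And>x. (f has_vector_derivative f' x) (at x)" "\<And>x. norm (f' x) \<le> B"
  shows "norm (f x - f y) \<le> B * norm (x - y)"
proof (rule differentiable_bound[of UNIV f "\<lambda>x t. t *\<^sub>R f' x"])
  fix x
  show "(f has_derivative (\<lambda>t. t *\<^sub>R f' x)) (at x within UNIV)"
    using assms(1)[of x] by (simp add: has_vector_derivative_def)
  show "onorm (\<lambda>t. t *\<^sub>R f' x) \<le> B"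
    using assms(2)[of x] by (intro onorm_le) (simp add: mult.commute[of B] mult_left_mono)
qed auto

lemma vderiv_quotient_tendsto:
  fixes f :: "real \<Rightarrow> 'a::real_normed_vector"
  assumes "(f has_vector_derivative d) (at x)"
  shows "((\<lambda>h. (f (x + h) - f x) /\<^sub>R h) \<longlongrightarrow> d) (at 0)"
proof (rule LIM_zero_cancel, rule tendsto_norm_zero_cancel)
  have "((\<lambda>h. norm (f (x + h) - f x - h *\<^sub>R d) / norm h) \<longlongrightarrow> 0) (at 0)"
    using assms unfolding has_vector_derivative_def has_derivative_at by simp
  then show "((\<lambda>h. norm ((f (x + h) - f x) /\<^sub>R h - d)) \<longlongrightarrow> 0) (at 0)"
  proof (rule Lim_transform_eventually)
    have "norm (f (x + h) - f x - h *\<^sub>R d) / norm h = norm ((f (x + h) - f x) /\<^sub>R h - d)" if "h \<noteq> 0" for h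
    proof -
      have "(f (x + h) - f x) /\<^sub>R h - d = (f (x + h) - f x - h *\<^sub>R d) /\<^sub>R h"
        using that by (simp add: scaleR_diff_right)
      then show ?thesis by (simp add: divide_inverse mult.commute)
    qed
    then show "\<forall>\<^sub>F h in at 0. norm (f (x + h) - f x - h *\<^sub>R d) / norm h = norm ((f (x + h) - f x) /\<^sub>R h - d)"
      by (auto simp: eventually_at_filter)
  qed
qed

subsection \<open>Bump functions\<close>

text \<open>Derivatives of \<open>e\<^sup>-\<^sup>1\<^sup>/\<^sup>x\<close> are polynomials in \<open>1 / x\<close> times the same exponential, so this class is
  closed under differentiation.\<close>

definition exp_cut :: "real poly \<Rightarrow> real \<Rightarrow> real" where
  "exp_cut p x = (if 0 < x then poly p (1 / x) * exp (- (1 / x)) else 0)"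

lemma poly_exp_tendsto_0: "((\<lambda>z. z * poly p z * exp (- z)) \<longlongrightarrow> (0::real)) at_top"
proof (induction p)
  case (pCons a p)
  have "((\<lambda>z::real. a * z * exp (- z)) \<longlongrightarrow> 0) at_top" by real_asymp
  moreover have "((\<lambda>z. z * (z * poly p z * exp (- z))) \<longlongrightarrow> 0) at_top"
  proof -
    have "((\<lambda>z. z ^ k * exp (- z)) \<longlongrightarrow> (0::real)) at_top" for k
      using tendsto_power_div_exp_0[of k] by (simp add: exp_minus field_simps)
    then have "((\<lambda>z. \<Sum>i\<le>degree p. coeff p i * (z ^ (i + 2) * exp (- z))) \<longlongrightarrow> (\<Sum>i\<le>degree p. coeff p i * 0)) at_top"
      by (intro tendsto_sum tendsto_mult_left)
    moreover have "(\<lambda>z. \<Sum>i\<le>degree p. coeff p i * (z ^ (i + 2) * exp (- z))) = (\<lambda>z. z * (z * poly p z * exp (- z)))"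
      by (rule ext) (simp add: poly_altdef sum_distrib_left sum_distrib_right power_add power2_eq_square mult_ac)
    ultimately show ?thesis by simp
  qed
  ultimately have "((\<lambda>z. a * z * exp (- z) + z * (z * poly p z * exp (- z))) \<longlongrightarrow> 0 + 0) at_top"
    by (rule tendsto_add)
  then show ?case by (simp add: algebra_simps)
qed simp

lemma exp_cut_deriv:
  "(exp_cut p has_real_derivative exp_cut ([:0, 0, 1:] * (p - pderiv p)) x) (at x)"
proof (cases "x = 0")
  case False
  then consider "0 < x" | "x < 0" by linarith
  then show ?thesis
  proof cases
    case 1
    have "((\<lambda>x. poly p (1 / x) * exp (- (1 / x))) has_real_derivative
        exp_cut ([:0, 0, 1:] * (p - pderiv p)) x) (at x)"
      using 1
      by (auto intro!: derivative_eq_intros DERIV_chain'[OF _ poly_DERIV] simp: exp_cut_def power2_eq_square field_simps)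
    then show ?thesis
      by (rule has_field_derivative_transform_within_open[of _ _ _ "{0<..}"])
        (use 1 in \<open>auto simp: exp_cut_def\<close>)
  next
    case 2
    have "((\<lambda>x. 0) has_real_derivative exp_cut ([:0, 0, 1:] * (p - pderiv p)) x) (at x)"
      using 2 by (simp add: exp_cut_def)
    then show ?thesis
      by (rule has_field_derivative_transform_within_open[of _ _ _ "{..<0}"])
        (use 2 in \<open>auto simp: exp_cut_def\<close>)
  qed
next
  case True
  have "((\<lambda>h. exp_cut p h / h) \<longlongrightarrow> 0) (at 0)"
  proof (rule filterlim_split_at)
    show "((\<lambda>h. exp_cut p h / h) \<longlongrightarrow> 0) (at_left 0)"
      by (rule tendsto_eventually)
        (auto simp: eventually_at_filter exp_cut_def)
    have "((\<lambda>h. (1 / h) * poly p (1 / h) * exp (- (1 / h))) \<longlongrightarrow> 0) (at_right (0::real))"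
      by (rule filterlim_compose[OF poly_exp_tendsto_0]) real_asymp
    then show "((\<lambda>h. exp_cut p h / h) \<longlongrightarrow> 0) (at_right 0)"
      by (rule Lim_transform_eventually) (auto simp: eventually_at_filter exp_cut_def)
  qed
  then show ?thesis using True by (simp add: has_field_derivative_iff exp_cut_def)
qed

lemma smooth_exp_cut: "smooth (exp_cut p)"
proof -
  have "k_smooth k (exp_cut p)" for k
  proof (induction k arbitrary: p)
    case (Suc k)
    show ?case
      using exp_cut_deriv[of p] Suc.IH[of "[:0, 0, 1:] * (p - pderiv p)"]
      by (auto simp: has_real_derivative_iff_has_vector_derivative simp del: mult_pCons_left)
  qed simp
  then show ?thesis by (simp add: smooth_iff_k_smooth)
qed

definition bump :: "real \<Rightarrow> real \<Rightarrow> real \<Rightarrow> real" where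
  "bump a b x = exp_cut 1 (x - a) * exp_cut 1 (b - x)"

lemma bump_smooth: "smooth (bump a b)"
  unfolding bump_def
  using smooth_mult[OF smooth_affine[OF smooth_exp_cut[of 1], of 1 "-a"]
      smooth_affine[OF smooth_exp_cut[of 1], of "-1" b]]
  by simp

lemma bump_pos: "a < x \<Longrightarrow> x < b \<Longrightarrow> 0 < bump a b x"
  by (simp add: bump_def exp_cut_def)

lemma bump_zero: "x \<notin> {a<..<b} \<Longrightarrow> bump a b x = 0"
  by (auto simp: bump_def exp_cut_def)

lemma bump_bounds: "0 \<le> bump a b x" "bump a b x \<le> 1"
  by (auto simp: bump_def exp_cut_def intro!: mult_le_one)

text \<open>A bump function \<open>B\<close> is positive exactly inside the interval, so \<open>1 - (1 - B)\<^sup>n\<close> increases to the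
  indicator; as a polynomial in \<open>B\<close> it is smooth, and it vanishes wherever \<open>B\<close> does.\<close>

definition interval_approx :: "real \<Rightarrow> real \<Rightarrow> nat \<Rightarrow> real \<Rightarrow> complex" where
  "interval_approx a b n x = of_real (1 - (1 - bump a b x) ^ n)"

lemma interval_approx_smooth: "smooth (interval_approx a b n)"
  unfolding interval_approx_def
  by (intro smooth_of_real smooth_diff smooth_const smooth_power bump_smooth)

lemma interval_approx_bounded: "norm (interval_approx a b n x) \<le> 1"
proof -
  have "0 \<le> (1 - bump a b x) ^ n" "(1 - bump a b x) ^ n \<le> 1"
    using bump_bounds[of a b x] by (auto intro: power_le_one)
  then show ?thesis unfolding interval_approx_def norm_of_real by simp
qed

lemma interval_approx_zero: "x \<notin> {a<..<b} \<Longrightarrow> interval_approx a b n x = 0"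
  by (simp add: interval_approx_def bump_zero)

lemma interval_approx_test: "interval_approx a b n \<in> test_fun"
  by (rule test_funI[OF interval_approx_smooth, of a b]) (auto intro: interval_approx_zero)

lemma interval_approx_tendsto:
  "(\<lambda>n. interval_approx a b n x) \<longlonglongrightarrow> indicator {a<..<b} x"
proof (cases "x \<in> {a<..<b}")
  case True
  have "norm (1 - bump a b x) < 1"
    using True bump_bounds[of a b x] bump_pos[of a x b] by simp
  then have "(\<lambda>n. (1 - bump a b x) ^ n) \<longlonglongrightarrow> 0"
    by (rule LIMSEQ_power_zero)
  then have "(\<lambda>n. of_real (1 - (1 - bump a b x) ^ n) :: complex) \<longlonglongrightarrow> of_real (1 - 0)"
    by (intro tendsto_of_real tendsto_diff tendsto_const)
  then show ?thesis using True by (simp add: interval_approx_def)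
qed (simp add: interval_approx_zero)

section \<open>Density of test functions and duality\<close>

lemma locally_integrable_measurable:
  fixes f :: "real \<Rightarrow> complex"
  assumes "\<And>a b. set_integrable lborel {a..b} f"
  shows "f \<in> borel_measurable borel"
proof (rule borel_measurable_LIMSEQ_metric)
  show "(\<lambda>x. indicator {- real n..real n} x *\<^sub>R f x) \<in> borel_measurable borel" for n
    using assms[of "- real n" "real n"] unfolding set_integrable_def by auto
  fix x :: real
  obtain N :: nat where N: "\<bar>x\<bar> \<le> real N" using real_arch_simple by blast
  have "\<forall>\<^sub>F n in sequentially. indicator {- real n..real n} x *\<^sub>R f x = f x"
    using eventually_ge_at_top[of N]
    by eventually_elim (use N in \<open>auto simp: indicator_def abs_le_iff\<close>)
  then show "(\<lambda>n. indicator {- real n..real n} x *\<^sub>R f x) \<longlonglongrightarrow> f x"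
    by (rule tendsto_eventually)
qed

lemma locally_integrable_mult_bounded:
  fixes f g :: "real \<Rightarrow> complex"
  assumes "\<And>a b. set_integrable lborel {a..b} f" "g \<in> borel_measurable borel"
    "\<And>x. norm (g x) \<le> B" "\<And>x. x \<notin> {a..b} \<Longrightarrow> g x = 0"
  shows "integrable lborel (\<lambda>x. f x * g x)"
proof (rule Bochner_Integration.integrable_bound)
  show "integrable lborel (\<lambda>x. B *\<^sub>R (indicator {a..b} x *\<^sub>R f x))"
    using assms(1)[of a b] unfolding set_integrable_def by (rule integrable_scaleR_right)
  show "(\<lambda>x. f x * g x) \<in> borel_measurable lborel"
    using locally_integrable_measurable[OF assms(1)] assms(2) by measurable
  show "AE x in lborel. norm (f x * g x) \<le> norm (B *\<^sub>R (indicator {a..b} x *\<^sub>R f x))"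
  proof (rule AE_I2)
    fix x
    have B: "0 \<le> B" using assms(3)[of x] norm_ge_zero order_trans by blast
    show "norm (f x * g x) \<le> norm (B *\<^sub>R (indicator {a..b} x *\<^sub>R f x))"
      using assms(3)[of x] assms(4)[of x] B
      by (cases "x \<in> {a..b}") (auto simp: norm_mult mult.commute[of B] intro: mult_left_mono)
  qed
qed

lemma locally_integrable_mult_test:
  fixes f :: "real \<Rightarrow> complex"
  assumes "\<And>a b. set_integrable lborel {a..b} f" "\<phi> \<in> test_fun"
  shows "integrable lborel (\<lambda>x. f x * \<phi> x)"
proof -
  obtain R where "\<And>x. x \<notin> {-R..R} \<Longrightarrow> \<phi> x = 0" using test_fun_interval[OF assms(2)] by metis
  moreover obtain B where "\<And>x. norm (\<phi> x) \<le> B" using test_fun_bounded[OF assms(2)] by metis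
  ultimately show ?thesis
    using locally_integrable_mult_bounded[OF assms(1) smooth_measurable[OF test_fun_smooth[OF assms(2)]]]
    by metis
qed

lemma borel_interval_induct [consumes 1, case_names interval compl union]:
  fixes A :: "real set"
  assumes "A \<in> sets borel" "\<And>a b. P {a<..<b}"
    "\<And>A. A \<in> sets borel \<Longrightarrow> P A \<Longrightarrow> P (- A)"
    "\<And>A. disjoint_family A \<Longrightarrow> range A \<subseteq> sets borel \<Longrightarrow> (\<And>i::nat. P (A i)) \<Longrightarrow> P (\<Union>i. A i)"
  shows "P A"
proof -
  define G :: "real set set" where "G = range (\<lambda>(a, b). {a<..<b})"
  have bG: "sets borel = sigma_sets UNIV G"
    using arg_cong[OF borel_eq_box[where 'a=real], of sets] by (simp add: G_def box_real)
  have "Int_stable G"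
  proof (rule Int_stableI)
    fix a b assume "a \<in> G" "b \<in> G"
    then obtain p q r s where "a = {p<..<q}" "b = {r<..<s}" by (auto simp: G_def)
    then have "a \<inter> b = {max p r<..<min q s}" by auto
    then show "a \<inter> b \<in> G" unfolding G_def by auto
  qed
  moreover have "G \<subseteq> Pow UNIV" by simp
  moreover have "A \<in> sigma_sets UNIV G" using assms(1) by (simp add: bG)
  ultimately show ?thesis
  proof (induction A rule: sigma_sets_induct_disjoint)
    case (basic A)
    then show ?case using assms(2) by (auto simp: G_def)
  next
    case empty
    then show ?case using assms(2)[of 0 0] by simp
  next
    case (compl A)
    then show ?case using assms(3)[of A] by (simp add: bG Compl_eq_Diff_UNIV)
  next
    case (union A)
    then show ?case using assms(4)[of A] by (simp add: bG)
  qed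
qed

text \<open>The fundamental lemma of the calculus of variations: testing against smooth approximations of
  indicators shows that all integrals over intervals vanish.\<close>

lemma fundamental_lemma:
  fixes f :: "real \<Rightarrow> complex"
  assumes int: "\<And>a b. set_integrable lborel {a..b} f"
    and zero: "\<And>\<phi>. \<phi> \<in> test_fun \<Longrightarrow> (LINT x|lborel. f x * \<phi> x) = 0"
  shows "AE x in lborel. f x = 0"
proof -
  note fm = locally_integrable_measurable[OF int]
  have interval: "(LINT x|lborel. f x * indicator {a<..<b} x) = 0" for a b :: real
  proof -
    have i: "integrable lborel (\<lambda>x. f x * indicator {a..b} x)"
      by (rule locally_integrable_mult_bounded[OF int, of _ 1 a b]) (auto simp: indicator_def)
    have "(\<lambda>n. LINT x|lborel. f x * interval_approx a b n x) \<longlonglongrightarrow> (LINT x|lborel. f x * indicator {a<..<b} x)"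
    proof (rule integral_dominated_convergence[where w="\<lambda>x. norm (f x * indicator {a..b} x)"])
      show "integrable lborel (\<lambda>x. norm (f x * indicator {a..b} x))" using i by (rule integrable_norm)
      show "(\<lambda>x. f x * indicator {a<..<b} x) \<in> borel_measurable lborel" using fm by measurable
      show "(\<lambda>x. f x * interval_approx a b n x) \<in> borel_measurable lborel" for n
        using fm smooth_measurable[OF interval_approx_smooth] by measurable
      show "AE x in lborel. (\<lambda>n. f x * interval_approx a b n x) \<longlonglongrightarrow> f x * indicator {a<..<b} x"
        by (intro AE_I2 tendsto_mult_left interval_approx_tendsto)
      show "AE x in lborel. norm (f x * interval_approx a b n x) \<le> norm (f x * indicator {a..b} x)" for n
      proof (rule AE_I2)
        fix x
        show "norm (f x * interval_approx a b n x) \<le> norm (f x * indicator {a..b} x)"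
          using interval_approx_bounded[of a b n x] interval_approx_zero[of x a b n]
          by (cases "x \<in> {a<..<b}") (auto simp: norm_mult mult_left_le)
      qed
    qed
    moreover have "(\<lambda>n. LINT x|lborel. f x * interval_approx a b n x) = (\<lambda>n. 0)"
      by (simp add: zero interval_approx_test)
    ultimately show ?thesis using LIMSEQ_unique tendsto_const by metis
  qed
  have "AE x in lborel. f x * indicator {- real n<..<real n} x = 0" for n :: nat
  proof (rule sigma_finite_measure.density_zero[OF sigma_finite_lborel])
    define h where "h = (\<lambda>x. f x * indicator {- real n<..<real n} x)"
    have ih: "integrable lborel h"
      unfolding h_def by (rule locally_integrable_mult_bounded[OF int, of _ 1 "-real n" "real n"]) (auto simp: indicator_def)
    then show "integrable lborel (\<lambda>x. f x * indicator {- real n<..<real n} x)" by (simp add: h_def)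
    fix A :: "real set" assume "A \<in> sets lborel"
    then have "A \<in> sets borel" by simp
    then have "(LINT x:A|lborel. h x) = 0"
    proof (induction A rule: borel_interval_induct)
      case (interval a b)
      have "(\<lambda>x. indicator {a<..<b} x *\<^sub>R h x) = (\<lambda>x. f x * indicator {max a (- real n)<..<min b (real n)} x)"
        by (auto simp: h_def indicator_def)
      then show ?case
        unfolding set_lebesgue_integral_def using \<open>\<And>a b. (LINT x|lborel. f x * indicator {a<..<b} x) = 0\<close> by simp
    next
      case (compl A)
      have "(LINT x:(-A)|lborel. h x) = (LINT x|lborel. h x - indicator A x *\<^sub>R h x)"
        unfolding set_lebesgue_integral_def
        by (rule Bochner_Integration.integral_cong) (auto simp: indicator_def)
      also have "\<dots> = (LINT x|lborel. h x) - (LINT x:A|lborel. h x)"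
        unfolding set_lebesgue_integral_def
        by (rule Bochner_Integration.integral_diff) (use ih compl in \<open>auto intro: integrable_mult_indicator\<close>)
      also have "\<dots> = 0" using compl interval[of "- real n" "real n"] by (simp add: h_def)
      finally show ?case .
    next
      case (union A)
      have "(LINT x:(\<Union>i. A i)|lborel. h x) = (\<Sum>i. LINT x:(A i)|lborel. h x)"
      proof (rule lebesgue_integral_countable_add)
        show "A i \<inter> A j = {}" if "i \<noteq> j" for i j
          using union(1) that by (auto simp: disjoint_family_on_def)
        show "set_integrable lborel (\<Union> (range A)) h"
          unfolding set_integrable_def using union(2) ih by (intro integrable_mult_indicator) auto
      qed (use union in auto)
      then show ?case using union by simp
    qed
    then show "(LINT x:A|lborel. f x * indicator {- real n<..<real n} x) = 0" by (simp add: h_def)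
  qed
  then have "AE x in lborel. \<forall>n::nat. f x * indicator {- real n<..<real n} x = 0"
    unfolding AE_all_countable by blast
  then show ?thesis
  proof eventually_elim
    fix x assume a: "\<forall>n::nat. f x * indicator {- real n<..<real n} x = 0"
    obtain n :: nat where "\<bar>x\<bar> < real n" using reals_Archimedean2 by blast
    then show "f x = 0" using a[rule_format, of n] by (simp add: indicator_def abs_less_iff split: if_splits)
  qed
qed

text \<open>The interval is fixed because primitives of the approximants will have to vanish off it.\<close>

definition test_approximable :: "real \<Rightarrow> real \<Rightarrow> (real \<Rightarrow> complex) \<Rightarrow> bool" where
  "test_approximable a b f \<longleftrightarrow> L2 f \<and>
     (\<forall>e>0. \<exists>\<phi>\<in>test_fun. (\<forall>x. x \<notin> {a..b} \<longrightarrow> \<phi> x = 0) \<and> L2_norm (\<lambda>x. f x - \<phi> x) < e)"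

lemma test_approximable_limit:
  assumes "L2 f" "\<And>n. test_approximable a b (s n)" "(\<lambda>n::nat. L2_norm (\<lambda>x. s n x - f x)) \<longlonglongrightarrow> 0"
  shows "test_approximable a b f"
  unfolding test_approximable_def
proof (intro conjI allI impI)
  fix e :: real assume e: "0 < e"
  have "\<forall>\<^sub>F n in sequentially. L2_norm (\<lambda>x. s n x - f x) < e / 2"
    by (rule order_tendstoD(2)[OF assms(3)]) (use e in auto)
  then obtain n where n: "L2_norm (\<lambda>x. s n x - f x) < e / 2"
    by (auto simp: eventually_sequentially)
  obtain \<phi> where p: "\<phi> \<in> test_fun" "\<forall>x. x \<notin> {a..b} \<longrightarrow> \<phi> x = 0" "L2_norm (\<lambda>x. s n x - \<phi> x) < e / 2"
    using assms(2)[of n] e unfolding test_approximable_def by (meson half_gt_zero)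
  have sL: "L2 (s n)" using assms(2) by (simp add: test_approximable_def)
  have "L2_norm (\<lambda>x. (f x - s n x) + (s n x - \<phi> x)) \<le> L2_norm (\<lambda>x. f x - s n x) + L2_norm (\<lambda>x. s n x - \<phi> x)"
    by (intro L2_norm_triangle L2_diff assms(1) sL test_fun_L2 p)
  then have "L2_norm (\<lambda>x. f x - \<phi> x) < e"
    using n p(3) L2_norm_minus_commute[of f "s n"] by simp
  then show "\<exists>\<phi>\<in>test_fun. (\<forall>x. x \<notin> {a..b} \<longrightarrow> \<phi> x = 0) \<and> L2_norm (\<lambda>x. f x - \<phi> x) < e"
    using p by blast
qed (rule assms(1))

lemma test_approximable_test:
  assumes "\<phi> \<in> test_fun" "\<And>x. x \<notin> {a..b} \<Longrightarrow> \<phi> x = 0"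
  shows "test_approximable a b \<phi>"
  unfolding test_approximable_def
  using assms by (auto simp: test_fun_L2 L2_norm_zero intro!: bexI[of _ \<phi>])

lemma test_approximable_zero: "test_approximable a b (\<lambda>x. 0)"
  by (rule test_approximable_test) (auto intro!: test_funI smooth_const)

lemma test_approximable_add:
  assumes "test_approximable a b f" "test_approximable a b g"
  shows "test_approximable a b (\<lambda>x. f x + g x)"
  unfolding test_approximable_def
proof (intro conjI allI impI)
  have L: "L2 f" "L2 g" using assms by (auto simp: test_approximable_def)
  then show "L2 (\<lambda>x. f x + g x)" by (rule L2_add)
  fix e :: real assume e: "0 < e"
  obtain \<phi> where p: "\<phi> \<in> test_fun" "\<forall>x. x \<notin> {a..b} \<longrightarrow> \<phi> x = 0" "L2_norm (\<lambda>x. f x - \<phi> x) < e / 2"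
    using assms(1) e unfolding test_approximable_def by (meson half_gt_zero)
  obtain \<psi> where q: "\<psi> \<in> test_fun" "\<forall>x. x \<notin> {a..b} \<longrightarrow> \<psi> x = 0" "L2_norm (\<lambda>x. g x - \<psi> x) < e / 2"
    using assms(2) e unfolding test_approximable_def by (meson half_gt_zero)
  have "L2_norm (\<lambda>x. (f x - \<phi> x) + (g x - \<psi> x)) \<le> L2_norm (\<lambda>x. f x - \<phi> x) + L2_norm (\<lambda>x. g x - \<psi> x)"
    by (intro L2_norm_triangle L2_diff L test_fun_L2 p q)
  then have "L2_norm (\<lambda>x. f x + g x - (\<phi> x + \<psi> x)) < e"
    using p(3) q(3) by (simp add: algebra_simps)
  then show "\<exists>\<phi>\<in>test_fun. (\<forall>x. x \<notin> {a..b} \<longrightarrow> \<phi> x = 0) \<and> L2_norm (\<lambda>x. f x + g x - \<phi> x) < e"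
    using p q test_fun_add by (intro bexI[of _ "\<lambda>x. \<phi> x + \<psi> x"]) auto
qed

lemma test_approximable_cmult:
  assumes "test_approximable a b f"
  shows "test_approximable a b (\<lambda>x. c * f x)"
  unfolding test_approximable_def
proof (intro conjI allI impI)
  have L: "L2 f" using assms by (auto simp: test_approximable_def)
  then show "L2 (\<lambda>x. c * f x)" by (rule L2_cmult)
  fix e :: real assume e: "0 < e"
  have "0 < e / (1 + norm c)" using e by (simp add: add_pos_nonneg)
  then obtain \<phi> where p: "\<phi> \<in> test_fun" "\<forall>x. x \<notin> {a..b} \<longrightarrow> \<phi> x = 0" "L2_norm (\<lambda>x. f x - \<phi> x) < e / (1 + norm c)"
    using assms unfolding test_approximable_def by meson
  have "norm c * L2_norm (\<lambda>x. f x - \<phi> x) \<le> (1 + norm c) * L2_norm (\<lambda>x. f x - \<phi> x)"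
    by (intro mult_right_mono L2_norm_nonneg) auto
  also have "\<dots> < (1 + norm c) * (e / (1 + norm c))"
    by (rule mult_strict_left_mono[OF p(3)]) (simp add: add_pos_nonneg)
  also have "\<dots> = e" by (simp add: add_pos_nonneg add_nonneg_eq_0_iff)
  finally have "L2_norm (\<lambda>x. c * f x - c * \<phi> x) < e"
    using L2_norm_cmult[of c "\<lambda>x. f x - \<phi> x"] by (simp add: right_diff_distrib)
  then show "\<exists>\<phi>\<in>test_fun. (\<forall>x. x \<notin> {a..b} \<longrightarrow> \<phi> x = 0) \<and> L2_norm (\<lambda>x. c * f x - \<phi> x) < e"
    using p test_fun_cmult by (intro bexI[of _ "\<lambda>x. c * \<phi> x"]) auto
qed

lemma test_approximable_sum:
  assumes "finite S" "\<And>i. i \<in> S \<Longrightarrow> test_approximable a b (f i)"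
  shows "test_approximable a b (\<lambda>x. \<Sum>i\<in>S. f i x)"
  using assms
  by (induction S rule: finite_induct) (auto intro: test_approximable_zero test_approximable_add)

lemma test_approximable_interval: "test_approximable a b (indicator {a<..<b})"
proof (rule test_approximable_limit)
  show I: "L2 (indicator {a<..<b} :: real \<Rightarrow> complex)"
    by (rule L2_bounded_on_interval(1)[where B=1 and a="min a b" and b="max a b"]) (auto simp: indicator_def)
  show "test_approximable a b (interval_approx a b n)" for n
    by (rule test_approximable_test[OF interval_approx_test]) (auto intro: interval_approx_zero)
  show "(\<lambda>n. L2_norm (\<lambda>x. interval_approx a b n x - indicator {a<..<b} x)) \<longlonglongrightarrow> 0"
  proof (rule L2_tendsto_dominated[OF I I])
    show "AE x in lborel. norm (interval_approx a b n x) \<le> norm (indicator {a<..<b} x :: complex)" for n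
      using interval_approx_bounded[of a b n] interval_approx_zero[of _ a b n]
      by (auto simp: indicator_def)
  qed (auto intro: smooth_measurable interval_approx_smooth interval_approx_tendsto)
qed

text \<open>The Borel sets with this property form a Dynkin system that contains the intervals.\<close>

lemma test_approximable_indicator:
  assumes "A \<in> sets borel"
  shows "test_approximable a b (indicator (A \<inter> {a<..<b}))"
  using assms
proof (induction A rule: borel_interval_induct)
  case (interval c d)
  have I: "{c<..<d} \<inter> {a<..<b} = {max a c<..<min b d}" by auto
  have "test_approximable (max a c) (min b d) (indicator {max a c<..<min b d})"
    by (rule test_approximable_interval)
  then show ?case unfolding I test_approximable_def
    by (metis atLeastAtMost_iff max.bounded_iff min.bounded_iff)
next
  case (compl A)
  have "indicator (- A \<inter> {a<..<b}) = (\<lambda>x. indicator {a<..<b} x + (-1) * indicator (A \<inter> {a<..<b}) x :: complex)"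
    by (auto simp: indicator_def)
  then show ?case
    using test_approximable_add[OF test_approximable_interval test_approximable_cmult[OF compl(2), of "-1"]]
    by simp
next
  case (union A)
  have Lind: "L2 (indicator (B \<inter> {a<..<b}) :: real \<Rightarrow> complex)" if "B \<in> sets borel" for B
    using that by (intro L2_bounded_on_interval(1)[where B=1 and a="min a b" and b="max a b"]) (auto simp: indicator_def)
  show ?case
  proof (rule test_approximable_limit)
    show "L2 (indicator (\<Union> (range A) \<inter> {a<..<b}) :: real \<Rightarrow> complex)"
      using union(2) by (intro Lind) auto
    show "test_approximable a b (\<lambda>x. \<Sum>i<n. indicator (A i \<inter> {a<..<b}) x)" for n
      by (intro test_approximable_sum union) auto
    have s: "(\<Sum>i<n. indicator (A i \<inter> {a<..<b}) x :: complex) = indicator ((\<Union>i<n. A i) \<inter> {a<..<b}) x" for n x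
    proof -
      have "(\<Sum>i<n. indicator (A i \<inter> {a<..<b}) x :: complex) = indicator (\<Union>i<n. A i \<inter> {a<..<b}) x"
        by (rule indicator_UN_disjoint[symmetric])
          (use union(1) in \<open>auto simp: disjoint_family_on_def\<close>)
      then show ?thesis by simp
    qed
    show "(\<lambda>n. L2_norm (\<lambda>x. (\<Sum>i<n. indicator (A i \<inter> {a<..<b}) x) - indicator (\<Union> (range A) \<inter> {a<..<b}) x)) \<longlonglongrightarrow> 0"
      unfolding s
    proof (rule L2_tendsto_dominated)
      show "L2 (indicator (\<Union> (range A) \<inter> {a<..<b}) :: real \<Rightarrow> complex)"
        using union(2) by (intro Lind) auto
      show "L2 (indicator (UNIV \<inter> {a<..<b}) :: real \<Rightarrow> complex)" by (rule Lind) simp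
      show "(indicator (\<Union> (A ` {..<n}) \<inter> {a<..<b}) :: real \<Rightarrow> complex) \<in> borel_measurable borel" for n
        using union(2) by (intro borel_measurable_indicator) auto
      show "AE x in lborel. norm (indicator (\<Union> (A ` {..<n}) \<inter> {a<..<b}) x :: complex)
          \<le> norm (indicator (UNIV \<inter> {a<..<b}) x :: complex)" for n
        by (auto simp: indicator_def)
      show "AE x in lborel. (\<lambda>n. indicator (\<Union> (A ` {..<n}) \<inter> {a<..<b}) x)
          \<longlonglongrightarrow> (indicator (\<Union> (range A) \<inter> {a<..<b}) x :: complex)"
      proof (rule AE_I2, rule tendsto_eventually)
        fix x
        show "\<forall>\<^sub>F n in sequentially. indicator (\<Union> (A ` {..<n}) \<inter> {a<..<b}) x
            = (indicator (\<Union> (range A) \<inter> {a<..<b}) x :: complex)"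
        proof (cases "\<exists>i. x \<in> A i")
          case True
          then obtain i where i: "x \<in> A i" by blast
          show ?thesis using eventually_gt_at_top[of i]
            by eventually_elim (use i in \<open>auto simp: indicator_def\<close>)
        qed (auto simp: indicator_def)
      qed
    qed
  qed
qed

text \<open>A dominated sequence of simple functions vanishes where \<open>f\<close> does, so it reduces the claim to
  indicators of subsets of the interval.\<close>

lemma L2_test_approximable:
  assumes f: "L2 f" and z: "\<And>x. x \<notin> {a<..<b} \<Longrightarrow> f x = 0"
  shows "test_approximable a b f"
proof -
  have "f \<in> borel_measurable lborel" using L2_measurable[OF f] by simp
  from borel_measurable_implies_sequence_metric[OF this, of 0]
  obtain F where F: "\<And>i. simple_function lborel (F i)" "\<And>x. (\<lambda>i. F i x) \<longlonglongrightarrow> f x"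
    "\<And>i x. norm (F i x) \<le> 2 * norm (f x)"
    by auto
  have m: "F i \<in> borel_measurable borel" for i
    using borel_measurable_simple_function[OF F(1)[of i]] by simp
  show ?thesis
  proof (rule test_approximable_limit[OF f])
    show "(\<lambda>n. L2_norm (\<lambda>x. F n x - f x)) \<longlonglongrightarrow> 0"
    proof (rule L2_tendsto_dominated[OF f L2_cmult[OF f, of 2]])
      show "AE x in lborel. norm (F n x) \<le> norm (2 * f x)" for n
        using F(3) by (simp add: norm_mult)
    qed (use F(2) m in auto)
    fix n
    have "test_approximable a b (\<lambda>x. \<Sum>y\<in>range (F n). y * indicator ((F n -` {y}) \<inter> {a<..<b}) x)"
    proof (intro test_approximable_sum test_approximable_cmult test_approximable_indicator)
      show "finite (range (F n))" using F(1)[of n] by (simp add: simple_function_def)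
      show "F n -` {y} \<in> sets borel" for y
        using measurable_sets[OF m[of n], of "{y}"] by simp
    qed
    moreover have "(\<Sum>y\<in>range (F n). y * indicator ((F n -` {y}) \<inter> {a<..<b}) x) = F n x" for x
    proof -
      have fin: "finite (range (F n))" using F(1)[of n] by (simp add: simple_function_def)
      have z0: "F n x = 0" if "x \<notin> {a<..<b}" using F(3)[of n x] z[OF that] by simp
      have "(\<Sum>y\<in>range (F n). y * indicator ((F n -` {y}) \<inter> {a<..<b}) x)
          = (\<Sum>y\<in>range (F n). if y = F n x then y else 0)"
        by (rule sum.cong) (use z0 in \<open>auto simp: indicator_def\<close>)
      also have "\<dots> = F n x" using fin by simp
      finally show ?thesis .
    qed
    ultimately show "test_approximable a b (F n)" by simp
  qed
qed

lemma test_approx_sequence: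
  assumes "test_approximable a b f"
  obtains s where "\<And>n::nat. s n \<in> test_fun" "\<And>n x. x \<notin> {a..b} \<Longrightarrow> s n x = 0"
    "(\<lambda>n. L2_norm (\<lambda>x. s n x - f x)) \<longlonglongrightarrow> 0"
proof -
  have "\<forall>n::nat. \<exists>\<phi>. \<phi> \<in> test_fun \<and> (\<forall>x. x \<notin> {a..b} \<longrightarrow> \<phi> x = 0) \<and> L2_norm (\<lambda>x. f x - \<phi> x) < 1 / real (Suc n)"
    using assms unfolding test_approximable_def by (metis zero_less_divide_1_iff of_nat_0_less_iff zero_less_Suc)
  then obtain s where s: "\<And>n. s n \<in> test_fun" "\<And>n x. x \<notin> {a..b} \<Longrightarrow> s n x = 0"
    "\<And>n. L2_norm (\<lambda>x. f x - s n x) < 1 / real (Suc n)"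
    by metis
  have "(\<lambda>n. L2_norm (\<lambda>x. s n x - f x)) \<longlonglongrightarrow> 0"
  proof (rule tendsto_sandwich[where f="\<lambda>_. 0"])
    show "\<forall>\<^sub>F n in sequentially. L2_norm (\<lambda>x. s n x - f x) \<le> 1 / real (Suc n)"
      using s(3) L2_norm_minus_commute[of f] by (simp add: less_imp_le)
    show "(\<lambda>n. 1 / real (Suc n)) \<longlonglongrightarrow> 0"
      using LIMSEQ_inverse_real_of_nat by (simp add: inverse_eq_divide)
  qed (auto simp: L2_norm_nonneg)
  then show ?thesis using that s by blast
qed

text \<open>The bound is applied to test functions that approximate the conjugate of \<open>f\<close>.\<close>

lemma L2_norm_le_duality_interval:
  assumes f: "L2 f" and z: "\<And>x. x \<notin> {a<..<b} \<Longrightarrow> f x = 0" and C: "0 \<le> C"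
    and le: "\<And>\<phi>. \<phi> \<in> test_fun \<Longrightarrow> (\<And>x. x \<notin> {a..b} \<Longrightarrow> \<phi> x = 0) \<Longrightarrow>
      norm (LINT x|lborel. f x * \<phi> x) \<le> C * L2_norm \<phi>"
  shows "L2_norm f \<le> C"
proof -
  have cf: "L2 (\<lambda>x. cnj (f x))" by (rule L2_cnj[OF f])
  obtain s where s: "\<And>n::nat. s n \<in> test_fun" "\<And>n x. x \<notin> {a..b} \<Longrightarrow> s n x = 0"
    "(\<lambda>n. L2_norm (\<lambda>x. s n x - cnj (f x))) \<longlonglongrightarrow> 0"
    using test_approx_sequence[OF L2_test_approximable[OF cf, of a b]] z by auto
  have sL: "L2 (s n)" for n by (rule test_fun_L2[OF s(1)])
  have "(\<lambda>n. LINT x|lborel. f x * s n x) \<longlonglongrightarrow> (LINT x|lborel. f x * cnj (f x))"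
    by (rule pairing_tendsto[OF f cf sL s(3)])
  then have l: "(\<lambda>n. norm (LINT x|lborel. f x * s n x)) \<longlonglongrightarrow> norm (LINT x|lborel. f x * cnj (f x))"
    by (rule tendsto_norm)
  have "(\<lambda>n. L2_norm (s n)) \<longlonglongrightarrow> L2_norm f"
  proof (rule LIM_zero_cancel, rule tendsto_rabs_zero_cancel, rule tendsto_sandwich[where f="\<lambda>_. 0"])
    show "\<forall>\<^sub>F n in sequentially. \<bar>L2_norm (s n) - L2_norm f\<bar> \<le> L2_norm (\<lambda>x. s n x - cnj (f x))"
      using L2_norm_abs_diff[OF sL cf] by (simp add: L2_norm_cnj)
  qed (use s(3) in auto)
  then have r: "(\<lambda>n. C * L2_norm (s n)) \<longlonglongrightarrow> C * L2_norm f" by (rule tendsto_mult_left)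
  have "norm (LINT x|lborel. f x * cnj (f x)) \<le> C * L2_norm f"
    by (rule LIMSEQ_le[OF l r]) (use le[OF s(1,2)] in auto)
  moreover have "(LINT x|lborel. f x * cnj (f x)) = of_real ((L2_norm f)\<^sup>2)"
    unfolding L2_norm_square integral_complex_of_real[symmetric]
    by (simp only: complex_norm_square)
  ultimately have "L2_norm f * L2_norm f \<le> C * L2_norm f"
    by (simp add: power2_eq_square norm_mult)
  then show ?thesis
    using C L2_norm_nonneg[of f] by (metis mult_right_le_imp_le order_le_less)
qed

lemma L2_truncation_tendsto:
  assumes "L2 f"
  shows "(\<lambda>n::nat. L2_norm (\<lambda>x. indicator {- real n<..<real n} x * f x - f x)) \<longlonglongrightarrow> 0"
proof (rule L2_tendsto_dominated[OF assms assms])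
  show "(\<lambda>x. indicator {- real n<..<real n} x * f x) \<in> borel_measurable borel" for n
    using L2_measurable[OF assms] by measurable
  show "AE x in lborel. norm (indicator {- real n<..<real n} x * f x) \<le> norm (f x)" for n
    by (auto simp: indicator_def)
  show "AE x in lborel. (\<lambda>n. indicator {- real n<..<real n} x * f x) \<longlonglongrightarrow> f x"
  proof (rule AE_I2, rule tendsto_eventually)
    fix x
    obtain N :: nat where N: "\<bar>x\<bar> < real N" using reals_Archimedean2 by blast
    show "\<forall>\<^sub>F n in sequentially. indicator {- real n<..<real n} x * f x = f x"
      using eventually_ge_at_top[of N]
      by eventually_elim (use N in \<open>auto simp: indicator_def\<close>)
  qed
qed

lemma L2_norm_le_duality:
  assumes f: "L2 f" and C: "0 \<le> C"
    and le: "\<And>\<phi>. \<phi> \<in> test_fun \<Longrightarrow> norm (LINT x|lborel. f x * \<phi> x) \<le> C * L2_norm \<phi>"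
  shows "L2_norm f \<le> C"
proof -
  have fn: "L2 (\<lambda>x. indicator {- real n<..<real n} x * f x)" for n
    using f by (rule L2_indicator) simp
  have n: "L2_norm (\<lambda>x. indicator {- real n<..<real n} x * f x) \<le> C" for n :: nat
  proof (rule L2_norm_le_duality_interval[OF fn _ C, where a="- real n" and b="real n"])
    fix \<phi> :: "real \<Rightarrow> complex" assume p: "\<phi> \<in> test_fun" "\<And>x. x \<notin> {- real n..real n} \<Longrightarrow> \<phi> x = 0"
    have "AE x in lborel. x \<noteq> - real n" "AE x in lborel. x \<noteq> real n" by (auto simp: AE_lborel_singleton)
    then have "AE x in lborel. indicator {- real n<..<real n} x * f x * \<phi> x = f x * \<phi> x"
    proof eventually_elim
      case (elim x)
      then show ?case using p(2)[of x] by (cases "x \<in> {- real n..real n}") (auto simp: indicator_def)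
    qed
    then have "(LINT x|lborel. indicator {- real n<..<real n} x * f x * \<phi> x) = (LINT x|lborel. f x * \<phi> x)"
      by (intro integral_cong_AE)
        (use L2_measurable[OF f] L2_measurable[OF test_fun_L2[OF p(1)]] in measurable)
    then show "norm (LINT x|lborel. indicator {- real n<..<real n} x * f x * \<phi> x) \<le> C * L2_norm \<phi>"
      using le[OF p(1)] by simp
  qed auto
  have "L2_norm f \<le> C + L2_norm (\<lambda>x. indicator {- real n<..<real n} x * f x - f x)" for n :: nat
    using L2_norm_triangle_sub[OF f fn[of n]] n[of n]
      L2_norm_minus_commute[of f "\<lambda>x. indicator {- real n<..<real n} x * f x"] by simp
  moreover have "(\<lambda>n. C + L2_norm (\<lambda>x. indicator {- real n<..<real n} x * f x - f x)) \<longlonglongrightarrow> C + 0"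
    by (intro tendsto_add tendsto_const L2_truncation_tendsto f)
  ultimately have "L2_norm f \<le> C + 0"
    by (intro LIMSEQ_le_const) blast+
  then show ?thesis by simp
qed

section \<open>Weak derivatives\<close>

lemma has_weak_derivD:
  assumes "has_weak_deriv f g"
  shows "set_integrable lborel {a..b} f" "set_integrable lborel {a..b} g"
    "\<phi> \<in> test_fun \<Longrightarrow> (LINT x|lborel. f x * nth_vderiv 1 \<phi> x) = - (LINT x|lborel. g x * \<phi> x)"
  using assms unfolding has_weak_deriv_def by auto

lemma has_weak_derivI:
  assumes "L2 f" "L2 g"
    "\<And>\<phi>. \<phi> \<in> test_fun \<Longrightarrow> (LINT x|lborel. f x * nth_vderiv 1 \<phi> x) = - (LINT x|lborel. g x * \<phi> x)"
  shows "has_weak_deriv f g"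
  unfolding has_weak_deriv_def using assms L2_set_integrable by blast

lemma weak_deriv_unique:
  assumes "has_weak_deriv f g" "has_weak_deriv f h"
  shows "AE x in lborel. g x = h x"
proof -
  have "AE x in lborel. g x - h x = 0"
  proof (rule fundamental_lemma)
    show "set_integrable lborel {a..b} (\<lambda>x. g x - h x)" for a b
      using has_weak_derivD(2)[OF assms(1)] has_weak_derivD(2)[OF assms(2)] by (rule set_integral_diff)
    fix \<phi> :: "real \<Rightarrow> complex" assume p: "\<phi> \<in> test_fun"
    have "(LINT x|lborel. (g x - h x) * \<phi> x) = (LINT x|lborel. g x * \<phi> x) - (LINT x|lborel. h x * \<phi> x)"
      using locally_integrable_mult_test[OF has_weak_derivD(2)[OF assms(1)] p]
        locally_integrable_mult_test[OF has_weak_derivD(2)[OF assms(2)] p]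
      by (simp add: left_diff_distrib)
    also have "\<dots> = 0"
      using has_weak_derivD(3)[OF assms(1) p] has_weak_derivD(3)[OF assms(2) p] by simp
    finally show "(LINT x|lborel. (g x - h x) * \<phi> x) = 0" .
  qed
  then show ?thesis by simp
qed

lemma H1_iff: "H1 f \<longleftrightarrow> L2 f \<and> (\<exists>g. has_weak_deriv f g \<and> L2 g)"
  by simp

text \<open>The chosen weak derivative is an arbitrary one. By uniqueness it agrees almost everywhere with
  any square integrable one, which makes its norm independent of the choice.\<close>

lemma weak_deriv_props:
  assumes "L2 g" "has_weak_deriv f g"
  shows "has_weak_deriv f (weak_deriv f)" "L2 (weak_deriv f)" "L2_norm (weak_deriv f) = L2_norm g"
    "AE x in lborel. weak_deriv f x = g x"
proof -
  show w: "has_weak_deriv f (weak_deriv f)"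
    unfolding weak_deriv_def by (rule someI[of "has_weak_deriv f", OF assms(2)])
  show ae: "AE x in lborel. weak_deriv f x = g x"
    by (rule weak_deriv_unique[OF w assms(2)])
  have m: "weak_deriv f \<in> borel_measurable borel"
    using has_weak_derivD(2)[OF w] by (rule locally_integrable_measurable)
  show "L2 (weak_deriv f)"
    by (rule L2_dominated(1)[OF assms(1) m]) (use ae in eventually_elim, simp)
  show "L2_norm (weak_deriv f) = L2_norm g"
    by (rule L2_norm_cong_AE[OF _ m L2_measurable[OF assms(1)]]) (use ae in eventually_elim, simp)
qed

lemma H1D:
  assumes "H1 f"
  shows "L2 f" "has_weak_deriv f (weak_deriv f)" "L2 (weak_deriv f)"
  using assms weak_deriv_props unfolding H1_iff by blast+

lemma H1I:
  assumes "L2 f" "L2 g" "has_weak_deriv f g"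
  shows "H1 f" "L2_norm (weak_deriv f) = L2_norm g" "H1_norm f = sqrt ((L2_norm f)\<^sup>2 + (L2_norm g)\<^sup>2)"
  using assms weak_deriv_props(3)[OF assms(2,3)] unfolding H1_iff H1_norm_def by auto

lemma H1_norm_nonneg: "0 \<le> H1_norm f"
  by (simp add: H1_norm_def)

lemma L2_norm_le_H1_norm: "L2_norm f \<le> H1_norm f"
  unfolding H1_norm_def by (rule real_le_rsqrt) simp

lemma L2_norm_weak_deriv_le: "L2_norm (weak_deriv f) \<le> H1_norm f"
  unfolding H1_norm_def by (rule real_le_rsqrt) simp

lemma H1_norm_le_sum: "H1_norm f \<le> L2_norm f + L2_norm (weak_deriv f)"
  unfolding H1_norm_def by (rule sqrt_sum_squares_le_sum) (auto simp: L2_norm_nonneg)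

lemma has_weak_deriv_linear:
  assumes "L2 f" "L2 f'" "has_weak_deriv f f'" "L2 g" "L2 g'" "has_weak_deriv g g'"
  shows "has_weak_deriv (\<lambda>x. c * f x + d * g x) (\<lambda>x. c * f' x + d * g' x)"
proof (rule has_weak_derivI)
  show "L2 (\<lambda>x. c * f x + d * g x)" "L2 (\<lambda>x. c * f' x + d * g' x)"
    using assms by (auto intro!: L2_add L2_cmult)
  fix \<phi> :: "real \<Rightarrow> complex" assume p: "\<phi> \<in> test_fun"
  have I: "(LINT x|lborel. (c * F x + d * G x) * P x) = c * (LINT x|lborel. F x * P x) + d * (LINT x|lborel. G x * P x)"
    if "L2 F" "L2 G" "P \<in> test_fun" for F G P
    using L2_integrable_mult[OF that(1) test_fun_L2[OF that(3)]]
      L2_integrable_mult[OF that(2) test_fun_L2[OF that(3)]]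
    by (simp add: distrib_right mult.assoc)
  show "(LINT x|lborel. (c * f x + d * g x) * nth_vderiv 1 \<phi> x) = - (LINT x|lborel. (c * f' x + d * g' x) * \<phi> x)"
    unfolding I[OF assms(1,4) test_fun_deriv[OF p]] I[OF assms(2,5) p]
    using has_weak_derivD(3)[OF assms(3) p] has_weak_derivD(3)[OF assms(6) p]
    by (simp add: algebra_simps del: One_nat_def)
qed

lemma H1_linear:
  assumes "H1 f" "H1 g"
  shows "H1 (\<lambda>x. c * f x + d * g x)"
    "has_weak_deriv (\<lambda>x. c * f x + d * g x) (\<lambda>x. c * weak_deriv f x + d * weak_deriv g x)"
    "H1_norm (\<lambda>x. c * f x + d * g x) \<le> norm c * H1_norm f + norm d * H1_norm g"
proof -
  note f = H1D[OF assms(1)] and g = H1D[OF assms(2)]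
  show w: "has_weak_deriv (\<lambda>x. c * f x + d * g x) (\<lambda>x. c * weak_deriv f x + d * weak_deriv g x)"
    by (rule has_weak_deriv_linear) (use f g in auto)
  note I = H1I[OF L2_add[OF L2_cmult[OF f(1)] L2_cmult[OF g(1)]] L2_add[OF L2_cmult[OF f(3)] L2_cmult[OF g(3)]] w]
  show "H1 (\<lambda>x. c * f x + d * g x)" by (rule I(1))
  have a: "L2_norm (\<lambda>x. c * f x + d * g x) \<le> norm c * L2_norm f + norm d * L2_norm g"
    using L2_norm_triangle[OF L2_cmult[OF f(1), of c] L2_cmult[OF g(1), of d]] by (simp add: L2_norm_cmult)
  have b: "L2_norm (\<lambda>x. c * weak_deriv f x + d * weak_deriv g x) \<le> norm c * L2_norm (weak_deriv f) + norm d * L2_norm (weak_deriv g)"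
    using L2_norm_triangle[OF L2_cmult[OF f(3), of c] L2_cmult[OF g(3), of d]] by (simp add: L2_norm_cmult)
  have "H1_norm (\<lambda>x. c * f x + d * g x)
      \<le> sqrt ((norm c * L2_norm f + norm d * L2_norm g)\<^sup>2 + (norm c * L2_norm (weak_deriv f) + norm d * L2_norm (weak_deriv g))\<^sup>2)"
    unfolding I(3) using a b by (intro real_sqrt_le_mono add_mono power_mono) (auto simp: L2_norm_nonneg)
  also have "\<dots> \<le> sqrt ((norm c * L2_norm f)\<^sup>2 + (norm c * L2_norm (weak_deriv f))\<^sup>2)
      + sqrt ((norm d * L2_norm g)\<^sup>2 + (norm d * L2_norm (weak_deriv g))\<^sup>2)"
    by (rule real_sqrt_sum_squares_triangle_ineq)
  also have "\<dots> = norm c * H1_norm f + norm d * H1_norm g"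
    unfolding H1_norm_def by (simp add: power_mult_distrib distrib_left[symmetric] real_sqrt_mult)
  finally show "H1_norm (\<lambda>x. c * f x + d * g x) \<le> norm c * H1_norm f + norm d * H1_norm g" .
qed

lemma H1_add:
  assumes "H1 f" "H1 g"
  shows "H1 (\<lambda>x. f x + g x)" "H1_norm (\<lambda>x. f x + g x) \<le> H1_norm f + H1_norm g"
    "has_weak_deriv (\<lambda>x. f x + g x) (\<lambda>x. weak_deriv f x + weak_deriv g x)"
  using H1_linear[OF assms, of 1 1] by auto

lemma H1_diff:
  assumes "H1 f" "H1 g"
  shows "H1 (\<lambda>x. f x - g x)" "H1_norm (\<lambda>x. f x - g x) \<le> H1_norm f + H1_norm g"
    "has_weak_deriv (\<lambda>x. f x - g x) (\<lambda>x. weak_deriv f x - weak_deriv g x)"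
  using H1_linear[OF assms, of 1 "-1"] by auto

lemma H1_shift:
  assumes "H1 f"
  shows "H1 (\<lambda>x. f (x + h))" "H1_norm (\<lambda>x. f (x + h)) = H1_norm f"
    "has_weak_deriv (\<lambda>x. f (x + h)) (\<lambda>x. weak_deriv f (x + h))"
proof -
  note f = H1D[OF assms]
  show w: "has_weak_deriv (\<lambda>x. f (x + h)) (\<lambda>x. weak_deriv f (x + h))"
  proof (rule has_weak_derivI)
    fix \<phi> :: "real \<Rightarrow> complex" assume p: "\<phi> \<in> test_fun"
    define \<psi> where "\<psi> = (\<lambda>x. \<phi> (x + (- h)))"
    have q: "\<psi> \<in> test_fun" unfolding \<psi>_def by (rule test_fun_shift[OF p])
    have d: "nth_vderiv 1 \<psi> = (\<lambda>x. nth_vderiv 1 \<phi> (x + (- h)))"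
      unfolding \<psi>_def by (rule nth_vderiv_1_shift[OF test_fun_smooth[OF p]])
    have "(LINT x|lborel. f (x + h) * nth_vderiv 1 \<phi> x) = (LINT x|lborel. f x * nth_vderiv 1 \<psi> x)"
      using LINT_shift[of "\<lambda>x. f x * nth_vderiv 1 \<psi> x" h] unfolding d by simp
    also have "\<dots> = - (LINT x|lborel. weak_deriv f x * \<psi> x)" by (rule has_weak_derivD(3)[OF f(2) q])
    also have "(LINT x|lborel. weak_deriv f x * \<psi> x) = (LINT x|lborel. weak_deriv f (x + h) * \<phi> x)"
      using LINT_shift[of "\<lambda>x. weak_deriv f x * \<psi> x" h] unfolding \<psi>_def by simp
    finally show "(LINT x|lborel. f (x + h) * nth_vderiv 1 \<phi> x) = - (LINT x|lborel. weak_deriv f (x + h) * \<phi> x)" .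
  qed (use L2_shift f in auto)
  from H1I[OF L2_shift[OF f(1)] L2_shift[OF f(3)] w]
  show "H1 (\<lambda>x. f (x + h))" "H1_norm (\<lambda>x. f (x + h)) = H1_norm f"
    by (auto simp: L2_norm_shift[of "weak_deriv f"] L2_norm_shift[of f] H1_norm_def)
qed

lemma H1_cnj:
  assumes "H1 f"
  shows "H1 (\<lambda>x. cnj (f x))" "H1_norm (\<lambda>x. cnj (f x)) = H1_norm f"
    "has_weak_deriv (\<lambda>x. cnj (f x)) (\<lambda>x. cnj (weak_deriv f x))"
proof -
  note f = H1D[OF assms]
  show w: "has_weak_deriv (\<lambda>x. cnj (f x)) (\<lambda>x. cnj (weak_deriv f x))"
  proof (rule has_weak_derivI)
    fix \<phi> :: "real \<Rightarrow> complex" assume p: "\<phi> \<in> test_fun"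
    have d: "nth_vderiv 1 (\<lambda>x. cnj (\<phi> x)) = (\<lambda>x. cnj (nth_vderiv 1 \<phi> x))"
      by (intro nth_vderiv_1_eqI bounded_linear.has_vector_derivative[OF bounded_linear_cnj]
          smooth_has_vderiv test_fun_smooth p)
    have "cnj (LINT x|lborel. f x * nth_vderiv 1 (\<lambda>x. cnj (\<phi> x)) x)
        = cnj (- (LINT x|lborel. weak_deriv f x * cnj (\<phi> x)))"
      using has_weak_derivD(3)[OF f(2) test_fun_cnj[OF p]] by (simp del: One_nat_def)
    then show "(LINT x|lborel. cnj (f x) * nth_vderiv 1 \<phi> x) = - (LINT x|lborel. cnj (weak_deriv f x) * \<phi> x)"
      unfolding d using Bochner_Integration.integral_cnj[of lborel "\<lambda>x. f x * cnj (nth_vderiv 1 \<phi> x)"]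
        Bochner_Integration.integral_cnj[of lborel "\<lambda>x. weak_deriv f x * cnj (\<phi> x)"]
      by (simp del: Bochner_Integration.integral_cnj One_nat_def)
  qed (use L2_cnj f in auto)
  from H1I[OF L2_cnj[OF f(1)] L2_cnj[OF f(3)] w]
  show "H1 (\<lambda>x. cnj (f x))" "H1_norm (\<lambda>x. cnj (f x)) = H1_norm f"
    by (auto simp: L2_norm_cnj H1_norm_def)
qed

lemma continuous_set_integrable:
  fixes f :: "real \<Rightarrow> complex"
  assumes "continuous_on UNIV f"
  shows "set_integrable lborel {a..b} f"
  unfolding set_integrable_def
  by (rule borel_integrable_compact) (use assms in \<open>auto intro: continuous_on_subset\<close>)

lemma classical_imp_weak_deriv:
  fixes f f' :: "real \<Rightarrow> complex"
  assumes "\<And>x. (f has_vector_derivative f' x) (at x)" "continuous_on UNIV f'"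
  shows "has_weak_deriv f f'"
  unfolding has_weak_deriv_def
proof (intro conjI allI ballI)
  have cf: "continuous_on UNIV f"
    using assms(1) by (meson continuous_at_imp_continuous_on has_vector_derivative_continuous)
  then show i: "set_integrable lborel {a..b} f" for a b by (rule continuous_set_integrable)
  show i': "set_integrable lborel {a..b} f'" for a b using assms(2) by (rule continuous_set_integrable)
  fix \<phi> :: "real \<Rightarrow> complex" assume p: "\<phi> \<in> test_fun"
  obtain R where R: "\<And>x. x \<notin> {-R..R} \<Longrightarrow> \<phi> x = 0" using test_fun_interval[OF p] by metis
  have "(LINT x|lborel. f x * nth_vderiv 1 \<phi> x + f' x * \<phi> x) = 0"
  proof (rule LINT_deriv_compact_support)
    show "((\<lambda>x. f x * \<phi> x) has_vector_derivative (f x * nth_vderiv 1 \<phi> x + f' x * \<phi> x)) (at x)" for x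
      by (intro has_vector_derivative_mult assms smooth_has_vderiv test_fun_smooth p)
    show "continuous_on UNIV (\<lambda>x. f x * nth_vderiv 1 \<phi> x + f' x * \<phi> x)"
      by (intro continuous_intros cf assms smooth_continuous smooth_vderiv test_fun_smooth p)
    show "f x * \<phi> x = 0" if "x \<notin> {-R..R}" for x using R[OF that] by simp
  qed
  then show "(LINT x|lborel. f x * nth_vderiv 1 \<phi> x) = - (LINT x|lborel. f' x * \<phi> x)"
    using locally_integrable_mult_test[OF i test_fun_deriv[OF p]] locally_integrable_mult_test[OF i' p]
    by (simp add: eq_neg_iff_add_eq_0)
qed

lemma test_fun_H1:
  assumes "\<phi> \<in> test_fun"
  shows "has_weak_deriv \<phi> (nth_vderiv 1 \<phi>)" "H1 \<phi>" "L2_norm (weak_deriv \<phi>) = L2_norm (nth_vderiv 1 \<phi>)"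
    "H1_norm \<phi> = sqrt ((L2_norm \<phi>)\<^sup>2 + (L2_norm (nth_vderiv 1 \<phi>))\<^sup>2)"
proof -
  show w: "has_weak_deriv \<phi> (nth_vderiv 1 \<phi>)"
    by (intro classical_imp_weak_deriv smooth_has_vderiv smooth_continuous smooth_vderiv test_fun_smooth assms)
  from H1I[OF test_fun_L2[OF assms] test_fun_L2[OF test_fun_deriv[OF assms]] w]
  show "H1 \<phi>" "L2_norm (weak_deriv \<phi>) = L2_norm (nth_vderiv 1 \<phi>)"
    "H1_norm \<phi> = sqrt ((L2_norm \<phi>)\<^sup>2 + (L2_norm (nth_vderiv 1 \<phi>))\<^sup>2)" by auto
qed

lemma has_weak_deriv_cutoff:
  assumes "L2 f" "L2 g" "has_weak_deriv f g" "\<omega> \<in> test_fun"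
  shows "has_weak_deriv (\<lambda>x. \<omega> x * f x) (\<lambda>x. \<omega> x * g x + nth_vderiv 1 \<omega> x * f x)"
    "L2 (\<lambda>x. \<omega> x * f x)" "L2 (\<lambda>x. \<omega> x * g x + nth_vderiv 1 \<omega> x * f x)"
proof -
  have m: "L2 (\<lambda>x. \<eta> x * h x)" if \<eta>: "\<eta> \<in> test_fun" and h: "L2 h" for \<eta> h
  proof -
    obtain B where "\<And>x. norm (\<eta> x) \<le> B" using test_fun_bounded[OF \<eta>] by metis
    then show ?thesis
      using L2_mult_bounded(1)[OF h smooth_measurable[OF test_fun_smooth[OF \<eta>]]] by metis
  qed
  show 1: "L2 (\<lambda>x. \<omega> x * f x)" by (intro m assms)
  show 2: "L2 (\<lambda>x. \<omega> x * g x + nth_vderiv 1 \<omega> x * f x)" by (intro m assms L2_add test_fun_deriv)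
  show "has_weak_deriv (\<lambda>x. \<omega> x * f x) (\<lambda>x. \<omega> x * g x + nth_vderiv 1 \<omega> x * f x)"
  proof (rule has_weak_derivI[OF 1 2])
    fix \<phi> :: "real \<Rightarrow> complex" assume p: "\<phi> \<in> test_fun"
    have q: "(\<lambda>x. \<omega> x * \<phi> x) \<in> test_fun" by (intro test_fun_mult p test_fun_smooth assms)
    have d: "nth_vderiv 1 (\<lambda>x. \<omega> x * \<phi> x) = (\<lambda>x. \<omega> x * nth_vderiv 1 \<phi> x + nth_vderiv 1 \<omega> x * \<phi> x)"
      by (intro nth_vderiv_1_mult test_fun_smooth p assms)
    have i1: "integrable lborel (\<lambda>x. (\<omega> x * f x) * nth_vderiv 1 \<phi> x)"
      by (intro L2_integrable_mult m assms test_fun_L2 test_fun_deriv p)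
    have i2: "integrable lborel (\<lambda>x. (nth_vderiv 1 \<omega> x * f x) * \<phi> x)"
      by (intro L2_integrable_mult m assms test_fun_L2 test_fun_deriv p)
    have i3: "integrable lborel (\<lambda>x. (\<omega> x * g x) * \<phi> x)"
      by (intro L2_integrable_mult m assms test_fun_L2 test_fun_deriv p)
    have "(LINT x|lborel. (\<omega> x * f x) * nth_vderiv 1 \<phi> x + (nth_vderiv 1 \<omega> x * f x) * \<phi> x)
        = - (LINT x|lborel. (\<omega> x * g x) * \<phi> x)"
      using has_weak_derivD(3)[OF assms(3) q] unfolding d by (simp add: algebra_simps)
    then have "(LINT x|lborel. (\<omega> x * f x) * nth_vderiv 1 \<phi> x)
        = - ((LINT x|lborel. (\<omega> x * g x) * \<phi> x) + (LINT x|lborel. (nth_vderiv 1 \<omega> x * f x) * \<phi> x))"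
      using i1 i2 by (simp add: algebra_simps del: One_nat_def)
    also have "(LINT x|lborel. (\<omega> x * g x) * \<phi> x) + (LINT x|lborel. (nth_vderiv 1 \<omega> x * f x) * \<phi> x)
        = (LINT x|lborel. (\<omega> x * g x) * \<phi> x + (nth_vderiv 1 \<omega> x * f x) * \<phi> x)"
      using i2 i3 by simp
    finally show "(LINT x|lborel. (\<omega> x * f x) * nth_vderiv 1 \<phi> x)
        = - (LINT x|lborel. (\<omega> x * g x + nth_vderiv 1 \<omega> x * f x) * \<phi> x)"
      by (simp add: algebra_simps)
  qed
qed

section \<open>Density of test functions in the Sobolev space\<close>

lemma LINT_norm_le_interval:
  assumes "L2 f" "\<And>x. x \<notin> {a..b} \<Longrightarrow> f x = 0" "a \<le> b"
  shows "(LINT x|lborel. norm (f x)) \<le> sqrt (b - a) * L2_norm f" "integrable lborel f"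
proof -
  define I :: "real \<Rightarrow> complex" where "I = indicator {a..b}"
  have I: "L2 I" "L2_norm I \<le> 1 * sqrt (b - a)"
    by (rule L2_bounded_on_interval[OF _ _ _ assms(3)]; auto simp: I_def indicator_def)+
  have e: "(\<lambda>x. I x * f x) = f"
    using assms(2) by (auto simp: I_def indicator_def fun_eq_iff)
  have e': "I x * f x = f x" for x using fun_cong[OF e, of x] .
  have "(LINT x|lborel. norm (f x)) = (LINT x|lborel. norm (I x * f x))"
    by (simp only: e')
  also have "\<dots> \<le> L2_norm I * L2_norm f"
    by (rule L2_Cauchy_Schwarz_norm[OF I(1) assms(1)])
  also have "\<dots> \<le> sqrt (b - a) * L2_norm f"
    using I(2) by (intro mult_right_mono L2_norm_nonneg) auto
  finally show "(LINT x|lborel. norm (f x)) \<le> sqrt (b - a) * L2_norm f" .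
  show "integrable lborel f" using L2_integrable_mult[OF I(1) assms(1)] unfolding e .
qed

lemma smooth_primitive:
  fixes \<eta> :: "real \<Rightarrow> complex"
  assumes p: "\<eta> \<in> test_fun" and z: "\<And>x. x \<notin> {a..b} \<Longrightarrow> \<eta> x = 0" and ab: "a \<le> b"
  obtains \<zeta> where "smooth \<zeta>" "\<And>x. (\<zeta> has_vector_derivative \<eta> x) (at x)" "\<And>x. x \<le> a \<Longrightarrow> \<zeta> x = 0"
    "\<And>x. b \<le> x \<Longrightarrow> \<zeta> x = (LINT y|lborel. \<eta> y)" "\<And>x. norm (\<zeta> x) \<le> (LINT y|lborel. norm (\<eta> y))"
proof -
  have "\<exists>F. \<forall>x. (- \<infinity>) < ereal x \<longrightarrow> ereal x < \<infinity> \<longrightarrow> (F has_vector_derivative \<eta> x) (at x)"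
    by (rule einterval_antiderivative)
      (use smooth_continuous[OF test_fun_smooth[OF p], of UNIV] in \<open>auto simp: continuous_on_eq_continuous_at\<close>)
  then obtain F where F: "\<And>x. (F has_vector_derivative \<eta> x) (at x)" by auto
  have i: "integrable lborel \<eta>"
    by (rule LINT_norm_le_interval(2)[OF test_fun_L2[OF p] z ab])
  have ftc: "(LINT y|lborel. indicator {u..v} y *\<^sub>R \<eta> y) = F v - F u" if "u \<le> v" for u v
    by (rule integral_FTC_atLeastAtMost[OF that])
      (use F smooth_continuous[OF test_fun_smooth[OF p]] in \<open>auto intro: has_vector_derivative_at_within\<close>)
  define \<zeta> where "\<zeta> x = F x - F a" for x
  have d: "(\<zeta> has_vector_derivative \<eta> x) (at x)" for x
    unfolding \<zeta>_def using F[of x] by (auto intro!: derivative_eq_intros)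
  have left: "\<zeta> x = 0" if "x \<le> a" for x
  proof -
    have "AE y in lborel. y \<noteq> a" by (simp add: AE_lborel_singleton)
    then have "AE y in lborel. indicator {x..a} y *\<^sub>R \<eta> y = 0"
      by eventually_elim (use z ab in \<open>auto simp: indicator_def\<close>)
    then have "(LINT y|lborel. indicator {x..a} y *\<^sub>R \<eta> y) = 0" by (rule integral_eq_zero_AE)
    then show ?thesis using ftc[OF that] by (simp add: \<zeta>_def)
  qed
  have right: "\<zeta> x = (LINT y|lborel. indicator {a..x} y *\<^sub>R \<eta> y)" if "a \<le> x" for x
    using ftc[OF that] by (simp add: \<zeta>_def)
  have "\<zeta> x = (LINT y|lborel. \<eta> y)" if "b \<le> x" for x
  proof -
    have "(\<lambda>y. indicator {a..x} y *\<^sub>R \<eta> y) = \<eta>"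
      using z that by (force simp: indicator_def fun_eq_iff)
    then show ?thesis using right[of x] that ab by simp
  qed
  moreover have "norm (\<zeta> x) \<le> (LINT y|lborel. norm (\<eta> y))" for x
  proof (cases "a \<le> x")
    case True
    have "norm (\<zeta> x) \<le> (LINT y|lborel. norm (indicator {a..x} y *\<^sub>R \<eta> y))"
      unfolding right[OF True] by (rule integral_norm_bound)
    also have "\<dots> \<le> (LINT y|lborel. norm (\<eta> y))"
      by (intro integral_mono integrable_norm integrable_mult_indicator i) (auto simp: indicator_def)
    finally show ?thesis .
  qed (use left[of x] in simp)
  moreover have "smooth \<zeta>" by (rule smoothI[OF d test_fun_smooth[OF p]])
  ultimately show ?thesis using that d left by blast
qed

lemma normalized_bump:
  assumes "a < b"
  obtains \<theta> where "\<theta> \<in> test_fun" "\<And>x. x \<notin> {a<..<b} \<Longrightarrow> \<theta> x = 0" "(LINT x|lborel. \<theta> x) = 1"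
proof -
  define B :: "real \<Rightarrow> complex" where "B x = of_real (bump a b x)" for x
  have t: "B \<in> test_fun"
    unfolding B_def by (rule test_funI[OF smooth_of_real[OF bump_smooth], of a b]) (auto simp: bump_zero)
  have i: "integrable lborel (bump a b)"
  proof -
    have "integrable lborel B"
      by (rule LINT_norm_le_interval(2)[OF test_fun_L2[OF t], of a b]) (use assms in \<open>auto simp: B_def bump_zero\<close>)
    then show ?thesis unfolding B_def by (simp add: complex_of_real_integrable_eq)
  qed
  have "(LINT x|lborel. bump a b x) \<noteq> 0"
  proof
    assume "(LINT x|lborel. bump a b x) = 0"
    then have "AE x in lborel. bump a b x = 0"
      using integral_nonneg_eq_0_iff_AE[OF i] bump_bounds by auto
    then have "AE x in lborel. x \<notin> {a<..<b}"
      by eventually_elim (use bump_pos[of a _ b] in force)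
    then have "emeasure lborel {a<..<b} = 0"
      by (subst (asm) AE_iff_measurable[of "{a<..<b}"]) auto
    then show False using assms by simp
  qed
  then have "(LINT x|lborel. B x) \<noteq> 0" unfolding B_def by simp
  then show ?thesis
    using test_fun_cmult[OF t, of "1 / (LINT x|lborel. B x)"]
    by (intro that[of "\<lambda>x. 1 / (LINT x|lborel. B x) * B x"]) (auto simp: B_def bump_zero)
qed

lemma smooth_step:
  assumes "a < b"
  obtains \<kappa> \<theta> :: "real \<Rightarrow> complex" where "smooth \<kappa>" "\<theta> \<in> test_fun" "\<And>x. x \<notin> {a<..<b} \<Longrightarrow> \<theta> x = 0"
    "\<And>x. (\<kappa> has_vector_derivative \<theta> x) (at x)" "\<And>x. x \<le> a \<Longrightarrow> \<kappa> x = 0" "\<And>x. b \<le> x \<Longrightarrow> \<kappa> x = 1"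
proof -
  obtain \<theta> where t: "\<theta> \<in> test_fun" "\<And>x. x \<notin> {a<..<b} \<Longrightarrow> \<theta> x = 0" "(LINT x|lborel. \<theta> x) = 1"
    using normalized_bump[OF assms] by metis
  show ?thesis
    by (rule smooth_primitive[OF t(1), of a b]) (use t assms that in auto)
qed

lemma plateau:
  obtains \<omega> :: "real \<Rightarrow> complex" where "\<omega> \<in> test_fun" "\<And>x. \<bar>x\<bar> \<le> 1 \<Longrightarrow> \<omega> x = 1"
proof -
  obtain \<kappa>1 :: "real \<Rightarrow> complex" where 1: "smooth \<kappa>1" "\<And>x. x \<le> -2 \<Longrightarrow> \<kappa>1 x = 0" "\<And>x. -1 \<le> x \<Longrightarrow> \<kappa>1 x = 1"
    by (rule smooth_step[of "-2" "-1"]) auto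
  obtain \<kappa>2 :: "real \<Rightarrow> complex" where 2: "smooth \<kappa>2" "\<And>x. x \<le> 1 \<Longrightarrow> \<kappa>2 x = 0" "\<And>x. 2 \<le> x \<Longrightarrow> \<kappa>2 x = 1"
    by (rule smooth_step[of 1 2]) auto
  have "(\<lambda>x. \<kappa>1 x - \<kappa>2 x) \<in> test_fun"
    by (rule test_funI[OF smooth_diff[OF 1(1) 2(1)], of "-2" 2]) (use 1 2 in force)
  then show ?thesis using 1 2 by (intro that[of "\<lambda>x. \<kappa>1 x - \<kappa>2 x"]) auto
qed

text \<open>Poincare's inequality, by duality: a test function differs from the derivative of a test
  function by a multiple of a bump to the right of the interval.\<close>

lemma Poincare:
  assumes h: "L2 h" and k: "L2 k" and w: "has_weak_deriv h k" and ab: "a \<le> b"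
    and zh: "\<And>x. x \<notin> {a<..<b} \<Longrightarrow> h x = 0" and zk: "\<And>x. x \<notin> {a..b} \<Longrightarrow> k x = 0"
  shows "L2_norm h \<le> (b - a) * L2_norm k"
proof (rule L2_norm_le_duality_interval[OF h zh])
  show "0 \<le> (b - a) * L2_norm k" using ab by (simp add: L2_norm_nonneg)
  fix \<eta> :: "real \<Rightarrow> complex" assume e: "\<eta> \<in> test_fun" and ze: "\<And>x. x \<notin> {a..b} \<Longrightarrow> \<eta> x = 0"
  obtain \<zeta> where z: "smooth \<zeta>" "\<And>x. (\<zeta> has_vector_derivative \<eta> x) (at x)" "\<And>x. x \<le> a \<Longrightarrow> \<zeta> x = 0"
    "\<And>x. b \<le> x \<Longrightarrow> \<zeta> x = (LINT y|lborel. \<eta> y)" "\<And>x. norm (\<zeta> x) \<le> (LINT y|lborel. norm (\<eta> y))"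
    using smooth_primitive[OF e ze ab] by blast
  obtain \<kappa> \<theta> :: "real \<Rightarrow> complex" where s: "smooth \<kappa>" "\<And>x. x \<notin> {b<..<b+1} \<Longrightarrow> \<theta> x = 0"
    "\<And>x. (\<kappa> has_vector_derivative \<theta> x) (at x)" "\<And>x. x \<le> b \<Longrightarrow> \<kappa> x = 0" "\<And>x. b + 1 \<le> x \<Longrightarrow> \<kappa> x = 1"
    using smooth_step[of b "b+1"] by (metis less_add_one)
  define c where "c = (LINT y|lborel. \<eta> y)"
  define \<psi> where "\<psi> = (\<lambda>x. \<zeta> x - c * \<kappa> x)"
  have p: "\<psi> \<in> test_fun"
    unfolding \<psi>_def
    by (rule test_funI[OF smooth_diff[OF z(1) smooth_mult[OF smooth_const s(1)]], of a "b+1"])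
      (use z(3,4) s(4,5) ab in \<open>auto simp: c_def not_le\<close>)
  have d: "nth_vderiv 1 \<psi> = (\<lambda>x. \<eta> x - c * \<theta> x)"
    unfolding \<psi>_def
    by (intro nth_vderiv_1_eqI has_vector_derivative_diff z(2)
        bounded_linear.has_vector_derivative[OF bounded_linear_mult_right] s(3))
  have e1: "(\<lambda>x. h x * \<eta> x) = (\<lambda>x. h x * nth_vderiv 1 \<psi> x)"
  proof
    fix x show "h x * \<eta> x = h x * nth_vderiv 1 \<psi> x"
      unfolding d using zh[of x] s(2)[of x] by (cases "x \<in> {a<..<b}") auto
  qed
  define Z where "Z = (\<lambda>x. indicator {a..b} x * \<zeta> x)"
  have e2: "(\<lambda>x. k x * \<psi> x) = (\<lambda>x. k x * Z x)"
  proof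
    fix x show "k x * \<psi> x = k x * Z x"
      using zk[of x] s(4)[of x] by (cases "x \<in> {a..b}") (auto simp: \<psi>_def Z_def)
  qed
  have ZB: "norm (Z x) \<le> sqrt (b - a) * L2_norm \<eta>" for x
    using z(5)[of x] LINT_norm_le_interval(1)[OF test_fun_L2[OF e] ze ab]
      ab L2_norm_nonneg[of \<eta>] by (auto simp: Z_def indicator_def)
  have Zm: "Z \<in> borel_measurable borel" unfolding Z_def using smooth_measurable[OF z(1)] by measurable
  have ZL: "L2 Z" "L2_norm Z \<le> sqrt (b - a) * L2_norm \<eta> * sqrt (b - a)"
    using L2_bounded_on_interval[OF Zm ZB _ ab] by (auto simp: Z_def)
  have "(LINT x|lborel. h x * \<eta> x) = - (LINT x|lborel. k x * Z x)"
    unfolding e1 using has_weak_derivD(3)[OF w p] unfolding e2 .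
  then have "norm (LINT x|lborel. h x * \<eta> x) \<le> L2_norm k * L2_norm Z"
    using L2_Cauchy_Schwarz[OF k ZL(1)] by simp
  also have "\<dots> \<le> L2_norm k * (sqrt (b - a) * L2_norm \<eta> * sqrt (b - a))"
    by (intro mult_left_mono ZL L2_norm_nonneg)
  also have "\<dots> = (b - a) * L2_norm k * L2_norm \<eta>" using ab by (simp add: algebra_simps)
  finally show "norm (LINT x|lborel. h x * \<eta> x) \<le> (b - a) * L2_norm k * L2_norm \<eta>" .
qed

text \<open>Pair with a test function that equals one on the interval: its derivative lives outside.\<close>

lemma weak_deriv_mean_zero:
  assumes h: "L2 h" and k: "L2 k" and w: "has_weak_deriv h k" and ab: "a \<le> b"
    and zh: "\<And>x. x \<notin> {a<..<b} \<Longrightarrow> h x = 0" and zk: "\<And>x. x \<notin> {a..b} \<Longrightarrow> k x = 0"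
  shows "(LINT x|lborel. k x) = 0"
proof -
  obtain \<kappa>1 \<theta>1 :: "real \<Rightarrow> complex" where 1: "smooth \<kappa>1" "\<And>x. x \<notin> {a-1<..<a} \<Longrightarrow> \<theta>1 x = 0"
    "\<And>x. (\<kappa>1 has_vector_derivative \<theta>1 x) (at x)" "\<And>x. x \<le> a-1 \<Longrightarrow> \<kappa>1 x = 0" "\<And>x. a \<le> x \<Longrightarrow> \<kappa>1 x = 1"
    by (rule smooth_step[of "a-1" a]) auto
  obtain \<kappa>2 \<theta>2 :: "real \<Rightarrow> complex" where 2: "smooth \<kappa>2" "\<And>x. x \<notin> {b<..<b+1} \<Longrightarrow> \<theta>2 x = 0"
    "\<And>x. (\<kappa>2 has_vector_derivative \<theta>2 x) (at x)" "\<And>x. x \<le> b \<Longrightarrow> \<kappa>2 x = 0" "\<And>x. b+1 \<le> x \<Longrightarrow> \<kappa>2 x = 1"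
    by (rule smooth_step[of b "b+1"]) auto
  define \<omega> where "\<omega> = (\<lambda>x. \<kappa>1 x - \<kappa>2 x)"
  have t: "\<omega> \<in> test_fun"
    unfolding \<omega>_def by (rule test_funI[OF smooth_diff[OF 1(1) 2(1)], of "a-1" "b+1"]) (use 1 2 ab in force)
  have d: "nth_vderiv 1 \<omega> = (\<lambda>x. \<theta>1 x - \<theta>2 x)"
    unfolding \<omega>_def by (intro nth_vderiv_1_eqI has_vector_derivative_diff 1 2)
  have "(\<lambda>x. h x * nth_vderiv 1 \<omega> x) = (\<lambda>x. 0)"
  proof
    fix x show "h x * nth_vderiv 1 \<omega> x = 0"
      unfolding d using zh[of x] 1(2)[of x] 2(2)[of x] by (cases "x \<in> {a<..<b}") auto
  qed
  moreover have "(\<lambda>x. k x * \<omega> x) = k"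
  proof
    fix x show "k x * \<omega> x = k x"
      unfolding \<omega>_def using zk[of x] 1(5)[of x] 2(4)[of x] by (cases "x \<in> {a..b}") auto
  qed
  ultimately show ?thesis using has_weak_derivD(3)[OF w t] by simp
qed

text \<open>The derivative is approximated first. After its mean is corrected by a bump, the primitive of the
  approximant is compactly supported, and Poincare's inequality controls its distance to \<open>h\<close>.\<close>

lemma H1_dense_interval:
  assumes h: "L2 h" and k: "L2 k" and w: "has_weak_deriv h k" and ab: "a < b"
    and zh: "\<And>x. x \<notin> {a<..<b} \<Longrightarrow> h x = 0" and zk: "\<And>x. x \<notin> {a<..<b} \<Longrightarrow> k x = 0"
  obtains s where "\<And>n::nat. s n \<in> test_fun" "(\<lambda>n. L2_norm (\<lambda>x. s n x - h x)) \<longlonglongrightarrow> 0"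
    "(\<lambda>n. L2_norm (\<lambda>x. nth_vderiv 1 (s n) x - k x)) \<longlonglongrightarrow> 0"
proof -
  obtain q where q: "\<And>n::nat. q n \<in> test_fun" "\<And>n x. x \<notin> {a..b} \<Longrightarrow> q n x = 0"
    "(\<lambda>n. L2_norm (\<lambda>x. q n x - k x)) \<longlonglongrightarrow> 0"
    using test_approx_sequence[OF L2_test_approximable[OF k zk]] by blast
  obtain \<theta> where t: "\<theta> \<in> test_fun" "\<And>x. x \<notin> {a<..<b} \<Longrightarrow> \<theta> x = 0" "(LINT x|lborel. \<theta> x) = 1"
    using normalized_bump[OF ab] by metis
  define m where "m n = (LINT x|lborel. q n x)" for n
  define p where "p n = (\<lambda>x. q n x - m n * \<theta> x)" for n
  have kz: "(LINT x|lborel. k x) = 0"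
    by (rule weak_deriv_mean_zero[OF h k w _ zh, of a b]) (use ab zk in auto)
  have m0: "m \<longlonglongrightarrow> 0"
  proof -
    have I: "L2 (indicator {a..b} :: real \<Rightarrow> complex)"
      by (rule L2_bounded_on_interval(1)[where B=1 and a=a and b=b]) (use ab in \<open>auto simp: indicator_def\<close>)
    have "(\<lambda>n. LINT x|lborel. indicator {a..b} x * q n x) \<longlonglongrightarrow> (LINT x|lborel. indicator {a..b} x * k x)"
      by (rule pairing_tendsto[OF I k test_fun_L2[OF q(1)] q(3)])
    moreover have "(\<lambda>x. indicator {a..b} x * q n x) = q n" for n
      using q(2) by (auto simp: indicator_def fun_eq_iff)
    moreover have "(\<lambda>x. indicator {a..b} x * k x) = k"
    proof
      fix x show "indicator {a..b} x * k x = k x" using zk[of x] by (cases "x \<in> {a<..<b}") auto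
    qed
    ultimately show ?thesis using kz by (simp add: m_def[abs_def])
  qed
  have p1: "p n \<in> test_fun" for n unfolding p_def by (intro test_fun_diff test_fun_cmult q t)
  have p2: "p n x = 0" if "x \<notin> {a..b}" for n x using q(2)[OF that] t(2)[of x] that by (auto simp: p_def)
  have p3: "(LINT x|lborel. p n x) = 0" for n
  proof -
    have "integrable lborel (q n)" by (rule LINT_norm_le_interval(2)[OF test_fun_L2[OF q(1)] q(2)]) (use ab in auto)
    moreover have "integrable lborel \<theta>"
      by (rule LINT_norm_le_interval(2)[OF test_fun_L2[OF t(1)], of a b]) (use ab t(2) in auto)
    ultimately show ?thesis by (simp add: p_def m_def t(3))
  qed
  have p4: "(\<lambda>n. L2_norm (\<lambda>x. p n x - k x)) \<longlonglongrightarrow> 0"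
  proof (rule tendsto_sandwich[where f="\<lambda>_. 0"])
    show "\<forall>\<^sub>F n in sequentially. L2_norm (\<lambda>x. p n x - k x) \<le> L2_norm (\<lambda>x. q n x - k x) + norm (m n) * L2_norm \<theta>"
    proof (rule always_eventually, rule allI)
      fix n
      have "L2_norm (\<lambda>x. (q n x - k x) - m n * \<theta> x) \<le> L2_norm (\<lambda>x. q n x - k x) + L2_norm (\<lambda>x. m n * \<theta> x)"
        by (intro L2_norm_diff_le L2_diff L2_cmult test_fun_L2 q t k)
      then show "L2_norm (\<lambda>x. p n x - k x) \<le> L2_norm (\<lambda>x. q n x - k x) + norm (m n) * L2_norm \<theta>"
        unfolding L2_norm_cmult p_def by (simp add: algebra_simps)
    qed
    show "(\<lambda>n. L2_norm (\<lambda>x. q n x - k x) + norm (m n) * L2_norm \<theta>) \<longlonglongrightarrow> 0"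
      using tendsto_add[OF q(3) tendsto_mult_right[OF tendsto_norm[OF m0]], of "L2_norm \<theta>"] by simp
  qed (auto simp: L2_norm_nonneg)
  have "\<exists>\<phi>. \<phi> \<in> test_fun \<and> (\<forall>x. x \<notin> {a<..<b} \<longrightarrow> \<phi> x = 0) \<and> nth_vderiv 1 \<phi> = p n" for n
  proof -
    obtain \<zeta> where z: "smooth \<zeta>" "\<And>x. (\<zeta> has_vector_derivative p n x) (at x)" "\<And>x. x \<le> a \<Longrightarrow> \<zeta> x = 0"
      "\<And>x. b \<le> x \<Longrightarrow> \<zeta> x = (LINT y|lborel. p n y)"
      by (rule smooth_primitive[OF p1[of n] p2[of _ n] less_imp_le[OF ab]]) blast+
    then have "\<zeta> x = 0" if "x \<notin> {a<..<b}" for x using that p3[of n] by (cases "x \<le> a") auto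
    moreover from this have "\<zeta> \<in> test_fun" by (intro test_funI[OF z(1), of a b]) auto
    ultimately show ?thesis using nth_vderiv_1_eqI[OF z(2)] by blast
  qed
  then obtain s where s: "\<And>n. s n \<in> test_fun" "\<And>n x. x \<notin> {a<..<b} \<Longrightarrow> s n x = 0" "\<And>n. nth_vderiv 1 (s n) = p n"
    by metis
  have "(\<lambda>n. L2_norm (\<lambda>x. s n x - h x)) \<longlonglongrightarrow> 0"
  proof (rule tendsto_sandwich[where f="\<lambda>_. 0"])
    show "\<forall>\<^sub>F n in sequentially. L2_norm (\<lambda>x. s n x - h x) \<le> (b - a) * L2_norm (\<lambda>x. p n x - k x)"
    proof (rule always_eventually, rule allI, rule Poincare)
      fix n
      show "has_weak_deriv (\<lambda>x. s n x - h x) (\<lambda>x. p n x - k x)"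
        using has_weak_deriv_linear[OF test_fun_L2[OF s(1)] _ test_fun_H1(1)[OF s(1)] h k w, of n 1 "-1"]
        unfolding s(3) using test_fun_L2[OF p1] by simp
      show "L2 (\<lambda>x. s n x - h x)" by (rule L2_diff[OF test_fun_L2[OF s(1)] h])
      show "L2 (\<lambda>x. p n x - k x)" by (rule L2_diff[OF test_fun_L2[OF p1] k])
      show "a \<le> b" using ab by simp
      show "s n x - h x = 0" if "x \<notin> {a<..<b}" for x using zh[OF that] s(2)[OF that] by simp
      show "p n x - k x = 0" if "x \<notin> {a..b}" for x using zk[of x] p2[OF that] that by auto
    qed
    show "(\<lambda>n. (b - a) * L2_norm (\<lambda>x. p n x - k x)) \<longlonglongrightarrow> 0"
      using tendsto_mult_left[OF p4, of "b - a"] by simp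
  qed (auto simp: L2_norm_nonneg)
  then show ?thesis using that[of s] s p4 by simp
qed

text \<open>Cutting off with \<open>\<omega>(x / (n + 1))\<close> changes the derivative by a term of size \<open>1 / n\<close>, which reduces
  the claim to functions supported in an interval.\<close>

theorem test_fun_dense_H1:
  assumes f: "L2 f" and g: "L2 g" and w: "has_weak_deriv f g" and e: "0 < e"
  obtains \<phi> where "\<phi> \<in> test_fun" "L2_norm (\<lambda>x. \<phi> x - f x) < e" "L2_norm (\<lambda>x. nth_vderiv 1 \<phi> x - g x) < e"
proof -
  obtain \<omega> :: "real \<Rightarrow> complex" where om: "\<omega> \<in> test_fun" "\<And>x. \<bar>x\<bar> \<le> 1 \<Longrightarrow> \<omega> x = 1" using plateau by metis
  obtain R where R: "R \<ge> 1" "\<And>x. x \<notin> {-R..R} \<Longrightarrow> \<omega> x = 0" using test_fun_interval[OF om(1)] by metis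
  obtain B where B: "B \<ge> 0" "\<And>x. norm (\<omega> x) \<le> B" using test_fun_bounded[OF om(1)] by metis
  obtain B' where B': "B' \<ge> 0" "\<And>x. norm (nth_vderiv 1 \<omega> x) \<le> B'" using test_fun_bounded[OF test_fun_deriv[OF om(1)]] by metis
  define c where "c n = (\<lambda>x. \<omega> (1 / real (Suc n) * x + 0))" for n
  have csm: "smooth (c n)" for n unfolding c_def by (intro smooth_affine test_fun_smooth om)
  have cz: "c n x = 0" if "x \<notin> {- (R * Suc n)..R * Suc n}" for n x
  proof -
    have "1 / real (Suc n) * x + 0 \<notin> {-R..R}" using that by (auto simp: field_simps)
    then show ?thesis unfolding c_def by (rule R(2))
  qed
  have ct: "c n \<in> test_fun" for n by (rule test_funI[OF csm cz])
  have cd: "(c n has_vector_derivative (1 / real (Suc n)) *\<^sub>R nth_vderiv 1 \<omega> (1 / real (Suc n) * x + 0)) (at x)" for n x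
  proof -
    have "((\<lambda>x. 1 / real (Suc n) * x + 0) has_vector_derivative 1 / real (Suc n)) (at x)"
      by (auto intro!: derivative_eq_intros)
    from vector_diff_chain_at[OF this smooth_has_vderiv[OF test_fun_smooth[OF om(1)]]]
    show ?thesis by (simp add: o_def c_def)
  qed
  have cd': "norm (nth_vderiv 1 (c n) x) \<le> B' / real (Suc n)" for n x
    unfolding nth_vderiv_1_eqI[OF cd] using B'(2) by (simp add: divide_right_mono)
  have lim: "(\<lambda>n. L2_norm (\<lambda>x. c n x * F x - F x)) \<longlonglongrightarrow> 0" if F: "L2 F" for F
  proof (rule L2_tendsto_dominated[OF F L2_cmult[OF F, of "of_real B"]])
    show "(\<lambda>x. c n x * F x) \<in> borel_measurable borel" for n
      using smooth_measurable[OF csm[of n]] L2_measurable[OF F] by measurable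
    show "AE x in lborel. norm (c n x * F x) \<le> norm (of_real B * F x)" for n
      using B by (auto simp: norm_mult c_def intro!: mult_right_mono)
    show "AE x in lborel. (\<lambda>n. c n x * F x) \<longlonglongrightarrow> F x"
    proof (rule AE_I2, rule tendsto_eventually)
      fix x
      obtain N :: nat where N: "\<bar>x\<bar> \<le> real N" using real_arch_simple by blast
      show "\<forall>\<^sub>F n in sequentially. c n x * F x = F x"
        using eventually_ge_at_top[of N]
      proof eventually_elim
        case (elim n)
        have "\<bar>1 / real (Suc n) * x + 0\<bar> \<le> 1" using N elim by (simp add: abs_mult field_simps)
        then have "c n x = 1" unfolding c_def by (rule om(2))
        then show ?case by simp
      qed
    qed
  qed
  define G where "G n = (\<lambda>x. c n x * g x + nth_vderiv 1 (c n) x * f x)" for n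
  have cut: "has_weak_deriv (\<lambda>x. c n x * f x) (G n)" "L2 (\<lambda>x. c n x * f x)" "L2 (G n)" for n
    using has_weak_deriv_cutoff[OF f g w ct] unfolding G_def by auto
  have cdf: "L2 (\<lambda>x. nth_vderiv 1 (c n) x * f x)" "L2_norm (\<lambda>x. nth_vderiv 1 (c n) x * f x) \<le> B' / real (Suc n) * L2_norm f" for n
    using L2_mult_bounded[OF f smooth_measurable[OF smooth_vderiv[OF csm]] cd'] by auto
  have cg: "L2 (\<lambda>x. c n x * g x)" for n
    using L2_mult_bounded(1)[OF g smooth_measurable[OF csm], of n B] B(2) by (simp add: c_def)
  have limG: "(\<lambda>n. L2_norm (\<lambda>x. G n x - g x)) \<longlonglongrightarrow> 0"
  proof (rule tendsto_sandwich[where f="\<lambda>_. 0"])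
    show "\<forall>\<^sub>F n in sequentially. L2_norm (\<lambda>x. G n x - g x) \<le> L2_norm (\<lambda>x. c n x * g x - g x) + B' / real (Suc n) * L2_norm f"
    proof (rule always_eventually, rule allI)
      fix n
      have "L2_norm (\<lambda>x. (c n x * g x - g x) + nth_vderiv 1 (c n) x * f x)
          \<le> L2_norm (\<lambda>x. c n x * g x - g x) + L2_norm (\<lambda>x. nth_vderiv 1 (c n) x * f x)"
        by (intro L2_norm_triangle L2_diff cdf cg g)
      then show "L2_norm (\<lambda>x. G n x - g x) \<le> L2_norm (\<lambda>x. c n x * g x - g x) + B' / real (Suc n) * L2_norm f"
        using cdf(2)[of n] by (simp add: G_def algebra_simps)
    qed
    have "(\<lambda>n. B' / real (Suc n) * L2_norm f) \<longlonglongrightarrow> 0"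
      using tendsto_mult_left[OF LIMSEQ_inverse_real_of_nat, of "B' * L2_norm f"] by (simp add: divide_inverse mult_ac)
    from tendsto_add[OF lim[OF g] this]
    show "(\<lambda>n. L2_norm (\<lambda>x. c n x * g x - g x) + B' / real (Suc n) * L2_norm f) \<longlonglongrightarrow> 0" by simp
  qed (auto simp: L2_norm_nonneg)
  have "\<forall>\<^sub>F n in sequentially. L2_norm (\<lambda>x. c n x * f x - f x) < e / 2 \<and> L2_norm (\<lambda>x. G n x - g x) < e / 2"
    by (intro eventually_conj order_tendstoD(2)[OF lim[OF f]] order_tendstoD(2)[OF limG]) (use e in auto)
  then obtain n where n: "L2_norm (\<lambda>x. c n x * f x - f x) < e / 2" "L2_norm (\<lambda>x. G n x - g x) < e / 2"
    by (auto simp: eventually_sequentially)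
  define S where "S = R * Suc n + 1"
  have "0 \<le> R * Suc n" using R(1) by simp
  then have S: "- S < S" "\<And>x. x \<notin> {-S<..<S} \<Longrightarrow> x \<notin> {- (R * Suc n)..R * Suc n}"
    unfolding S_def by auto
  have dz: "nth_vderiv 1 (c n) x = 0" if "x \<notin> {- (R * Suc n)..R * Suc n}" for x
    using vderiv_zero_off_closed[of "{- (R * Suc n)..R * Suc n}" "c n" x] cz[of _ n] that
      smooth_has_vderiv[OF csm] by blast
  obtain s where s: "\<And>j::nat. s j \<in> test_fun" "(\<lambda>j. L2_norm (\<lambda>x. s j x - c n x * f x)) \<longlonglongrightarrow> 0"
    "(\<lambda>j. L2_norm (\<lambda>x. nth_vderiv 1 (s j) x - G n x)) \<longlonglongrightarrow> 0"
  proof (rule H1_dense_interval[OF cut(2,3,1) S(1)])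
    show "c n x * f x = 0" if "x \<notin> {-S<..<S}" for x using cz[OF S(2)[OF that]] by simp
    show "G n x = 0" if "x \<notin> {-S<..<S}" for x
      unfolding G_def cz[OF S(2)[OF that]] dz[OF S(2)[OF that]] by simp
  qed blast
  have "\<forall>\<^sub>F j in sequentially. L2_norm (\<lambda>x. s j x - c n x * f x) < e / 2 \<and> L2_norm (\<lambda>x. nth_vderiv 1 (s j) x - G n x) < e / 2"
    by (intro eventually_conj order_tendstoD(2)[OF s(2)] order_tendstoD(2)[OF s(3)]) (use e in auto)
  then obtain j where j: "L2_norm (\<lambda>x. s j x - c n x * f x) < e / 2" "L2_norm (\<lambda>x. nth_vderiv 1 (s j) x - G n x) < e / 2"
    by (auto simp: eventually_sequentially)
  show ?thesis
  proof (rule that[OF s(1)[of j]])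
    have "L2_norm (\<lambda>x. (s j x - c n x * f x) + (c n x * f x - f x)) \<le> L2_norm (\<lambda>x. s j x - c n x * f x) + L2_norm (\<lambda>x. c n x * f x - f x)"
      by (intro L2_norm_triangle L2_diff test_fun_L2 s cut f)
    then show "L2_norm (\<lambda>x. s j x - f x) < e" using j n by simp
    have "L2_norm (\<lambda>x. (nth_vderiv 1 (s j) x - G n x) + (G n x - g x)) \<le> L2_norm (\<lambda>x. nth_vderiv 1 (s j) x - G n x) + L2_norm (\<lambda>x. G n x - g x)"
      by (intro L2_norm_triangle L2_diff test_fun_L2 test_fun_deriv s cut g)
    then show "L2_norm (\<lambda>x. nth_vderiv 1 (s j) x - g x) < e" using j n by simp
  qed
qed

section \<open>Sobolev's inequality and difference quotients\<close>

text \<open>The square of the modulus is the integral of its own derivative from the left.\<close>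

lemma test_fun_pointwise_bound:
  assumes p: "\<phi> \<in> test_fun"
  shows "norm (\<phi> x) \<le> H1_norm \<phi>"
proof -
  obtain R where R: "R \<ge> 1" "\<And>x. x \<notin> {-R..R} \<Longrightarrow> \<phi> x = 0" using test_fun_interval[OF p] by metis
  define S where "S = R + \<bar>x\<bar> + 1"
  note sm = test_fun_smooth[OF p]
  define d where "d y = \<phi> y * cnj (nth_vderiv 1 \<phi> y) + nth_vderiv 1 \<phi> y * cnj (\<phi> y)" for y
  have L: "L2 \<phi>" "L2 (nth_vderiv 1 \<phi>)" by (intro test_fun_L2 test_fun_deriv p)+
  have i: "integrable lborel d"
    unfolding d_def by (intro Bochner_Integration.integrable_add L2_integrable_mult L2_cnj L)
  have "(LINT y|lborel. indicator {-S..x} y *\<^sub>R d y) = \<phi> x * cnj (\<phi> x) - \<phi> (-S) * cnj (\<phi> (-S))"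
  proof (rule integral_FTC_atLeastAtMost)
    have "((\<lambda>x. \<phi> x * cnj (\<phi> x)) has_vector_derivative d y) (at y)" for y
      unfolding d_def
      by (intro has_vector_derivative_mult smooth_has_vderiv sm
          bounded_linear.has_vector_derivative[OF bounded_linear_cnj])
    then show "((\<lambda>x. \<phi> x * cnj (\<phi> x)) has_vector_derivative d y) (at y within {-S..x})" for y
      by (rule has_vector_derivative_at_within)
    show "continuous_on {-S..x} d"
      unfolding d_def by (intro continuous_intros smooth_continuous smooth_vderiv sm)
  qed (use R in \<open>auto simp: S_def\<close>)
  moreover have "\<phi> (-S) = 0" by (rule R(2)) (use R in \<open>auto simp: S_def\<close>)
  ultimately have "norm (\<phi> x * cnj (\<phi> x)) = norm (LINT y|lborel. indicator {-S..x} y *\<^sub>R d y)" by simp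
  also have "\<dots> \<le> (LINT y|lborel. norm (indicator {-S..x} y *\<^sub>R d y))" by (rule integral_norm_bound)
  also have "\<dots> \<le> (LINT y|lborel. 2 * norm (\<phi> y * nth_vderiv 1 \<phi> y))"
  proof (rule integral_mono)
    show "integrable lborel (\<lambda>y. norm (indicator {-S..x} y *\<^sub>R d y))"
      by (intro integrable_norm integrable_mult_indicator i) auto
    show "integrable lborel (\<lambda>y. 2 * norm (\<phi> y * nth_vderiv 1 \<phi> y))"
      by (intro integrable_mult_right integrable_norm L2_integrable_mult L)
    fix y
    have "norm (d y) \<le> 2 * norm (\<phi> y * nth_vderiv 1 \<phi> y)"
      unfolding d_def by (rule norm_triangle_le) (simp add: norm_mult)
    then show "norm (indicator {-S..x} y *\<^sub>R d y) \<le> 2 * norm (\<phi> y * nth_vderiv 1 \<phi> y)"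
      by (auto simp: indicator_def)
  qed
  also have "\<dots> \<le> 2 * (L2_norm \<phi> * L2_norm (nth_vderiv 1 \<phi>))"
    using L2_Cauchy_Schwarz_norm[OF L] by simp
  also have "\<dots> \<le> (L2_norm \<phi>)\<^sup>2 + (L2_norm (nth_vderiv 1 \<phi>))\<^sup>2"
    using sum_squares_bound[of "L2_norm \<phi>" "L2_norm (nth_vderiv 1 \<phi>)"] by simp
  finally have "(norm (\<phi> x))\<^sup>2 \<le> (L2_norm \<phi>)\<^sup>2 + (L2_norm (nth_vderiv 1 \<phi>))\<^sup>2"
    by (simp add: norm_mult power2_eq_square)
  then show ?thesis unfolding test_fun_H1(4)[OF p] by (rule real_le_rsqrt)
qed

lemma test_fun_dense_H1_norm:
  assumes f: "H1 f" and e: "0 < e"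
  obtains \<phi> where "\<phi> \<in> test_fun" "H1_norm (\<lambda>x. \<phi> x - f x) < e"
proof -
  note fD = H1D[OF f]
  obtain \<phi> where p: "\<phi> \<in> test_fun" "L2_norm (\<lambda>x. \<phi> x - f x) < e / 2" "L2_norm (\<lambda>x. nth_vderiv 1 \<phi> x - weak_deriv f x) < e / 2"
    using test_fun_dense_H1[OF fD(1,3,2), of "e / 2"] e by auto
  note pL = test_fun_L2[OF p(1)] test_fun_L2[OF test_fun_deriv[OF p(1)]]
  have "has_weak_deriv (\<lambda>x. \<phi> x - f x) (\<lambda>x. nth_vderiv 1 \<phi> x - weak_deriv f x)"
    using has_weak_deriv_linear[OF pL test_fun_H1(1)[OF p(1)] fD(1,3,2), of 1 "-1"] by simp
  from H1I(2)[OF L2_diff[OF pL(1) fD(1)] L2_diff[OF pL(2) fD(3)] this]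
  have "H1_norm (\<lambda>x. \<phi> x - f x) < e"
    using H1_norm_le_sum[of "\<lambda>x. \<phi> x - f x"] p by simp
  then show ?thesis using that p by blast
qed

text \<open>Along a subsequence of approximating test functions the pointwise bounds converge almost
  everywhere.\<close>

theorem Sobolev_inequality:
  assumes f: "H1 f"
  shows "AE x in lborel. norm (f x) \<le> H1_norm f"
proof -
  note fD = H1D[OF f]
  have "\<exists>\<phi>\<in>test_fun. H1_norm (\<lambda>x. \<phi> x - f x) < 1 / real (Suc n)" for n
    using test_fun_dense_H1_norm[OF f, of "1 / real (Suc n)"] by auto
  then obtain s where s: "\<And>n. s n \<in> test_fun" "\<And>n. H1_norm (\<lambda>x. s n x - f x) < 1 / real (Suc n)" by metis
  have sH: "H1 (s n)" for n by (rule test_fun_H1(2)[OF s(1)])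
  have l1: "(\<lambda>n. 1 / real (Suc n)) \<longlonglongrightarrow> 0"
    using LIMSEQ_inverse_real_of_nat by (simp add: inverse_eq_divide)
  have "\<exists>r. strict_mono r \<and> (AE x in lborel. (\<lambda>n. (norm (s (r n) x - f x))\<^sup>2) \<longlonglongrightarrow> 0)"
  proof (rule tendsto_L1_AE_subseq)
    show "integrable lborel (\<lambda>x. (norm (s n x - f x))\<^sup>2)" for n
      by (intro L2_integrable L2_diff test_fun_L2 s fD)
    show "(\<lambda>n. LINT x|lborel. norm ((norm (s n x - f x))\<^sup>2)) \<longlonglongrightarrow> 0"
    proof (rule tendsto_sandwich[where f="\<lambda>_. 0"])
      show "\<forall>\<^sub>F n in sequentially. (LINT x|lborel. norm ((norm (s n x - f x))\<^sup>2)) \<le> (1 / real (Suc n))\<^sup>2"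
      proof (rule always_eventually, rule allI)
        fix n
        have "L2_norm (\<lambda>x. s n x - f x) \<le> 1 / real (Suc n)"
          using L2_norm_le_H1_norm[of "\<lambda>x. s n x - f x"] s(2)[of n] by simp
        then have "(L2_norm (\<lambda>x. s n x - f x))\<^sup>2 \<le> (1 / real (Suc n))\<^sup>2"
          by (intro power_mono) (auto simp: L2_norm_nonneg)
        then show "(LINT x|lborel. norm ((norm (s n x - f x))\<^sup>2)) \<le> (1 / real (Suc n))\<^sup>2"
          by (simp add: L2_norm_square)
      qed
      show "(\<lambda>n. (1 / real (Suc n))\<^sup>2) \<longlonglongrightarrow> 0" using tendsto_power[OF l1, of 2] by simp
    qed auto
  qed
  then obtain r where r: "strict_mono r" "AE x in lborel. (\<lambda>n. (norm (s (r n) x - f x))\<^sup>2) \<longlonglongrightarrow> 0" by blast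
  from r(2) show ?thesis
  proof eventually_elim
    fix x assume "(\<lambda>n. (norm (s (r n) x - f x))\<^sup>2) \<longlonglongrightarrow> 0"
    from tendsto_real_sqrt[OF this] have a: "(\<lambda>n. norm (s (r n) x - f x)) \<longlonglongrightarrow> 0" by simp
    have le: "norm (f x) \<le> (H1_norm f + 1 / real (Suc (r n))) + norm (s (r n) x - f x)" for n
    proof -
      have "norm (f x) \<le> norm (s (r n) x) + norm (s (r n) x - f x)"
        by (metis norm_minus_commute norm_triangle_sub)
      moreover have "norm (s (r n) x) \<le> H1_norm (s (r n))" by (rule test_fun_pointwise_bound[OF s(1)])
      moreover have "H1_norm (s (r n)) \<le> H1_norm (\<lambda>x. s (r n) x - f x) + H1_norm f"
        using H1_add(2)[OF H1_diff(1)[OF sH f] f, of "r n"] by simp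
      ultimately show ?thesis using s(2)[of "r n"] by linarith
    qed
    have "(\<lambda>n. (H1_norm f + 1 / real (Suc (r n))) + norm (s (r n) x - f x)) \<longlonglongrightarrow> (H1_norm f + 0) + 0"
      by (intro tendsto_add tendsto_const a LIMSEQ_subseq_LIMSEQ[OF l1 r(1), unfolded o_def])
    then have "norm (f x) \<le> (H1_norm f + 0) + 0"
      by (rule LIMSEQ_le_const) (use le in blast)
    then show "norm (f x) \<le> H1_norm f" by simp
  qed
qed

text \<open>In a pairing, the difference quotient can be moved from \<open>f\<close> to the test function, where it
  converges to the derivative. Only finite steps of \<open>f\<close> are measured, so this yields bounds for a weak
  derivative whose equation is not available.\<close>

lemma weak_deriv_norm_le_translations:
  assumes f: "L2 f" and g: "L2 g" and w: "has_weak_deriv f g" and C: "0 \<le> C"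
    and le: "\<And>h. 0 < h \<Longrightarrow> h \<le> 1 \<Longrightarrow> L2_norm (\<lambda>x. f (x + h) - f x) \<le> C * h"
  shows "L2_norm g \<le> C"
proof (rule L2_norm_le_duality[OF g C])
  fix \<phi> :: "real \<Rightarrow> complex" assume p: "\<phi> \<in> test_fun"
  define h where "h n = 1 / real (Suc n)" for n
  have h: "0 < h n" "h n \<le> 1" for n by (auto simp: h_def)
  have hl: "h \<longlonglongrightarrow> 0" unfolding h_def using LIMSEQ_inverse_real_of_nat by (simp add: inverse_eq_divide)
  obtain R where R: "R \<ge> 1" "\<And>x. x \<notin> {-R..R} \<Longrightarrow> \<phi> x = 0" using test_fun_interval[OF p] by metis
  obtain B where B: "B \<ge> 0" "\<And>x. norm (nth_vderiv 1 \<phi> x) \<le> B" using test_fun_bounded[OF test_fun_deriv[OF p]] by metis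
  define q where "q n = (\<lambda>x. of_real (1 / h n) * (\<phi> x - \<phi> (x + (- h n))))" for n
  have qt: "q n \<in> test_fun" for n unfolding q_def by (intro test_fun_cmult test_fun_diff test_fun_shift p)
  have lip: "norm (\<phi> x - \<phi> y) \<le> B * norm (x - y)" for x y
    by (rule vderiv_lipschitz[OF smooth_has_vderiv[OF test_fun_smooth[OF p]] B(2)])
  have qb: "norm (q n x) \<le> B" for n x
  proof -
    have "norm (q n x) = 1 / h n * norm (\<phi> x - \<phi> (x - h n))"
      unfolding q_def norm_mult norm_of_real using h[of n] by simp
    also have "\<dots> \<le> 1 / h n * (B * h n)"
      using lip[of x "x - h n"] h[of n] by (intro mult_left_mono) auto
    finally show ?thesis using h(1)[of n] by simp
  qed
  have qz: "q n x = 0" if "x \<notin> {-(R+1)..R+1}" for n x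
  proof -
    have "x \<notin> {-R..R}" "x + (- h n) \<notin> {-R..R}" using that h[of n] by auto
    then show ?thesis by (simp add: q_def R(2))
  qed
  have ql: "(\<lambda>n. q n x) \<longlonglongrightarrow> nth_vderiv 1 \<phi> x" for x
  proof -
    have "filterlim (\<lambda>n. - h n) (at 0) sequentially"
      unfolding filterlim_at using tendsto_minus[OF hl] h(1) by (auto simp: less_imp_neq[THEN not_sym])
    from filterlim_compose[OF vderiv_quotient_tendsto[OF smooth_has_vderiv[OF test_fun_smooth[OF p], of x]] this]
    have "(\<lambda>n. (\<phi> (x + - h n) - \<phi> x) /\<^sub>R (- h n)) \<longlonglongrightarrow> nth_vderiv 1 \<phi> x" .
    moreover have "(\<phi> (x + - h n) - \<phi> x) /\<^sub>R (- h n) = q n x" for n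
      using h(1)[of n] by (simp add: q_def scaleR_conv_of_real divide_simps)
    ultimately show ?thesis by simp
  qed
  have ind: "L2 (\<lambda>x. indicator {-(R+1)..R+1} x * of_real B)"
    by (rule L2_bounded_on_interval(1)[where B=B and a="-(R+1)" and b="R+1"]) (use B R in \<open>auto simp: indicator_def\<close>)
  have "(\<lambda>n. L2_norm (\<lambda>x. q n x - nth_vderiv 1 \<phi> x)) \<longlonglongrightarrow> 0"
  proof (rule L2_tendsto_dominated[OF _ ind])
    show "AE x in lborel. norm (q n x) \<le> norm (indicator {-(R+1)..R+1} x * of_real B :: complex)" for n
    proof (rule AE_I2)
      fix x show "norm (q n x) \<le> norm (indicator {-(R+1)..R+1} x * of_real B :: complex)"
        using qb[of n x] qz[of x n] B by (cases "x \<in> {-(R+1)..R+1}") auto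
    qed
    show "AE x in lborel. (\<lambda>n. q n x) \<longlonglongrightarrow> nth_vderiv 1 \<phi> x" by (rule AE_I2[OF ql])
    show "q n \<in> borel_measurable borel" for n by (rule L2_measurable[OF test_fun_L2[OF qt]])
    show "L2 (nth_vderiv 1 \<phi>)" by (rule test_fun_L2[OF test_fun_deriv[OF p]])
  qed
  from pairing_tendsto[OF f test_fun_L2[OF test_fun_deriv[OF p]] test_fun_L2[OF qt] this]
  have l: "(\<lambda>n. norm (LINT x|lborel. f x * q n x)) \<longlonglongrightarrow> norm (LINT x|lborel. f x * nth_vderiv 1 \<phi> x)"
    by (rule tendsto_norm)
  have b: "norm (LINT x|lborel. f x * q n x) \<le> C * L2_norm \<phi>" for n
  proof -
    have i1: "integrable lborel (\<lambda>x. f x * \<phi> x)" by (intro L2_integrable_mult f test_fun_L2 p)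
    have i2: "integrable lborel (\<lambda>x. f x * \<phi> (x + (- h n)))" by (intro L2_integrable_mult f test_fun_L2 test_fun_shift p)
    have i3: "integrable lborel (\<lambda>x. f (x + h n) * \<phi> x)" by (intro L2_integrable_mult L2_shift f test_fun_L2 p)
    have "(LINT x|lborel. f x * q n x) = (LINT x|lborel. of_real (1 / h n) * (f x * \<phi> x - f x * \<phi> (x + (- h n))))"
      by (rule Bochner_Integration.integral_cong) (auto simp: q_def algebra_simps)
    also have "\<dots> = of_real (1 / h n) * ((LINT x|lborel. f x * \<phi> x) - (LINT x|lborel. f x * \<phi> (x + (- h n))))"
      using i1 i2 by simp
    also have "(LINT x|lborel. f x * \<phi> (x + (- h n))) = (LINT x|lborel. f (x + h n) * \<phi> x)"
      using LINT_shift[of "\<lambda>x. f x * \<phi> (x + (- h n))" "h n"] by simp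
    also have "(LINT x|lborel. f x * \<phi> x) - (LINT x|lborel. f (x + h n) * \<phi> x) = - (LINT x|lborel. (f (x + h n) - f x) * \<phi> x)"
      using i1 i3 by (simp add: left_diff_distrib)
    finally have "norm (LINT x|lborel. f x * q n x) = 1 / h n * norm (LINT x|lborel. (f (x + h n) - f x) * \<phi> x)"
      using h(1)[of n] by (simp add: norm_mult norm_divide)
    also have "\<dots> \<le> 1 / h n * (L2_norm (\<lambda>x. f (x + h n) - f x) * L2_norm \<phi>)"
      using h(1)[of n] by (intro mult_left_mono L2_Cauchy_Schwarz L2_diff L2_shift f test_fun_L2 p) auto
    also have "\<dots> \<le> 1 / h n * ((C * h n) * L2_norm \<phi>)"
      using h[of n] by (intro mult_left_mono mult_right_mono le) (auto simp: L2_norm_nonneg)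
    finally show ?thesis using h(1)[of n] by simp
  qed
  have "norm (LINT x|lborel. f x * nth_vderiv 1 \<phi> x) \<le> C * L2_norm \<phi>"
    by (rule LIMSEQ_le_const2[OF l]) (use b in blast)
  then show "norm (LINT x|lborel. g x * \<phi> x) \<le> C * L2_norm \<phi>"
    unfolding has_weak_derivD(3)[OF w p] by simp
qed

section \<open>The energy identity\<close>

lemma Hminus1_lincomb:
  assumes "Hminus1 F" "Hminus1 G"
  shows "Hminus1 (\<lambda>\<phi>. a * F \<phi> + b * G \<phi>)"
proof -
  obtain C where C: "\<And>\<phi>. \<phi> \<in> test_fun \<Longrightarrow> norm (F \<phi>) \<le> C * H1_norm \<phi>"
    using assms(1) unfolding Hminus1_def by blast
  obtain D where D: "\<And>\<phi>. \<phi> \<in> test_fun \<Longrightarrow> norm (G \<phi>) \<le> D * H1_norm \<phi>"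
    using assms(2) unfolding Hminus1_def by blast
  have "norm (a * F \<phi> + b * G \<phi>) \<le> (norm a * C + norm b * D) * H1_norm \<phi>" if "\<phi> \<in> test_fun" for \<phi>
  proof -
    have "norm (a * F \<phi> + b * G \<phi>) \<le> norm a * norm (F \<phi>) + norm b * norm (G \<phi>)"
      by (rule norm_triangle_le) (simp add: norm_mult)
    also have "\<dots> \<le> norm a * (C * H1_norm \<phi>) + norm b * (D * H1_norm \<phi>)"
      by (intro add_mono mult_left_mono C D that) auto
    finally show ?thesis by (simp add: algebra_simps)
  qed
  moreover have "a * F (\<lambda>x. \<phi> x + \<psi> x) + b * G (\<lambda>x. \<phi> x + \<psi> x) = a * F \<phi> + b * G \<phi> + (a * F \<psi> + b * G \<psi>)"
    if "\<phi> \<in> test_fun" "\<psi> \<in> test_fun" for \<phi> \<psi>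
    using assms that unfolding Hminus1_def by (simp add: algebra_simps)
  moreover have "a * F (\<lambda>x. c * \<phi> x) + b * G (\<lambda>x. c * \<phi> x) = c * (a * F \<phi> + b * G \<phi>)" if "\<phi> \<in> test_fun" for \<phi> c
    using assms that unfolding Hminus1_def by (simp add: algebra_simps)
  ultimately show ?thesis unfolding Hminus1_def by blast
qed

text \<open>The supremum that defines the norm is the least bound only for functionals that are bounded;
  hence the assumption.\<close>

lemma Hminus1_norm_bound:
  assumes F: "Hminus1 F" and p: "\<phi> \<in> test_fun"
  shows "norm (F \<phi>) \<le> Hminus1_norm F * H1_norm \<phi>"
proof -
  obtain C where C: "\<And>\<phi>. \<phi> \<in> test_fun \<Longrightarrow> norm (F \<phi>) \<le> C * H1_norm \<phi>"
    using F unfolding Hminus1_def by blast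
  show ?thesis
  proof (cases "H1_norm \<phi> = 0")
    case True
    then show ?thesis using C[OF p] by simp
  next
    case False
    define N where "N = H1_norm \<phi>"
    have N: "0 < N" using False H1_norm_nonneg[of \<phi>] by (simp add: N_def)
    define \<psi> where "\<psi> = (\<lambda>x. of_real (1 / N) * \<phi> x)"
    have q: "\<psi> \<in> test_fun" unfolding \<psi>_def by (rule test_fun_cmult[OF p])
    have "H1_norm \<psi> \<le> 1"
      using H1_linear(3)[OF test_fun_H1(2)[OF p] test_fun_H1(2)[OF p], of "of_real (1 / N)" 0] N
      by (simp add: \<psi>_def N_def norm_divide)
    moreover have "bdd_above ((\<lambda>\<phi>. norm (F \<phi>)) ` {\<phi> \<in> test_fun. H1_norm \<phi> \<le> 1})"
    proof (rule bdd_aboveI2)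
      fix \<phi> :: "real \<Rightarrow> complex" assume a: "\<phi> \<in> {\<phi> \<in> test_fun. H1_norm \<phi> \<le> 1}"
      then have "norm (F \<phi>) \<le> C * H1_norm \<phi>" using C by blast
      also have "\<dots> \<le> \<bar>C\<bar> * 1" using a H1_norm_nonneg[of \<phi>] by (intro mult_mono) auto
      finally show "norm (F \<phi>) \<le> \<bar>C\<bar>" by simp
    qed
    ultimately have "norm (F \<psi>) \<le> Hminus1_norm F"
      unfolding Hminus1_norm_def using q by (intro cSUP_upper) auto
    moreover have "F \<psi> = of_real (1 / N) * F \<phi>"
      using F p unfolding Hminus1_def \<psi>_def by blast
    ultimately have "norm (F \<phi>) / N \<le> Hminus1_norm F" using N by (simp add: norm_divide)
    then show ?thesis using N by (simp add: N_def field_simps)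
  qed
qed

text \<open>At time \<open>t\<close>, \<open>i \<partial>\<^sub>t q + \<partial>\<^sub>y\<^sup>2 q = F\<close> holds with the time derivative taken in \<open>H\<^sup>-\<^sup>1\<close>, that is,
  the difference quotients converge uniformly against test functions of bounded \<open>H\<^sup>1\<close> norm.\<close>

definition evolves :: "(real \<Rightarrow> real \<Rightarrow> complex) \<Rightarrow> (real \<Rightarrow> complex) \<Rightarrow> real \<Rightarrow> bool" where
  "evolves q F t \<longleftrightarrow> (\<forall>\<epsilon>>0. \<forall>\<^sub>F s in at t within {1..}. \<forall>\<phi>\<in>test_fun.
     norm ((LINT x|lborel. (q s x - q t x) * \<phi> x) / of_real (s - t)
       - \<i> * ((LINT x|lborel. q t x * nth_vderiv 1 (nth_vderiv 1 \<phi>) x) - (LINT x|lborel. F x * \<phi> x)))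
     \<le> \<epsilon> * H1_norm \<phi>)"

lemma LINT_diff_mult:
  assumes "L2 f" "L2 g" "\<phi> \<in> test_fun"
  shows "(LINT x|lborel. (f x - g x) * \<phi> x) = (LINT x|lborel. f x * \<phi> x) - (LINT x|lborel. g x * \<phi> x)"
  using L2_integrable_mult[OF assms(1) test_fun_L2[OF assms(3)]] L2_integrable_mult[OF assms(2) test_fun_L2[OF assms(3)]]
  by (simp add: left_diff_distrib)

text \<open>The equation identifies the \<open>H\<^sup>-\<^sup>1\<close> derivative, and convergence in \<open>H\<^sup>-\<^sup>1\<close> norm is uniform
  convergence on test functions.\<close>

lemma global_solution_evolves:
  assumes "global_solution W \<beta> \<gamma> u" "1 \<le> t"
  shows "evolves u (nonlin W \<beta> \<gamma> t (u t)) t"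
proof -
  obtain v where v: "C1_Hminus1_deriv u v"
    and eq: "\<And>t \<phi>. 1 \<le> t \<Longrightarrow> \<phi> \<in> test_fun \<Longrightarrow>
      \<i> * v t \<phi> + distr_deriv (distr_deriv (distr_of (u t))) \<phi> - distr_of (nonlin W \<beta> \<gamma> t (u t)) \<phi> = 0"
    using assms(1) unfolding global_solution_def by blast
  have L: "L2 (u s)" if "1 \<le> s" for s
    using assms(1) that H1D(1) unfolding global_solution_def continuous_H1_def by blast
  define Q where "Q s = (\<lambda>\<phi>. (distr_of (u s) \<phi> - distr_of (u t) \<phi>) / of_real (s - t) - v t \<phi>)" for s
  have lim: "((\<lambda>s. Hminus1_norm (Q s)) \<longlongrightarrow> 0) (at t within {1..})"
    using v assms(2) unfolding C1_Hminus1_deriv_def Q_def by blast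
  have H: "Hminus1 (Q s)" if "1 \<le> s" for s
  proof -
    have "Hminus1 (\<lambda>\<phi>. (1 / of_real (s - t)) * (1 * distr_of (u s) \<phi> + (- 1) * distr_of (u t) \<phi>) + (- 1) * v t \<phi>)"
      using v assms(2) that unfolding C1_Hminus1_deriv_def by (intro Hminus1_lincomb) auto
    then show ?thesis unfolding Q_def by simp
  qed
  have vt: "v t \<phi> = \<i> * ((LINT x|lborel. u t x * nth_vderiv 1 (nth_vderiv 1 \<phi>) x) - (LINT x|lborel. nonlin W \<beta> \<gamma> t (u t) x * \<phi> x))"
    if p: "\<phi> \<in> test_fun" for \<phi>
  proof -
    have "\<i> * v t \<phi> = (LINT x|lborel. nonlin W \<beta> \<gamma> t (u t) x * \<phi> x) - (LINT x|lborel. u t x * nth_vderiv 1 (nth_vderiv 1 \<phi>) x)"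
      using eq[OF assms(2) p] by (simp add: distr_deriv_def distr_of_def algebra_simps del: One_nat_def)
    then have "\<i> * (\<i> * v t \<phi>) = \<i> * ((LINT x|lborel. nonlin W \<beta> \<gamma> t (u t) x * \<phi> x) - (LINT x|lborel. u t x * nth_vderiv 1 (nth_vderiv 1 \<phi>) x))"
      by simp
    moreover have "\<i> * (\<i> * v t \<phi>) = - v t \<phi>" by (simp add: mult.assoc[symmetric])
    ultimately have "v t \<phi> = - (\<i> * ((LINT x|lborel. nonlin W \<beta> \<gamma> t (u t) x * \<phi> x) - (LINT x|lborel. u t x * nth_vderiv 1 (nth_vderiv 1 \<phi>) x)))"
      by (metis minus_minus)
    then show ?thesis by (simp add: right_diff_distrib del: One_nat_def)
  qed
  show ?thesis
    unfolding evolves_def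
  proof (intro allI impI)
    fix \<epsilon> :: real assume e: "0 < \<epsilon>"
    have ev: "\<forall>\<^sub>F s in at t within {1..}. Hminus1_norm (Q s) < \<epsilon>" by (rule order_tendstoD(2)[OF lim e])
    have ge: "\<forall>\<^sub>F s in at t within {1..}. 1 \<le> s" by (auto simp: eventually_at_filter)
    show "\<forall>\<^sub>F s in at t within {1..}. \<forall>\<phi>\<in>test_fun.
     norm ((LINT x|lborel. (u s x - u t x) * \<phi> x) / of_real (s - t)
       - \<i> * ((LINT x|lborel. u t x * nth_vderiv 1 (nth_vderiv 1 \<phi>) x) - (LINT x|lborel. nonlin W \<beta> \<gamma> t (u t) x * \<phi> x)))
     \<le> \<epsilon> * H1_norm \<phi>"
      using ev ge
    proof eventually_elim
      case (elim s)
      show ?case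
      proof
        fix \<phi> :: "real \<Rightarrow> complex" assume p: "\<phi> \<in> test_fun"
        have "norm (Q s \<phi>) \<le> Hminus1_norm (Q s) * H1_norm \<phi>" by (rule Hminus1_norm_bound[OF H p]) (use elim in simp)
        also have "\<dots> \<le> \<epsilon> * H1_norm \<phi>" using elim by (intro mult_right_mono H1_norm_nonneg) simp
        finally show "norm ((LINT x|lborel. (u s x - u t x) * \<phi> x) / of_real (s - t)
            - \<i> * ((LINT x|lborel. u t x * nth_vderiv 1 (nth_vderiv 1 \<phi>) x) - (LINT x|lborel. nonlin W \<beta> \<gamma> t (u t) x * \<phi> x)))
          \<le> \<epsilon> * H1_norm \<phi>"
          using elim by (simp add: Q_def vt[OF p] LINT_diff_mult[OF L L p] assms(2) distr_of_def del: One_nat_def)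
      qed
    qed
  qed
qed

lemma evolves_diff:
  assumes q: "evolves q F t" and r: "evolves r G t" and t: "1 \<le> t"
    and L: "\<And>s. 1 \<le> s \<Longrightarrow> L2 (q s)" "\<And>s. 1 \<le> s \<Longrightarrow> L2 (r s)" "L2 F" "L2 G"
  shows "evolves (\<lambda>s x. q s x - r s x) (\<lambda>x. F x - G x) t"
  unfolding evolves_def
proof (intro allI impI)
  fix \<epsilon> :: real assume "0 < \<epsilon>"
  then have e: "0 < \<epsilon> / 2" by simp
  have ge: "\<forall>\<^sub>F s in at t within {1..}. 1 \<le> s" by (auto simp: eventually_at_filter)
  from q[unfolded evolves_def, rule_format, OF e] r[unfolded evolves_def, rule_format, OF e] ge
  show "\<forall>\<^sub>F s in at t within {1..}. \<forall>\<phi>\<in>test_fun.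
     norm ((LINT x|lborel. (q s x - r s x - (q t x - r t x)) * \<phi> x) / of_real (s - t)
       - \<i> * ((LINT x|lborel. (q t x - r t x) * nth_vderiv 1 (nth_vderiv 1 \<phi>) x) - (LINT x|lborel. (F x - G x) * \<phi> x)))
     \<le> \<epsilon> * H1_norm \<phi>"
  proof eventually_elim
    case (elim s)
    show ?case
    proof
      fix \<phi> :: "real \<Rightarrow> complex" assume p: "\<phi> \<in> test_fun"
      note p2 = test_fun_deriv[OF test_fun_deriv[OF p]]
      have d1: "(LINT x|lborel. (q s x - r s x - (q t x - r t x)) * \<phi> x)
          = (LINT x|lborel. (q s x - q t x) * \<phi> x) - (LINT x|lborel. (r s x - r t x) * \<phi> x)"
        using elim(3) t by (subst LINT_diff_mult[symmetric]) (auto intro!: L2_diff L p Bochner_Integration.integral_cong simp: algebra_simps)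
      have d2: "(LINT x|lborel. (q t x - r t x) * nth_vderiv 1 (nth_vderiv 1 \<phi>) x)
          = (LINT x|lborel. q t x * nth_vderiv 1 (nth_vderiv 1 \<phi>) x) - (LINT x|lborel. r t x * nth_vderiv 1 (nth_vderiv 1 \<phi>) x)"
        by (rule LINT_diff_mult[OF L(1)[OF t] L(2)[OF t] p2])
      note d3 = LINT_diff_mult[OF L(3,4) p]
      define X where "X = (LINT x|lborel. (q s x - q t x) * \<phi> x) / of_real (s - t)
       - \<i> * ((LINT x|lborel. q t x * nth_vderiv 1 (nth_vderiv 1 \<phi>) x) - (LINT x|lborel. F x * \<phi> x))"
      define Y where "Y = (LINT x|lborel. (r s x - r t x) * \<phi> x) / of_real (s - t)
       - \<i> * ((LINT x|lborel. r t x * nth_vderiv 1 (nth_vderiv 1 \<phi>) x) - (LINT x|lborel. G x * \<phi> x))"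
      have "norm X \<le> \<epsilon> / 2 * H1_norm \<phi>" "norm Y \<le> \<epsilon> / 2 * H1_norm \<phi>"
        using elim(1,2) p unfolding X_def Y_def by blast+
      then have "norm (X - Y) \<le> \<epsilon> * H1_norm \<phi>" using norm_triangle_ineq4[of X Y] by (simp add: field_simps)
      moreover have "X - Y = (LINT x|lborel. (q s x - r s x - (q t x - r t x)) * \<phi> x) / of_real (s - t)
       - \<i> * ((LINT x|lborel. (q t x - r t x) * nth_vderiv 1 (nth_vderiv 1 \<phi>) x) - (LINT x|lborel. (F x - G x) * \<phi> x))"
        unfolding d1 d2 d3 X_def Y_def diff_divide_distrib right_diff_distrib by (simp del: One_nat_def)
      ultimately show "norm ((LINT x|lborel. (q s x - r s x - (q t x - r t x)) * \<phi> x) / of_real (s - t)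
       - \<i> * ((LINT x|lborel. (q t x - r t x) * nth_vderiv 1 (nth_vderiv 1 \<phi>) x) - (LINT x|lborel. (F x - G x) * \<phi> x)))
       \<le> \<epsilon> * H1_norm \<phi>" by simp
    qed
  qed
qed

lemma evolves_shift:
  assumes q: "evolves q F t"
  shows "evolves (\<lambda>s x. q s (x + h)) (\<lambda>x. F (x + h)) t"
  unfolding evolves_def
proof (intro allI impI)
  fix \<epsilon> :: real assume e: "0 < \<epsilon>"
  from q[unfolded evolves_def, rule_format, OF e]
  show "\<forall>\<^sub>F s in at t within {1..}. \<forall>\<phi>\<in>test_fun.
     norm ((LINT x|lborel. (q s (x + h) - q t (x + h)) * \<phi> x) / of_real (s - t)
       - \<i> * ((LINT x|lborel. q t (x + h) * nth_vderiv 1 (nth_vderiv 1 \<phi>) x) - (LINT x|lborel. F (x + h) * \<phi> x)))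
     \<le> \<epsilon> * H1_norm \<phi>"
  proof eventually_elim
    case (elim s)
    show ?case
    proof
      fix \<phi> :: "real \<Rightarrow> complex" assume p: "\<phi> \<in> test_fun"
      define \<psi> where "\<psi> = (\<lambda>x. \<phi> (x + (- h)))"
      have p': "\<psi> \<in> test_fun" unfolding \<psi>_def by (rule test_fun_shift[OF p])
      have d: "nth_vderiv 1 (nth_vderiv 1 \<psi>) = (\<lambda>x. nth_vderiv 1 (nth_vderiv 1 \<phi>) (x + (- h)))"
        unfolding \<psi>_def nth_vderiv_1_shift[OF test_fun_smooth[OF p]]
        by (rule nth_vderiv_1_shift[OF smooth_vderiv[OF test_fun_smooth[OF p]]])
      have H: "H1_norm \<psi> = H1_norm \<phi>" unfolding \<psi>_def by (rule H1_shift(2)[OF test_fun_H1(2)[OF p]])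
      have "(LINT x|lborel. (q s (x + h) - q t (x + h)) * \<phi> x) = (LINT x|lborel. (q s x - q t x) * \<psi> x)"
        using LINT_shift[of "\<lambda>x. (q s x - q t x) * \<psi> x" h] by (simp add: \<psi>_def)
      moreover have "(LINT x|lborel. F (x + h) * \<phi> x) = (LINT x|lborel. F x * \<psi> x)"
        using LINT_shift[of "\<lambda>x. F x * \<psi> x" h] by (simp add: \<psi>_def)
      moreover have "(LINT x|lborel. q t (x + h) * nth_vderiv 1 (nth_vderiv 1 \<phi>) x) = (LINT x|lborel. q t x * nth_vderiv 1 (nth_vderiv 1 \<psi>) x)"
        using LINT_shift[of "\<lambda>x. q t x * nth_vderiv 1 (nth_vderiv 1 \<psi>) x" h] unfolding d by (simp del: One_nat_def)
      ultimately show "norm ((LINT x|lborel. (q s (x + h) - q t (x + h)) * \<phi> x) / of_real (s - t)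
         - \<i> * ((LINT x|lborel. q t (x + h) * nth_vderiv 1 (nth_vderiv 1 \<phi>) x) - (LINT x|lborel. F (x + h) * \<phi> x)))
         \<le> \<epsilon> * H1_norm \<phi>"
        using bspec[OF elim p'] H by (simp del: One_nat_def)
    qed
  qed
qed

text \<open>The second derivative is shared between both factors before passing to the limit, so that only
  \<open>H\<^sup>1\<close> convergence of the test functions is used. This allows pairing with the solution itself.\<close>

lemma weak_bound_extends_to_H1:
  assumes d: "L2 d" and q: "H1 q" and F: "L2 F" and e: "0 \<le> \<epsilon>"
    and le: "\<And>\<phi>. \<phi> \<in> test_fun \<Longrightarrow> norm ((LINT x|lborel. d x * \<phi> x) / c
       - \<i> * ((LINT x|lborel. q x * nth_vderiv 1 (nth_vderiv 1 \<phi>) x) - (LINT x|lborel. F x * \<phi> x))) \<le> \<epsilon> * H1_norm \<phi>"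
    and p: "H1 \<psi>"
  shows "norm ((LINT x|lborel. d x * \<psi> x) / c
       + \<i> * ((LINT x|lborel. weak_deriv q x * weak_deriv \<psi> x) + (LINT x|lborel. F x * \<psi> x))) \<le> \<epsilon> * H1_norm \<psi>"
proof -
  note qD = H1D[OF q] and pD = H1D[OF p]
  have "\<exists>\<phi>\<in>test_fun. H1_norm (\<lambda>x. \<phi> x - \<psi> x) < 1 / real (Suc n)" for n
    using test_fun_dense_H1_norm[OF p, of "1 / real (Suc n)"] by auto
  then obtain s where s: "\<And>n. s n \<in> test_fun" "\<And>n. H1_norm (\<lambda>x. s n x - \<psi> x) < 1 / real (Suc n)" by metis
  have sH: "H1 (s n)" for n by (rule test_fun_H1(2)[OF s(1)])
  have l1: "(\<lambda>n. 1 / real (Suc n)) \<longlonglongrightarrow> 0"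
    using LIMSEQ_inverse_real_of_nat by (simp add: inverse_eq_divide)
  have l2: "(\<lambda>n. L2_norm (\<lambda>x. s n x - \<psi> x)) \<longlonglongrightarrow> 0"
  proof (rule tendsto_sandwich[where f="\<lambda>_. 0", OF _ _ tendsto_const l1])
    show "\<forall>\<^sub>F n in sequentially. L2_norm (\<lambda>x. s n x - \<psi> x) \<le> 1 / real (Suc n)"
    proof (rule always_eventually, rule allI)
      fix n show "L2_norm (\<lambda>x. s n x - \<psi> x) \<le> 1 / real (Suc n)"
        using L2_norm_le_H1_norm[of "\<lambda>x. s n x - \<psi> x"] s(2)[of n] by linarith
    qed
  qed (auto simp: L2_norm_nonneg)
  have l3: "(\<lambda>n. L2_norm (\<lambda>x. nth_vderiv 1 (s n) x - weak_deriv \<psi> x)) \<longlonglongrightarrow> 0"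
  proof (rule tendsto_sandwich[where f="\<lambda>_. 0", OF _ _ tendsto_const l1])
    show "\<forall>\<^sub>F n in sequentially. L2_norm (\<lambda>x. nth_vderiv 1 (s n) x - weak_deriv \<psi> x) \<le> 1 / real (Suc n)"
    proof (rule always_eventually, rule allI)
      fix n
      have "has_weak_deriv (\<lambda>x. s n x - \<psi> x) (\<lambda>x. nth_vderiv 1 (s n) x - weak_deriv \<psi> x)"
        using has_weak_deriv_linear[OF test_fun_L2[OF s(1)] test_fun_L2[OF test_fun_deriv[OF s(1)]] test_fun_H1(1)[OF s(1)] pD(1,3,2), where c=1 and d="-1"] by simp
      from H1I(2)[OF L2_diff[OF test_fun_L2[OF s(1)] pD(1)] L2_diff[OF test_fun_L2[OF test_fun_deriv[OF s(1)]] pD(3)] this]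
      show "L2_norm (\<lambda>x. nth_vderiv 1 (s n) x - weak_deriv \<psi> x) \<le> 1 / real (Suc n)"
        using L2_norm_weak_deriv_le[of "\<lambda>x. s n x - \<psi> x"] s(2)[of n] by simp
    qed
  qed (auto simp: L2_norm_nonneg)
  have a: "(\<lambda>n. norm ((LINT x|lborel. d x * s n x) / c
       + \<i> * ((LINT x|lborel. weak_deriv q x * nth_vderiv 1 (s n) x) + (LINT x|lborel. F x * s n x))))
     \<longlonglongrightarrow> norm ((LINT x|lborel. d x * \<psi> x) / c
       + \<i> * ((LINT x|lborel. weak_deriv q x * weak_deriv \<psi> x) + (LINT x|lborel. F x * \<psi> x)))"
    unfolding divide_inverse
    by (intro tendsto_norm tendsto_add tendsto_mult tendsto_const pairing_tendsto d F qD pD test_fun_L2 test_fun_deriv s(1) l2 l3)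
  have b: "(\<lambda>n. \<epsilon> * (H1_norm \<psi> + 1 / real (Suc n))) \<longlonglongrightarrow> \<epsilon> * (H1_norm \<psi> + 0)"
    by (intro tendsto_mult tendsto_add tendsto_const l1)
  have "norm ((LINT x|lborel. d x * \<psi> x) / c
       + \<i> * ((LINT x|lborel. weak_deriv q x * weak_deriv \<psi> x) + (LINT x|lborel. F x * \<psi> x))) \<le> \<epsilon> * (H1_norm \<psi> + 0)"
  proof (rule LIMSEQ_le[OF a b], rule exI, intro allI impI)
    fix n
    have w: "(LINT x|lborel. q x * nth_vderiv 1 (nth_vderiv 1 (s n)) x) = - (LINT x|lborel. weak_deriv q x * nth_vderiv 1 (s n) x)"
      by (rule has_weak_derivD(3)[OF qD(2) test_fun_deriv[OF s(1)]])
    have "H1_norm (s n) \<le> H1_norm (\<lambda>x. s n x - \<psi> x) + H1_norm \<psi>"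
      using H1_add(2)[OF H1_diff(1)[OF sH p] p, of n] by simp
    then have ns: "\<epsilon> * H1_norm (s n) \<le> \<epsilon> * (H1_norm \<psi> + 1 / real (Suc n))"
      using s(2)[of n] e by (intro mult_left_mono) auto
    have eq: "(LINT x|lborel. d x * s n x) / c
       - \<i> * (- (LINT x|lborel. weak_deriv q x * nth_vderiv 1 (s n) x) - (LINT x|lborel. F x * s n x))
      = (LINT x|lborel. d x * s n x) / c
       + \<i> * ((LINT x|lborel. weak_deriv q x * nth_vderiv 1 (s n) x) + (LINT x|lborel. F x * s n x))"
      by (simp add: algebra_simps)
    show "norm ((LINT x|lborel. d x * s n x) / c
       + \<i> * ((LINT x|lborel. weak_deriv q x * nth_vderiv 1 (s n) x) + (LINT x|lborel. F x * s n x))) \<le> \<epsilon> * (H1_norm \<psi> + 1 / real (Suc n))"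
      using le[OF s(1)[of n]] unfolding w eq using ns by (rule order_trans)
  qed
  then show ?thesis by simp
qed

lemma complex_diff_mult_cnj_sum: "Re ((a - b) * cnj (a + b)) = (norm a)\<^sup>2 - (norm b)\<^sup>2"
  unfolding cmod_power2 by (simp add: power2_eq_square algebra_simps)

text \<open>The quotient is paired with the conjugate of \<open>q(s) + q(t)\<close>, whose real part gives the exact
  increment of the squared norm; the second derivative contributes a real quantity times \<open>i\<close>.\<close>

theorem energy_identity:
  assumes ev: "evolves q F t" and t: "1 \<le> t" and F: "L2 F"
    and H: "\<And>s. 1 \<le> s \<Longrightarrow> H1 (q s)"
    and cont: "((\<lambda>s. H1_norm (\<lambda>x. q s x - q t x)) \<longlongrightarrow> 0) (at t within {1..})"
  shows "((\<lambda>s. (L2_norm (q s))\<^sup>2) has_real_derivative 2 * Im (LINT x|lborel. F x * cnj (q t x))) (at t within {1..})"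
  unfolding has_field_derivative_iff
proof (rule tendstoI)
  fix e :: real assume e: "0 < e"
  define N where "N = 2 * H1_norm (q t) + 1"
  define K where "K = L2_norm (weak_deriv (q t)) + L2_norm F"
  have N: "0 < N" unfolding N_def using H1_norm_nonneg[of "q t"] by simp
  have K: "0 \<le> K" unfolding K_def by (simp add: L2_norm_nonneg add_nonneg_nonneg)
  define \<epsilon> where "\<epsilon> = e / (2 * N)"
  have eps: "0 < \<epsilon>" "\<epsilon> * N = e / 2" using e N by (auto simp: \<epsilon>_def)
  note q = H1D[OF H[OF t]]
  have ge: "\<forall>\<^sub>F s in at t within {1..}. 1 \<le> s \<and> s \<noteq> t" by (auto simp: eventually_at_filter)
  have "\<forall>\<^sub>F s in at t within {1..}. H1_norm (\<lambda>x. q s x - q t x) < min 1 (e / (2 * (K + 1)))"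
    by (rule order_tendstoD(2)[OF cont]) (use e K in auto)
  from this ge ev[unfolded evolves_def, rule_format, OF eps(1)]
  show "\<forall>\<^sub>F s in at t within {1..}.
      dist (((L2_norm (q s))\<^sup>2 - (L2_norm (q t))\<^sup>2) / (s - t)) (2 * Im (LINT x|lborel. F x * cnj (q t x))) < e"
  proof eventually_elim
    case (elim s)
    define \<delta> where "\<delta> = H1_norm (\<lambda>x. q s x - q t x)"
    have d: "\<delta> < 1" "(K + 1) * \<delta> < e / 2" "0 \<le> \<delta>"
      using elim(1) K H1_norm_nonneg[of "\<lambda>x. q s x - q t x"] by (auto simp: \<delta>_def field_simps)
    have s: "1 \<le> s" "s \<noteq> t" using elim by auto
    note qs = H1D[OF H[OF s(1)]]
    define \<psi> where "\<psi> = (\<lambda>x. cnj (q s x + q t x))"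
    have sumH: "H1 (\<lambda>x. q s x + q t x)" by (rule H1_add(1)[OF H[OF s(1)] H[OF t]])
    have pH: "H1 \<psi>" unfolding \<psi>_def by (rule H1_cnj(1)[OF sumH])
    have pn: "H1_norm \<psi> \<le> N"
    proof -
      have "H1_norm (q s) \<le> \<delta> + H1_norm (q t)"
        using H1_add(2)[OF H1_diff(1)[OF H[OF s(1)] H[OF t]] H[OF t]] by (simp add: \<delta>_def)
      moreover have "H1_norm \<psi> \<le> H1_norm (q s) + H1_norm (q t)"
        unfolding \<psi>_def H1_cnj(2)[OF sumH] by (rule H1_add(2)[OF H[OF s(1)] H[OF t]])
      ultimately show ?thesis using d by (simp add: N_def)
    qed
    have wd: "has_weak_deriv \<psi> (\<lambda>x. cnj (weak_deriv (q s) x + weak_deriv (q t) x))"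
    proof -
      have "has_weak_deriv (\<lambda>x. cnj (q s x) + cnj (q t x)) (\<lambda>x. cnj (weak_deriv (q s) x) + cnj (weak_deriv (q t) x))"
        using has_weak_deriv_linear[OF L2_cnj[OF qs(1)] L2_cnj[OF qs(3)] H1_cnj(3)[OF H[OF s(1)]]
            L2_cnj[OF q(1)] L2_cnj[OF q(3)] H1_cnj(3)[OF H[OF t]], of 1 1] by simp
      then show ?thesis by (simp add: \<psi>_def)
    qed
    have wae: "AE x in lborel. weak_deriv \<psi> x = cnj (weak_deriv (q s) x + weak_deriv (q t) x)"
      by (rule weak_deriv_unique[OF H1D(2)[OF pH] wd])
    define D where "D = (\<lambda>x. weak_deriv (q s) x - weak_deriv (q t) x)"
    have DL: "L2 D" unfolding D_def by (rule L2_diff[OF qs(3) q(3)])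
    have Dn: "L2_norm D \<le> \<delta>"
      using H1I(2)[OF L2_diff[OF qs(1) q(1)] DL] H1_diff(3)[OF H[OF s(1)] H[OF t]]
        L2_norm_weak_deriv_le[of "\<lambda>x. q s x - q t x"] by (simp add: \<delta>_def D_def)
    define d0 where "d0 = (\<lambda>x. q s x - q t x)"
    have d0: "L2 d0" "L2_norm d0 \<le> \<delta>"
      unfolding d0_def \<delta>_def by (auto intro!: L2_diff qs q L2_norm_le_H1_norm)
    define I1 where "I1 = (LINT x|lborel. weak_deriv (q t) x * cnj (D x))"
    define I2 where "I2 = (LINT x|lborel. F x * cnj (d0 x))"
    define J where "J = (LINT x|lborel. F x * cnj (q t x))"
    have I1: "norm I1 \<le> L2_norm (weak_deriv (q t)) * \<delta>"
      unfolding I1_def using L2_Cauchy_Schwarz[OF q(3) L2_cnj[OF DL]]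
        mult_left_mono[OF Dn L2_norm_nonneg[of "weak_deriv (q t)"]] by (simp add: L2_norm_cnj)
    have I2: "norm I2 \<le> L2_norm F * \<delta>"
      unfolding I2_def using L2_Cauchy_Schwarz[OF F L2_cnj[OF d0(1)]]
        mult_left_mono[OF d0(2) L2_norm_nonneg[of F]] by (simp add: L2_norm_cnj)
    have e1: "(LINT x|lborel. weak_deriv (q t) x * weak_deriv \<psi> x) = of_real (2 * (L2_norm (weak_deriv (q t)))\<^sup>2) + I1"
    proof -
      have i1: "integrable lborel (\<lambda>x. weak_deriv (q t) x * cnj (weak_deriv (q t) x))"
        by (intro L2_integrable_mult L2_cnj q)
      have i2: "integrable lborel (\<lambda>x. weak_deriv (q t) x * cnj (D x))" by (intro L2_integrable_mult L2_cnj q DL)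
      have "(LINT x|lborel. weak_deriv (q t) x * weak_deriv \<psi> x)
          = (LINT x|lborel. 2 * (weak_deriv (q t) x * cnj (weak_deriv (q t) x)) + weak_deriv (q t) x * cnj (D x))"
      proof (rule integral_cong_AE)
        show "AE x in lborel. weak_deriv (q t) x * weak_deriv \<psi> x
            = 2 * (weak_deriv (q t) x * cnj (weak_deriv (q t) x)) + weak_deriv (q t) x * cnj (D x)"
          using wae by eventually_elim (simp add: D_def algebra_simps)
        show "(\<lambda>x. weak_deriv (q t) x * weak_deriv \<psi> x) \<in> borel_measurable lborel"
          using L2_integrable_mult[OF q(3) H1D(3)[OF pH]] by simp
        show "(\<lambda>x. 2 * (weak_deriv (q t) x * cnj (weak_deriv (q t) x)) + weak_deriv (q t) x * cnj (D x)) \<in> borel_measurable lborel"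
          using i1 i2 by (intro borel_measurable_integrable Bochner_Integration.integrable_add integrable_mult_right) auto
      qed
      also have "\<dots> = 2 * (LINT x|lborel. weak_deriv (q t) x * cnj (weak_deriv (q t) x)) + I1"
        using i1 i2 by (simp add: I1_def)
      also have "(LINT x|lborel. weak_deriv (q t) x * cnj (weak_deriv (q t) x)) = of_real ((L2_norm (weak_deriv (q t)))\<^sup>2)"
        unfolding L2_norm_square integral_complex_of_real[symmetric] by (simp only: complex_norm_square)
      finally show ?thesis by simp
    qed
    have e2: "(LINT x|lborel. F x * \<psi> x) = 2 * J + I2"
    proof -
      have i1: "integrable lborel (\<lambda>x. F x * cnj (q t x))" by (intro L2_integrable_mult L2_cnj q F)
      have i2: "integrable lborel (\<lambda>x. F x * cnj (d0 x))" by (intro L2_integrable_mult L2_cnj d0 F)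
      have "(LINT x|lborel. F x * \<psi> x) = (LINT x|lborel. 2 * (F x * cnj (q t x)) + F x * cnj (d0 x))"
        by (rule Bochner_Integration.integral_cong) (auto simp: \<psi>_def d0_def algebra_simps)
      then show ?thesis using i1 i2 by (simp add: J_def I2_def)
    qed
    define X where "X = (LINT x|lborel. (q s x - q t x) * \<psi> x)"
    have ReX: "Re X = (L2_norm (q s))\<^sup>2 - (L2_norm (q t))\<^sup>2"
    proof -
      have "integrable lborel (\<lambda>x. (q s x - q t x) * \<psi> x)" by (intro L2_integrable_mult L2_diff qs q H1D(1)[OF pH])
      then have "Re X = (LINT x|lborel. Re ((q s x - q t x) * \<psi> x))" unfolding X_def by (rule integral_Re[symmetric])
      also have "\<dots> = (LINT x|lborel. (norm (q s x))\<^sup>2 - (norm (q t x))\<^sup>2)"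
        unfolding \<psi>_def complex_diff_mult_cnj_sum ..
      also have "\<dots> = (L2_norm (q s))\<^sup>2 - (L2_norm (q t))\<^sup>2"
        using L2_integrable[OF qs(1)] L2_integrable[OF q(1)] by (simp add: L2_norm_square)
      finally show ?thesis .
    qed
    have "norm (X / of_real (s - t) + \<i> * ((LINT x|lborel. weak_deriv (q t) x * weak_deriv \<psi> x) + (LINT x|lborel. F x * \<psi> x))) \<le> \<epsilon> * H1_norm \<psi>"
      unfolding X_def by (rule weak_bound_extends_to_H1[OF L2_diff[OF qs(1) q(1)] H[OF t] F _ _ pH]) (use eps elim(3) in auto)
    also have "\<dots> \<le> \<epsilon> * N" using eps pn by (intro mult_left_mono) auto
    finally have b: "norm (X / of_real (s - t) + \<i> * (of_real (2 * (L2_norm (weak_deriv (q t)))\<^sup>2) + I1 + (2 * J + I2))) \<le> e / 2"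
      unfolding e1 e2 eps(2) .
    define Z where "Z = X / of_real (s - t) + \<i> * (of_real (2 * (L2_norm (weak_deriv (q t)))\<^sup>2) + I1 + (2 * J + I2))"
    have "Re Z = Re X / (s - t) - Im I1 - 2 * Im J - Im I2"
      unfolding Z_def by (simp del: of_real_diff)
    then have "Re X / (s - t) - 2 * Im J = Re Z + Im I1 + Im I2" by simp
    moreover have "\<bar>Re Z\<bar> \<le> e / 2" using abs_Re_le_cmod[of Z] b by (simp add: Z_def)
    moreover have "\<bar>Im I1\<bar> \<le> L2_norm (weak_deriv (q t)) * \<delta>" using abs_Im_le_cmod[of I1] I1 by simp
    moreover have "\<bar>Im I2\<bar> \<le> L2_norm F * \<delta>" using abs_Im_le_cmod[of I2] I2 by simp
    moreover have "L2_norm (weak_deriv (q t)) * \<delta> + L2_norm F * \<delta> < e / 2"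
      using d by (simp add: K_def algebra_simps)
    ultimately show ?case unfolding dist_real_def ReX J_def by linarith
  qed
qed

text \<open>The inequality makes \<open>t\<^sup>\<mu> y - R / (a - \<mu>) t\<^sup>\<mu>\<^sup>-\<^sup>a\<close> nondecreasing, and this function tends to zero at
  infinity; hence it is nowhere positive.\<close>

lemma decay_from_infinity:
  fixes y y' :: "real \<Rightarrow> real"
  assumes T: "1 < T" and d: "\<And>t. T \<le> t \<Longrightarrow> (y has_real_derivative y' t) (at t within {1..})"
    and le: "\<And>t. T \<le> t \<Longrightarrow> - (\<mu> / t * y t) - R * t powr (- a - 1) \<le> y' t"
    and lim: "((\<lambda>t. t powr \<mu> * y t) \<longlongrightarrow> 0) at_top" and a: "\<mu> < a" and t: "T \<le> t"
  shows "y t \<le> R / (a - \<mu>) * t powr (- a)"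
proof -
  define z where "z s = s powr \<mu> * y s - R / (a - \<mu>) * s powr (\<mu> - a)" for s
  have mono: "z s \<le> z r" if "T \<le> s" "s \<le> r" for s r
  proof (rule DERIV_nonneg_imp_nondecreasing[OF that(2)])
    fix x assume x: "s \<le> x" "x \<le> r"
    have x1: "1 < x" "T \<le> x" using x that T by auto
    have "(y has_real_derivative y' x) (at x)"
      using d[OF x1(2)] unfolding at_within_interior[of x "{1..}", unfolded interior_real_atLeast, OF greaterThan_iff[THEN iffD2, OF x1(1)]] .
    then have "(z has_real_derivative (\<mu> * x powr (\<mu> - 1) * y x + x powr \<mu> * y' x - R / (a - \<mu>) * ((\<mu> - a) * x powr (\<mu> - a - 1)))) (at x)"
      unfolding z_def using x1 a by (auto intro!: derivative_eq_intros)
    moreover have "0 \<le> \<mu> * x powr (\<mu> - 1) * y x + x powr \<mu> * y' x - R / (a - \<mu>) * ((\<mu> - a) * x powr (\<mu> - a - 1))"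
    proof -
      have "x powr \<mu> * (- (\<mu> / x * y x) - R * x powr (- a - 1)) \<le> x powr \<mu> * y' x"
        by (rule mult_left_mono[OF le[OF x1(2)]]) simp
      moreover have "x powr \<mu> * (- (\<mu> / x * y x) - R * x powr (- a - 1))
          = - (\<mu> * (x powr \<mu> / x) * y x) - R * (x powr \<mu> * x powr (- a - 1))"
        by (simp add: algebra_simps)
      moreover have "x powr \<mu> / x = x powr (\<mu> - 1)" using x1 by (simp add: powr_diff)
      moreover have "x powr \<mu> * x powr (- a - 1) = x powr (\<mu> - a - 1)"
        by (simp add: powr_add[symmetric] add_diff_eq)
      moreover have "R / (a - \<mu>) * ((\<mu> - a) * x powr (\<mu> - a - 1)) = - (R * x powr (\<mu> - a - 1))"
        using a by (simp add: field_simps)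
      ultimately show ?thesis by simp
    qed
    ultimately show "\<exists>y. (z has_real_derivative y) (at x) \<and> 0 \<le> y" by blast
  qed
  have "\<forall>\<^sub>F r in at_top. z t \<le> z r"
    using eventually_ge_at_top[of t] by eventually_elim (rule mono[OF t])
  moreover have "(z \<longlongrightarrow> 0 - R / (a - \<mu>) * 0) at_top"
    unfolding z_def
    by (intro tendsto_diff lim tendsto_mult tendsto_const tendsto_neg_powr) (use a in \<open>auto simp: filterlim_ident\<close>)
  ultimately have "z t \<le> 0"
    by (intro tendsto_lowerbound[of z 0 at_top]) auto
  then have "t powr \<mu> * y t \<le> R / (a - \<mu>) * t powr (\<mu> - a)" by (simp add: z_def)
  moreover have "t powr (\<mu> - a) = t powr \<mu> * t powr (- a)" by (simp add: powr_add[symmetric])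
  ultimately have "t powr \<mu> * y t \<le> t powr \<mu> * (R / (a - \<mu>) * t powr (- a))" by (simp add: mult_ac)
  then show ?thesis by (rule mult_left_le_imp_le) (use t T in simp)
qed

section \<open>Profiles with expansions in inverse powers of time and logarithms\<close>

text \<open>Finite sums of \<open>t\<^sup>-\<^sup>j (log t)\<^sup>l f(x)\<close> with \<open>j \<ge> k\<close> and \<open>f\<close> smooth and zero off \<open>K\<close>. The order \<open>k\<close>
  ignores logarithms, so the class of each order is closed under multiplication by \<open>log t\<close>, which
  the logarithmic phase produces with every derivative in \<open>x\<close>.\<close>

inductive log_expansion :: "real set \<Rightarrow> nat \<Rightarrow> (real \<Rightarrow> real \<Rightarrow> complex) \<Rightarrow> bool" for K :: "real set" and k :: nat where
  monomial: "smooth f \<Longrightarrow> (\<And>x. x \<notin> K \<Longrightarrow> f x = 0) \<Longrightarrow> k \<le> j \<Longrightarrow>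
    log_expansion K k (\<lambda>t x. of_real ((1 / t) ^ j * ln t ^ l) * f x)"
| sum: "log_expansion K k g \<Longrightarrow> log_expansion K k h \<Longrightarrow> log_expansion K k (\<lambda>t x. g t x + h t x)"

lemma log_expansion_zero: "log_expansion K k (\<lambda>t x. 0)"
  using monomial[of "\<lambda>x. 0" K k k 0] by (simp add: smooth_const)

lemma log_expansion_profile:
  assumes "smooth f" "\<And>x. x \<notin> K \<Longrightarrow> f x = 0"
  shows "log_expansion K 0 (\<lambda>t x. f x)"
  using monomial[of f K 0 0 0] assms by simp

lemma log_expansion_mono: "log_expansion K k g \<Longrightarrow> m \<le> k \<Longrightarrow> log_expansion K m g"
proof (induction rule: log_expansion.induct)
  case (monomial f j l)
  then show ?case by (intro log_expansion.monomial) auto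
qed (auto intro: log_expansion.sum)

text \<open>All closure properties have the same shape: an additive operation that maps monomials into
  the class maps the class into itself.\<close>

lemma log_expansion_map:
  assumes "log_expansion K k g"
    and "\<And>g h. F (\<lambda>t x. g t x + h t x) = (\<lambda>t x. F g t x + F h t x)"
    and "\<And>f j l. smooth f \<Longrightarrow> (\<And>x. x \<notin> K \<Longrightarrow> f x = 0) \<Longrightarrow> k \<le> j \<Longrightarrow>
      log_expansion K m (F (\<lambda>t x. of_real ((1 / t) ^ j * ln t ^ l) * f x))"
  shows "log_expansion K m (F g)"
  using assms(1)
proof (induction rule: log_expansion.induct)
  case (sum g h)
  then show ?case by (simp add: assms(2) log_expansion.sum)
qed (use assms(3) in auto)

lemma log_expansion_smooth_mult:
  assumes "log_expansion K k g" "smooth p"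
  shows "log_expansion K k (\<lambda>t x. p x * g t x)"
proof (rule log_expansion_map[OF assms(1), where F="\<lambda>g t x. p x * g t x"])
  fix f :: "real \<Rightarrow> complex" and j l assume f: "smooth f" "\<And>x. x \<notin> K \<Longrightarrow> f x = 0" "k \<le> j"
  have "log_expansion K k (\<lambda>t x. of_real ((1 / t) ^ j * ln t ^ l) * (p x * f x))"
    by (rule monomial) (use f assms(2) in \<open>auto intro: smooth_mult\<close>)
  then show "log_expansion K k (\<lambda>t x. p x * (of_real ((1 / t) ^ j * ln t ^ l) * f x))"
    by (simp add: mult_ac)
qed (simp add: algebra_simps)

lemma log_expansion_cmult: "log_expansion K k g \<Longrightarrow> log_expansion K k (\<lambda>t x. c * g t x)"
  by (rule log_expansion_smooth_mult[OF _ smooth_const])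

lemma log_expansion_diff:
  "log_expansion K k g \<Longrightarrow> log_expansion K k h \<Longrightarrow> log_expansion K k (\<lambda>t x. g t x - h t x)"
  using sum[of K k g "\<lambda>t x. - 1 * h t x"] log_expansion_cmult[of K k h "-1"] by simp

lemma log_expansion_cnj:
  assumes "log_expansion K k g"
  shows "log_expansion K k (\<lambda>t x. cnj (g t x))"
proof (rule log_expansion_map[OF assms(1), where F="\<lambda>g t x. cnj (g t x)"])
  fix f :: "real \<Rightarrow> complex" and j l assume f: "smooth f" "\<And>x. x \<notin> K \<Longrightarrow> f x = 0" "k \<le> j"
  have "log_expansion K k (\<lambda>t x. of_real ((1 / t) ^ j * ln t ^ l) * cnj (f x))"
    by (rule monomial) (use f in \<open>auto intro: smooth_cnj\<close>)
  then show "log_expansion K k (\<lambda>t x. cnj (of_real ((1 / t) ^ j * ln t ^ l) * f x))"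
    by simp
qed simp

lemma log_expansion_time_mult:
  assumes "log_expansion K k g"
  shows "log_expansion K (k + i) (\<lambda>t x. of_real ((1 / t) ^ i * ln t ^ m) * g t x)"
proof (rule log_expansion_map[OF assms(1), where F="\<lambda>g t x. of_real ((1 / t) ^ i * ln t ^ m) * g t x"])
  fix f :: "real \<Rightarrow> complex" and j l assume f: "smooth f" "\<And>x. x \<notin> K \<Longrightarrow> f x = 0" "k \<le> j"
  have "log_expansion K (k + i) (\<lambda>t x. of_real ((1 / t) ^ (i + j) * ln t ^ (m + l)) * f x)"
    by (rule monomial) (use f in auto)
  then show "log_expansion K (k + i) (\<lambda>t x. of_real ((1 / t) ^ i * ln t ^ m) * (of_real ((1 / t) ^ j * ln t ^ l) * f x))"
    unfolding power_add of_real_mult by (simp only: mult_ac)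
qed (simp add: algebra_simps)

lemma log_expansion_ln_mult: "log_expansion K k g \<Longrightarrow> log_expansion K k (\<lambda>t x. of_real (ln t) * g t x)"
  using log_expansion_time_mult[of K k g 0 1] by simp

lemma log_expansion_inverse_mult: "log_expansion K k g \<Longrightarrow> log_expansion K (Suc k) (\<lambda>t x. of_real (1 / t) * g t x)"
  using log_expansion_time_mult[of K k g 1 0] by simp

lemma log_expansion_mult:
  assumes "log_expansion K k g" "log_expansion K m h"
  shows "log_expansion K (k + m) (\<lambda>t x. g t x * h t x)"
proof (rule log_expansion_map[OF assms(1), where F="\<lambda>g t x. g t x * h t x"])
  fix f :: "real \<Rightarrow> complex" and j l assume f: "smooth f" "\<And>x. x \<notin> K \<Longrightarrow> f x = 0" "k \<le> j"
  have "log_expansion K (m + j) (\<lambda>t x. of_real ((1 / t) ^ j * ln t ^ l) * (f x * h t x))"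
    by (intro log_expansion_time_mult log_expansion_smooth_mult assms(2) f(1))
  then have "log_expansion K (k + m) (\<lambda>t x. of_real ((1 / t) ^ j * ln t ^ l) * (f x * h t x))"
    by (rule log_expansion_mono) (use f in simp)
  then show "log_expansion K (k + m) (\<lambda>t x. of_real ((1 / t) ^ j * ln t ^ l) * f x * h t x)"
    by (simp add: mult.assoc)
qed (simp add: algebra_simps)

lemma log_expansion_zero_off: "log_expansion K k g \<Longrightarrow> x \<notin> K \<Longrightarrow> g t x = 0"
  by (induction rule: log_expansion.induct) auto

lemma log_expansion_deriv_x:
  assumes "log_expansion K k g" "closed K"
  shows "\<exists>g'. log_expansion K k g' \<and> (\<forall>t x. (g t has_vector_derivative g' t x) (at x))"
  using assms(1)
proof (induction rule: log_expansion.induct)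
  case (monomial f j l)
  have "log_expansion K k (\<lambda>t x. of_real ((1 / t) ^ j * ln t ^ l) * nth_vderiv 1 f x)"
  proof (rule log_expansion.monomial)
    show "nth_vderiv 1 f x = 0" if "x \<notin> K" for x
      by (rule vderiv_zero_off_closed[OF assms(2) monomial(2) that smooth_has_vderiv[OF monomial(1)]])
    show "smooth (nth_vderiv 1 f)" by (rule smooth_vderiv[OF monomial(1)])
  qed (rule monomial(3))
  moreover have "((\<lambda>x. of_real ((1 / t) ^ j * ln t ^ l) * f x) has_vector_derivative of_real ((1 / t) ^ j * ln t ^ l) * nth_vderiv 1 f x) (at x)" for t x
    by (intro bounded_linear.has_vector_derivative[OF bounded_linear_mult_right] smooth_has_vderiv monomial)
  ultimately show ?case by blast
next
  case (sum g h)
  then obtain g' h' where "log_expansion K k g'" "\<forall>t x. (g t has_vector_derivative g' t x) (at x)"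
    "log_expansion K k h'" "\<forall>t x. (h t has_vector_derivative h' t x) (at x)" by blast
  then show ?case
    by (intro exI[of _ "\<lambda>t x. g' t x + h' t x"]) (auto intro: log_expansion.sum has_vector_derivative_add)
qed

lemma time_monomial_deriv:
  assumes "0 < t"
  shows "((\<lambda>t. (1 / t) ^ j * ln t ^ l) has_real_derivative
    real l * ((1 / t) ^ Suc j * ln t ^ (l - 1)) - real j * ((1 / t) ^ Suc j * ln t ^ l)) (at t)"
proof -
  have d: "((\<lambda>t. (1 / t) ^ j) has_real_derivative - real j * (1 / t) ^ Suc j) (at t)"
  proof (cases j)
    case (Suc i)
    have "((\<lambda>t. 1 / t) has_real_derivative - ((1 / t) ^ 2)) (at t)"
      using assms by (auto intro!: derivative_eq_intros simp: power2_eq_square)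
    from DERIV_power[OF this, of j] show ?thesis
      by (rule DERIV_cong) (use assms in \<open>simp add: Suc power2_eq_square field_simps\<close>)
  qed simp
  have e: "((\<lambda>t. ln t ^ l) has_real_derivative real l * (ln t ^ (l - 1) * (1 / t))) (at t)"
    using DERIV_power[OF DERIV_ln_divide[OF assms], of l] by (simp add: mult_ac)
  from DERIV_mult[OF d e] show ?thesis by (simp add: algebra_simps)
qed

lemma time_monomial_vderiv:
  fixes c :: complex
  assumes "0 < t"
  shows "((\<lambda>t. of_real ((1 / t) ^ j * ln t ^ l) * c) has_vector_derivative
    (of_nat l * (of_real ((1 / t) ^ Suc j * ln t ^ (l - 1)) * c) - of_nat j * (of_real ((1 / t) ^ Suc j * ln t ^ l) * c))) (at t)"
proof -
  have "((\<lambda>t. of_real ((1 / t) ^ j * ln t ^ l)) has_vector_derivative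
      of_real (real l * ((1 / t) ^ Suc j * ln t ^ (l - 1)) - real j * ((1 / t) ^ Suc j * ln t ^ l))) (at t)"
    using time_monomial_deriv[OF assms] by (intro has_vector_derivative_of_real) (simp add: has_real_derivative_iff_has_vector_derivative)
  from bounded_linear.has_vector_derivative[OF bounded_linear_mult_left this, of c]
  show ?thesis by (simp add: algebra_simps)
qed

lemma log_expansion_deriv_t:
  assumes "log_expansion K k g"
  shows "\<exists>g'. log_expansion K (Suc k) g' \<and> (\<forall>t>0. \<forall>x. ((\<lambda>t. g t x) has_vector_derivative g' t x) (at t))"
  using assms
proof (induction rule: log_expansion.induct)
  case (monomial f j l)
  show ?case
  proof (intro exI[of _ "\<lambda>t x. of_nat l * (of_real ((1 / t) ^ Suc j * ln t ^ (l - 1)) * f x) - of_nat j * (of_real ((1 / t) ^ Suc j * ln t ^ l) * f x)"] conjI)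
    show "log_expansion K (Suc k) (\<lambda>t x. of_nat l * (of_real ((1 / t) ^ Suc j * ln t ^ (l - 1)) * f x) - of_nat j * (of_real ((1 / t) ^ Suc j * ln t ^ l) * f x))"
      by (intro log_expansion_diff log_expansion_cmult log_expansion.monomial) (use monomial in auto)
  qed (use time_monomial_vderiv in blast)
next
  case (sum g h)
  then obtain g' h' where "log_expansion K (Suc k) g'" "\<forall>t>0. \<forall>x. ((\<lambda>t. g t x) has_vector_derivative g' t x) (at t)"
    "log_expansion K (Suc k) h'" "\<forall>t>0. \<forall>x. ((\<lambda>t. h t x) has_vector_derivative h' t x) (at t)" by blast
  then show ?case
    by (intro exI[of _ "\<lambda>t x. g' t x + h' t x"]) (auto intro: log_expansion.sum has_vector_derivative_add)
qed

text \<open>A primitive of \<open>t\<^sup>-\<^sup>1 (log t)\<^sup>l\<close> would not decay, hence the order at least two. For a monomial, the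
  recursion on the power of the logarithm is integration by parts.\<close>

lemma log_expansion_primitive:
  assumes "log_expansion K (Suc k) g" "1 \<le> k"
  shows "\<exists>G. log_expansion K k G \<and> (\<forall>t>0. \<forall>x. ((\<lambda>t. G t x) has_vector_derivative g t x) (at t))"
  using assms(1)
proof (induction rule: log_expansion.induct)
  case (monomial f j l)
  then obtain m where m: "j = Suc m" "k \<le> m" "1 \<le> m" using assms(2) by (cases j) auto
  have m0: "complex_of_nat m \<noteq> 0" using m(3) by simp
  show ?case unfolding m(1)
  proof (induction l)
    case 0
    have "log_expansion K k (\<lambda>t x. (- 1 / of_nat m) * (of_real ((1 / t) ^ m * ln t ^ 0) * f x))"
      by (intro log_expansion_cmult log_expansion.monomial) (use monomial m in auto)
    moreover have "((\<lambda>t. (- 1 / of_nat m) * (of_real ((1 / t) ^ m * ln t ^ 0) * f x)) has_vector_derivative of_real ((1 / t) ^ Suc m * ln t ^ 0) * f x) (at t)" if "0 < t" for t x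
      using bounded_linear.has_vector_derivative[OF bounded_linear_mult_right time_monomial_vderiv[OF that, of m 0 "f x"], of "- 1 / of_nat m"] m0
      by simp
    ultimately show ?case by blast
  next
    case (Suc l)
    then obtain G where G: "log_expansion K k G"
      "\<And>t x. 0 < t \<Longrightarrow> ((\<lambda>t. G t x) has_vector_derivative of_real ((1 / t) ^ Suc m * ln t ^ l) * f x) (at t)" by blast
    have "log_expansion K k (\<lambda>t x. (- 1 / of_nat m) * (of_real ((1 / t) ^ m * ln t ^ Suc l) * f x - of_nat (Suc l) * G t x))"
      by (intro log_expansion_cmult log_expansion_diff log_expansion.monomial G) (use monomial m in auto)
    moreover have "((\<lambda>t. (- 1 / of_nat m) * (of_real ((1 / t) ^ m * ln t ^ Suc l) * f x - of_nat (Suc l) * G t x)) has_vector_derivative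
        of_real ((1 / t) ^ Suc m * ln t ^ Suc l) * f x) (at t)" if "0 < t" for t x
    proof -
      have "((\<lambda>t. of_real ((1 / t) ^ m * ln t ^ Suc l) * f x - of_nat (Suc l) * G t x) has_vector_derivative
        (of_nat (Suc l) * (of_real ((1 / t) ^ Suc m * ln t ^ (Suc l - 1)) * f x) - of_nat m * (of_real ((1 / t) ^ Suc m * ln t ^ Suc l) * f x)
          - of_nat (Suc l) * (of_real ((1 / t) ^ Suc m * ln t ^ l) * f x))) (at t)"
        by (intro has_vector_derivative_diff time_monomial_vderiv that
            bounded_linear.has_vector_derivative[OF bounded_linear_mult_right] G(2))
      from bounded_linear.has_vector_derivative[OF bounded_linear_mult_right this, of "- 1 / of_nat m"]
      show ?thesis
        by (rule has_vector_derivative_eq_rhs) (use m0 in \<open>simp del: of_nat_Suc power_Suc\<close>)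
    qed
    ultimately show ?case by blast
  qed
next
  case (sum g h)
  then obtain G H where "log_expansion K k G" "\<forall>t>0. \<forall>x. ((\<lambda>t. G t x) has_vector_derivative g t x) (at t)"
    "log_expansion K k H" "\<forall>t>0. \<forall>x. ((\<lambda>t. H t x) has_vector_derivative h t x) (at t)" by blast
  then show ?case
    by (intro exI[of _ "\<lambda>t x. G t x + H t x"]) (auto intro: log_expansion.sum has_vector_derivative_add)
qed

lemma ln_power_bound:
  obtains C :: real where "C \<ge> 0" "\<And>t. 1 \<le> t \<Longrightarrow> ln t ^ l \<le> C * t powr (1/4)"
proof -
  define a where "a = 1 / (4 * real (Suc l))"
  have a: "0 < a" by (simp add: a_def)
  have "ln t ^ l \<le> (1 / a) ^ l * t powr (1/4)" if t: "1 \<le> t" for t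
  proof -
    have "ln t ^ l \<le> (t powr a / a) ^ l"
      using t a ln_powr_bound[of t a] by (intro power_mono) auto
    also have "\<dots> = (1 / a) ^ l * t powr (a * real l)"
      using t by (simp add: power_divide powr_power mult.commute)
    also have "\<dots> \<le> (1 / a) ^ l * t powr (1/4)"
      using t a by (intro mult_left_mono powr_mono) (auto simp: a_def field_simps)
    finally show ?thesis .
  qed
  then show ?thesis using that[of "(1 / a) ^ l"] a by simp
qed

text \<open>All powers of the logarithm are absorbed in the factor \<open>t\<^sup>1\<^sup>/\<^sup>4\<close>.\<close>

lemma log_expansion_bound:
  assumes "log_expansion K k g" "compact K"
  shows "\<exists>C\<ge>0. \<forall>t\<ge>1. \<forall>x. norm (g t x) \<le> C * t powr (1/4 - real k)"
  using assms(1)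
proof (induction rule: log_expansion.induct)
  case (monomial f j l)
  obtain B where B: "B \<ge> 0" "\<And>x. norm (f x) \<le> B"
    using continuous_zero_off_compact_bounded[OF smooth_continuous[OF monomial(1)] assms(2) monomial(2)] by metis
  obtain C :: real where C: "C \<ge> 0" "\<And>t. 1 \<le> t \<Longrightarrow> ln t ^ l \<le> C * t powr (1/4)" using ln_power_bound[of l] by metis
  have "norm (of_real ((1 / t) ^ j * ln t ^ l) * f x) \<le> (B * C) * t powr (1/4 - real k)" if t: "1 \<le> t" for t x
  proof -
    have "(1 / t) ^ j \<le> (1 / t) ^ k" using t monomial(3) by (intro power_decreasing) auto
    also have "\<dots> = t powr (- real k)"
      using t by (simp add: powr_minus powr_realpow power_divide divide_inverse power_inverse)
    finally have "(1 / t) ^ j * ln t ^ l \<le> t powr (- real k) * (C * t powr (1/4))"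
      using t C by (intro mult_mono) auto
    then have "norm (of_real ((1 / t) ^ j * ln t ^ l) * f x) \<le> (t powr (- real k) * (C * t powr (1/4))) * B"
      unfolding norm_mult norm_of_real using t B C by (intro mult_mono) auto
    also have "\<dots> = (B * C) * t powr (1/4 - real k)"
      by (simp add: powr_add[symmetric] mult_ac)
    finally show ?thesis .
  qed
  then show ?case using B C by (intro exI[of _ "B * C"]) auto
next
  case (sum g h)
  then obtain C D where "C \<ge> 0" "\<forall>t\<ge>1. \<forall>x. norm (g t x) \<le> C * t powr (1/4 - real k)"
    "D \<ge> 0" "\<forall>t\<ge>1. \<forall>x. norm (h t x) \<le> D * t powr (1/4 - real k)" by blast
  then have "\<forall>t\<ge>1. \<forall>x. norm (g t x + h t x) \<le> (C + D) * t powr (1/4 - real k)"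
    unfolding distrib_right by (meson add_mono norm_triangle_le)
  then show ?case using \<open>C \<ge> 0\<close> \<open>D \<ge> 0\<close> by (intro exI[of _ "C + D"]) auto
qed

section \<open>Approximate solutions to all orders\<close>

lemma cis_vderiv:
  assumes "(f has_real_derivative d) (at x)"
  shows "((\<lambda>x. cis (f x)) has_vector_derivative (\<i> * of_real d * cis (f x))) (at x)"
proof -
  have "(f has_derivative (\<lambda>h. h * d)) (at x)"
    using assms unfolding has_field_derivative_def by (rule has_derivative_eq_rhs) (auto simp: mult.commute)
  from has_derivative_cis[OF this]
  show ?thesis unfolding has_vector_derivative_def
    by (rule has_derivative_eq_rhs) (auto simp: scaleR_conv_of_real)
qed

text \<open>Partial derivatives of a profile, together with the chain rule along the rays
  \<open>x = y / t\<close>; for general functions the last clause would not follow from the first two.\<close>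

definition profile_derivs ::
  "(real \<Rightarrow> real \<Rightarrow> complex) \<Rightarrow> (real \<Rightarrow> real \<Rightarrow> complex) \<Rightarrow> (real \<Rightarrow> real \<Rightarrow> complex) \<Rightarrow> bool" where
  "profile_derivs g gx gt \<longleftrightarrow>
     (\<forall>t x. (g t has_vector_derivative gx t x) (at x)) \<and>
     (\<forall>t>0. \<forall>x. ((\<lambda>t. g t x) has_vector_derivative gt t x) (at t)) \<and>
     (\<forall>t>0. \<forall>y. ((\<lambda>s. g s (y / s)) has_vector_derivative gt t (y / t) - of_real (y / t\<^sup>2) * gx t (y / t)) (at t))"

lemma profile_derivs_add:
  assumes "profile_derivs g gx gt" "profile_derivs h hx ht"
  shows "profile_derivs (\<lambda>t x. g t x + h t x) (\<lambda>t x. gx t x + hx t x) (\<lambda>t x. gt t x + ht t x)"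
  unfolding profile_derivs_def
proof (intro conjI allI impI)
  fix t y :: real assume t: "0 < t"
  have "((\<lambda>s. g s (y / s) + h s (y / s)) has_vector_derivative
      (gt t (y / t) - of_real (y / t\<^sup>2) * gx t (y / t)) + (ht t (y / t) - of_real (y / t\<^sup>2) * hx t (y / t))) (at t)"
    using assms t unfolding profile_derivs_def by (intro has_vector_derivative_add) auto
  then show "((\<lambda>s. g s (y / s) + h s (y / s)) has_vector_derivative
      gt t (y / t) + ht t (y / t) - of_real (y / t\<^sup>2) * (gx t (y / t) + hx t (y / t))) (at t)"
    by (rule has_vector_derivative_eq_rhs) (simp add: algebra_simps)
qed (use assms in \<open>auto simp: profile_derivs_def intro!: has_vector_derivative_add\<close>)

lemma log_expansion_derivs:
  assumes "log_expansion K k g" "closed K"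
  obtains gx gt where "log_expansion K k gx" "log_expansion K (Suc k) gt" "profile_derivs g gx gt"
proof -
  from assms(1) have "\<exists>gx gt. log_expansion K k gx \<and> log_expansion K (Suc k) gt \<and> profile_derivs g gx gt"
  proof (induction rule: log_expansion.induct)
    case (monomial f j l)
    define m where "m t = complex_of_real ((1 / t) ^ j * ln t ^ l)" for t
    note mono = log_expansion.monomial[of f K k j l, OF monomial]
    obtain gx where gx: "log_expansion K k gx" "\<And>t x. ((\<lambda>x. m t * f x) has_vector_derivative gx t x) (at x)"
      using log_expansion_deriv_x[OF mono assms(2)] by (auto simp: m_def)
    obtain gt where gt: "log_expansion K (Suc k) gt" "\<And>t x. 0 < t \<Longrightarrow> ((\<lambda>t. m t * f x) has_vector_derivative gt t x) (at t)"
      using log_expansion_deriv_t[OF mono] by (auto simp: m_def)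
    have "((\<lambda>s. m s * f (y / s)) has_vector_derivative gt t (y / t) - of_real (y / t\<^sup>2) * gx t (y / t)) (at t)"
      if t: "0 < t" for t y
    proof -
      obtain m' where m': "(m has_vector_derivative m') (at t)"
        using time_monomial_vderiv[OF t, of j l 1] unfolding mult_1_right m_def by blast
      have r: "((\<lambda>s. y / s) has_vector_derivative - (y / t\<^sup>2)) (at t)"
        using t by (auto intro!: derivative_eq_intros simp: has_real_derivative_iff_has_vector_derivative[symmetric] power2_eq_square)
      have f': "(f has_vector_derivative nth_vderiv 1 f z) (at z)" for z
        by (rule smooth_has_vderiv[OF monomial(1)])
      have "((\<lambda>s. f (y / s)) has_vector_derivative (- (y / t\<^sup>2)) *\<^sub>R nth_vderiv 1 f (y / t)) (at t)"
        using vector_diff_chain_at[OF r f'] by (simp only: o_def)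
      from has_vector_derivative_mult[OF m' this]
      have "((\<lambda>s. m s * f (y / s)) has_vector_derivative m t * ((- (y / t\<^sup>2)) *\<^sub>R nth_vderiv 1 f (y / t)) + m' * f (y / t)) (at t)" .
      moreover have "gx t (y / t) = m t * nth_vderiv 1 f (y / t)"
        by (rule vector_derivative_unique_at[OF gx(2)])
          (intro bounded_linear.has_vector_derivative[OF bounded_linear_mult_right] f')
      moreover have "gt t (y / t) = m' * f (y / t)"
        by (rule vector_derivative_unique_at[OF gt(2)[OF t]])
          (intro bounded_linear.has_vector_derivative[OF bounded_linear_mult_left] m')
      ultimately show ?thesis by (simp add: scaleR_conv_of_real algebra_simps)
    qed
    then have "profile_derivs (\<lambda>t x. m t * f x) gx gt"
      unfolding profile_derivs_def using gx gt by blast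
    then show ?case using gx(1) gt(1) unfolding m_def by blast
  next
    case (sum g h)
    then obtain gx gt hx ht where g: "log_expansion K k gx" "log_expansion K (Suc k) gt" "profile_derivs g gx gt"
      and h: "log_expansion K k hx" "log_expansion K (Suc k) ht" "profile_derivs h hx ht" by blast
    from profile_derivs_add[OF g(3) h(3)] log_expansion.sum[OF g(1) h(1)] log_expansion.sum[OF g(2) h(2)]
    show ?case by blast
  qed
  then show ?thesis using that by blast
qed

lemma profile_derivs_cong_t:
  assumes "profile_derivs g gx gt" "\<And>t x. 0 < t \<Longrightarrow> ((\<lambda>t. g t x) has_vector_derivative gt' t x) (at t)"
  shows "profile_derivs g gx gt'"
proof -
  have "gt t x = gt' t x" if "0 < t" for t x
    using assms that unfolding profile_derivs_def by (metis vector_derivative_unique_at)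
  then show ?thesis using assms unfolding profile_derivs_def by auto
qed

locale scattering_profile =
  fixes \<beta> :: real and A :: "real \<Rightarrow> complex"
  assumes A_test: "A \<in> test_fun"
begin

abbreviation K :: "real set" where "K \<equiv> fsupport A"

definition dens' :: "real \<Rightarrow> complex" where
  "dens' x = A x * cnj (nth_vderiv 1 A x) + nth_vderiv 1 A x * cnj (A x)"

definition dens'' :: "real \<Rightarrow> complex" where
  "dens'' = nth_vderiv 1 dens'"

text \<open>For \<open>g = A\<close> this is the asymptotic profile of the modified wave operator. Corrections carry the
  same two phases.\<close>

definition wave :: "(real \<Rightarrow> real \<Rightarrow> complex) \<Rightarrow> real \<Rightarrow> real \<Rightarrow> complex" where
  "wave g t y = of_real (t powr (-1/2)) * cis (y\<^sup>2 / (4 * t) - \<beta> * (norm (A (y / t)))\<^sup>2 * ln t) * g t (y / t)"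

text \<open>The operators through which \<open>\<partial>\<^sub>y\<close> and \<open>\<partial>\<^sub>t\<close> act on the profile of a wave. The derivatives of the
  profile are separate arguments, because time derivatives are only known for \<open>t > 0\<close>.\<close>

definition space_op ::
  "(real \<Rightarrow> real \<Rightarrow> complex) \<Rightarrow> (real \<Rightarrow> real \<Rightarrow> complex) \<Rightarrow> real \<Rightarrow> real \<Rightarrow> complex" where
  "space_op g gx t x = \<i> / 2 * of_real x * g t x
     + of_real (1 / t) * (gx t x - \<i> * of_real \<beta> * (of_real (ln t) * (dens' x * g t x)))"

definition time_op ::
  "(real \<Rightarrow> real \<Rightarrow> complex) \<Rightarrow> (real \<Rightarrow> real \<Rightarrow> complex) \<Rightarrow> (real \<Rightarrow> real \<Rightarrow> complex) \<Rightarrow> real \<Rightarrow> real \<Rightarrow> complex" where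
  "time_op g gx gt t x = gt t x - \<i> / 4 * (of_real (x\<^sup>2) * g t x)
     - of_real (1 / t) * (1 / 2 * g t x + of_real x * gx t x
         + \<i> * of_real \<beta> * (A x * cnj (A x) * g t x - of_real (ln t) * (dens' x * (of_real x * g t x))))"

text \<open>The square of \<open>\<partial>\<^sub>x - i \<beta> log t (|A|\<^sup>2)'\<close>, which is \<open>\<partial>\<^sub>x\<^sup>2\<close> conjugated with the logarithmic phase.\<close>

definition gauged_laplacian ::
  "(real \<Rightarrow> real \<Rightarrow> complex) \<Rightarrow> (real \<Rightarrow> real \<Rightarrow> complex) \<Rightarrow> (real \<Rightarrow> real \<Rightarrow> complex) \<Rightarrow> real \<Rightarrow> real \<Rightarrow> complex" where
  "gauged_laplacian g gx gxx t x = gxx t x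
     - \<i> * of_real \<beta> * (of_real (ln t) * (dens'' x * g t x + 2 * (dens' x * gx t x)))
     - (of_real \<beta>)\<^sup>2 * (of_real (ln t) * (of_real (ln t) * (dens' x * (dens' x * g t x))))"

text \<open>The profile of \<open>(i \<partial>\<^sub>t + \<partial>\<^sub>y\<^sup>2) u - \<beta> |u|\<^sup>2 u\<close> for the wave \<open>u\<close> with profile \<open>b\<close>. The logarithmic phase
  replaces \<open>|b|\<^sup>2\<close> by \<open>|b|\<^sup>2 - |A|\<^sup>2\<close>, so the residual of \<open>b = A\<close> is already of order two.\<close>

definition residual where
  "residual b bx bxx bt t x = \<i> * bt t x
     + of_real \<beta> * (of_real (1 / t) * ((A x * cnj (A x) - b t x * cnj (b t x)) * b t x))
     + of_real (1 / t) * (of_real (1 / t) * gauged_laplacian b bx bxx t x)"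

lemma closed_K: "closed K" by (simp add: fsupport_def)

lemma compact_K: "compact K" using A_test by (simp add: test_fun_def)

lemma smooth_A: "smooth A" by (rule test_fun_smooth[OF A_test])

lemma A_zero: "x \<notin> K \<Longrightarrow> A x = 0" by (rule not_in_fsupport)

lemma smooth_dens': "smooth dens'"
  unfolding dens'_def by (intro smooth_add smooth_mult smooth_cnj smooth_vderiv smooth_A)

lemma smooth_dens'': "smooth dens''"
  unfolding dens''_def by (intro smooth_vderiv smooth_dens')

lemma dens'_real: "of_real (Re (dens' x)) = dens' x"
  by (simp add: dens'_def complex_eq_iff del: One_nat_def)

lemma norm_A_deriv: "((\<lambda>x. (norm (A x))\<^sup>2) has_real_derivative Re (dens' x)) (at x)"
proof -
  have "((\<lambda>x. A x * cnj (A x)) has_vector_derivative dens' x) (at x)"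
    unfolding dens'_def
    by (intro has_vector_derivative_mult smooth_has_vderiv smooth_A
        bounded_linear.has_vector_derivative[OF bounded_linear_cnj])
  from bounded_linear.has_vector_derivative[OF bounded_linear_Re this]
  have "((\<lambda>x. Re (A x * cnj (A x))) has_vector_derivative Re (dens' x)) (at x)" .
  moreover have "(\<lambda>x. Re (A x * cnj (A x))) = (\<lambda>x. (norm (A x))\<^sup>2)"
    unfolding complex_norm_square[symmetric] by simp
  ultimately show ?thesis by (simp add: has_real_derivative_iff_has_vector_derivative)
qed

lemma norm_A_complex: "of_real ((norm (A x))\<^sup>2) = A x * cnj (A x)"
  by (rule complex_norm_square)

lemma wave_deriv_y:
  assumes t: "0 < t" and g: "\<And>x. (g t has_vector_derivative gx t x) (at x)"
  shows "(wave g t has_vector_derivative wave (space_op g gx) t y) (at y)"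
proof -
  define P where "P y = cis (y\<^sup>2 / (4 * t) - \<beta> * (norm (A (y / t)))\<^sup>2 * ln t)" for y
  have lin: "((\<lambda>y. y / t) has_real_derivative 1 / t) (at y)" using t by (auto intro!: derivative_eq_intros)
  have "((\<lambda>y. y\<^sup>2 / (4 * t) - \<beta> * (norm (A (y / t)))\<^sup>2 * ln t) has_real_derivative
      y / (2 * t) - \<beta> * (Re (dens' (y / t)) * (1 / t)) * ln t) (at y)"
  proof (rule DERIV_diff)
    show "((\<lambda>y. y\<^sup>2 / (4 * t)) has_real_derivative y / (2 * t)) (at y)"
      using t by (auto intro!: derivative_eq_intros)
    show "((\<lambda>y. \<beta> * (norm (A (y / t)))\<^sup>2 * ln t) has_real_derivative \<beta> * (Re (dens' (y / t)) * (1 / t)) * ln t) (at y)"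
      by (intro DERIV_cmult_right DERIV_cmult DERIV_chain2[OF norm_A_deriv lin])
  qed
  from cis_vderiv[OF this]
  have dP: "(P has_vector_derivative \<i> * of_real (y / (2 * t) - \<beta> * (Re (dens' (y / t)) * (1 / t)) * ln t) * P y) (at y)"
    unfolding P_def .
  have dg: "((\<lambda>y. g t (y / t)) has_vector_derivative (1 / t) *\<^sub>R gx t (y / t)) (at y)"
    using vector_diff_chain_at[OF lin[unfolded has_real_derivative_iff_has_vector_derivative] g] by (simp only: o_def)
  have "((\<lambda>y. of_real (t powr (-1/2)) * (P y * g t (y / t))) has_vector_derivative
      of_real (t powr (-1/2)) * (P y * ((1 / t) *\<^sub>R gx t (y / t))
        + \<i> * of_real (y / (2 * t) - \<beta> * (Re (dens' (y / t)) * (1 / t)) * ln t) * P y * g t (y / t))) (at y)"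
    by (intro bounded_linear.has_vector_derivative[OF bounded_linear_mult_right] has_vector_derivative_mult dP dg)
  moreover have "(\<lambda>y. of_real (t powr (-1/2)) * (P y * g t (y / t))) = wave g t"
    by (auto simp: wave_def P_def mult.assoc)
  moreover have "of_real (t powr (-1/2)) * (P y * ((1 / t) *\<^sub>R gx t (y / t))
        + \<i> * of_real (y / (2 * t) - \<beta> * (Re (dens' (y / t)) * (1 / t)) * ln t) * P y * g t (y / t))
      = wave (space_op g gx) t y"
  proof -
    have "of_real (y / (2 * t) - \<beta> * (Re (dens' (y / t)) * (1 / t)) * ln t)
        = of_real (y / t) / 2 - of_real \<beta> * (dens' (y / t) * of_real (1 / t)) * complex_of_real (ln t)"
      by (subst (2) dens'_real[symmetric]) simp
    then show ?thesis
      unfolding wave_def space_op_def P_def[symmetric] scaleR_conv_of_real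
      by (simp add: algebra_simps dens'_real)
  qed
  ultimately show ?thesis by simp
qed

lemma wave_deriv_t:
  assumes t: "0 < t" and g: "profile_derivs g gx gt"
  shows "((\<lambda>t. wave g t y) has_vector_derivative wave (time_op g gx gt) t y) (at t)"
proof -
  define P where "P t = cis (y\<^sup>2 / (4 * t) - \<beta> * (norm (A (y / t)))\<^sup>2 * ln t)" for t
  have inv: "((\<lambda>s. y / s) has_real_derivative - (y / t\<^sup>2)) (at t)"
    using t by (auto intro!: derivative_eq_intros simp: power2_eq_square)
  have q: "((\<lambda>s. y\<^sup>2 / (4 * s)) has_real_derivative - ((y / t)\<^sup>2 / 4)) (at t)"
    using t by (auto intro!: derivative_eq_intros simp: power2_eq_square field_simps)
  have "((\<lambda>t. y\<^sup>2 / (4 * t) - \<beta> * (norm (A (y / t)))\<^sup>2 * ln t) has_real_derivative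
      - ((y / t)\<^sup>2 / 4) - (\<beta> * (Re (dens' (y / t)) * (- (y / t\<^sup>2))) * ln t + \<beta> * (norm (A (y / t)))\<^sup>2 * (1 / t))) (at t)"
    by (rule derivative_eq_intros DERIV_chain2[OF norm_A_deriv inv] q DERIV_ln_divide[OF t] refl)+ simp
  from cis_vderiv[OF this]
  have dP: "(P has_vector_derivative \<i> * of_real (- ((y / t)\<^sup>2 / 4) - (\<beta> * (Re (dens' (y / t)) * (- (y / t\<^sup>2))) * ln t
      + \<beta> * (norm (A (y / t)))\<^sup>2 * (1 / t))) * P t) (at t)"
    unfolding P_def .
  have "t powr (- (3 / 2)) = t powr (- (1 / 2)) / t" using powr_diff[of t "- (1 / 2)" 1] t by simp
  then have "((\<lambda>s. s powr (-1/2)) has_real_derivative - (1 / 2) * (t powr (-1/2) * (1 / t))) (at t)"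
    using t by (auto intro!: derivative_eq_intros)
  then have dr: "((\<lambda>s. complex_of_real (s powr (-1/2))) has_vector_derivative of_real (- (1 / 2) * (t powr (-1/2) * (1 / t)))) (at t)"
    by (intro has_vector_derivative_of_real) (simp add: has_real_derivative_iff_has_vector_derivative)
  have dg: "((\<lambda>s. g s (y / s)) has_vector_derivative gt t (y / t) - of_real (y / t\<^sup>2) * gx t (y / t)) (at t)"
    using g t by (simp add: profile_derivs_def)
  have "((\<lambda>t. of_real (t powr (-1/2)) * (P t * g t (y / t))) has_vector_derivative
      of_real (t powr (-1/2)) * (P t * (gt t (y / t) - of_real (y / t\<^sup>2) * gx t (y / t))
        + \<i> * of_real (- ((y / t)\<^sup>2 / 4) - (\<beta> * (Re (dens' (y / t)) * (- (y / t\<^sup>2))) * ln t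
      + \<beta> * (norm (A (y / t)))\<^sup>2 * (1 / t))) * P t * g t (y / t))
      + of_real (- (1 / 2) * (t powr (-1/2) * (1 / t))) * (P t * g t (y / t))) (at t)"
    by (intro has_vector_derivative_mult dP dg dr)
  moreover have "(\<lambda>t. of_real (t powr (-1/2)) * (P t * g t (y / t))) = (\<lambda>t. wave g t y)"
    by (auto simp: wave_def P_def mult.assoc)
  moreover have "of_real (t powr (-1/2)) * (P t * (gt t (y / t) - of_real (y / t\<^sup>2) * gx t (y / t))
        + \<i> * of_real (- ((y / t)\<^sup>2 / 4) - (\<beta> * (Re (dens' (y / t)) * (- (y / t\<^sup>2))) * ln t
      + \<beta> * (norm (A (y / t)))\<^sup>2 * (1 / t))) * P t * g t (y / t))
      + of_real (- (1 / 2) * (t powr (-1/2) * (1 / t))) * (P t * g t (y / t))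
      = wave (time_op g gx gt) t y"
  proof -
    define x where "x = y / t"
    define \<tau> where "\<tau> = 1 / t"
    have yt: "y / t\<^sup>2 = x * \<tau>" by (simp add: x_def \<tau>_def power2_eq_square)
    have 1: "of_real (- (x\<^sup>2 / 4) - (\<beta> * (Re (dens' x) * (- (x * \<tau>))) * ln t + \<beta> * (norm (A x))\<^sup>2 * \<tau>))
        = - (of_real (x\<^sup>2)) / 4 + of_real \<beta> * dens' x * (of_real x * of_real \<tau>) * of_real (ln t)
          - of_real \<beta> * (A x * cnj (A x)) * complex_of_real \<tau>"
      unfolding norm_A_complex[symmetric] by (subst dens'_real[symmetric]) simp
    have w: "wave h t y = of_real (t powr (-1/2)) * P t * h t x" for h
      by (simp add: wave_def P_def x_def)
    show ?thesis
      unfolding w time_op_def x_def[symmetric] \<tau>_def[symmetric] yt 1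
      by (simp add: algebra_simps)
  qed
  ultimately show ?thesis by simp
qed

lemma space_op_deriv:
  assumes "\<And>x. (g t has_vector_derivative gx t x) (at x)" "\<And>x. (gx t has_vector_derivative gxx t x) (at x)"
  shows "(space_op g gx t has_vector_derivative
    \<i> / 2 * (of_real x * gx t x + g t x) + of_real (1 / t) * (gxx t x
      - \<i> * of_real \<beta> * (of_real (ln t) * (dens' x * gx t x + dens'' x * g t x)))) (at x)"
proof -
  have x: "((\<lambda>x. complex_of_real x) has_vector_derivative 1) (at x)"
    by (auto intro!: derivative_eq_intros has_vector_derivative_of_real[of "\<lambda>x. x" 1, simplified])
  have d: "(dens' has_vector_derivative dens'' x) (at x)"
    unfolding dens''_def by (rule smooth_has_vderiv[OF smooth_dens'])
  have "((\<lambda>x. \<i> / 2 * (of_real x * g t x)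
     + of_real (1 / t) * (gx t x - \<i> * of_real \<beta> * (of_real (ln t) * (dens' x * g t x)))) has_vector_derivative
    \<i> / 2 * (of_real x * gx t x + 1 * g t x) + of_real (1 / t) * (gxx t x
      - \<i> * of_real \<beta> * (of_real (ln t) * (dens' x * gx t x + dens'' x * g t x)))) (at x)"
    by (intro has_vector_derivative_add has_vector_derivative_diff has_vector_derivative_mult x d assms
        bounded_linear.has_vector_derivative[OF bounded_linear_mult_right])
  moreover have "(\<lambda>x. \<i> / 2 * (of_real x * g t x)
     + of_real (1 / t) * (gx t x - \<i> * of_real \<beta> * (of_real (ln t) * (dens' x * g t x)))) = space_op g gx t"
    by (auto simp: space_op_def mult.assoc)
  ultimately show ?thesis by simp
qed

text \<open>The quadratic phase cancels all terms except \<open>i \<partial>\<^sub>t\<close> and \<open>t\<^sup>-\<^sup>2\<close> times the Laplacian, and differentiating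
  the logarithmic phase in time contributes the potential \<open>\<beta> |A|\<^sup>2 / t\<close>.\<close>

lemma schroedinger_profile_identity:
  assumes "t \<noteq> 0"
    and "hx = \<i> / 2 * (of_real x * gx t x + g t x) + of_real (1 / t) * (gxx t x
      - \<i> * of_real \<beta> * (of_real (ln t) * (dens' x * gx t x + dens'' x * g t x)))"
  shows "\<i> * time_op g gx gt t x + space_op (space_op g gx) (\<lambda>_ _. hx) t x
    = \<i> * gt t x + of_real \<beta> * (of_real (1 / t) * (A x * cnj (A x) * g t x))
      + of_real (1 / t) * (of_real (1 / t) * gauged_laplacian g gx gxx t x)"
proof -
  define \<tau> where "\<tau> = complex_of_real (1 / t)"
  have I: "\<i> * (\<i> * z) = - z" for z :: complex by (simp add: mult.assoc[symmetric])
  show ?thesis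
    unfolding assms(2) time_op_def space_op_def gauged_laplacian_def \<tau>_def[symmetric]
    by (simp add: algebra_simps I power2_eq_square)
qed

lemma space_op_expansion:
  assumes "log_expansion K k g" "log_expansion K k gx"
  shows "log_expansion K k (space_op g gx)"
proof -
  have "log_expansion K k (\<lambda>t x. \<i> / 2 * of_real x * g t x)"
    by (rule log_expansion_smooth_mult[OF assms(1)]) (intro smooth_mult smooth_const smooth_of_real smooth_ident)
  moreover have "log_expansion K k (\<lambda>t x. of_real (1 / t) * (gx t x - \<i> * of_real \<beta> * (of_real (ln t) * (dens' x * g t x))))"
    by (rule log_expansion_mono[OF log_expansion_inverse_mult[where k=k]])
      (intro log_expansion_diff assms log_expansion_cmult log_expansion_ln_mult log_expansion_smooth_mult smooth_dens' le_SucI order_refl)+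
  ultimately show ?thesis unfolding space_op_def[abs_def] by (rule log_expansion.sum)
qed

lemma time_op_expansion:
  assumes "log_expansion K k g" "log_expansion K k gx" "log_expansion K k gt"
  shows "log_expansion K k (time_op g gx gt)"
  unfolding time_op_def[abs_def]
  by (intro log_expansion_diff assms log_expansion_cmult log_expansion_smooth_mult
      log_expansion_mono[OF log_expansion_inverse_mult le_SucI[OF order_refl]] log_expansion.sum
      log_expansion_ln_mult smooth_dens' smooth_of_real smooth_power smooth_ident smooth_mult smooth_cnj smooth_A)

lemma gauged_laplacian_expansion:
  assumes "log_expansion K k g" "log_expansion K k gx" "log_expansion K k gxx"
  shows "log_expansion K k (gauged_laplacian g gx gxx)"
  unfolding gauged_laplacian_def[abs_def]
  by (intro log_expansion_diff assms log_expansion_cmult log_expansion_smooth_mult log_expansion.sum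
      log_expansion_ln_mult smooth_dens' smooth_dens'')

lemma gauged_laplacian_add:
  "gauged_laplacian (\<lambda>t x. g t x + h t x) (\<lambda>t x. gx t x + hx t x) (\<lambda>t x. gxx t x + hxx t x) t x
    = gauged_laplacian g gx gxx t x + gauged_laplacian h hx hxx t x"
  by (simp add: gauged_laplacian_def algebra_simps)

text \<open>A correction \<open>c\<close> of order \<open>k\<close> has to solve \<open>i c\<^sub>t = 2 (\<beta> / t) A Re (cnj A * c) - \<rho>\<close>, where \<open>\<rho>\<close> is the
  residual; the neglected terms are of order \<open>k + 2\<close>. The coupling term has the same order as \<open>c\<^sub>t\<close> and
  cannot be treated as an error, but it is nilpotent: it points in the direction \<open>i A\<close>, which does not
  contribute to \<open>Re (cnj A * c)\<close>. Two integrations in time therefore solve the equation exactly, one for \<open>\<rho>\<close>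
  and one for the coupling.\<close>

lemma expansion_step:
  assumes k: "1 \<le> k"
    and b: "log_expansion K 0 b" and r: "log_expansion K 1 (\<lambda>t x. b t x - A x)"
    and bd: "profile_derivs b bx bt" "\<And>t x. (bx t has_vector_derivative bxx t x) (at x)"
    and be: "log_expansion K 0 bx" "log_expansion K 0 bxx" "log_expansion K 0 bt"
    and res: "log_expansion K (Suc k) (residual b bx bxx bt)"
  obtains b' bx' bxx' bt' where "log_expansion K 0 b'" "log_expansion K 1 (\<lambda>t x. b' t x - A x)"
    "profile_derivs b' bx' bt'" "\<And>t x. (bx' t has_vector_derivative bxx' t x) (at x)"
    "log_expansion K 0 bx'" "log_expansion K 0 bxx'" "log_expansion K 0 bt'"
    "log_expansion K (Suc (Suc k)) (residual b' bx' bxx' bt')"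
proof -
  define \<rho> where "\<rho> = residual b bx bxx bt"
  have "log_expansion K (Suc k) (\<lambda>t x. \<i> * \<rho> t x)"
    using res unfolding \<rho>_def by (rule log_expansion_cmult)
  then obtain G where G: "log_expansion K k G" "\<And>t x. 0 < t \<Longrightarrow> ((\<lambda>t. G t x) has_vector_derivative \<i> * \<rho> t x) (at t)"
    using log_expansion_primitive[OF _ k] by blast
  define q where "q = (\<lambda>t x. cnj (A x) * G t x + A x * cnj (G t x))"
  have qe: "log_expansion K k q"
    unfolding q_def by (intro log_expansion.sum log_expansion_smooth_mult log_expansion_cnj G smooth_cnj smooth_A)
  obtain Q0 where Q0: "log_expansion K k Q0"
    "\<And>t x. 0 < t \<Longrightarrow> ((\<lambda>t. Q0 t x) has_vector_derivative of_real (1 / t) * q t x) (at t)"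
    using log_expansion_primitive[OF log_expansion_inverse_mult[OF qe] k] by blast
  \<comment> \<open>With \<open>Q\<close> real, adding a real multiple of \<open>i A Q\<close> to \<open>G\<close> leaves the real part of \<open>cnj A * G\<close> unchanged.\<close>
  define Q where "Q = (\<lambda>t x. 1 / 2 * (Q0 t x + cnj (Q0 t x)))"
  have Qe: "log_expansion K k Q"
    unfolding Q_def by (intro log_expansion.sum log_expansion_cmult log_expansion_cnj Q0)
  have Qr: "cnj (Q t x) = Q t x" for t x by (simp add: Q_def add.commute)
  have qr: "cnj (q t x) = q t x" for t x by (simp add: q_def add.commute)
  have Qd: "((\<lambda>t. Q t x) has_vector_derivative of_real (1 / t) * q t x) (at t)" if t: "0 < t" for t x
  proof -
    have "((\<lambda>t. 1 / 2 * (Q0 t x + cnj (Q0 t x))) has_vector_derivative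
        1 / 2 * (of_real (1 / t) * q t x + cnj (of_real (1 / t) * q t x))) (at t)"
      by (intro bounded_linear.has_vector_derivative[OF bounded_linear_mult_right] has_vector_derivative_add
          bounded_linear.has_vector_derivative[OF bounded_linear_cnj] Q0(2)[OF t])
    then show ?thesis unfolding Q_def by (simp add: qr)
  qed
  define c where "c = (\<lambda>t x. G t x + (- \<i> * of_real \<beta>) * (A x * Q t x))"
  define ct where "ct = (\<lambda>t x. \<i> * \<rho> t x + (- \<i> * of_real \<beta>) * (A x * (of_real (1 / t) * q t x)))"
  have ce: "log_expansion K k c"
    unfolding c_def by (intro log_expansion.sum log_expansion_cmult log_expansion_smooth_mult G Qe smooth_A)
  have cte: "log_expansion K (Suc k) ct"
    unfolding ct_def \<rho>_def
    by (intro log_expansion.sum log_expansion_cmult log_expansion_smooth_mult log_expansion_inverse_mult res qe smooth_A)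
  have ctd: "((\<lambda>t. c t x) has_vector_derivative ct t x) (at t)" if "0 < t" for t x
    unfolding c_def ct_def
    by (intro has_vector_derivative_add bounded_linear.has_vector_derivative[OF bounded_linear_mult_right] G(2) Qd that)
  obtain cx ct0 where cx: "log_expansion K k cx" "profile_derivs c cx ct0"
    using log_expansion_derivs[OF ce closed_K] by metis
  have cd: "profile_derivs c cx ct" by (rule profile_derivs_cong_t[OF cx(2) ctd])
  obtain cxx where cxx: "log_expansion K k cxx" "\<And>t x. (cx t has_vector_derivative cxx t x) (at x)"
    using log_expansion_deriv_x[OF cx(1) closed_K] by blast
  define s where "s = (\<lambda>t x. b t x - A x)"
  define X where "X = (\<lambda>t x. 2 * ((A x * cnj (s t x) + cnj (A x) * s t x + s t x * cnj (s t x)) * c t x)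
      + (2 * (A x * s t x) + s t x * s t x) * cnj (c t x)
      + 2 * (b t x * (c t x * cnj (c t x))) + cnj (b t x) * (c t x * c t x) + c t x * c t x * cnj (c t x))"
  have se: "log_expansion K 1 s" using r by (simp add: s_def)
  have Xe: "log_expansion K (Suc k) X"
  proof -
    have m: "log_expansion K (Suc k) (\<lambda>t x. f t x * g t x)" if "log_expansion K 1 f" "log_expansion K k g" for f g
      using log_expansion_mult[OF that] by simp
    have ss: "log_expansion K 1 (\<lambda>t x. s t x * h t x)" if "log_expansion K 1 h" for h
      by (rule log_expansion_mono[OF log_expansion_mult[OF se that]]) simp
    have cc: "log_expansion K (Suc k) (\<lambda>t x. f t x * g t x)" if "log_expansion K k f" "log_expansion K k g" for f g
      by (rule log_expansion_mono[OF log_expansion_mult[OF that]]) (use k in simp)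
    have bc: "log_expansion K (Suc k) (\<lambda>t x. f t x * g t x)" if "log_expansion K 0 f" "log_expansion K (Suc k) g" for f g
      using log_expansion_mult[OF that] by simp
    have cek: "log_expansion K (Suc k) (\<lambda>t x. c t x * c t x * cnj (c t x))"
      by (rule log_expansion_mono[OF log_expansion_mult[OF cc[OF ce ce] log_expansion_cnj[OF ce]]]) simp
    show ?thesis
      unfolding X_def
      by (intro log_expansion.sum log_expansion_cmult m cc bc cek ce log_expansion_cnj b se ss
          log_expansion_smooth_mult smooth_A smooth_cnj)
  qed
  have identity: "residual (\<lambda>t x. b t x + c t x) (\<lambda>t x. bx t x + cx t x) (\<lambda>t x. bxx t x + cxx t x) (\<lambda>t x. bt t x + ct t x) t x
      = (- of_real \<beta>) * (of_real (1 / t) * X t x) + of_real (1 / t) * (of_real (1 / t) * gauged_laplacian c cx cxx t x)" for t x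
  proof -
    define \<tau> where "\<tau> = complex_of_real (1 / t)"
    have I: "\<i> * (\<i> * z) = - z" for z :: complex by (simp add: mult.assoc[symmetric])
    have ict: "\<i> * ct t x = - \<rho> t x + of_real \<beta> * (A x * (\<tau> * q t x))"
      unfolding ct_def \<tau>_def by (simp add: algebra_simps I)
    have qc: "q t x = cnj (A x) * c t x + A x * cnj (c t x)"
      unfolding q_def c_def by (simp add: Qr algebra_simps)
    have bs: "b t x = A x + s t x" by (simp add: s_def)
    have cub: "(A x * cnj (A x) - (b t x + c t x) * cnj (b t x + c t x)) * (b t x + c t x)
        = (A x * cnj (A x) - b t x * cnj (b t x)) * b t x - A x * q t x - X t x"
      unfolding X_def qc bs by (simp add: algebra_simps)
    have "residual (\<lambda>t x. b t x + c t x) (\<lambda>t x. bx t x + cx t x) (\<lambda>t x. bxx t x + cxx t x) (\<lambda>t x. bt t x + ct t x) t x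
      = \<i> * bt t x + \<i> * ct t x
        + of_real \<beta> * (\<tau> * ((A x * cnj (A x) - b t x * cnj (b t x)) * b t x - A x * q t x - X t x))
        + \<tau> * (\<tau> * (gauged_laplacian b bx bxx t x + gauged_laplacian c cx cxx t x))"
      unfolding residual_def gauged_laplacian_add cub \<tau>_def by (simp add: algebra_simps)
    also have "\<dots> = \<rho> t x + (\<i> * ct t x - of_real \<beta> * (A x * (\<tau> * q t x))) - of_real \<beta> * (\<tau> * X t x) + \<tau> * (\<tau> * gauged_laplacian c cx cxx t x)"
      unfolding \<rho>_def residual_def \<tau>_def by (simp add: algebra_simps)
    finally show ?thesis unfolding ict \<tau>_def by simp
  qed
  show ?thesis
  proof (rule that)
    show "log_expansion K 0 (\<lambda>t x. b t x + c t x)" by (intro log_expansion.sum b log_expansion_mono[OF ce]) simp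
    have "log_expansion K 1 (\<lambda>t x. (b t x - A x) + c t x)" by (intro log_expansion.sum r log_expansion_mono[OF ce] k)
    then show "log_expansion K 1 (\<lambda>t x. b t x + c t x - A x)" by (simp add: algebra_simps)
    show "profile_derivs (\<lambda>t x. b t x + c t x) (\<lambda>t x. bx t x + cx t x) (\<lambda>t x. bt t x + ct t x)"
      by (rule profile_derivs_add[OF bd(1) cd])
    show "((\<lambda>x. bx t x + cx t x) has_vector_derivative bxx t x + cxx t x) (at x)" for t x
      by (intro has_vector_derivative_add bd cxx)
    show "log_expansion K 0 (\<lambda>t x. bx t x + cx t x)" by (intro log_expansion.sum be log_expansion_mono[OF cx(1)]) simp
    show "log_expansion K 0 (\<lambda>t x. bxx t x + cxx t x)" by (intro log_expansion.sum be log_expansion_mono[OF cxx(1)]) simp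
    show "log_expansion K 0 (\<lambda>t x. bt t x + ct t x)" by (intro log_expansion.sum be log_expansion_mono[OF cte]) simp
    have "log_expansion K (Suc (Suc k)) (\<lambda>t x. (- of_real \<beta>) * (of_real (1 / t) * X t x) + of_real (1 / t) * (of_real (1 / t) * gauged_laplacian c cx cxx t x))"
      by (intro log_expansion.sum log_expansion_cmult log_expansion_inverse_mult Xe gauged_laplacian_expansion ce cx cxx)
    then show "log_expansion K (Suc (Suc k)) (residual (\<lambda>t x. b t x + c t x) (\<lambda>t x. bx t x + cx t x) (\<lambda>t x. bxx t x + cxx t x) (\<lambda>t x. bt t x + ct t x))"
      unfolding identity[symmetric] .
  qed
qed

lemma approximate_profile:
  "\<exists>b bx bxx bt. log_expansion K 0 b \<and> log_expansion K 1 (\<lambda>t x. b t x - A x) \<and>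
    profile_derivs b bx bt \<and> (\<forall>t x. (bx t has_vector_derivative bxx t x) (at x)) \<and>
    log_expansion K 0 bx \<and> log_expansion K 0 bxx \<and> log_expansion K 0 bt \<and>
    log_expansion K (n + 2) (residual b bx bxx bt)"
proof (induction n)
  case 0
  define b where "b = (\<lambda>t::real. A)"
  have b: "log_expansion K 0 b" unfolding b_def by (rule log_expansion_profile[OF smooth_A A_zero])
  obtain bx bt0 where bx: "log_expansion K 0 bx" "profile_derivs b bx bt0"
    using log_expansion_derivs[OF b closed_K] by metis
  have bd: "profile_derivs b bx (\<lambda>t x. 0)"
    by (rule profile_derivs_cong_t[OF bx(2)]) (simp add: b_def)
  obtain bxx where bxx: "log_expansion K 0 bxx" "\<And>t x. (bx t has_vector_derivative bxx t x) (at x)"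
    using log_expansion_deriv_x[OF bx(1) closed_K] by blast
  have "log_expansion K (Suc (Suc 0)) (\<lambda>t x. of_real (1 / t) * (of_real (1 / t) * gauged_laplacian b bx bxx t x))"
    by (intro log_expansion_inverse_mult gauged_laplacian_expansion b bx bxx)
  moreover have "residual b bx bxx (\<lambda>t x. 0) = (\<lambda>t x. of_real (1 / t) * (of_real (1 / t) * gauged_laplacian b bx bxx t x))"
    by (intro ext) (simp add: residual_def b_def)
  ultimately have "log_expansion K (0 + 2) (residual b bx bxx (\<lambda>t x. 0))" by (simp add: numeral_2_eq_2)
  moreover have "log_expansion K 1 (\<lambda>t x. b t x - A x)" by (simp add: b_def log_expansion_zero)
  ultimately show ?case using b bd bx(1) bxx log_expansion_zero[of K 0] by blast
next
  case (Suc n)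
  then obtain b bx bxx bt where *: "log_expansion K 0 b" "log_expansion K 1 (\<lambda>t x. b t x - A x)"
    "profile_derivs b bx bt" "\<And>t x. (bx t has_vector_derivative bxx t x) (at x)"
    "log_expansion K 0 bx" "log_expansion K 0 bxx" "log_expansion K 0 bt"
    "log_expansion K (Suc (Suc n)) (residual b bx bxx bt)" by auto
  have one: "1 \<le> Suc n" by simp
  show ?case unfolding add_Suc add_2_eq_Suc' by (rule expansion_step[OF one *]) blast
qed

end

section \<open>Estimates for the approximate solutions\<close>

lemma C1_compact_support_L2:
  fixes f :: "real \<Rightarrow> complex"
  assumes d: "\<And>x. (f has_vector_derivative f' x) (at x)"
    and b: "\<And>x. norm (f x) \<le> B" "\<And>x. norm (f' x) \<le> B"
    and z: "\<And>x. x \<notin> {-S..S} \<Longrightarrow> f x = 0" and S: "0 \<le> S"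
  shows "L2 f" "L2_norm f \<le> B * sqrt (2 * S)"
    "0 \<le> h \<Longrightarrow> h \<le> 1 \<Longrightarrow> L2_norm (\<lambda>x. f (x + h) - f x) \<le> h * (B * sqrt (2 * (S + 1)))"
proof -
  have m: "f \<in> borel_measurable borel"
    using d by (intro borel_measurable_continuous_onI) (meson continuous_at_imp_continuous_on has_vector_derivative_continuous)
  show "L2 f" "L2_norm f \<le> B * sqrt (2 * S)"
    using L2_bounded_on_interval[OF m b(1), where a="- S" and b=S] z S by auto
  assume h: "0 \<le> h" "h \<le> 1"
  have m': "(\<lambda>x. f (x + h) - f x) \<in> borel_measurable borel" using m by measurable
  have lip: "norm (f (x + h) - f x) \<le> B * h" for x
    using vderiv_lipschitz[OF d b(2), of "x + h" x] h by simp
  have z': "f (x + h) - f x = 0" if "x \<notin> {-(S + 1)..S + 1}" for x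
  proof -
    have "x \<notin> {-S..S}" "x + h \<notin> {-S..S}" using that h by auto
    then show ?thesis using z by simp
  qed
  have "L2_norm (\<lambda>x. f (x + h) - f x) \<le> B * h * sqrt (S + 1 - - (S + 1))"
    by (rule L2_bounded_on_interval(2)[OF m' lip z']) (use S in auto)
  then show "L2_norm (\<lambda>x. f (x + h) - f x) \<le> h * (B * sqrt (2 * (S + 1)))" by (simp add: mult_ac)
qed

lemma vderiv_lipschitz_from_1:
  fixes f :: "real \<Rightarrow> complex"
  assumes "\<And>t. 1 \<le> t \<Longrightarrow> (f has_vector_derivative f' t) (at t)" "\<And>t. 1 \<le> t \<Longrightarrow> norm (f' t) \<le> B"
    "1 \<le> s" "1 \<le> t"
  shows "norm (f s - f t) \<le> B * \<bar>s - t\<bar>"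
proof -
  have "norm (f s - f t) \<le> B * norm (s - t)"
  proof (rule differentiable_bound[of "{1..}" f "\<lambda>t h. h *\<^sub>R f' t"])
    fix x :: real assume x: "x \<in> {1..}"
    show "(f has_derivative (\<lambda>h. h *\<^sub>R f' x)) (at x within {1..})"
      using assms(1)[of x] x unfolding has_vector_derivative_def by (auto intro: has_derivative_at_withinI)
    show "onorm (\<lambda>h. h *\<^sub>R f' x) \<le> B"
      using assms(2)[of x] x by (intro onorm_le) (simp add: mult.commute[of B] mult_left_mono)
  qed (use assms in auto)
  then show ?thesis by simp
qed

lemma vderiv_taylor_from_1:
  fixes f :: "real \<Rightarrow> complex"
  assumes d: "\<And>t. 1 \<le> t \<Longrightarrow> (f has_vector_derivative f' t) (at t)"
    and d': "\<And>t. 1 \<le> t \<Longrightarrow> (f' has_vector_derivative f'' t) (at t)"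
    and b: "\<And>t. 1 \<le> t \<Longrightarrow> norm (f'' t) \<le> B" and st: "1 \<le> s" "1 \<le> t"
  shows "norm (f s - f t - (s - t) *\<^sub>R f' t) \<le> B * \<bar>s - t\<bar>\<^sup>2"
proof -
  have seg: "closed_segment t s \<subseteq> {1..}" using st by (auto simp: closed_segment_eq_real_ivl split: if_splits)
  have B: "0 \<le> B" using order_trans[OF norm_ge_zero b[of 1]] by simp
  have "norm (f s - f t - (s - t) *\<^sub>R f' t) \<le> norm (s - t) * (B * \<bar>s - t\<bar>)"
  proof (rule vector_differentiable_bound_linearization[of "closed_segment t s"])
    fix x assume x: "x \<in> closed_segment t s"
    then have x1: "1 \<le> x" using seg by auto
    show "(f has_vector_derivative f' x) (at x within closed_segment t s)"
      using d[OF x1] by (rule has_vector_derivative_at_within)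
    have "norm (f' x - f' t) \<le> B * \<bar>x - t\<bar>" by (rule vderiv_lipschitz_from_1[OF d' b x1 st(2)])
    also have "\<dots> \<le> B * \<bar>s - t\<bar>"
      using x B by (intro mult_left_mono) (auto simp: closed_segment_eq_real_ivl split: if_splits)
    finally show "norm (f' x - f' t) \<le> B * \<bar>s - t\<bar>" .
  qed auto
  then show ?thesis by (simp add: power2_eq_square mult_ac)
qed

lemma L2_norm_le_combination:
  assumes "L2 f" "L2 g" "L2 k" "0 \<le> a" "0 \<le> b" "0 \<le> c" "F \<in> borel_measurable borel"
    "AE x in lborel. norm (F x) \<le> a * norm (f x) + b * norm (g x) + c * norm (k x)"
  shows "L2 F" "L2_norm F \<le> a * L2_norm f + b * L2_norm g + c * L2_norm k"
proof -
  have nL: "L2 (\<lambda>x. of_real (d * norm (h x)))" "L2_norm (\<lambda>x. of_real (d * norm (h x))) = d * L2_norm h"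
    if "L2 h" "0 \<le> d" for h d
  proof -
    have m: "(\<lambda>x. complex_of_real (d * norm (h x))) \<in> borel_measurable borel"
      using L2_measurable[OF that(1)] by measurable
    have e: "norm (complex_of_real (d * norm (h x))) = norm (of_real d * h x)" for x
      using that by (simp add: norm_mult)
    show "L2 (\<lambda>x. of_real (d * norm (h x)))"
      by (rule L2_dominated(1)[OF L2_cmult[OF that(1), of "of_real d"] m]) (rule AE_I2, simp only: e order_refl)
    have "L2_norm (\<lambda>x. of_real (d * norm (h x))) = L2_norm (\<lambda>x. of_real d * h x)"
      unfolding L2_norm_def e ..
    then show "L2_norm (\<lambda>x. of_real (d * norm (h x))) = d * L2_norm h"
      using that by (simp add: L2_norm_cmult)
  qed
  note f = nL[OF assms(1,4)] and g = nL[OF assms(2,5)] and k = nL[OF assms(3,6)]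
  define G where "G = (\<lambda>x. complex_of_real (a * norm (f x)) + of_real (b * norm (g x)) + of_real (c * norm (k x)))"
  have GL: "L2 G" unfolding G_def by (intro L2_add f g k)
  have ae: "AE x in lborel. norm (F x) \<le> norm (G x)"
    using assms(8)
  proof eventually_elim
    case (elim x)
    have "G x = of_real (a * norm (f x) + b * norm (g x) + c * norm (k x))" by (simp add: G_def)
    then have "norm (G x) = \<bar>a * norm (f x) + b * norm (g x) + c * norm (k x)\<bar>" by (simp only: norm_of_real)
    then show ?case using elim by linarith
  qed
  show "L2 F" by (rule L2_dominated(1)[OF GL assms(7) ae])
  have "L2_norm F \<le> L2_norm G" by (rule L2_dominated(2)[OF GL assms(7) ae])
  also have "\<dots> \<le> L2_norm (\<lambda>x. complex_of_real (a * norm (f x)) + of_real (b * norm (g x))) + L2_norm (\<lambda>x. complex_of_real (c * norm (k x)))"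
    unfolding G_def by (intro L2_norm_triangle L2_add f g k)
  also have "\<dots> \<le> (L2_norm (\<lambda>x. complex_of_real (a * norm (f x))) + L2_norm (\<lambda>x. complex_of_real (b * norm (g x)))) + L2_norm (\<lambda>x. complex_of_real (c * norm (k x)))"
    by (intro add_right_mono L2_norm_triangle f g)
  finally show "L2_norm F \<le> a * L2_norm f + b * L2_norm g + c * L2_norm k"
    unfolding f(2) g(2) k(2) .
qed

context scattering_profile
begin

lemma wave_zero:
  assumes "log_expansion K k g" "y / t \<notin> K"
  shows "wave g t y = 0"
  using log_expansion_zero_off[OF assms] by (simp add: wave_def)

lemma profile_radius:
  obtains R where "R \<ge> 1" "\<And>k g t y. log_expansion K k g \<Longrightarrow> 0 < t \<Longrightarrow> y \<notin> {- (R * t)..R * t} \<Longrightarrow> wave g t y = 0"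
proof -
  obtain R where R: "R \<ge> 1" "K \<subseteq> {-R..R}" using compact_real_interval[OF compact_K] by metis
  have "wave g t y = 0" if g: "log_expansion K k g" and t: "0 < t" and y: "y \<notin> {- (R * t)..R * t}" for k g t y
  proof (rule wave_zero[OF g])
    have "y / t \<notin> {-R..R}" using t y by (auto simp: field_simps)
    then show "y / t \<notin> K" using R(2) by blast
  qed
  then show ?thesis using that R(1) by blast
qed

lemma wave_bound:
  assumes "log_expansion K k g"
  obtains C where "C \<ge> 0" "\<And>t y. 1 \<le> t \<Longrightarrow> norm (wave g t y) \<le> C * t powr (- 1/4 - real k)"
proof -
  obtain C where C: "C \<ge> 0" "\<And>t x. 1 \<le> t \<Longrightarrow> norm (g t x) \<le> C * t powr (1/4 - real k)"
    using log_expansion_bound[OF assms compact_K] by blast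
  have "norm (wave g t y) \<le> C * t powr (- 1/4 - real k)" if t: "1 \<le> t" for t y
  proof -
    have "norm (wave g t y) = t powr (-1/2) * norm (g t (y / t))"
      by (simp add: wave_def norm_mult)
    also have "\<dots> \<le> t powr (-1/2) * (C * t powr (1/4 - real k))" by (intro mult_left_mono C t) simp
    also have "\<dots> = C * (t powr (-1/2) * t powr (1/4 - real k))" by simp
    also have "t powr (-1/2) * t powr (1/4 - real k) = t powr (- 1/4 - real k)" by (simp add: powr_add[symmetric])
    finally show ?thesis .
  qed
  then show ?thesis using that C(1) by blast
qed

lemma wave_bounded:
  assumes "log_expansion K k g"
  obtains C where "C \<ge> 0" "\<And>t y. 1 \<le> t \<Longrightarrow> norm (wave g t y) \<le> C"
proof -
  obtain C where C: "C \<ge> 0" "\<And>t y. 1 \<le> t \<Longrightarrow> norm (wave g t y) \<le> C * t powr (- 1/4 - real k)"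
    using wave_bound[OF assms] by metis
  have "C * t powr (- 1/4 - real k) \<le> C * 1" if "1 \<le> t" for t
    using that C(1) powr_mono[of "- 1/4 - real k" 0 t] by (intro mult_left_mono) auto
  then show ?thesis using that C by (metis mult.right_neutral order_trans)
qed

lemma wave_continuous:
  assumes "log_expansion K k g" "0 < t"
  shows "continuous_on UNIV (wave g t)"
proof -
  obtain gx gt where "profile_derivs g gx gt"
    using log_expansion_derivs[OF assms(1) closed_K] by metis
  then have "\<And>y. (wave g t has_vector_derivative wave (space_op g gx) t y) (at y)"
    by (intro wave_deriv_y assms(2)) (auto simp: profile_derivs_def)
  then show ?thesis by (meson continuous_at_imp_continuous_on has_vector_derivative_continuous)
qed

lemma L2_bounded_on_cone:
  assumes "f \<in> borel_measurable borel" "\<And>y. norm (f y) \<le> B" "\<And>y. y \<notin> {- (R * t)..R * t} \<Longrightarrow> f y = 0"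
    "1 \<le> R" "1 \<le> t"
  shows "L2 f" "L2_norm f \<le> B * (sqrt (2 * R) * t powr (1/2))"
proof -
  have Rt: "0 \<le> R * t" using assms(4,5) by simp
  have "L2 f" "L2_norm f \<le> B * sqrt (R * t - - (R * t))"
    using L2_bounded_on_interval[OF assms(1,2), where a="- (R * t)" and b="R * t"] assms(3) Rt by auto
  moreover have "sqrt (R * t - - (R * t)) = sqrt (2 * R) * t powr (1/2)"
    using assms(4,5) by (simp add: powr_half_sqrt real_sqrt_mult[symmetric])
  ultimately show "L2 f" "L2_norm f \<le> B * (sqrt (2 * R) * t powr (1/2))" by auto
qed

lemma wave_L2:
  assumes "log_expansion K k g"
  obtains C where "C \<ge> 0" "\<And>t. 1 \<le> t \<Longrightarrow> L2 (wave g t)" "\<And>t. 1 \<le> t \<Longrightarrow> L2_norm (wave g t) \<le> C * t powr (1/4 - real k)"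
proof -
  obtain R where R: "R \<ge> 1" "\<And>k g t y. log_expansion K k g \<Longrightarrow> 0 < t \<Longrightarrow> y \<notin> {- (R * t)..R * t} \<Longrightarrow> wave g t y = 0"
    using profile_radius by blast
  obtain C where C: "C \<ge> 0" "\<And>t y. 1 \<le> t \<Longrightarrow> norm (wave g t y) \<le> C * t powr (- 1/4 - real k)"
    using wave_bound[OF assms] by metis
  have *: "L2 (wave g t)" "L2_norm (wave g t) \<le> (C * sqrt (2 * R)) * t powr (1/4 - real k)" if t: "1 \<le> t" for t
  proof -
    have m: "wave g t \<in> borel_measurable borel"
      using t by (intro borel_measurable_continuous_onI wave_continuous[OF assms]) simp
    have z: "wave g t y = 0" if "y \<notin> {- (R * t)..R * t}" for y using R(2)[OF assms _ that] t by simp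
    note b = L2_bounded_on_cone[OF m C(2)[OF t] z R(1) t]
    show "L2 (wave g t)" by (rule b(1))
    have "L2_norm (wave g t) \<le> C * t powr (- 1/4 - real k) * (sqrt (2 * R) * t powr (1/2))" by (rule b(2))
    also have "\<dots> = (C * sqrt (2 * R)) * (t powr (- 1/4 - real k) * t powr (1/2))" by simp
    also have "t powr (- 1/4 - real k) * t powr (1/2) = t powr (1/4 - real k)" by (simp add: powr_add[symmetric])
    finally show "L2_norm (wave g t) \<le> (C * sqrt (2 * R)) * t powr (1/4 - real k)" .
  qed
  show ?thesis by (rule that[of "C * sqrt (2 * R)"]) (use * C(1) R(1) in auto)
qed

lemma wave_weak_deriv:
  assumes "log_expansion K k g" "profile_derivs g gx gt" "log_expansion K k gx" "0 < t"
  shows "has_weak_deriv (wave g t) (wave (space_op g gx) t)"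
  by (rule classical_imp_weak_deriv)
    (use assms in \<open>auto intro!: wave_deriv_y wave_continuous[OF space_op_expansion] simp: profile_derivs_def\<close>)

lemma wave_H1:
  assumes "log_expansion K k g"
  shows "1 \<le> t \<Longrightarrow> H1 (wave g t)"
proof -
  assume t: "1 \<le> t"
  obtain gx gt where g: "log_expansion K k gx" "profile_derivs g gx gt"
    using log_expansion_derivs[OF assms closed_K] by metis
  have "L2 (wave g t)" "L2 (wave (space_op g gx) t)"
    using wave_L2[OF assms] wave_L2[OF space_op_expansion[OF assms g(1)]] t by metis+
  moreover have "has_weak_deriv (wave g t) (wave (space_op g gx) t)"
    by (rule wave_weak_deriv[OF assms g(2,1)]) (use t in simp)
  ultimately show ?thesis by (rule H1I(1))
qed

lemma wave_lipschitz_time: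
  assumes "log_expansion K k g"
  obtains C where "C \<ge> 0" "\<And>s t y. 1 \<le> s \<Longrightarrow> 1 \<le> t \<Longrightarrow> norm (wave g s y - wave g t y) \<le> C * \<bar>s - t\<bar>"
proof -
  obtain gx gt where g: "log_expansion K k gx" "log_expansion K (Suc k) gt" "profile_derivs g gx gt"
    using log_expansion_derivs[OF assms closed_K] by metis
  have e: "log_expansion K k (time_op g gx gt)"
    by (intro time_op_expansion assms g log_expansion_mono[OF g(2)]) simp
  obtain C where C: "C \<ge> 0" "\<And>t y. 1 \<le> t \<Longrightarrow> norm (wave (time_op g gx gt) t y) \<le> C"
    using wave_bounded[OF e] by metis
  have "norm (wave g s y - wave g t y) \<le> C * \<bar>s - t\<bar>" if "1 \<le> s" "1 \<le> t" for s t y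
    by (rule vderiv_lipschitz_from_1[of "\<lambda>t. wave g t y" "\<lambda>t. wave (time_op g gx gt) t y"])
      (use wave_deriv_t[OF _ g(3)] C(2) that in auto)
  then show ?thesis using that C(1) by blast
qed

lemma wave_taylor_time:
  assumes "log_expansion K k g" "log_expansion K k gx" "log_expansion K k gt" "profile_derivs g gx gt"
  obtains C where "C \<ge> 0" "\<And>s t y. 1 \<le> s \<Longrightarrow> 1 \<le> t \<Longrightarrow>
    norm (wave g s y - wave g t y - (s - t) *\<^sub>R wave (time_op g gx gt) t y) \<le> C * \<bar>s - t\<bar>\<^sup>2"
proof -
  define h where "h = time_op g gx gt"
  have e: "log_expansion K k h" unfolding h_def by (intro time_op_expansion assms)
  obtain hx ht where h: "log_expansion K k hx" "log_expansion K (Suc k) ht" "profile_derivs h hx ht"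
    using log_expansion_derivs[OF e closed_K] by metis
  have e2: "log_expansion K k (time_op h hx ht)"
    by (intro time_op_expansion e h log_expansion_mono[OF h(2)]) simp
  obtain C where C: "C \<ge> 0" "\<And>t y. 1 \<le> t \<Longrightarrow> norm (wave (time_op h hx ht) t y) \<le> C"
    using wave_bounded[OF e2] by metis
  have "norm (wave g s y - wave g t y - (s - t) *\<^sub>R wave (time_op g gx gt) t y) \<le> C * \<bar>s - t\<bar>\<^sup>2" if "1 \<le> s" "1 \<le> t" for s t y
    by (rule vderiv_taylor_from_1[of "\<lambda>t. wave g t y" "\<lambda>t. wave (time_op g gx gt) t y" "\<lambda>t. wave (time_op h hx ht) t y"])
      (use wave_deriv_t[OF _ assms(4)] wave_deriv_t[OF _ h(3)] C(2) that in \<open>auto simp: h_def\<close>)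
  then show ?thesis using that C(1) by blast
qed

lemma near_time: "\<forall>\<^sub>F s in at t within {1..}. 1 \<le> s \<and> s \<le> t + 1 \<and> s \<noteq> (t::real)"
proof -
  have "\<forall>\<^sub>F s in at t within {1..}. s < t + 1"
    by (rule order_tendstoD(2)[OF tendsto_ident_at]) simp
  moreover have "\<forall>\<^sub>F s in at t within {1..}. 1 \<le> s \<and> s \<noteq> t" by (auto simp: eventually_at_filter)
  ultimately show ?thesis by eventually_elim auto
qed

lemma time_dist_tendsto: "((\<lambda>s. C * \<bar>s - t\<bar>) \<longlongrightarrow> 0) (at t within S)" for C t :: real
proof -
  have "((\<lambda>s. C * \<bar>s - t\<bar>) \<longlongrightarrow> C * \<bar>t - t\<bar>) (at t within S)" by (intro tendsto_intros)
  then show ?thesis by simp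
qed

lemma wave_L2_lipschitz_time:
  assumes g: "log_expansion K k g" and t: "1 \<le> t"
  obtains C where "C \<ge> 0" "\<And>s. 1 \<le> s \<Longrightarrow> s \<le> t + 1 \<Longrightarrow> L2_norm (\<lambda>y. wave g s y - wave g t y) \<le> C * \<bar>s - t\<bar>"
proof -
  obtain R where R: "R \<ge> 1" "\<And>k g t y. log_expansion K k g \<Longrightarrow> 0 < t \<Longrightarrow> y \<notin> {- (R * t)..R * t} \<Longrightarrow> wave g t y = 0"
    using profile_radius by blast
  obtain C where C: "C \<ge> 0" "\<And>s t y. 1 \<le> s \<Longrightarrow> 1 \<le> t \<Longrightarrow> norm (wave g s y - wave g t y) \<le> C * \<bar>s - t\<bar>"
    using wave_lipschitz_time[OF g] by metis
  have "L2_norm (\<lambda>y. wave g s y - wave g t y) \<le> (C * (sqrt (2 * R) * (t + 1) powr (1/2))) * \<bar>s - t\<bar>" if s: "1 \<le> s" "s \<le> t + 1" for s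
  proof -
    have m: "(\<lambda>y. wave g s y - wave g t y) \<in> borel_measurable borel"
      using s t by (intro borel_measurable_continuous_onI continuous_on_diff wave_continuous[OF g]) auto
    have z: "wave g s y - wave g t y = 0" if y: "y \<notin> {- (R * (t + 1))..R * (t + 1)}" for y
    proof -
      have "R * s \<le> R * (t + 1)" "R * t \<le> R * (t + 1)" using R(1) s by auto
      then have "y \<notin> {- (R * s)..R * s}" "y \<notin> {- (R * t)..R * t}" using y by auto
      then show ?thesis using R(2)[OF g] s t by simp
    qed
    have "L2_norm (\<lambda>y. wave g s y - wave g t y) \<le> (C * \<bar>s - t\<bar>) * (sqrt (2 * R) * (t + 1) powr (1/2))"
      by (rule L2_bounded_on_cone(2)[OF m C(2)[OF s(1) t] z R(1)]) (use t in auto)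
    then show ?thesis by (simp add: mult_ac)
  qed
  then show ?thesis using that[of "C * (sqrt (2 * R) * (t + 1) powr (1/2))"] C(1) R(1) by auto
qed

lemma wave_continuous_H1:
  assumes g: "log_expansion K k g" and t: "1 \<le> t"
  shows "((\<lambda>s. H1_norm (\<lambda>y. wave g s y - wave g t y)) \<longlongrightarrow> 0) (at t within {1..})"
proof -
  obtain gx gt where gx: "log_expansion K k gx" "profile_derivs g gx gt"
    using log_expansion_derivs[OF g closed_K] by metis
  define h where "h = space_op g gx"
  have h: "log_expansion K k h" unfolding h_def by (rule space_op_expansion[OF g gx(1)])
  obtain C where C: "\<And>s. 1 \<le> s \<Longrightarrow> s \<le> t + 1 \<Longrightarrow> L2_norm (\<lambda>y. wave g s y - wave g t y) \<le> C * \<bar>s - t\<bar>"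
    using wave_L2_lipschitz_time[OF g t] by metis
  obtain D where D: "\<And>s. 1 \<le> s \<Longrightarrow> s \<le> t + 1 \<Longrightarrow> L2_norm (\<lambda>y. wave h s y - wave h t y) \<le> D * \<bar>s - t\<bar>"
    using wave_L2_lipschitz_time[OF h t] by metis
  have Lg: "L2 (wave g s)" and Lh: "L2 (wave h s)" if "1 \<le> s" for s
    using wave_L2[OF g] wave_L2[OF h] that by metis+
  have w: "has_weak_deriv (wave g s) (wave h s)" if "1 \<le> s" for s
    unfolding h_def by (rule wave_weak_deriv[OF g gx(2,1)]) (use that in simp)
  show ?thesis
  proof (rule tendsto_sandwich[where f="\<lambda>_. 0"])
    show "\<forall>\<^sub>F s in at t within {1..}. H1_norm (\<lambda>y. wave g s y - wave g t y) \<le> (C + D) * \<bar>s - t\<bar>"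
      using near_time
    proof eventually_elim
      case (elim s)
      have "has_weak_deriv (\<lambda>y. wave g s y - wave g t y) (\<lambda>y. wave h s y - wave h t y)"
        using has_weak_deriv_linear[OF Lg[of s] Lh[of s] w[of s] Lg[of t] Lh[of t] w[of t], where c=1 and d="-1"] elim t by simp
      from H1I(2)[OF L2_diff[OF Lg Lg] L2_diff[OF Lh Lh] this]
      have "H1_norm (\<lambda>y. wave g s y - wave g t y) \<le> L2_norm (\<lambda>y. wave g s y - wave g t y) + L2_norm (\<lambda>y. wave h s y - wave h t y)"
        using H1_norm_le_sum[of "\<lambda>y. wave g s y - wave g t y"] elim t by simp
      then show ?case using C[of s] D[of s] elim by (simp add: distrib_right)
    qed
  qed (auto simp: H1_norm_nonneg time_dist_tendsto)
qed

text \<open>The wave is twice differentiable in time with bounded second derivative and support in a fixed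
  ball for times near \<open>t\<close>, so its difference quotients converge in \<open>L\<^sup>2\<close>, hence in \<open>H\<^sup>-\<^sup>1\<close>.\<close>

lemma wave_evolves:
  assumes g: "log_expansion K 0 g" "log_expansion K 0 gx" "log_expansion K 0 gt" "profile_derivs g gx gt"
    and h: "profile_derivs (space_op g gx) hx ht" "log_expansion K 0 hx" and t: "1 \<le> t"
  shows "evolves (wave g) (\<lambda>y. \<i> * wave (time_op g gx gt) t y + wave (space_op (space_op g gx) hx) t y) t"
proof -
  define G where "G = space_op g gx"
  define U' where "U' = time_op g gx gt"
  have Ge: "log_expansion K 0 G" unfolding G_def by (rule space_op_expansion[OF g(1,2)])
  have GGe: "log_expansion K 0 (space_op G hx)" by (rule space_op_expansion[OF Ge h(2)])
  have Ue: "log_expansion K 0 U'" unfolding U'_def by (rule time_op_expansion[OF g(1-3)])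
  have L: "L2 (wave f s)" if "log_expansion K k f" "1 \<le> s" for f k s using wave_L2[OF that(1)] that(2) by metis
  obtain R where R: "R \<ge> 1" "\<And>k g t y. log_expansion K k g \<Longrightarrow> 0 < t \<Longrightarrow> y \<notin> {- (R * t)..R * t} \<Longrightarrow> wave g t y = 0"
    using profile_radius by blast
  obtain C where C: "C \<ge> 0" "\<And>s t y. 1 \<le> s \<Longrightarrow> 1 \<le> t \<Longrightarrow>
    norm (wave g s y - wave g t y - (s - t) *\<^sub>R wave U' t y) \<le> C * \<bar>s - t\<bar>\<^sup>2"
    using wave_taylor_time[OF g] unfolding U'_def by metis
  define D where "D = C * (sqrt (2 * R) * (t + 1) powr (1/2))"
  have w1: "has_weak_deriv (wave g t) (wave G t)" unfolding G_def by (rule wave_weak_deriv[OF g(1,4,2)]) (use t in simp)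
  have w2: "has_weak_deriv (wave G t) (wave (space_op G hx) t)"
    by (rule wave_weak_deriv[OF Ge h(1)[folded G_def] h(2)]) (use t in simp)
  show ?thesis
    unfolding evolves_def G_def[symmetric] U'_def[symmetric]
  proof (intro allI impI)
    fix \<epsilon> :: real assume e: "0 < \<epsilon>"
    have "\<forall>\<^sub>F s in at t within {1..}. D * \<bar>s - t\<bar> < \<epsilon>" by (rule order_tendstoD(2)[OF time_dist_tendsto e])
    then show "\<forall>\<^sub>F s in at t within {1..}. \<forall>\<phi>\<in>test_fun.
       norm ((LINT x|lborel. (wave g s x - wave g t x) * \<phi> x) / of_real (s - t)
         - \<i> * ((LINT x|lborel. wave g t x * nth_vderiv 1 (nth_vderiv 1 \<phi>) x)
           - (LINT x|lborel. (\<i> * wave U' t x + wave (space_op G hx) t x) * \<phi> x)))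
       \<le> \<epsilon> * H1_norm \<phi>"
      using near_time
    proof eventually_elim
      case (elim s)
      have s: "1 \<le> s" "s \<le> t + 1" "s \<noteq> t" using elim by auto
      define Z where "Z = (\<lambda>y. wave g s y - wave g t y - (s - t) *\<^sub>R wave U' t y)"
      have ZL: "L2 Z" unfolding Z_def scaleR_conv_of_real
        by (intro L2_diff L2_cmult L[OF g(1)] L[OF Ue] s t)
      have zz: "Z y = 0" if y: "y \<notin> {- (R * (t + 1))..R * (t + 1)}" for y
      proof -
        have "R * s \<le> R * (t + 1)" "R * t \<le> R * (t + 1)" using R(1) s by auto
        then have "y \<notin> {- (R * s)..R * s}" "y \<notin> {- (R * t)..R * t}" using y by auto
        then show ?thesis using R(2)[OF g(1)] R(2)[OF Ue] s t by (simp add: Z_def)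
      qed
      have ZN: "L2_norm Z \<le> D * \<bar>s - t\<bar>\<^sup>2"
      proof -
        have "L2_norm Z \<le> (C * \<bar>s - t\<bar>\<^sup>2) * (sqrt (2 * R) * (t + 1) powr (1/2))"
          by (rule L2_bounded_on_cone(2)[OF L2_measurable[OF ZL] _ zz R(1)]) (use t C(2)[OF s(1) t] in \<open>auto simp: Z_def\<close>)
        then show ?thesis by (simp add: D_def mult_ac)
      qed
      show ?case
      proof
        fix \<phi> :: "real \<Rightarrow> complex" assume p: "\<phi> \<in> test_fun"
        have pL: "L2 \<phi>" by (rule test_fun_L2[OF p])
        have a: "(LINT x|lborel. wave g t x * nth_vderiv 1 (nth_vderiv 1 \<phi>) x) = (LINT x|lborel. wave (space_op G hx) t x * \<phi> x)"
          using has_weak_derivD(3)[OF w1 test_fun_deriv[OF p]] has_weak_derivD(3)[OF w2 p] by simp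
        have i1: "integrable lborel (\<lambda>x. wave U' t x * \<phi> x)" by (intro L2_integrable_mult L[OF Ue] t pL)
        have i2: "integrable lborel (\<lambda>x. wave (space_op G hx) t x * \<phi> x)" by (intro L2_integrable_mult L[OF GGe] t pL)
        have i3: "integrable lborel (\<lambda>x. (wave g s x - wave g t x) * \<phi> x)"
          by (intro L2_integrable_mult L2_diff L[OF g(1)] s t pL)
        have b: "(LINT x|lborel. (\<i> * wave U' t x + wave (space_op G hx) t x) * \<phi> x)
            = \<i> * (LINT x|lborel. wave U' t x * \<phi> x) + (LINT x|lborel. wave (space_op G hx) t x * \<phi> x)"
          using i1 i2 by (simp add: distrib_right mult.assoc)
        have "(LINT x|lborel. Z x * \<phi> x)
            = (LINT x|lborel. (wave g s x - wave g t x) * \<phi> x - of_real (s - t) * (wave U' t x * \<phi> x))"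
          by (rule Bochner_Integration.integral_cong) (auto simp: Z_def scaleR_conv_of_real algebra_simps)
        also have "\<dots> = (LINT x|lborel. (wave g s x - wave g t x) * \<phi> x) - of_real (s - t) * (LINT x|lborel. wave U' t x * \<phi> x)"
          using i1 i3 by simp
        finally have "(LINT x|lborel. (wave g s x - wave g t x) * \<phi> x) / of_real (s - t)
            = (LINT x|lborel. wave U' t x * \<phi> x) + (LINT x|lborel. Z x * \<phi> x) / of_real (s - t)"
          using s(3) by (simp add: field_simps)
        then have "(LINT x|lborel. (wave g s x - wave g t x) * \<phi> x) / of_real (s - t)
           - \<i> * ((LINT x|lborel. wave g t x * nth_vderiv 1 (nth_vderiv 1 \<phi>) x)
             - (LINT x|lborel. (\<i> * wave U' t x + wave (space_op G hx) t x) * \<phi> x)) = (LINT x|lborel. Z x * \<phi> x) / of_real (s - t)"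
          unfolding a b by (simp add: mult.assoc[symmetric])
        moreover have "norm ((LINT x|lborel. Z x * \<phi> x) / of_real (s - t)) \<le> \<epsilon> * H1_norm \<phi>"
        proof -
          have "norm (LINT x|lborel. Z x * \<phi> x) \<le> L2_norm Z * L2_norm \<phi>" by (rule L2_Cauchy_Schwarz[OF ZL pL])
          also have "\<dots> \<le> (D * \<bar>s - t\<bar>\<^sup>2) * H1_norm \<phi>"
            by (rule mult_mono[OF ZN L2_norm_le_H1_norm]) (auto simp: L2_norm_nonneg D_def C(1) R(1) order_trans[OF zero_le_one R(1)])
          finally have "norm ((LINT x|lborel. Z x * \<phi> x) / of_real (s - t)) \<le> ((D * \<bar>s - t\<bar>\<^sup>2) * H1_norm \<phi>) / \<bar>s - t\<bar>"
            using s(3) unfolding norm_divide norm_of_real by (intro divide_right_mono) auto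
          also have "\<dots> = (D * \<bar>s - t\<bar>) * H1_norm \<phi>"
            unfolding power2_eq_square[of "\<bar>s - t\<bar>"] using s(3) by (simp del: abs_mult_self_eq)
          also have "\<dots> \<le> \<epsilon> * H1_norm \<phi>" using elim by (intro mult_right_mono H1_norm_nonneg) simp
          finally show ?thesis .
        qed
        ultimately show "norm ((LINT x|lborel. (wave g s x - wave g t x) * \<phi> x) / of_real (s - t)
           - \<i> * ((LINT x|lborel. wave g t x * nth_vderiv 1 (nth_vderiv 1 \<phi>) x)
             - (LINT x|lborel. (\<i> * wave U' t x + wave (space_op G hx) t x) * \<phi> x))) \<le> \<epsilon> * H1_norm \<phi>"
          by simp
      qed
    qed
  qed
qed

end

section \<open>Differences of the nonlinearity\<close>

text \<open>Homogeneous growth of degree \<open>p\<close>, with a bound for the increment of the difference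
  \<open>f(a) - f(b)\<close> when the pair moves to \<open>(a', b')\<close>. In the application \<open>b\<close> is the smooth approximate
  solution and only \<open>a - b\<close> has to be controlled, so the increment of \<open>b\<close> alone must be accompanied
  by a factor \<open>a - b\<close>.\<close>

definition growth :: "nat \<Rightarrow> real \<Rightarrow> real \<Rightarrow> real \<Rightarrow> (complex \<Rightarrow> complex) \<Rightarrow> bool" where
  "growth p L D M f \<longleftrightarrow> 0 \<le> L \<and> 0 \<le> D \<and> 0 \<le> M \<and>
    (\<forall>r>0. \<forall>a b. norm a \<le> r \<longrightarrow> norm b \<le> r \<longrightarrow>
      norm (f a) \<le> r ^ p \<and> norm (f a - f b) \<le> L * (r ^ p / r) * norm (a - b) \<and>
      (\<forall>a' b'. norm a' \<le> r \<longrightarrow> norm b' \<le> r \<longrightarrow>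
        norm ((f a' - f b') - (f a - f b))
          \<le> D * (r ^ p / r) * norm ((a' - b') - (a - b)) + M * (r ^ p / r\<^sup>2) * (norm (a - b) * norm (b' - b))))"

lemma growthD:
  assumes "growth p L D M f"
  shows "0 \<le> L" "0 \<le> D" "0 \<le> M"
    "0 < r \<Longrightarrow> norm a \<le> r \<Longrightarrow> norm (f a) \<le> r ^ p"
    "0 < r \<Longrightarrow> norm a \<le> r \<Longrightarrow> norm b \<le> r \<Longrightarrow> norm (f a - f b) \<le> L * (r ^ p / r) * norm (a - b)"
    "0 < r \<Longrightarrow> norm a \<le> r \<Longrightarrow> norm b \<le> r \<Longrightarrow> norm a' \<le> r \<Longrightarrow> norm b' \<le> r \<Longrightarrow>
      norm ((f a' - f b') - (f a - f b))
          \<le> D * (r ^ p / r) * norm ((a' - b') - (a - b)) + M * (r ^ p / r\<^sup>2) * (norm (a - b) * norm (b' - b))"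
  using assms unfolding growth_def by blast+

lemma growth_ident: "growth 1 1 1 0 (\<lambda>z. z)"
  by (simp add: growth_def)

lemma growth_cnj: "growth 1 1 1 0 cnj"
  unfolding growth_def
  by (simp add: complex_cnj_diff[symmetric] del: complex_cnj_diff)

text \<open>The difference of products is split by the product rule into four terms. In the two mixed ones,
  an increment of \<open>a - b\<close> multiplied by another small quantity is absorbed into the \<open>D\<close> term, since
  \<open>|a - b|\<close> and \<open>|b' - b|\<close> are at most \<open>2 r\<close>.\<close>

lemma growth_mult:
  assumes f: "growth p L D M f" and g: "growth q L' D' M' g"
  shows "growth (p + q) (L + L') (D + D' + 4 * (L * L')) (M + M' + 2 * (L * L')) (\<lambda>z. f z * g z)"
  unfolding growth_def
proof (intro conjI allI impI)
  note fD = growthD[OF f] and gD = growthD[OF g]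
  show "0 \<le> L + L'" "0 \<le> D + D' + 4 * (L * L')" "0 \<le> M + M' + 2 * (L * L')"
    using fD(1-3) gD(1-3) by auto
  fix r :: real and a b :: complex assume r: "0 < r" and a: "norm a \<le> r" and b: "norm b \<le> r"
  define X where "X = r ^ p"
  define Y where "Y = r ^ q"
  have XY: "0 \<le> X" "0 \<le> Y" "r ^ (p + q) = X * Y" using r by (auto simp: X_def Y_def power_add)
  show "norm (f a * g a) \<le> r ^ (p + q)"
    unfolding norm_mult power_add using r a by (intro mult_mono fD gD) auto
  define w where "w = norm (a - b)"
  have w: "0 \<le> w" by (simp add: w_def)
  have fL: "norm (f z - f z') \<le> L * (X / r) * norm (z - z')" if "norm z \<le> r" "norm z' \<le> r" for z z'
    unfolding X_def by (rule fD(5)[OF r that])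
  have gL: "norm (g z - g z') \<le> L' * (Y / r) * norm (z - z')" if "norm z \<le> r" "norm z' \<le> r" for z z'
    unfolding Y_def by (rule gD(5)[OF r that])
  have fB: "norm (f z) \<le> X" if "norm z \<le> r" for z unfolding X_def by (rule fD(4)[OF r that])
  have gB: "norm (g z) \<le> Y" if "norm z \<le> r" for z unfolding Y_def by (rule gD(4)[OF r that])
  have "norm (f a * g a - f b * g b) = norm ((f a - f b) * g a + f b * (g a - g b))"
    by (simp add: algebra_simps)
  also have "\<dots> \<le> norm (f a - f b) * norm (g a) + norm (f b) * norm (g a - g b)"
    by (rule norm_triangle_le) (simp add: norm_mult)
  also have "\<dots> \<le> (L * (X / r) * norm (a - b)) * Y + X * (L' * (Y / r) * norm (a - b))"
    using a b XY r fD(1) gD(1) by (intro add_mono mult_mono fL gL fB gB) auto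
  also have "\<dots> = (L + L') * (r ^ (p + q) / r) * norm (a - b)"
    unfolding XY(3) by (simp add: algebra_simps add_divide_distrib)
  finally show "norm (f a * g a - f b * g b) \<le> (L + L') * (r ^ (p + q) / r) * norm (a - b)" .
  fix a' b' :: complex assume a': "norm a' \<le> r" and b': "norm b' \<le> r"
  define e where "e = norm ((a' - b') - (a - b))"
  define d where "d = norm (b' - b)"
  have ed: "0 \<le> e" "0 \<le> d" by (auto simp: e_def d_def)
  have w2: "w \<le> 2 * r" unfolding w_def using norm_triangle_ineq4[of a b] a b by simp
  have d2: "d \<le> 2 * r" unfolding d_def using norm_triangle_ineq4[of b' b] b b' by simp
  have aa: "norm (a' - a) \<le> d + e"
  proof -
    have "a' - a = (b' - b) + ((a' - b') - (a - b))" by simp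
    then show ?thesis unfolding d_def e_def by (metis norm_triangle_ineq)
  qed
  have w': "norm (a' - b') \<le> w + e"
  proof -
    have "a' - b' = (a - b) + ((a' - b') - (a - b))" by simp
    then show ?thesis unfolding w_def e_def by (metis norm_triangle_ineq)
  qed
  define Z where "Z = X * Y / r"
  have Z: "0 \<le> Z" using XY r by (simp add: Z_def)
  have t1: "norm (((f a' - f b') - (f a - f b)) * g a') \<le> D * Z * e + M * (Z / r) * (w * d)"
  proof -
    have "norm (((f a' - f b') - (f a - f b)) * g a') \<le> (D * (X / r) * e + M * (X / r\<^sup>2) * (w * d)) * Y"
      unfolding norm_mult
      using fD(6)[OF r a b a' b'] gB[OF a'] XY r fD(2,3) ed w
      by (intro mult_mono) (auto simp: X_def[symmetric] e_def[symmetric] d_def[symmetric] w_def[symmetric] intro!: add_nonneg_nonneg mult_nonneg_nonneg)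
    also have "\<dots> = D * Z * e + M * (Z / r) * (w * d)"
      by (simp add: Z_def power2_eq_square algebra_simps add_divide_distrib)
    finally show ?thesis .
  qed
  have t2: "norm ((f a - f b) * (g a' - g a)) \<le> L * L' * (Z / r) * (w * d) + 2 * (L * L') * Z * e"
  proof -
    have "norm ((f a - f b) * (g a' - g a)) \<le> (L * (X / r) * w) * (L' * (Y / r) * (d + e))"
      unfolding norm_mult
      using fL[OF a b] order_trans[OF gL[OF a' a] mult_left_mono[OF aa, of "L' * (Y / r)"]] XY r fD(1) gD(1) ed w
      by (intro mult_mono) (auto simp: w_def[symmetric])
    also have "\<dots> = L * L' * (Z / r) * (w * d) + (L * L' * (Z / r) * e) * w"
      by (simp add: Z_def algebra_simps add_divide_distrib)
    also have "(L * L' * (Z / r) * e) * w \<le> (L * L' * (Z / r) * e) * (2 * r)"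
      using w2 Z r ed fD(1) gD(1) by (intro mult_left_mono) auto
    also have "(L * L' * (Z / r) * e) * (2 * r) = 2 * (L * L') * Z * e" using r by simp
    finally show ?thesis by simp
  qed
  have t3: "norm ((f b' - f b) * (g a' - g b')) \<le> L * L' * (Z / r) * (w * d) + 2 * (L * L') * Z * e"
  proof -
    have "norm ((f b' - f b) * (g a' - g b')) \<le> (L * (X / r) * d) * (L' * (Y / r) * (w + e))"
      unfolding norm_mult
      using fL[OF b' b] order_trans[OF gL[OF a' b'] mult_left_mono[OF w', of "L' * (Y / r)"]] XY r fD(1) gD(1) ed w
      by (intro mult_mono) (auto simp: d_def[symmetric])
    also have "\<dots> = L * L' * (Z / r) * (w * d) + (L * L' * (Z / r) * e) * d"
      by (simp add: Z_def algebra_simps add_divide_distrib)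
    also have "(L * L' * (Z / r) * e) * d \<le> (L * L' * (Z / r) * e) * (2 * r)"
      using d2 Z r ed fD(1) gD(1) by (intro mult_left_mono) auto
    also have "(L * L' * (Z / r) * e) * (2 * r) = 2 * (L * L') * Z * e" using r by simp
    finally show ?thesis by simp
  qed
  have t4: "norm (f b * ((g a' - g b') - (g a - g b))) \<le> D' * Z * e + M' * (Z / r) * (w * d)"
  proof -
    have "norm (f b * ((g a' - g b') - (g a - g b))) \<le> X * (D' * (Y / r) * e + M' * (Y / r\<^sup>2) * (w * d))"
      unfolding norm_mult
      using gD(6)[OF r a b a' b'] fB[OF b] XY r ed w
      by (intro mult_mono) (auto simp: Y_def[symmetric] e_def[symmetric] d_def[symmetric] w_def[symmetric])
    also have "\<dots> = D' * Z * e + M' * (Z / r) * (w * d)"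
      by (simp add: Z_def power2_eq_square algebra_simps add_divide_distrib)
    finally show ?thesis .
  qed
  have "(f a' * g a' - f b' * g b') - (f a * g a - f b * g b)
      = ((f a' - f b') - (f a - f b)) * g a' + (f a - f b) * (g a' - g a)
        + (f b' - f b) * (g a' - g b') + f b * ((g a' - g b') - (g a - g b))"
    by (simp add: algebra_simps)
  then have "norm ((f a' * g a' - f b' * g b') - (f a * g a - f b * g b))
      \<le> norm (((f a' - f b') - (f a - f b)) * g a') + norm ((f a - f b) * (g a' - g a))
        + norm ((f b' - f b) * (g a' - g b')) + norm (f b * ((g a' - g b') - (g a - g b)))"
    by (metis (no_types, lifting) add_mono norm_triangle_le order_refl)
  also have "\<dots> \<le> (D * Z * e + M * (Z / r) * (w * d)) + (L * L' * (Z / r) * (w * d) + 2 * (L * L') * Z * e)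
      + (L * L' * (Z / r) * (w * d) + 2 * (L * L') * Z * e) + (D' * Z * e + M' * (Z / r) * (w * d))"
    by (intro add_mono t1 t2 t3 t4)
  also have "\<dots> = (D + D' + 4 * (L * L')) * Z * e + (M + M' + 2 * (L * L')) * (Z / r) * (w * d)"
    by (simp add: algebra_simps)
  finally show "norm ((f a' * g a' - f b' * g b') - (f a * g a - f b * g b))
      \<le> (D + D' + 4 * (L * L')) * (r ^ (p + q) / r) * norm ((a' - b') - (a - b))
        + (M + M' + 2 * (L * L')) * (r ^ (p + q) / r\<^sup>2) * (norm (a - b) * norm (b' - b))"
    unfolding XY(3) Z_def w_def d_def e_def by (simp add: power2_eq_square)
qed

definition cubic :: "complex \<Rightarrow> complex" where
  "cubic z = z * cnj z * z"

definition quintic :: "complex \<Rightarrow> complex" where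
  "quintic z = cubic z * (z * cnj z)"

lemma cubic_growth: "growth 3 3 15 6 cubic"
  using growth_mult[OF growth_mult[OF growth_ident growth_cnj] growth_ident]
  by (simp add: cubic_def[abs_def] numeral_eq_Suc)

lemma quintic_growth: "growth 5 5 45 20 quintic"
  using growth_mult[OF cubic_growth growth_mult[OF growth_ident growth_cnj]]
  by (simp add: quintic_def[abs_def])

abbreviation nonlin_at :: "real \<Rightarrow> real \<Rightarrow> complex \<Rightarrow> complex" where
  "nonlin_at \<beta> V z \<equiv> of_real \<beta> * cubic z - of_real V * quintic z"

lemma nonlin_eq: "nonlin W \<beta> \<gamma> t f y = nonlin_at \<beta> (W (y + \<gamma> * t)) (f y)"
proof -
  have n: "of_real ((norm z)\<^sup>2) = z * cnj z" for z :: complex by (rule complex_norm_square)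
  have n4: "complex_of_real (norm z ^ 4) = (z * cnj z) * (z * cnj z)" for z :: complex
  proof -
    have "norm z ^ 4 = (norm z)\<^sup>2 * (norm z)\<^sup>2" by (simp add: power_add[symmetric])
    then show ?thesis unfolding n[symmetric] of_real_mult[symmetric] by simp
  qed
  show ?thesis
    unfolding nonlin_def of_real_mult n n4 cubic_def quintic_def by (simp add: algebra_simps)
qed

lemma nonlin_difference:
  assumes r: "0 < r" and ab: "norm a \<le> r" "norm b \<le> r" and V: "\<bar>V\<bar> \<le> B"
  shows "norm (nonlin_at \<beta> V a - nonlin_at \<beta> V b)
    \<le> (15 * \<bar>\<beta>\<bar> * r\<^sup>2 + 45 * B * r ^ 4) * norm (a - b)"
proof -
  have B: "0 \<le> B" using V by linarith
  have p: "r ^ 3 / r = r\<^sup>2" "r ^ 5 / r = r ^ 4" using r by (auto simp: power_eq_if)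
  have c: "norm (cubic a - cubic b) \<le> 3 * r\<^sup>2 * norm (a - b)"
    using growthD(5)[OF cubic_growth r ab] unfolding p by simp
  have q: "norm (quintic a - quintic b) \<le> 5 * r ^ 4 * norm (a - b)"
    using growthD(5)[OF quintic_growth r ab] unfolding p by simp
  have "norm (nonlin_at \<beta> V a - nonlin_at \<beta> V b)
      = norm (of_real \<beta> * (cubic a - cubic b) - of_real V * (quintic a - quintic b))"
    by (simp add: algebra_simps)
  also have "\<dots> \<le> \<bar>\<beta>\<bar> * norm (cubic a - cubic b) + \<bar>V\<bar> * norm (quintic a - quintic b)"
    by (rule order_trans[OF norm_triangle_ineq4]) (simp add: norm_mult)
  also have "\<dots> \<le> \<bar>\<beta>\<bar> * (3 * r\<^sup>2 * norm (a - b)) + B * (5 * r ^ 4 * norm (a - b))"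
    using V B by (intro add_mono mult_mono c q) auto
  also have "\<dots> \<le> \<bar>\<beta>\<bar> * (15 * r\<^sup>2 * norm (a - b)) + B * (45 * r ^ 4 * norm (a - b))"
    using B by (intro add_mono mult_left_mono mult_right_mono) auto
  finally show ?thesis by (simp add: algebra_simps)
qed

lemma nonlin_second_difference:
  assumes r: "0 < r" and ab: "norm a \<le> r" "norm b \<le> r" "norm a' \<le> r" "norm b' \<le> r"
    and V: "\<bar>V\<bar> \<le> B" "\<bar>V'\<bar> \<le> B" "\<bar>V' - V\<bar> \<le> B' * h" and bb: "norm (b' - b) \<le> C * h" and h: "0 \<le> h"
  shows "norm ((nonlin_at \<beta> V' a' - nonlin_at \<beta> V' b')
      - (nonlin_at \<beta> V a - nonlin_at \<beta> V b))
    \<le> (15 * \<bar>\<beta>\<bar> * r\<^sup>2 + 45 * B * r ^ 4) * norm ((a' - b') - (a - b))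
      + h * (6 * \<bar>\<beta>\<bar> * r * C + 20 * B * r ^ 3 * C + 5 * B' * r ^ 4) * norm (a - b)"
proof -
  have B: "0 \<le> B" using V by linarith
  have p: "r ^ 3 / r = r\<^sup>2" "r ^ 5 / r = r ^ 4" "r ^ 3 / r\<^sup>2 = r" "r ^ 5 / r\<^sup>2 = r ^ 3"
    using r by (auto simp: power_eq_if)
  define e where "e = norm ((a' - b') - (a - b))"
  define w where "w = norm (a - b)"
  have w: "0 \<le> w" by (simp add: w_def)
  define c2 where "c2 = (cubic a' - cubic b') - (cubic a - cubic b)"
  define q1 where "q1 = quintic a - quintic b"
  define q2 where "q2 = (quintic a' - quintic b') - (quintic a - quintic b)"
  have c: "norm c2 \<le> 15 * r\<^sup>2 * e + 6 * r * (w * (C * h))"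
  proof -
    have "norm c2 \<le> 15 * r\<^sup>2 * e + 6 * r * (w * norm (b' - b))"
      using growthD(6)[OF cubic_growth r ab] unfolding p c2_def e_def w_def by simp
    also have "6 * r * (w * norm (b' - b)) \<le> 6 * r * (w * (C * h))"
      using r w bb by (intro mult_left_mono) auto
    finally show ?thesis by simp
  qed
  have q: "norm q2 \<le> 45 * r ^ 4 * e + 20 * r ^ 3 * (w * (C * h))"
  proof -
    have "norm q2 \<le> 45 * r ^ 4 * e + 20 * r ^ 3 * (w * norm (b' - b))"
      using growthD(6)[OF quintic_growth r ab] unfolding p q2_def e_def w_def by simp
    also have "20 * r ^ 3 * (w * norm (b' - b)) \<le> 20 * r ^ 3 * (w * (C * h))"
      using r w bb by (intro mult_left_mono) auto
    finally show ?thesis by simp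
  qed
  have q': "norm q1 \<le> 5 * r ^ 4 * w"
    using growthD(5)[OF quintic_growth r ab(1,2)] unfolding p q1_def w_def by simp
  have "(nonlin_at \<beta> V' a' - nonlin_at \<beta> V' b')
      - (nonlin_at \<beta> V a - nonlin_at \<beta> V b)
      = of_real \<beta> * c2 - of_real V' * q2 - of_real (V' - V) * q1"
    by (simp add: c2_def q2_def q1_def algebra_simps)
  also have "norm \<dots> \<le> \<bar>\<beta>\<bar> * norm c2 + \<bar>V'\<bar> * norm q2 + \<bar>V' - V\<bar> * norm q1"
    by (intro order_trans[OF norm_triangle_ineq4] add_mono) (simp_all add: norm_mult del: of_real_diff)
  also have "\<dots> \<le> \<bar>\<beta>\<bar> * (15 * r\<^sup>2 * e + 6 * r * (w * (C * h))) + B * (45 * r ^ 4 * e + 20 * r ^ 3 * (w * (C * h)))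
      + (B' * h) * (5 * r ^ 4 * w)"
    using V B q' by (intro add_mono mult_mono c q) auto
  also have "\<dots> = (15 * \<bar>\<beta>\<bar> * r\<^sup>2 + 45 * B * r ^ 4) * e + h * (6 * \<bar>\<beta>\<bar> * r * C + 20 * B * r ^ 3 * C + 5 * B' * r ^ 4) * w"
    by (simp add: algebra_simps)
  finally show ?thesis unfolding e_def w_def .
qed

section \<open>Decay of differences\<close>

lemma neg_powr_tendsto: "0 < a \<Longrightarrow> ((\<lambda>t::real. C * t powr (- a)) \<longlongrightarrow> 0) at_top"
  using tendsto_mult_right_zero[OF tendsto_neg_powr[of "- a" "\<lambda>t. t" at_top], of C] by (simp add: filterlim_ident)

text \<open>The part of the forcing that is linear in \<open>q\<close> lets the norm vary at most like \<open>t\<^sup>0\<^sup>.\<^sup>4\<close>. The a priori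
  decay \<open>t\<^sup>-\<^sup>3\<^sup>/\<^sup>4\<close> is faster, so integration from infinity leaves only the remaining forcing.\<close>

lemma energy_decay:
  assumes T: "1 < T" and m: "2 \<le> m" and c: "0 \<le> c"
    and H: "\<And>s. 1 \<le> s \<Longrightarrow> H1 (q s)"
    and cont: "\<And>t. 1 \<le> t \<Longrightarrow> ((\<lambda>s. H1_norm (\<lambda>x. q s x - q t x)) \<longlongrightarrow> 0) (at t within {1..})"
    and ev: "\<And>t. T \<le> t \<Longrightarrow> evolves q (F t) t" and F: "\<And>t. T \<le> t \<Longrightarrow> L2 (F t)"
    and le: "\<And>t. T \<le> t \<Longrightarrow> L2_norm (F t) \<le> 4/10 / t * L2_norm (q t) + c * t powr (- m)"
    and apriori: "\<And>t. T \<le> t \<Longrightarrow> L2_norm (q t) \<le> C * t powr (- 3/4)" and t: "T \<le> t"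
  shows "L2_norm (q t) \<le> 2 * c * t powr (- (m - 1))"
proof -
  define y where "y t = (L2_norm (q t))\<^sup>2" for t
  have "y t \<le> 2 * c\<^sup>2 / ((2 * m - 2) - 13/10) * t powr (- (2 * m - 2))"
  proof (rule decay_from_infinity[OF T _ _ _ _ t])
    fix s assume s: "T \<le> s"
    then have s1: "1 \<le> s" "0 < s" using T by auto
    show "(y has_real_derivative 2 * Im (LINT x|lborel. F s x * cnj (q s x))) (at s within {1..})"
      unfolding y_def by (rule energy_identity[OF ev[OF s] s1(1) F[OF s] H cont[OF s1(1)]])
    define Q where "Q = L2_norm (q s)"
    have Q: "0 \<le> Q" by (simp add: Q_def L2_norm_nonneg)
    have "\<bar>Im (LINT x|lborel. F s x * cnj (q s x))\<bar> \<le> L2_norm (F s) * Q"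
      using abs_Im_le_cmod[of "LINT x|lborel. F s x * cnj (q s x)"]
        L2_Cauchy_Schwarz[OF F[OF s] L2_cnj[OF H1D(1)[OF H[OF s1(1)]]]] by (simp add: L2_norm_cnj Q_def)
    also have "\<dots> \<le> (4/10 / s * Q + c * s powr (- m)) * Q"
      using le[OF s] Q by (intro mult_right_mono) (auto simp: Q_def)
    also have "\<dots> = 4/10 / s * Q\<^sup>2 + (c * s powr (- m)) * Q" by (simp add: power2_eq_square algebra_simps)
    also have "(c * s powr (- m)) * Q \<le> 1/4 * Q\<^sup>2 / s + c\<^sup>2 * s powr (1 - 2 * m)"
    proof -
      \<comment> \<open>Young's inequality with weight \<open>s\<close>, so that the quadratic term stays scale invariant.\<close>
      have "0 \<le> (Q / (2 * sqrt s) - c * s powr (- m) * sqrt s)\<^sup>2" by simp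
      also have "\<dots> = Q\<^sup>2 / (4 * s) + (c * s powr (- m))\<^sup>2 * s - (c * s powr (- m)) * Q"
        using s1 by (simp add: power2_diff power_divide power_mult_distrib)
      also have "(c * s powr (- m))\<^sup>2 * s = c\<^sup>2 * s powr (1 - 2 * m)"
      proof -
        have "(s powr (- m))\<^sup>2 * s = s powr (- m) * s powr (- m) * s powr 1" using s1 by (simp add: power2_eq_square)
        also have "\<dots> = s powr (1 - 2 * m)" by (simp only: powr_add[symmetric]) simp
        finally show ?thesis by (simp add: power_mult_distrib)
      qed
      finally show ?thesis by simp
    qed
    finally have "\<bar>Im (LINT x|lborel. F s x * cnj (q s x))\<bar> \<le> 4/10 / s * Q\<^sup>2 + (1/4 * Q\<^sup>2 / s + c\<^sup>2 * s powr (1 - 2 * m))" by simp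
    moreover have "4/10 / s * Q\<^sup>2 + (1/4 * Q\<^sup>2 / s) = 13/20 / s * Q\<^sup>2" by simp
    moreover have "- (2 * m - 2) - 1 = 1 - 2 * m" by simp
    ultimately show "- (13/10 / s * y s) - 2 * c\<^sup>2 * s powr (- (2 * m - 2) - 1) \<le> 2 * Im (LINT x|lborel. F s x * cnj (q s x))"
      unfolding y_def Q_def[symmetric] by (simp add: abs_le_iff)
  next
    show "((\<lambda>t. t powr (13/10) * y t) \<longlongrightarrow> 0) at_top"
    proof (rule tendsto_sandwich[where f="\<lambda>_. 0"])
      show "\<forall>\<^sub>F t in at_top. t powr (13/10) * y t \<le> C\<^sup>2 * t powr (- (2/10))"
        using eventually_ge_at_top[of T]
      proof eventually_elim
        case (elim t)
        then have t0: "0 < t" using T by simp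
        have "y t \<le> (C * t powr (- 3/4))\<^sup>2"
          unfolding y_def by (intro power_mono apriori elim L2_norm_nonneg)
        also have "\<dots> = C\<^sup>2 * (t powr (- 3/4) * t powr (- 3/4))" by (simp add: power2_eq_square)
        also have "t powr (- 3/4) * t powr (- 3/4) = t powr (- (3/2))" by (simp add: powr_add[symmetric])
        finally have "t powr (13/10) * y t \<le> t powr (13/10) * (C\<^sup>2 * t powr (- (3/2)))" by (intro mult_left_mono) auto
        also have "\<dots> = C\<^sup>2 * (t powr (13/10) * t powr (- (3/2)))" by simp
        also have "t powr (13/10) * t powr (- (3/2)) = t powr (- (2/10))" by (simp only: powr_add[symmetric]) simp
        finally show ?case .
      qed
    qed (auto simp: y_def intro: neg_powr_tendsto)
  qed (use m in auto)
  also have "\<dots> \<le> (4 * c\<^sup>2) * t powr (- (2 * m - 2))"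
  proof (rule mult_right_mono)
    have "2 * c\<^sup>2 / ((2 * m - 2) - 13/10) \<le> 2 * c\<^sup>2 / (1/2)"
      using m by (intro divide_left_mono) auto
    then show "2 * c\<^sup>2 / ((2 * m - 2) - 13/10) \<le> 4 * c\<^sup>2" by simp
  qed simp
  also have "\<dots> = (2 * c * t powr (- (m - 1)))\<^sup>2"
  proof -
    have "t powr (- (2 * m - 2)) = t powr (- (m - 1)) * t powr (- (m - 1))" by (simp add: powr_add[symmetric])
    then show ?thesis by (simp add: power2_eq_square)
  qed
  finally show ?thesis unfolding y_def
    by (rule power2_le_imp_le) (use c in simp)
qed

lemma AE_shift:
  fixes h :: real
  assumes "AE x in lborel. P x"
  shows "AE x in lborel. P (x + h)"
proof -
  from assms obtain N where N: "N \<in> null_sets lborel" "{x. \<not> P x} \<subseteq> N"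
    by (auto simp: eventually_ae_filter)
  have "{x. x - (- h) \<in> N} \<in> null_sets lborel" by (rule null_sets_translation[OF N(1)])
  from AE_not_in[OF this] have "AE x in lborel. x + h \<notin> N" by simp
  then show ?thesis by eventually_elim (use N(2) in blast)
qed

section \<open>Solutions are close to the approximate solutions\<close>

lemma Linf_norm_AE:
  assumes "Linf_norm f \<le> ereal c"
  shows "AE x in lborel. norm (f x) \<le> c"
proof -
  have "AE x in lborel. ereal (norm (f x)) \<le> Linf_norm f"
    unfolding Linf_norm_def by (rule esssup_AE)
  then show ?thesis
    by eventually_elim (metis assms ereal_less_eq(3) order_trans)
qed

lemma Linf_norm_nonneg: "0 \<le> Linf_norm f"
proof (cases "(\<lambda>x. ereal (norm (f x))) \<in> borel_measurable lborel")
  case True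
  have "esssup lborel (\<lambda>x::real. 0::ereal) = 0"
    by (rule esssup_const) simp
  moreover have "esssup lborel (\<lambda>x::real. 0::ereal) \<le> Linf_norm f"
    unfolding Linf_norm_def by (rule esssup_mono) simp_all
  ultimately show ?thesis by simp
qed (simp add: Linf_norm_def esssup_non_measurable top_ereal_def)

lemma continuous_AE_bound:
  fixes f :: "real \<Rightarrow> real"
  assumes "continuous_on UNIV f" "AE x in lborel. f x \<le> c"
  shows "f x \<le> c"
proof (rule ccontr)
  assume "\<not> f x \<le> c"
  have op: "open {x. c < f x}" using assms(1) by (intro open_Collect_less continuous_intros) auto
  moreover have "x \<in> {x. c < f x}" using \<open>\<not> f x \<le> c\<close> by simp
  ultimately obtain e where e: "0 < e" "ball x e \<subseteq> {x. c < f x}" by (meson openE)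
  have "AE y in lborel. y \<notin> ball x e"
    using assms(2) by eventually_elim (use e(2) in force)
  then have "emeasure lborel (ball x e) = 0"
    by (subst (asm) AE_iff_measurable[of "ball x e"]) auto
  then show False using e(1) by (simp add: ball_eq_greaterThanLessThan)
qed

lemma schwartz_decay:
  fixes W :: "real \<Rightarrow> real"
  assumes "schwartz W"
  obtains C where "C \<ge> 0" "\<And>x. \<bar>x\<bar> ^ k * \<bar>W x\<bar> \<le> C" "\<And>x. \<bar>x\<bar> ^ k * \<bar>nth_vderiv 1 W x\<bar> \<le> C"
proof -
  obtain C0 where C0: "\<And>x. \<bar>x\<bar> ^ k * norm (nth_vderiv 0 W x) \<le> C0"
    using assms unfolding schwartz_def by blast
  obtain C1 where C1: "\<And>x. \<bar>x\<bar> ^ k * norm (nth_vderiv 1 W x) \<le> C1"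
    using assms unfolding schwartz_def by blast
  have "0 \<le> C0" using C0[of 0] by (meson mult_nonneg_nonneg norm_ge_zero order_trans zero_le_power abs_ge_zero)
  then show ?thesis
    using C0 C1 by (intro that[of "max C0 C1"]) (auto simp: nth_vderiv_0 le_max_iff_disj simp del: One_nat_def)
qed

lemma schwartz_smooth: "schwartz W \<Longrightarrow> smooth W"
  by (simp add: schwartz_def)

text \<open>The uniform norm of the profile wave at time \<open>2\<close> already controls \<open>|A|\<close> everywhere, by continuity. If the supremum over all
  times were infinite, smallness would force \<open>\<beta> = 0\<close>.\<close>

lemma small_profile_bound:
  assumes A: "A \<in> test_fun" and s: "small_profile \<eta> m W \<beta> A" and \<eta>: "0 < \<eta>"
  shows "\<bar>\<beta>\<bar> * (norm (A x))\<^sup>2 \<le> \<eta>"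
proof (cases "\<beta> = 0")
  case False
  define a where "a = a_size \<beta> A"
  have le: "ereal \<bar>\<beta>\<bar> * a\<^sup>2 \<le> ereal \<eta>" using s by (simp add: small_profile_def a_def)
  have "ereal (2 powr (1/2)) * (Linf_norm (u_asym \<beta> A 2) + Linf_norm (weak_deriv (u_asym \<beta> A 2))) \<le> a"
    unfolding a_def a_size_def by (rule SUP_upper) simp
  moreover have "ereal (2 powr (1/2)) * Linf_norm (u_asym \<beta> A 2)
      \<le> ereal (2 powr (1/2)) * (Linf_norm (u_asym \<beta> A 2) + Linf_norm (weak_deriv (u_asym \<beta> A 2)))"
    by (intro ereal_mult_left_mono) (use Linf_norm_nonneg[of "weak_deriv (u_asym \<beta> A 2)"] in \<open>auto intro: add_increasing2\<close>)
  ultimately have a1: "ereal (2 powr (1/2)) * Linf_norm (u_asym \<beta> A 2) \<le> a" by (rule order_trans[rotated])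
  have a0: "0 \<le> a" by (rule order_trans[OF _ a1]) (simp add: Linf_norm_nonneg)
  obtain r where r: "a = ereal r"
  proof (cases a)
    case PInf
    then show ?thesis using le False by (simp add: power2_eq_square)
  qed (use a0 in auto)
  have r0: "0 \<le> r" using a0 r by simp
  have br: "\<bar>\<beta>\<bar> * r\<^sup>2 \<le> \<eta>" using le by (simp add: r power2_eq_square)
  define L where "L = 2 powr (- 1/2) * r"
  have "Linf_norm (u_asym \<beta> A 2) \<le> ereal L"
  proof -
    have "ereal (2 powr (- 1/2)) * (ereal (2 powr (1/2)) * Linf_norm (u_asym \<beta> A 2)) \<le> ereal (2 powr (- 1/2)) * ereal r"
      using a1 r by (intro ereal_mult_left_mono) auto
    moreover have "ereal (2 powr (- 1/2)) * (ereal (2 powr (1/2)) * Linf_norm (u_asym \<beta> A 2)) = Linf_norm (u_asym \<beta> A 2)"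
      by (simp add: mult.assoc[symmetric] powr_add[symmetric])
    ultimately show ?thesis by (simp add: L_def)
  qed
  from Linf_norm_AE[OF this] have ae: "AE y in lborel. norm (u_asym \<beta> A 2 y) \<le> L" .
  have nu: "norm (u_asym \<beta> A 2 y) = 2 powr (-1/2) * norm (A (1/2 * y + 0))" for y
    by (simp add: u_asym_def norm_mult)
  have "continuous_on UNIV (\<lambda>y. norm (u_asym \<beta> A 2 y))"
    unfolding nu
    by (intro continuous_intros smooth_continuous smooth_affine test_fun_smooth A)
  from continuous_AE_bound[OF this ae, of "2 * x"] have "norm (A x) \<le> r"
    unfolding nu L_def by simp
  then have "(norm (A x))\<^sup>2 \<le> r\<^sup>2" by (intro power_mono) auto
  then have "\<bar>\<beta>\<bar> * (norm (A x))\<^sup>2 \<le> \<bar>\<beta>\<bar> * r\<^sup>2" by (intro mult_left_mono) auto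
  then show ?thesis using br by linarith
qed (use \<eta> in simp)

lemma log_rate_bound:
  fixes C B :: real
  assumes "0 \<le> B"
  obtains C' where "C' \<ge> 0" "\<And>t. 1 \<le> t \<Longrightarrow> C * t powr (- 1) * (1 + B * ln t)\<^sup>2 \<le> C' * t powr (- 3/4)"
proof -
  have "C * t powr (- 1) * (1 + B * ln t)\<^sup>2 \<le> (\<bar>C\<bar> * (1 + 8 * B)\<^sup>2) * t powr (- 3/4)" if t: "1 \<le> t" for t
  proof -
    have "ln t \<le> t powr (1/8) / (1/8)" using t by (intro ln_powr_bound) auto
    then have "B * ln t \<le> B * (8 * t powr (1/8))" using assms by (intro mult_left_mono) auto
    moreover have "1 \<le> t powr (1/8)" using t by (simp add: ge_one_powr_ge_zero)
    ultimately have "1 + B * ln t \<le> (1 + 8 * B) * t powr (1/8)" by (simp add: algebra_simps)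
    then have "(1 + B * ln t)\<^sup>2 \<le> ((1 + 8 * B) * t powr (1/8))\<^sup>2" using t assms by (intro power_mono) auto
    also have "\<dots> = (1 + 8 * B)\<^sup>2 * (t powr (1/8) * t powr (1/8))" by (simp add: power2_eq_square)
    also have "t powr (1/8) * t powr (1/8) = t powr (1/4)" by (simp add: powr_add[symmetric])
    finally have b: "(1 + B * ln t)\<^sup>2 \<le> (1 + 8 * B)\<^sup>2 * t powr (1/4)" .
    have "C * t powr (- 1) * (1 + B * ln t)\<^sup>2 \<le> \<bar>C\<bar> * t powr (- 1) * ((1 + 8 * B)\<^sup>2 * t powr (1/4))"
      by (intro mult_mono b mult_right_mono) auto
    also have "\<dots> = (\<bar>C\<bar> * (1 + 8 * B)\<^sup>2) * (t powr (- 1) * t powr (1/4))" by simp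
    also have "t powr (- 1) * t powr (1/4) = t powr (- 3/4)" by (simp only: powr_add[symmetric]) simp
    finally show ?thesis .
  qed
  then show ?thesis by (intro that[of "\<bar>C\<bar> * (1 + 8 * B)\<^sup>2"]) auto
qed

lemma ereal_sum_leD:
  assumes "ereal a + b \<le> ereal c" "0 \<le> a" "0 \<le> b"
  shows "a \<le> c" "b \<le> ereal c"
proof -
  have "ereal a \<le> ereal a + b" using assms(3) by (rule add_increasing2) simp
  from order_trans[OF this assms(1)] show "a \<le> c" by simp
  have "b \<le> ereal a + b" using assms(2) by (intro add_increasing) auto
  from order_trans[OF this assms(1)] show "b \<le> ereal c" .
qed

lemma nonlin_L2:
  assumes u: "H1 f" and W: "W \<in> borel_measurable borel" "\<And>x. \<bar>W x\<bar> \<le> B"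
  shows "L2 (nonlin W \<beta> \<gamma> t f)"
proof -
  note f = H1D(1)[OF u]
  define M where "M = H1_norm f + 1"
  have M: "0 < M" using H1_norm_nonneg[of f] by (simp add: M_def)
  define C where "C = 15 * \<bar>\<beta>\<bar> * M\<^sup>2 + 45 * B * M ^ 4"
  have m: "nonlin W \<beta> \<gamma> t f \<in> borel_measurable borel"
    unfolding nonlin_def[abs_def] using L2_measurable[OF f] W(1) by measurable
  have "AE x in lborel. norm (nonlin W \<beta> \<gamma> t f x) \<le> norm (of_real C * f x)"
    using Sobolev_inequality[OF u]
  proof eventually_elim
    case (elim x)
    have "norm (nonlin W \<beta> \<gamma> t f x) \<le> C * norm (f x)"
      using nonlin_difference[OF M _ _ W(2), of "f x" 0 \<beta> "x + \<gamma> * t"] elim M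
      by (simp add: nonlin_eq cubic_def quintic_def C_def M_def)
    also have "\<dots> \<le> \<bar>C\<bar> * norm (f x)" by (intro mult_right_mono) auto
    finally show ?case by (simp add: norm_mult)
  qed
  from L2_dominated(1)[OF L2_cmult[OF f] m this] show ?thesis .
qed

context scattering_profile
begin

lemma wave_square:
  assumes "0 < t"
  shows "wave g t y * cnj (wave g t y) = of_real (1 / t) * (g t (y / t) * cnj (g t (y / t)))"
proof -
  define P where "P = cis (y\<^sup>2 / (4 * t) - \<beta> * (norm (A (y / t)))\<^sup>2 * ln t)"
  have P: "P * cnj P = 1" by (simp add: P_def cis_cnj cis_mult)
  have r: "complex_of_real (t powr (-1/2)) * of_real (t powr (-1/2)) = of_real (1 / t)"
  proof -
    have "t powr (-1/2) * t powr (-1/2) = t powr (- 1)" by (simp only: powr_add[symmetric]) simp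
    also have "\<dots> = 1 / t" using assms by (simp add: powr_minus divide_inverse)
    finally show ?thesis by (simp only: of_real_mult[symmetric])
  qed
  have "wave g t y * cnj (wave g t y)
      = (of_real (t powr (-1/2)) * of_real (t powr (-1/2))) * (P * cnj P) * (g t (y / t) * cnj (g t (y / t)))"
    unfolding wave_def P_def[symmetric] complex_cnj_mult complex_cnj_complex_of_real by (simp only: mult_ac)
  then show ?thesis unfolding P r by simp
qed

lemma wave_cmult: "c * wave g t y = wave (\<lambda>t x. c * g t x) t y"
  by (simp add: wave_def)

lemma wave_add: "wave g t y + wave h t y = wave (\<lambda>t x. g t x + h t x) t y"
  by (simp add: wave_def algebra_simps)

definition wave_quintic :: "(real \<Rightarrow> real \<Rightarrow> complex) \<Rightarrow> real \<Rightarrow> real \<Rightarrow> complex" where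
  "wave_quintic g t x = of_real (1 / t) * (of_real (1 / t) *
     (g t x * (g t x * cnj (g t x)) * (g t x * cnj (g t x))))"

lemma cubic_wave:
  assumes "0 < t"
  shows "cubic (wave g t y) = wave (\<lambda>t x. of_real (1 / t) * (g t x * cnj (g t x) * g t x)) t y"
  unfolding cubic_def wave_square[OF assms] by (simp add: wave_def)

lemma quintic_wave:
  assumes "0 < t"
  shows "quintic (wave g t y) = wave (wave_quintic g) t y"
  unfolding quintic_def cubic_def wave_square[OF assms] by (simp add: wave_def wave_quintic_def)

lemma wave_quintic_expansion:
  assumes "log_expansion K 0 g"
  shows "log_expansion K 0 (wave_quintic g)"
proof -
  have 2: "log_expansion K 0 (\<lambda>t x. g t x * cnj (g t x))"
    using log_expansion_mult[OF assms log_expansion_cnj[OF assms]] by simp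
  have 3: "log_expansion K 0 (\<lambda>t x. g t x * (g t x * cnj (g t x)))"
    using log_expansion_mult[OF assms 2] by simp
  have 5: "log_expansion K 0 (\<lambda>t x. g t x * (g t x * cnj (g t x)) * (g t x * cnj (g t x)))"
    using log_expansion_mult[OF 3 2] by simp
  show ?thesis
    unfolding wave_quintic_def[abs_def]
    by (rule log_expansion_mono[OF log_expansion_inverse_mult[OF log_expansion_inverse_mult[OF 5]]]) simp
qed

lemma u_asym_wave: "u_asym \<beta> A t y = wave (\<lambda>t. A) t y"
proof -
  have "cis (y\<^sup>2 / (4 * t)) * cis (- (\<beta> * (norm (A (y / t)))\<^sup>2 * ln t))
      = cis (y\<^sup>2 / (4 * t) - \<beta> * (norm (A (y / t)))\<^sup>2 * ln t)"
    by (simp add: cis_mult)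
  from this[symmetric] show ?thesis unfolding u_asym_def wave_def by (simp only: mult_ac)
qed

text \<open>On the support of the waves the argument of the potential is at least a multiple of \<open>t\<close>.\<close>

lemma potential_decay:
  assumes W: "schwartz W" and away: "supported_away_from A (- \<gamma>)"
  obtains C where "C \<ge> 0"
    "\<And>t y. 1 \<le> t \<Longrightarrow> y / t \<in> K \<Longrightarrow> \<bar>W (y + \<gamma> * t)\<bar> \<le> C * t powr (- real m)"
    "\<And>t y. 1 \<le> t \<Longrightarrow> y / t \<in> K \<Longrightarrow> \<bar>nth_vderiv 1 W (y + \<gamma> * t)\<bar> \<le> C * t powr (- real m)"
proof (cases "K = {}")
  case True
  then show ?thesis using that[of 0] by auto
next
  case False
  define d where "d = setdist K {- \<gamma>}"
  have d: "0 < d" using away False by (simp add: supported_away_from_def d_def)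
  obtain C where C: "C \<ge> 0" "\<And>x. \<bar>x\<bar> ^ m * \<bar>W x\<bar> \<le> C" "\<And>x. \<bar>x\<bar> ^ m * \<bar>nth_vderiv 1 W x\<bar> \<le> C"
    using schwartz_decay[OF W] by metis
  have *: "v \<le> C / d ^ m * t powr (- real m)"
    if t: "1 \<le> t" and k: "y / t \<in> K" and v: "0 \<le> v" "\<bar>y + \<gamma> * t\<bar> ^ m * v \<le> C" for t y v
  proof -
    have "d \<le> dist (y / t) (- \<gamma>)" unfolding d_def by (rule setdist_le_dist) (use k in auto)
    then have "d * t \<le> \<bar>y / t + \<gamma>\<bar> * t" using t by (intro mult_right_mono) (auto simp: dist_real_def)
    also have "\<dots> = \<bar>(y / t + \<gamma>) * t\<bar>" using t by (simp add: abs_mult)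
    also have "(y / t + \<gamma>) * t = y + \<gamma> * t" using t by (simp add: algebra_simps)
    finally have "(d * t) ^ m \<le> \<bar>y + \<gamma> * t\<bar> ^ m" using d t by (intro power_mono) auto
    then have "(d * t) ^ m * v \<le> C" using v by (meson mult_right_mono order_trans)
    then have "v \<le> C / (d * t) ^ m" using d t by (simp add: pos_le_divide_eq mult.commute)
    also have "\<dots> = C / d ^ m * t powr (- real m)"
      using t by (simp add: power_mult_distrib powr_minus powr_realpow divide_inverse)
    finally show ?thesis .
  qed
  show ?thesis
    by (rule that[of "C / d ^ m"]) (use * C d in \<open>auto simp del: One_nat_def\<close>)
qed

text \<open>The error of the approximate solution: the residual of the cubic equation, and the quintic
  term, which is small because of the potential.\<close>

lemma error_bounds:
  assumes W: "schwartz W" and away: "supported_away_from A (- \<gamma>)"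
    and r: "log_expansion K (n + 2) r" and q: "log_expansion K 0 q"
  obtains C where "C \<ge> 0" "\<And>t. 1 \<le> t \<Longrightarrow> L2 (\<lambda>y. wave r t y + of_real (W (y + \<gamma> * t)) * wave q t y)"
    "\<And>t. 1 \<le> t \<Longrightarrow> L2_norm (\<lambda>y. wave r t y + of_real (W (y + \<gamma> * t)) * wave q t y) \<le> C * t powr (- (real n + 1))"
    "\<And>t h. 1 \<le> t \<Longrightarrow> 0 \<le> h \<Longrightarrow> h \<le> 1 \<Longrightarrow>
       L2_norm (\<lambda>y. (wave r t (y + h) + of_real (W (y + h + \<gamma> * t)) * wave q t (y + h))
         - (wave r t y + of_real (W (y + \<gamma> * t)) * wave q t y)) \<le> h * (C * t powr (- (real n + 1)))"
proof -
  obtain R where R: "R \<ge> 1" "\<And>k g t y. log_expansion K k g \<Longrightarrow> 0 < t \<Longrightarrow> y \<notin> {- (R * t)..R * t} \<Longrightarrow> wave g t y = 0"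
    using profile_radius by blast
  obtain rx rt where rx: "log_expansion K (n + 2) rx" "profile_derivs r rx rt"
    using log_expansion_derivs[OF r closed_K] by metis
  obtain qx qt where qx: "log_expansion K 0 qx" "profile_derivs q qx qt"
    using log_expansion_derivs[OF q closed_K] by metis
  note re = space_op_expansion[OF r rx(1)] and qe = space_op_expansion[OF q qx(1)]
  obtain C1 where C1: "C1 \<ge> 0" "\<And>t y. 1 \<le> t \<Longrightarrow> norm (wave r t y) \<le> C1 * t powr (- 1/4 - real (n + 2))"
    using wave_bound[OF r] by metis
  obtain C2 where C2: "C2 \<ge> 0" "\<And>t y. 1 \<le> t \<Longrightarrow> norm (wave (space_op r rx) t y) \<le> C2 * t powr (- 1/4 - real (n + 2))"
    using wave_bound[OF re] by metis
  obtain C3 where C3: "C3 \<ge> 0" "\<And>t y. 1 \<le> t \<Longrightarrow> norm (wave q t y) \<le> C3" using wave_bounded[OF q] by metis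
  obtain C4 where C4: "C4 \<ge> 0" "\<And>t y. 1 \<le> t \<Longrightarrow> norm (wave (space_op q qx) t y) \<le> C4" using wave_bounded[OF qe] by metis
  obtain D where D: "D \<ge> 0"
    "\<And>t y. 1 \<le> t \<Longrightarrow> y / t \<in> K \<Longrightarrow> \<bar>W (y + \<gamma> * t)\<bar> \<le> D * t powr (- real (n + 2))"
    "\<And>t y. 1 \<le> t \<Longrightarrow> y / t \<in> K \<Longrightarrow> \<bar>nth_vderiv 1 W (y + \<gamma> * t)\<bar> \<le> D * t powr (- real (n + 2))"
    using potential_decay[OF W away] by metis
  define B where "B = C1 + C2 + D * C3 + D * C4"
  have B0: "0 \<le> B" using C1 C2 C3 C4 D by (simp add: B_def)
  define C where "C = B * sqrt (2 * (R + 1))"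
  define E where "E t y = wave r t y + of_real (W (y + \<gamma> * t)) * wave q t y" for t y
  define E' where "E' t y = wave (space_op r rx) t y + (of_real (W (y + \<gamma> * t)) * wave (space_op q qx) t y
      + of_real (nth_vderiv 1 W (y + \<gamma> * t)) * wave q t y)" for t y
  have main: "L2 (E t) \<and> L2_norm (E t) \<le> C * t powr (- (real n + 1)) \<and>
      (\<forall>h. 0 \<le> h \<longrightarrow> h \<le> 1 \<longrightarrow> L2_norm (\<lambda>y. E t (y + h) - E t y) \<le> h * (C * t powr (- (real n + 1))))" if t: "1 \<le> t" for t
  proof -
    have t0: "0 < t" using t by simp
    define b where "b = t powr (- real (n + 2))"
    have b: "t powr (- 1/4 - real (n + 2)) \<le> b" "0 \<le> b" unfolding b_def using t by (auto intro: powr_mono)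
    have dE: "(E t has_vector_derivative E' t y) (at y)" for y
    proof -
      have "((\<lambda>y. y + \<gamma> * t) has_vector_derivative 1) (at y)" by (auto intro!: derivative_eq_intros)
      from vector_diff_chain_at[OF this smooth_has_vderiv[OF schwartz_smooth[OF W]]]
      have "((\<lambda>y. W (y + \<gamma> * t)) has_vector_derivative nth_vderiv 1 W (y + \<gamma> * t)) (at y)"
        by (simp add: o_def del: One_nat_def)
      note dW = bounded_linear.has_vector_derivative[OF bounded_linear_of_real this]
      show ?thesis unfolding E_def E'_def
        by (intro has_vector_derivative_add has_vector_derivative_mult dW wave_deriv_y t0)
          (use rx(2) qx(2) in \<open>auto simp: profile_derivs_def\<close>)
    qed
    have bE: "norm (E t y) \<le> B * b" for y
    proof (cases "y / t \<in> K")
      case True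
      have "norm (E t y) \<le> norm (wave r t y) + \<bar>W (y + \<gamma> * t)\<bar> * norm (wave q t y)"
        unfolding E_def by (rule norm_triangle_le) (simp add: norm_mult)
      also have "\<dots> \<le> C1 * b + (D * b) * C3"
        using C1(2)[OF t] mult_left_mono[OF b(1) C1(1)] D(2)[OF t True] C3(2)[OF t] D(1) b(2)
        by (intro add_mono mult_mono) (auto simp: b_def intro: order_trans)
      also have "\<dots> \<le> B * b" using C2 C4 D b by (simp add: B_def algebra_simps)
      finally show ?thesis .
    next
      case False
      then show ?thesis using wave_zero[OF r False] wave_zero[OF q False] B0 b by (simp add: E_def)
    qed
    have bE': "norm (E' t y) \<le> B * b" for y
    proof (cases "y / t \<in> K")
      case True
      have "norm (E' t y) \<le> norm (wave (space_op r rx) t y) + (\<bar>W (y + \<gamma> * t)\<bar> * norm (wave (space_op q qx) t y)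
          + \<bar>nth_vderiv 1 W (y + \<gamma> * t)\<bar> * norm (wave q t y))"
        unfolding E'_def by (intro norm_triangle_le add_left_mono) (simp add: norm_mult del: One_nat_def)
      also have "\<dots> \<le> C2 * b + ((D * b) * C4 + (D * b) * C3)"
        using C2(2)[OF t] mult_left_mono[OF b(1) C2(1)] D(2,3)[OF t True] C3(2)[OF t] C4(2)[OF t] D(1) b(2)
        by (intro add_mono mult_mono) (auto simp: b_def intro: order_trans simp del: One_nat_def)
      also have "\<dots> \<le> B * b" using C1 D b by (simp add: B_def algebra_simps)
      finally show ?thesis .
    next
      case False
      then show ?thesis using wave_zero[OF re False] wave_zero[OF qe False] wave_zero[OF q False] B0 b by (simp add: E'_def)
    qed
    have zE: "E t y = 0" if "y \<notin> {- (R * t)..R * t}" for y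
      using R(2)[OF r t0 that] R(2)[OF q t0 that] by (simp add: E_def)
    have Rt: "0 \<le> R * t" using R(1) t by simp
    have c: "L2 (E t)" "L2_norm (E t) \<le> B * b * sqrt (2 * (R * t))"
      "0 \<le> h \<Longrightarrow> h \<le> 1 \<Longrightarrow> L2_norm (\<lambda>y. E t (y + h) - E t y) \<le> h * (B * b * sqrt (2 * (R * t + 1)))" for h
      using C1_compact_support_L2[OF dE bE bE' _ Rt] zE by blast+
    have root: "B * b * sqrt (2 * S) \<le> C * t powr (- (real n + 1))" if S: "0 \<le> S" "S \<le> (R + 1) * t" for S
    proof -
      have "sqrt (2 * S) \<le> sqrt (2 * (R + 1) * t)" using S by (intro real_sqrt_le_mono) (simp add: algebra_simps)
      also have "\<dots> = sqrt (2 * (R + 1)) * sqrt t" by (rule real_sqrt_mult)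
      also have "\<dots> \<le> sqrt (2 * (R + 1)) * t"
      proof (rule mult_left_mono)
        show "sqrt t \<le> t" by (rule real_le_lsqrt) (use t in \<open>auto simp: power2_eq_square\<close>)
      qed (use R(1) in simp)
      finally have "B * b * sqrt (2 * S) \<le> B * b * (sqrt (2 * (R + 1)) * t)" using B0 b by (intro mult_left_mono) auto
      also have "\<dots> = C * (b * t)" by (simp add: C_def)
      also have "b * t = t powr (- (real n + 1))"
      proof -
        have "b * t = t powr (- real (n + 2)) * t powr 1" using t by (simp add: b_def)
        also have "\<dots> = t powr (- real (n + 2) + 1)" by (simp only: powr_add[symmetric])
        also have "- real (n + 2) + 1 = - (real n + 1)" by simp
        finally show ?thesis .
      qed
      finally show ?thesis .
    qed
    have "L2_norm (\<lambda>y. E t (y + h) - E t y) \<le> h * (C * t powr (- (real n + 1)))" if "0 \<le> h" "h \<le> 1" for h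
    proof -
      have "h * (B * b * sqrt (2 * (R * t + 1))) \<le> h * (C * t powr (- (real n + 1)))"
        using that t Rt by (intro mult_left_mono root) (auto simp: distrib_right)
      then show ?thesis using c(3)[OF that] by linarith
    qed
    moreover have "L2_norm (E t) \<le> C * t powr (- (real n + 1))"
      using c(2) root[OF Rt] t by (simp add: distrib_right)
    ultimately show ?thesis using c(1) by blast
  qed
  have C0: "0 \<le> C" using B0 R(1) by (simp add: C_def)
  show ?thesis
    by (rule that[of C]) (use main in \<open>auto simp: E_def[abs_def] C0\<close>)
qed

end

context scattering_profile
begin

lemma profile_sup:
  assumes "\<And>x. \<bar>\<beta>\<bar> * (norm (A x))\<^sup>2 \<le> \<eta>" "0 < \<eta>"
  obtains S where "0 \<le> S" "\<And>x. norm (A x) \<le> S" "\<bar>\<beta>\<bar> * S\<^sup>2 \<le> \<eta>"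
proof (cases "\<beta> = 0")
  case True
  obtain B where "B \<ge> 0" "\<And>x. norm (A x) \<le> B" using test_fun_bounded[OF A_test] by metis
  then show ?thesis using that[of B] True assms(2) by simp
next
  case False
  define S where "S = sqrt (\<eta> / \<bar>\<beta>\<bar>)"
  have "norm (A x) \<le> S" for x
    unfolding S_def using assms(1)[of x] False
    by (intro real_le_rsqrt) (simp add: pos_le_divide_eq mult.commute)
  moreover have "S\<^sup>2 = \<eta> / \<bar>\<beta>\<bar>" unfolding S_def using assms(2) by simp
  ultimately show ?thesis using that[of S] False assms(2) by (simp add: S_def)
qed

text \<open>Room for the lower order terms of solution and wave, which perturb the size of \<open>A\<close> by \<open>\<epsilon>\<close>.\<close>

lemma enlarge_amplitude:
  fixes S :: real
  assumes "0 \<le> S" "\<bar>\<beta>\<bar> * S\<^sup>2 \<le> 1/100"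
  obtains \<epsilon> where "0 < \<epsilon>" "\<bar>\<beta>\<bar> * (S + \<epsilon>)\<^sup>2 \<le> 1/50"
proof -
  define D where "D = 100 * (\<bar>\<beta>\<bar> * (2 * S + 1) + 1)"
  have D: "100 \<le> D" using assms(1) by (simp add: D_def)
  define \<epsilon> where "\<epsilon> = 1 / D"
  have e: "0 < \<epsilon>" "\<epsilon> \<le> 1" "\<epsilon> * D = 1" using D by (auto simp: \<epsilon>_def)
  have "(S + \<epsilon>)\<^sup>2 = S\<^sup>2 + \<epsilon> * (2 * S + \<epsilon>)" by (simp add: power2_eq_square algebra_simps)
  also have "\<dots> \<le> S\<^sup>2 + \<epsilon> * (2 * S + 1)" using e by (intro add_left_mono mult_left_mono) auto
  finally have "\<bar>\<beta>\<bar> * (S + \<epsilon>)\<^sup>2 \<le> \<bar>\<beta>\<bar> * (S\<^sup>2 + \<epsilon> * (2 * S + 1))" by (intro mult_left_mono) auto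
  also have "\<dots> = \<bar>\<beta>\<bar> * S\<^sup>2 + \<epsilon> * (\<bar>\<beta>\<bar> * (2 * S + 1))" by (simp add: algebra_simps)
  also have "\<epsilon> * (\<bar>\<beta>\<bar> * (2 * S + 1)) \<le> \<epsilon> * (D / 100)" using e by (intro mult_left_mono) (auto simp: D_def)
  also have "\<dots> = 1/100" using e(3) by simp
  finally show ?thesis using that[of \<epsilon>] e(1) assms(2) by simp
qed

text \<open>The quintic term of the nonlinearity is moved into the error, where the potential makes it small.\<close>

lemma wave_equation:
  assumes t: "0 < t" and b: "profile_derivs b bx bt" "\<And>t x. (bx t has_vector_derivative bxx t x) (at x)"
    and h: "profile_derivs (space_op b bx) hx ht"
  shows "\<i> * wave (time_op b bx bt) t y + wave (space_op (space_op b bx) hx) t y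
    = nonlin_at \<beta> V (wave b t y)
      + (wave (residual b bx bxx bt) t y + of_real V * wave (wave_quintic b) t y)"
proof -
  have hx: "hx t x = \<i> / 2 * (of_real x * bx t x + b t x) + of_real (1 / t) * (bxx t x
      - \<i> * of_real \<beta> * (of_real (ln t) * (dens' x * bx t x + dens'' x * b t x)))" for x
    by (rule vector_derivative_unique_at[OF _ space_op_deriv[of b t bx bxx]])
      (use b h in \<open>auto simp: profile_derivs_def\<close>)
  have lin: "\<i> * time_op b bx bt t x + space_op (space_op b bx) hx t x
      = residual b bx bxx bt t x + of_real \<beta> * (of_real (1 / t) * (b t x * cnj (b t x) * b t x))" for x
  proof -
    have "space_op (space_op b bx) hx t x = space_op (space_op b bx) (\<lambda>_ _. hx t x) t x"
      by (simp add: space_op_def)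
    then have "\<i> * time_op b bx bt t x + space_op (space_op b bx) hx t x
        = \<i> * bt t x + of_real \<beta> * (of_real (1 / t) * (A x * cnj (A x) * b t x))
          + of_real (1 / t) * (of_real (1 / t) * gauged_laplacian b bx bxx t x)"
      using schroedinger_profile_identity[where g=b and gx=bx and gxx=bxx and t=t and x=x, OF _ hx, of bt] t by simp
    then show ?thesis unfolding residual_def by (simp add: algebra_simps)
  qed
  have "\<i> * wave (time_op b bx bt) t y + wave (space_op (space_op b bx) hx) t y
      = wave (\<lambda>t x. \<i> * time_op b bx bt t x + space_op (space_op b bx) hx t x) t y"
    unfolding wave_cmult wave_add ..
  also have "\<dots> = wave (\<lambda>t x. residual b bx bxx bt t x + of_real \<beta> * (of_real (1 / t) * (b t x * cnj (b t x) * b t x))) t y"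
    unfolding wave_def lin ..
  also have "\<dots> = wave (residual b bx bxx bt) t y + of_real \<beta> * cubic (wave b t y)"
    unfolding cubic_wave[OF t] wave_cmult wave_add ..
  finally show ?thesis unfolding quintic_wave[OF t] by simp
qed

text \<open>The energy estimate is used twice. For \<open>w\<close> the forcing is the nonlinear difference, linear in \<open>w\<close>,
  plus the error of the wave. For the translation differences of \<open>w\<close> it contains in addition
  products of \<open>w\<close> with increments of the wave and of the potential; these are \<open>O(h)\<close> times \<open>w\<close>, whose
  decay is known from the first estimate. One power of \<open>t\<close> is lost each time.\<close>

theorem solution_close_to_wave:
  assumes sol: "global_solution W \<beta> \<gamma> u" and W: "schwartz W" and away: "supported_away_from A (- \<gamma>)"
    and small: "\<And>x. \<bar>\<beta>\<bar> * (norm (A x))\<^sup>2 \<le> 1/100"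
    and asym: "\<forall>\<^sub>F t in at_top. ereal (H1_norm (\<lambda>y. u t y - u_asym \<beta> A t y)) + Linf_norm (\<lambda>y. u t y - u_asym \<beta> A t y)
          \<le> ereal (C0 * t powr (-1) * (1 + \<bar>\<beta>\<bar> * ln t)\<^sup>2)"
    and n: "2 \<le> n"
    and b: "log_expansion K 0 b" "log_expansion K 1 (\<lambda>t x. b t x - A x)"
    and bd: "profile_derivs b bx bt" "\<And>t x. (bx t has_vector_derivative bxx t x) (at x)"
    and be: "log_expansion K 0 bx" "log_expansion K 0 bxx" "log_expansion K 0 bt"
    and res: "log_expansion K (n + 2) (residual b bx bxx bt)"
  shows "\<exists>C\<ge>0. \<exists>T\<ge>1. \<forall>t\<ge>T. H1_norm (\<lambda>y. u t y - wave b t y) \<le> C * t powr (- (real n - 1))"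
proof -
  define U where "U = wave b"
  define w where "w t = (\<lambda>y. u t y - U t y)" for t
  have uH: "H1 (u t)" if "1 \<le> t" for t using sol that unfolding global_solution_def continuous_H1_def by blast
  have uL: "L2 (u t)" if "1 \<le> t" for t by (rule H1D(1)[OF uH[OF that]])
  have UH: "H1 (U t)" if "1 \<le> t" for t unfolding U_def by (rule wave_H1[OF b(1) that])
  have UL: "L2 (U t)" if "1 \<le> t" for t by (rule H1D(1)[OF UH[OF that]])
  have wH: "H1 (w t)" if "1 \<le> t" for t unfolding w_def by (rule H1_diff(1)[OF uH[OF that] UH[OF that]])
  have wL: "L2 (w t)" if "1 \<le> t" for t by (rule H1D(1)[OF wH[OF that]])
  have ucont: "((\<lambda>s. H1_norm (\<lambda>x. u s x - u t x)) \<longlongrightarrow> 0) (at t within {1..})" if "1 \<le> t" for t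
    using sol that unfolding global_solution_def continuous_H1_def by blast
  have Ucont: "((\<lambda>s. H1_norm (\<lambda>x. U s x - U t x)) \<longlongrightarrow> 0) (at t within {1..})" if "1 \<le> t" for t
    unfolding U_def by (rule wave_continuous_H1[OF b(1) that])
  have wcont: "((\<lambda>s. H1_norm (\<lambda>x. w s x - w t x)) \<longlongrightarrow> 0) (at t within {1..})" if t: "1 \<le> t" for t
  proof (rule tendsto_sandwich[where f="\<lambda>_. 0"])
    show "\<forall>\<^sub>F s in at t within {1..}. H1_norm (\<lambda>x. w s x - w t x) \<le> H1_norm (\<lambda>x. u s x - u t x) + H1_norm (\<lambda>x. U s x - U t x)"
      using near_time
    proof eventually_elim
      case (elim s)
      have "H1_norm (\<lambda>x. (u s x - u t x) - (U s x - U t x)) \<le> H1_norm (\<lambda>x. u s x - u t x) + H1_norm (\<lambda>x. U s x - U t x)"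
        using elim t by (intro H1_diff uH UH) auto
      then show ?case by (simp add: w_def algebra_simps)
    qed
    show "((\<lambda>s. H1_norm (\<lambda>x. u s x - u t x) + H1_norm (\<lambda>x. U s x - U t x)) \<longlongrightarrow> 0) (at t within {1..})"
      using tendsto_add[OF ucont[OF t] Ucont[OF t]] by simp
  qed (auto simp: H1_norm_nonneg)

  have Wm: "W \<in> borel_measurable borel" by (rule smooth_measurable[OF schwartz_smooth[OF W]])
  obtain B where B: "B \<ge> 0" "\<And>x. \<bar>x\<bar> ^ 0 * \<bar>W x\<bar> \<le> B" "\<And>x. \<bar>x\<bar> ^ 0 * \<bar>nth_vderiv 1 W x\<bar> \<le> B"
    using schwartz_decay[OF W, of 0] by metis
  have WB: "\<bar>W x\<bar> \<le> B" for x using B(2)[of x] by simp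
  have WL: "\<bar>W x - W y\<bar> \<le> B * \<bar>x - y\<bar>" for x y
    using vderiv_lipschitz[OF smooth_has_vderiv[OF schwartz_smooth[OF W]], of B x y] B(3) by (simp del: One_nat_def)

  \<comment> \<open>\<open>G\<close> is what the linear operator makes of the wave; \<open>F\<close> is therefore the forcing of \<open>w\<close>.\<close>
  obtain hx ht where h: "log_expansion K 0 hx" "profile_derivs (space_op b bx) hx ht"
    using log_expansion_derivs[OF space_op_expansion[OF b(1) be(1)] closed_K] by metis
  define G where "G t = (\<lambda>y. \<i> * wave (time_op b bx bt) t y + wave (space_op (space_op b bx) hx) t y)" for t
  define E where "E t = (\<lambda>y. wave (residual b bx bxx bt) t y + of_real (W (y + \<gamma> * t)) * wave (wave_quintic b) t y)" for t
  define F where "F t = (\<lambda>y. nonlin W \<beta> \<gamma> t (u t) y - G t y)" for t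
  have NL: "L2 (nonlin W \<beta> \<gamma> t (u t))" if "1 \<le> t" for t by (rule nonlin_L2[OF uH[OF that] Wm WB])
  have GL: "L2 (G t)" if t: "1 \<le> t" for t
  proof -
    have "L2 (wave (time_op b bx bt) t)" "L2 (wave (space_op (space_op b bx) hx) t)"
      using wave_L2[OF time_op_expansion[OF b(1) be(1,3)]]
        wave_L2[OF space_op_expansion[OF space_op_expansion[OF b(1) be(1)] h(1)]] t by metis+
    then show ?thesis unfolding G_def by (intro L2_add L2_cmult)
  qed
  have FL: "L2 (F t)" if "1 \<le> t" for t unfolding F_def by (intro L2_diff NL GL that)
  have ev: "evolves w (F t) t" if t: "1 \<le> t" for t
    unfolding w_def F_def U_def
  proof (rule evolves_diff[OF global_solution_evolves[OF sol t] _ t])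
    show "evolves (wave b) (G t) t"
      unfolding G_def by (rule wave_evolves[OF b(1) be(1,3) bd(1) h(2,1) t])
  qed (use uL UL NL[OF t] GL[OF t] in \<open>auto simp: U_def\<close>)
  have Feq: "F t y = (nonlin_at \<beta> (W (y + \<gamma> * t)) (u t y)
      - nonlin_at \<beta> (W (y + \<gamma> * t)) (U t y)) - E t y" if "1 \<le> t" for t y
    unfolding F_def G_def E_def U_def nonlin_eq
    using wave_equation[of t b bx bt bxx hx ht y "W (y + \<gamma> * t)", OF _ bd h(2)] that by simp

  \<comment> \<open>\<open>\<rho> t\<close> will bound both the solution and the wave at time \<open>t\<close>.\<close>
  obtain c where c: "c \<ge> 0" "\<And>t. 1 \<le> t \<Longrightarrow> L2 (E t)" "\<And>t. 1 \<le> t \<Longrightarrow> L2_norm (E t) \<le> c * t powr (- (real n + 1))"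
    "\<And>t h. 1 \<le> t \<Longrightarrow> 0 \<le> h \<Longrightarrow> h \<le> 1 \<Longrightarrow> L2_norm (\<lambda>y. E t (y + h) - E t y) \<le> h * (c * t powr (- (real n + 1)))"
    using error_bounds[OF W away res wave_quintic_expansion[OF b(1)]] unfolding E_def by blast
  obtain S where S: "0 \<le> S" "\<And>x. norm (A x) \<le> S" "\<bar>\<beta>\<bar> * S\<^sup>2 \<le> 1/100"
    using profile_sup[OF small] by (metis zero_less_divide_1_iff zero_less_numeral)
  obtain \<epsilon> where e: "0 < \<epsilon>" "\<bar>\<beta>\<bar> * (S + \<epsilon>)\<^sup>2 \<le> 1/50" using enlarge_amplitude[OF S(1,3)] by metis
  define \<sigma> where "\<sigma> = S + \<epsilon>"
  have sg: "0 < \<sigma>" using S(1) e(1) by (simp add: \<sigma>_def)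
  define \<rho> where "\<rho> t = \<sigma> * t powr (- 1/2)" for t
  obtain Ca where Ca: "Ca \<ge> 0" "\<And>t. 1 \<le> t \<Longrightarrow> C0 * t powr (- 1) * (1 + \<bar>\<beta>\<bar> * ln t)\<^sup>2 \<le> Ca * t powr (- 3/4)"
    using log_rate_bound[of "\<bar>\<beta>\<bar>" C0] by auto
  obtain Cb where Cb: "Cb \<ge> 0" "\<And>t x. 1 \<le> t \<Longrightarrow> norm (b t x - A x) \<le> Cb * t powr (1/4 - real 1)"
    using log_expansion_bound[OF b(2) compact_K] by blast
  obtain Cd where Cd: "Cd \<ge> 0" "\<And>t. 1 \<le> t \<Longrightarrow> L2_norm (wave (\<lambda>t x. b t x - A x) t) \<le> Cd * t powr (1/4 - real 1)"
    using wave_L2[OF b(2)] by metis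
  obtain Cu where Cu: "Cu \<ge> 0" "\<And>t y. 1 \<le> t \<Longrightarrow> norm (wave (space_op b bx) t y) \<le> Cu"
    using wave_bounded[OF space_op_expansion[OF b(1) be(1)]] by metis
  have eA: "log_expansion K 0 (\<lambda>t. A)" by (rule log_expansion_profile[OF smooth_A A_zero])

  have "\<forall>\<^sub>F t in at_top. (Ca + Cb) * t powr (- (1/4)) < \<epsilon>"
    by (rule order_tendstoD(2)[OF neg_powr_tendsto e(1)]) simp
  then have "\<forall>\<^sub>F t in at_top. (ereal (H1_norm (\<lambda>y. u t y - u_asym \<beta> A t y)) + Linf_norm (\<lambda>y. u t y - u_asym \<beta> A t y)
          \<le> ereal (C0 * t powr (-1) * (1 + \<bar>\<beta>\<bar> * ln t)\<^sup>2)) \<and> (Ca + Cb) * t powr (- (1/4)) < \<epsilon>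
      \<and> max 2 (450 * B * \<sigma> ^ 4) \<le> t"
    by (intro eventually_conj asym eventually_ge_at_top)
  then obtain T where Tall: "\<And>t. T \<le> t \<Longrightarrow> (ereal (H1_norm (\<lambda>y. u t y - u_asym \<beta> A t y)) + Linf_norm (\<lambda>y. u t y - u_asym \<beta> A t y)
          \<le> ereal (C0 * t powr (-1) * (1 + \<bar>\<beta>\<bar> * ln t)\<^sup>2)) \<and> (Ca + Cb) * t powr (- (1/4)) < \<epsilon>
      \<and> max 2 (450 * B * \<sigma> ^ 4) \<le> t"
    by (auto simp: eventually_at_top_linorder)
  have T: "1 < T" using Tall[of T] by simp
  have T1: "1 \<le> t" "0 < t" if "T \<le> t" for t using that T by auto
  have close: "H1_norm (\<lambda>y. u t y - u_asym \<beta> A t y) \<le> Ca * t powr (- 3/4)"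
    "Linf_norm (\<lambda>y. u t y - u_asym \<beta> A t y) \<le> ereal (Ca * t powr (- 3/4))" if t: "T \<le> t" for t
  proof -
    have "ereal (H1_norm (\<lambda>y. u t y - u_asym \<beta> A t y)) + Linf_norm (\<lambda>y. u t y - u_asym \<beta> A t y) \<le> ereal (Ca * t powr (- 3/4))"
      using Tall[OF t] Ca(2)[OF T1(1)[OF t]] by (meson ereal_less_eq(3) order_trans)
    from ereal_sum_leD[OF this H1_norm_nonneg Linf_norm_nonneg]
    show "H1_norm (\<lambda>y. u t y - u_asym \<beta> A t y) \<le> Ca * t powr (- 3/4)"
      "Linf_norm (\<lambda>y. u t y - u_asym \<beta> A t y) \<le> ereal (Ca * t powr (- 3/4))" by auto
  qed
  have split: "t powr (- 3/4) = t powr (- 1/2) * t powr (- (1/4))" for t :: real by (simp add: powr_add[symmetric])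
  have rate: "C * t powr (- 3/4) \<le> \<epsilon> * t powr (- 1/2)" if t: "T \<le> t" and C: "C \<le> Ca + Cb" for C t
  proof -
    have "C * t powr (- (1/4)) \<le> (Ca + Cb) * t powr (- (1/4))" using C by (intro mult_right_mono) auto
    also have "\<dots> \<le> \<epsilon>" using Tall[OF t] by simp
    finally have "(C * t powr (- (1/4))) * t powr (- 1/2) \<le> \<epsilon> * t powr (- 1/2)" by (intro mult_right_mono) auto
    then show ?thesis unfolding split by (simp add: mult_ac)
  qed
  have U_size: "norm (U t y) \<le> \<rho> t" if t: "T \<le> t" for t y
  proof -
    have "norm (U t y) = t powr (- 1/2) * norm (b t (y / t))" by (simp add: U_def wave_def norm_mult)
    also have "norm (b t (y / t)) \<le> S + Cb * t powr (- 3/4)"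
      using norm_triangle_ineq[of "b t (y / t) - A (y / t)" "A (y / t)"] Cb(2)[OF T1(1)[OF t], of "y / t"] S(2)[of "y / t"] by simp
    also have "Cb * t powr (- 3/4) \<le> \<epsilon> * t powr (- 1/2)" by (rule rate[OF t]) (use Ca in simp)
    also have "\<epsilon> * t powr (- 1/2) \<le> \<epsilon> * 1"
      using e T1(1)[OF t] powr_mono[of "- 1/2" 0 t] by (intro mult_left_mono) auto
    finally show ?thesis by (simp add: \<rho>_def \<sigma>_def mult_ac mult_right_mono)
  qed
  have u_size: "AE y in lborel. norm (u t y) \<le> \<rho> t" if t: "T \<le> t" for t
    using Linf_norm_AE[OF close(2)[OF t]]
  proof eventually_elim
    case (elim y)
    have "norm (u t y) \<le> norm (u_asym \<beta> A t y) + norm (u t y - u_asym \<beta> A t y)"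
      by (metis norm_triangle_sub norm_minus_commute)
    also have "norm (u_asym \<beta> A t y) = t powr (- 1/2) * norm (A (y / t))" by (simp add: u_asym_def norm_mult)
    also have "\<dots> \<le> t powr (- 1/2) * S" by (intro mult_left_mono S) simp
    also have "norm (u t y - u_asym \<beta> A t y) \<le> \<epsilon> * t powr (- 1/2)" using elim rate[OF t, of Ca] Cb by simp
    finally show ?case by (simp add: \<rho>_def \<sigma>_def algebra_simps)
  qed
  have rho: "0 < \<rho> t" "\<rho> t \<le> \<sigma>" if t: "T \<le> t" for t
    using sg T1[OF t] powr_mono[of "- 1/2" 0 t] by (auto simp: \<rho>_def mult_left_le)
  have kappa: "15 * \<bar>\<beta>\<bar> * (\<rho> t)\<^sup>2 + 45 * B * \<rho> t ^ 4 \<le> 4/10 / t" if t: "T \<le> t" for t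
  proof -
    have r2: "(\<rho> t)\<^sup>2 = \<sigma>\<^sup>2 / t"
    proof -
      have "(t powr (- 1/2))\<^sup>2 = t powr (- 1/2) * t powr (- 1/2)" by (simp add: power2_eq_square)
      also have "\<dots> = t powr (- 1)" by (simp only: powr_add[symmetric]) simp
      also have "\<dots> = 1 / t" using T1[OF t] by (simp add: powr_minus divide_inverse)
      finally show ?thesis by (simp add: \<rho>_def power_mult_distrib)
    qed
    have r4: "\<rho> t ^ 4 = \<sigma> ^ 4 / t\<^sup>2"
    proof -
      have "\<rho> t ^ 4 = ((\<rho> t)\<^sup>2)\<^sup>2" by simp
      also have "\<dots> = \<sigma> ^ 4 / t\<^sup>2" unfolding r2 by (simp add: power_divide)
      finally show ?thesis .
    qed
    have "450 * B * \<sigma> ^ 4 \<le> t" using Tall[OF t] by simp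
    then have "45 * B * \<sigma> ^ 4 \<le> 1/10 * t" by simp
    then have "45 * B * \<sigma> ^ 4 / t \<le> 1/10" using T1(2)[OF t] by (simp only: pos_divide_le_eq)
    moreover have "\<bar>\<beta>\<bar> * \<sigma>\<^sup>2 \<le> 1/50" using e(2) by (simp only: \<sigma>_def)
    ultimately have "15 * (\<bar>\<beta>\<bar> * \<sigma>\<^sup>2) + 45 * B * \<sigma> ^ 4 / t \<le> 4/10" by linarith
    then have "(15 * (\<bar>\<beta>\<bar> * \<sigma>\<^sup>2) + 45 * B * \<sigma> ^ 4 / t) / t \<le> (4/10) / t"
      using T1(2)[OF t] by (intro divide_right_mono) auto
    then show ?thesis unfolding r2 r4 by (simp add: power2_eq_square add_divide_distrib)
  qed
  have apriori: "L2_norm (w t) \<le> (Ca + Cd) * t powr (- 3/4)" if t: "T \<le> t" for t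
  proof -
    have aL: "L2 (u_asym \<beta> A t)"
    proof -
      have "L2 (wave (\<lambda>t. A) t)" using wave_L2[OF eA] T1(1)[OF t] by metis
      moreover have "u_asym \<beta> A t = wave (\<lambda>t. A) t" by (rule ext) (rule u_asym_wave)
      ultimately show ?thesis by simp
    qed
    have "w t = (\<lambda>y. (u t y - u_asym \<beta> A t y) - wave (\<lambda>t x. b t x - A x) t y)"
      unfolding w_def U_def u_asym_wave by (rule ext) (simp add: wave_def algebra_simps)
    moreover have "L2_norm (\<lambda>y. (u t y - u_asym \<beta> A t y) - wave (\<lambda>t x. b t x - A x) t y)
        \<le> L2_norm (\<lambda>y. u t y - u_asym \<beta> A t y) + L2_norm (wave (\<lambda>t x. b t x - A x) t)"
    proof (intro L2_norm_diff_le L2_diff uL T1(1)[OF t] aL)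
      show "L2 (wave (\<lambda>t x. b t x - A x) t)" using wave_L2[OF b(2)] T1(1)[OF t] by metis
    qed
    moreover have "L2_norm (\<lambda>y. u t y - u_asym \<beta> A t y) \<le> Ca * t powr (- 3/4)"
      using close(1)[OF t] L2_norm_le_H1_norm[of "\<lambda>y. u t y - u_asym \<beta> A t y"] by simp
    moreover have "L2_norm (wave (\<lambda>t x. b t x - A x) t) \<le> Cd * t powr (- 3/4)" using Cd(2)[OF T1(1)[OF t]] by simp
    ultimately show ?thesis by (simp add: distrib_right)
  qed

  have F_bound: "L2_norm (F t) \<le> 4/10 / t * L2_norm (w t) + c * t powr (- (real n + 1))" if t: "T \<le> t" for t
  proof -
    note t1 = T1(1)[OF t]
    have ae: "AE y in lborel. norm (F t y) \<le> 4/10 / t * norm (w t y) + 1 * norm (E t y) + 0 * norm (E t y)"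
      using u_size[OF t]
    proof eventually_elim
      case (elim y)
      have "norm (F t y) \<le> norm (nonlin_at \<beta> (W (y + \<gamma> * t)) (u t y)
          - nonlin_at \<beta> (W (y + \<gamma> * t)) (U t y)) + norm (E t y)"
        unfolding Feq[OF t1] by (rule norm_triangle_ineq4)
      also have "norm (nonlin_at \<beta> (W (y + \<gamma> * t)) (u t y)
          - nonlin_at \<beta> (W (y + \<gamma> * t)) (U t y))
          \<le> (15 * \<bar>\<beta>\<bar> * (\<rho> t)\<^sup>2 + 45 * B * \<rho> t ^ 4) * norm (u t y - U t y)"
        by (rule nonlin_difference[OF rho(1)[OF t] elim U_size[OF t] WB])
      also have "\<dots> \<le> 4/10 / t * norm (u t y - U t y)" by (intro mult_right_mono kappa[OF t]) simp
      finally show ?case by (simp add: w_def)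
    qed
    have "L2_norm (F t) \<le> 4/10 / t * L2_norm (w t) + 1 * L2_norm (E t) + 0 * L2_norm (E t)"
      by (rule L2_norm_le_combination(2)[OF wL[OF t1] c(2)[OF t1] c(2)[OF t1] _ _ _ L2_measurable[OF FL[OF t1]] ae])
        (use t1 in auto)
    then show ?thesis using c(3)[OF t1] by simp
  qed
  have w_decay: "L2_norm (w t) \<le> 2 * c * t powr (- real n)" if t: "T \<le> t" for t
    using energy_decay[OF T _ c(1) wH wcont ev[OF T1(1)] FL[OF T1(1)] F_bound apriori t] n by simp

  \<comment> \<open>The factor \<open>h\<close> in front of \<open>c'\<close> survives the energy estimate because it depends linearly on the forcing.\<close>
  define M where "M = 6 * \<bar>\<beta>\<bar> * \<sigma> * Cu + 20 * B * \<sigma> ^ 3 * Cu + 5 * B * \<sigma> ^ 4"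
  have M0: "0 \<le> M" using B(1) Cu(1) sg by (simp add: M_def)
  define c' where "c' = M * (2 * c) + c"
  have c'0: "0 \<le> c'" using M0 c(1) by (simp add: c'_def)
  have quotient: "L2_norm (\<lambda>y. w t (y + h) - w t y) \<le> 2 * (h * c') * t powr (- (real n - 1))"
    if h: "0 < h" "h \<le> 1" and t: "T \<le> t" for h t
  proof -
    define q where "q s = (\<lambda>y. w s (y + h) - w s y)" for s
    define Fh where "Fh s = (\<lambda>y. F s (y + h) - F s y)" for s
    have qH: "H1 (q s)" if "1 \<le> s" for s unfolding q_def by (rule H1_diff(1)[OF H1_shift(1)[OF wH[OF that]] wH[OF that]])
    have FhL: "L2 (Fh s)" if "1 \<le> s" for s unfolding Fh_def by (rule L2_diff[OF L2_shift[OF FL[OF that]] FL[OF that]])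
    have qcont: "((\<lambda>s. H1_norm (\<lambda>x. q s x - q t x)) \<longlongrightarrow> 0) (at t within {1..})" if t: "1 \<le> t" for t
    proof (rule tendsto_sandwich[where f="\<lambda>_. 0"])
      show "\<forall>\<^sub>F s in at t within {1..}. H1_norm (\<lambda>x. q s x - q t x) \<le> 2 * H1_norm (\<lambda>x. w s x - w t x)"
        using near_time
      proof eventually_elim
        case (elim s)
        have d: "H1 (\<lambda>x. w s x - w t x)" using elim t by (intro H1_diff(1) wH) auto
        have "H1_norm (\<lambda>x. (w s (x + h) - w t (x + h)) - (w s x - w t x)) \<le> H1_norm (\<lambda>x. w s (x + h) - w t (x + h)) + H1_norm (\<lambda>x. w s x - w t x)"
          by (rule H1_diff(2)[OF H1_shift(1)[OF d] d])
        then show ?case using H1_shift(2)[OF d, of h] by (simp add: q_def algebra_simps)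
      qed
      show "((\<lambda>s. 2 * H1_norm (\<lambda>x. w s x - w t x)) \<longlongrightarrow> 0) (at t within {1..})"
        using tendsto_mult_left[OF wcont[OF t], of 2] by simp
    qed (auto simp: H1_norm_nonneg)
    have qev: "evolves q (Fh s) s" if s: "1 \<le> s" for s
      unfolding q_def Fh_def
      by (rule evolves_diff[OF evolves_shift[OF ev[OF s]] ev[OF s] s])
        (use wL FL s in \<open>auto intro: L2_shift\<close>)
    have bound: "L2_norm (Fh s) \<le> 4/10 / s * L2_norm (q s) + (h * c') * s powr (- real n)" if s: "T \<le> s" for s
    proof -
      note s1 = T1(1)[OF s]
      define Eh where "Eh = (\<lambda>y. E s (y + h) - E s y)"
      have EhL: "L2 Eh" unfolding Eh_def by (rule L2_diff[OF L2_shift[OF c(2)[OF s1]] c(2)[OF s1]])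
      have Ulip: "norm (U s (y + h) - U s y) \<le> Cu * h" for y
        using vderiv_lipschitz[OF wave_deriv_y[of s b bx] Cu(2)[OF s1], of "y + h" y] T1(2)[OF s] bd(1) h
        by (auto simp: U_def profile_derivs_def)
      have ae: "AE y in lborel. norm (Fh s y) \<le> 4/10 / s * norm (q s y) + (h * M) * norm (w s y) + 1 * norm (Eh y)"
        using u_size[OF s] AE_shift[OF u_size[OF s], of h]
      proof eventually_elim
        case (elim y)
        let ?V = "W (y + \<gamma> * s)" and ?V' = "W (y + h + \<gamma> * s)"
        let ?X = "(nonlin_at \<beta> ?V' (u s (y + h))
            - nonlin_at \<beta> ?V' (U s (y + h)))
          - (nonlin_at \<beta> ?V (u s y)
            - nonlin_at \<beta> ?V (U s y))"
        have "Fh s y = ?X - Eh y" unfolding Fh_def Eh_def Feq[OF s1] by (simp add: algebra_simps)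
        then have "norm (Fh s y) \<le> norm ?X + norm (Eh y)" by (simp only: norm_triangle_ineq4)
        also have "norm ?X \<le> (15 * \<bar>\<beta>\<bar> * (\<rho> s)\<^sup>2 + 45 * B * \<rho> s ^ 4) * norm ((u s (y + h) - U s (y + h)) - (u s y - U s y))
            + h * (6 * \<bar>\<beta>\<bar> * \<rho> s * Cu + 20 * B * \<rho> s ^ 3 * Cu + 5 * B * \<rho> s ^ 4) * norm (u s y - U s y)"
          by (rule nonlin_second_difference[OF rho(1)[OF s] elim(1) U_size[OF s] elim(2) U_size[OF s] WB WB _ Ulip])
            (use WL[of "y + h + \<gamma> * s" "y + \<gamma> * s"] h in auto)
        also have "\<dots> \<le> 4/10 / s * norm ((u s (y + h) - U s (y + h)) - (u s y - U s y)) + h * M * norm (u s y - U s y)"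
        proof (intro add_mono mult_right_mono mult_left_mono kappa[OF s])
          show "6 * \<bar>\<beta>\<bar> * \<rho> s * Cu + 20 * B * \<rho> s ^ 3 * Cu + 5 * B * \<rho> s ^ 4 \<le> M"
            unfolding M_def using rho[OF s] B(1) Cu(1) by (intro add_mono mult_right_mono mult_left_mono power_mono) auto
        qed (use h in auto)
        finally show ?case by (simp add: q_def w_def)
      qed
      have "L2_norm (Fh s) \<le> 4/10 / s * L2_norm (q s) + (h * M) * L2_norm (w s) + 1 * L2_norm Eh"
        by (rule L2_norm_le_combination(2)[OF H1D(1)[OF qH[OF s1]] wL[OF s1] EhL _ _ _ L2_measurable[OF FhL[OF s1]] ae])
          (use s1 h M0 in auto)
      also have "\<dots> \<le> 4/10 / s * L2_norm (q s) + (h * M) * (2 * c * s powr (- real n)) + h * (c * s powr (- real n))"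
      proof -
        have "L2_norm Eh \<le> h * (c * s powr (- (real n + 1)))" unfolding Eh_def by (rule c(4)[OF s1]) (use h in auto)
        also have "\<dots> \<le> h * (c * s powr (- real n))" using h c(1) s1 by (intro mult_left_mono powr_mono) auto
        finally have "L2_norm Eh \<le> h * (c * s powr (- real n))" .
        moreover have "(h * M) * L2_norm (w s) \<le> (h * M) * (2 * c * s powr (- real n))"
          using h M0 by (intro mult_left_mono w_decay[OF s]) auto
        ultimately show ?thesis by simp
      qed
      also have "\<dots> = 4/10 / s * L2_norm (q s) + (h * c') * s powr (- real n)" by (simp add: c'_def algebra_simps)
      finally show ?thesis .
    qed
    have qap: "L2_norm (q s) \<le> (2 * (Ca + Cd)) * s powr (- 3/4)" if s: "T \<le> s" for s
    proof -
      note s1 = T1(1)[OF s]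
      have "L2_norm (q s) \<le> L2_norm (\<lambda>y. w s (y + h)) + L2_norm (w s)"
        unfolding q_def by (rule L2_norm_diff_le[OF L2_shift[OF wL[OF s1]] wL[OF s1]])
      then show ?thesis using apriori[OF s] L2_norm_shift[of "w s" h] by (simp add: algebra_simps)
    qed
    show ?thesis
      using energy_decay[OF T _ _ qH qcont qev[OF T1(1)] FhL[OF T1(1)] bound qap t] n h c'0 by (simp add: q_def)
  qed
  show ?thesis
  proof (intro exI conjI allI impI)
    show "0 \<le> 2 * c + 2 * c'" using c(1) c'0 by simp
    show "1 \<le> T" using T by simp
    fix t assume t: "T \<le> t"
    note t1 = T1(1)[OF t]
    have "L2_norm (weak_deriv (w t)) \<le> 2 * c' * t powr (- (real n - 1))"
    proof (rule weak_deriv_norm_le_translations[OF H1D(1,3,2)[OF wH[OF t1]]])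
      fix h :: real assume h: "0 < h" "h \<le> 1"
      show "L2_norm (\<lambda>x. w t (x + h) - w t x) \<le> 2 * c' * t powr (- (real n - 1)) * h"
        using quotient[OF h t] by (simp add: mult_ac)
    qed (use c'0 in simp)
    moreover have "L2_norm (w t) \<le> 2 * c * t powr (- (real n - 1))"
    proof -
      have "2 * c * t powr (- real n) \<le> 2 * c * t powr (- (real n - 1))"
        using c(1) t1 by (intro mult_left_mono powr_mono) auto
      then show ?thesis using w_decay[OF t] by linarith
    qed
    ultimately have "H1_norm (w t) \<le> (2 * c + 2 * c') * t powr (- (real n - 1))"
      using H1_norm_le_sum[of "w t"] by (simp add: distrib_right)
    then show "H1_norm (\<lambda>y. u t y - wave b t y) \<le> (2 * c + 2 * c') * t powr (- (real n - 1))"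
      by (simp add: w_def U_def)
  qed
qed

end

section \<open>Independence of the potential\<close>

theorem corollary5p6:
  shows "\<exists>\<eta>\<^sub>s>0. \<forall>\<eta>\<^sub>0 m\<^sub>0. \<eta>\<^sub>0 \<le> \<eta>\<^sub>s \<longrightarrow> wave_operator_constants \<eta>\<^sub>0 m\<^sub>0 \<longrightarrow>
    (\<forall>(\<beta>::real) (\<gamma>::real) (W\<^sub>1::real \<Rightarrow> real) (W\<^sub>2::real \<Rightarrow> real) (A::real \<Rightarrow> complex)
        (u\<^sub>1::real \<Rightarrow> real \<Rightarrow> complex) (u\<^sub>2::real \<Rightarrow> real \<Rightarrow> complex).
      schwartz W\<^sub>1 \<longrightarrow> schwartz W\<^sub>2 \<longrightarrow>
      A \<in> test_fun \<longrightarrow> supported_away_from A (- \<gamma>) \<longrightarrow>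
      small_profile \<eta>\<^sub>0 m\<^sub>0 W\<^sub>1 \<beta> A \<longrightarrow> small_profile \<eta>\<^sub>0 m\<^sub>0 W\<^sub>2 \<beta> A \<longrightarrow>
      wave_operator_solution W\<^sub>1 \<beta> \<gamma> A u\<^sub>1 \<longrightarrow> wave_operator_solution W\<^sub>2 \<beta> \<gamma> A u\<^sub>2 \<longrightarrow>
      (\<forall>\<nu>>0. \<exists>C>0. \<exists>T>0. \<forall>t\<ge>T.
         ereal (H1_norm (\<lambda>y. u\<^sub>1 t y - u\<^sub>2 t y)) + Linf_norm (\<lambda>y. u\<^sub>1 t y - u\<^sub>2 t y)
           \<le> ereal (C * t powr (- \<nu>))))"
proof (rule exI[of _ "1/100"], intro conjI allI impI)
  fix \<eta>\<^sub>0 :: real and m\<^sub>0 :: "real \<Rightarrow> real" and \<beta> \<gamma> :: real and W\<^sub>1 W\<^sub>2 :: "real \<Rightarrow> real" and A :: "real \<Rightarrow> complex"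
    and u\<^sub>1 u\<^sub>2 :: "real \<Rightarrow> real \<Rightarrow> complex" and \<nu> :: real
  assume \<eta>: "\<eta>\<^sub>0 \<le> 1/100" and const: "wave_operator_constants \<eta>\<^sub>0 m\<^sub>0"
    and W: "schwartz W\<^sub>1" "schwartz W\<^sub>2" and A: "A \<in> test_fun" and away: "supported_away_from A (- \<gamma>)"
    and small: "small_profile \<eta>\<^sub>0 m\<^sub>0 W\<^sub>1 \<beta> A" "small_profile \<eta>\<^sub>0 m\<^sub>0 W\<^sub>2 \<beta> A"
    and sol: "wave_operator_solution W\<^sub>1 \<beta> \<gamma> A u\<^sub>1" "wave_operator_solution W\<^sub>2 \<beta> \<gamma> A u\<^sub>2" and \<nu>: "0 < \<nu>"
  interpret scattering_profile \<beta> A by unfold_locales (rule A)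
  have \<eta>0: "0 < \<eta>\<^sub>0" using const by (simp add: wave_operator_constants_def)
  have sm: "\<bar>\<beta>\<bar> * (norm (A x))\<^sup>2 \<le> 1/100" for x
    using small_profile_bound[OF A small(1) \<eta>0, of x] \<eta> by linarith
  define n where "n = nat \<lceil>\<nu>\<rceil> + 2"
  have n: "2 \<le> n" "\<nu> \<le> real n - 1"
  proof -
    show "2 \<le> n" by (simp add: n_def)
    have "\<nu> \<le> of_int \<lceil>\<nu>\<rceil>" by (rule le_of_int_ceiling)
    also have "\<dots> \<le> real (nat \<lceil>\<nu>\<rceil>)" by (simp add: of_nat_nat)
    finally show "\<nu> \<le> real n - 1" by (simp add: n_def)
  qed
  \<comment> \<open>The same approximate solution serves for both potentials.\<close>
  obtain b bx bxx bt where b: "log_expansion K 0 b" "log_expansion K 1 (\<lambda>t x. b t x - A x)"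
    "profile_derivs b bx bt" "\<And>t x. (bx t has_vector_derivative bxx t x) (at x)"
    "log_expansion K 0 bx" "log_expansion K 0 bxx" "log_expansion K 0 bt"
    "log_expansion K (n + 2) (residual b bx bxx bt)"
    using approximate_profile[of n] by blast
  have close: "\<exists>C\<ge>0. \<exists>T\<ge>1. \<forall>t\<ge>T. H1_norm (\<lambda>y. u t y - wave b t y) \<le> C * t powr (- (real n - 1))"
    if WS: "schwartz W" and us: "wave_operator_solution W \<beta> \<gamma> A u" for W u
  proof -
    obtain C0 where "\<forall>\<^sub>F t in at_top. ereal (H1_norm (\<lambda>y. u t y - u_asym \<beta> A t y)) + Linf_norm (\<lambda>y. u t y - u_asym \<beta> A t y)
          \<le> ereal (C0 * t powr (-1) * (1 + \<bar>\<beta>\<bar> * ln t)\<^sup>2)"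
      using us unfolding wave_operator_solution_def by blast
    moreover have "global_solution W \<beta> \<gamma> u" using us unfolding wave_operator_solution_def by blast
    ultimately show ?thesis by (intro solution_close_to_wave[OF _ WS away sm _ n(1) b])
  qed
  obtain C1 T1 where 1: "C1 \<ge> 0" "T1 \<ge> 1" "\<And>t. T1 \<le> t \<Longrightarrow> H1_norm (\<lambda>y. u\<^sub>1 t y - wave b t y) \<le> C1 * t powr (- (real n - 1))"
    using close[OF W(1) sol(1)] by blast
  obtain C2 T2 where 2: "C2 \<ge> 0" "T2 \<ge> 1" "\<And>t. T2 \<le> t \<Longrightarrow> H1_norm (\<lambda>y. u\<^sub>2 t y - wave b t y) \<le> C2 * t powr (- (real n - 1))"
    using close[OF W(2) sol(2)] by blast
  have uH: "H1 (u\<^sub>1 t)" "H1 (u\<^sub>2 t)" if "1 \<le> t" for t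
    using sol that unfolding wave_operator_solution_def global_solution_def continuous_H1_def by blast+
  define C where "C = 2 * (C1 + C2) + 1"
  show "\<exists>C>0. \<exists>T>0. \<forall>t\<ge>T. ereal (H1_norm (\<lambda>y. u\<^sub>1 t y - u\<^sub>2 t y)) + Linf_norm (\<lambda>y. u\<^sub>1 t y - u\<^sub>2 t y) \<le> ereal (C * t powr (- \<nu>))"
  proof (rule exI[of _ C], rule conjI, simp add: C_def 1 2 add_nonneg_pos, rule exI[of _ "max T1 T2"], rule conjI, use 1 in simp, intro allI impI)
    fix t assume "max T1 T2 \<le> t"
    then have t: "T1 \<le> t" "T2 \<le> t" "1 \<le> t" using 1(2) by auto
    have wH: "H1 (wave b t)" by (rule wave_H1[OF b(1) t(3)])
    define N where "N = H1_norm (\<lambda>y. u\<^sub>1 t y - u\<^sub>2 t y)"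
    have dH: "H1 (\<lambda>y. u\<^sub>1 t y - u\<^sub>2 t y)" by (rule H1_diff(1)[OF uH[OF t(3)]])
    have "H1_norm (\<lambda>y. (u\<^sub>1 t y - wave b t y) - (u\<^sub>2 t y - wave b t y))
        \<le> H1_norm (\<lambda>y. u\<^sub>1 t y - wave b t y) + H1_norm (\<lambda>y. u\<^sub>2 t y - wave b t y)"
      by (intro H1_diff uH t wH)
    then have "N \<le> (C1 + C2) * t powr (- (real n - 1))" using 1(3)[OF t(1)] 2(3)[OF t(2)] by (simp add: N_def distrib_right)
    also have "\<dots> \<le> (C1 + C2) * t powr (- \<nu>)" using 1(1) 2(1) n(2) t(3) by (intro mult_left_mono powr_mono) auto
    finally have N: "N \<le> (C1 + C2) * t powr (- \<nu>)" .
    have "Linf_norm (\<lambda>y. u\<^sub>1 t y - u\<^sub>2 t y) \<le> ereal N"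
      unfolding Linf_norm_def
    proof (rule esssup_I)
      show "(\<lambda>x. ereal (norm (u\<^sub>1 t x - u\<^sub>2 t x))) \<in> borel_measurable lborel"
        using L2_measurable[OF H1D(1)[OF dH]] by measurable
      show "AE x in lborel. ereal (norm (u\<^sub>1 t x - u\<^sub>2 t x)) \<le> ereal N"
        using Sobolev_inequality[OF dH] by (simp add: N_def)
    qed
    then have "ereal N + Linf_norm (\<lambda>y. u\<^sub>1 t y - u\<^sub>2 t y) \<le> ereal N + ereal N" by (rule add_left_mono)
    also have "\<dots> \<le> ereal (C * t powr (- \<nu>))"
    proof -
      have "2 * ((C1 + C2) * t powr (- \<nu>)) \<le> C * t powr (- \<nu>)" unfolding C_def by (simp add: algebra_simps)
      then show ?thesis using N by simp
    qed
    finally show "ereal (H1_norm (\<lambda>y. u\<^sub>1 t y - u\<^sub>2 t y)) + Linf_norm (\<lambda>y. u\<^sub>1 t y - u\<^sub>2 t y) \<le> ereal (C * t powr (- \<nu>))"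
      unfolding N_def .
  qed
qed simp

end
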